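(* Let $\lambda,\mu,\kappa\in\mathbb C$ with $\kappa\ne-2$. (1) If $\lambda\mu\ne0$, then $V_{\widehat{\mathfrak{sl}_2}}(\lambda,\mu,\kappa)$ is a simple $\widehat{\mathfrak{sl}_2}$-module. (2) If $\lambda\ne0$, then for any $a\in\mathbb C$ the module $$M_{\widehat{\mathfrak{sl}_2}}(\lambda,0,\kappa,a):=V_{\widehat{\mathfrak{sl}_2}}(\lambda,0,\kappa)/U(\widehat{\mathfrak{sl}_2})(L(0)-a)w_{\lambda,0,\kappa}$$ has a unique simple quotient, denoted $L_{\widehat{\mathfrak{sl}_2}}(\lambda,0,\kappa,a)$. Moreover, any simple quotient of $V_{\widehat{\mathfrak{sl}_2}}(\lambda,0,\kappa)$ is isomorphic to $L_{\widehat{\mathfrak{sl}_2}}(\lambda,0,\kappa,a)$ for some $a\in\mathbb C$. (3) If $\mu\ne0$, then for any $a\in\mathbb C$ the module $$M_{\widehat{\mathfrak{sl}_2}}(0,\mu,\kappa,a):=V_{\widehat{\mathfrak{sl}_2}}(0,\mu,\kappa)/U(\widehat{\mathfrak{sl}_2})(h(0)/2-L(0)-a)w_{0,\mu,\kappa}$$ has a unique simple quotient, denoted $L_{\widehat{\mathfrak{sl}_2}}(0,\mu,\kappa,a)$. Moreover, any simple quotient of $V_{\widehat{\mathfrak{sl}_2}}(0,\mu,\kappa)$ is isomorphic to $L_{\widehat{\mathfrak{sl}_2}}(0,\mu,\kappa,a)$ for some $a\in\mathbb C$. (4) Any simple quotient of $V_{\widehat{\mathfrak{sl}_2}}(0,0,\kappa)$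 is obtained by restricting to $\widehat{\mathfrak{sl}_2}$ a simple highest weight $\widetilde{\mathfrak{sl}_2}$-module of level $\kappa$.
   Context: $\mathfrak{sl}_2$ has basis $e,f,h$ with $[e,f]=h$, $[h,e]=2e$, $[h,f]=-2f$ and form $(e,f)=1$, $(h,h)=2$ (other pairings zero). $\widetilde{\mathfrak{sl}_2}=\mathfrak{sl}_2\otimes\mathbb C[t,t^{-1}]\oplus\mathbb Cc\oplus\mathbb Cd$, with $c$ central, $x(n)=x\otimes t^n$, $[x(n),y(m)]=[x,y](n+m)+n(x,y)\delta_{n+m,0}c$, $[d,x(n)]=nx(n)$; $\widehat{\mathfrak{sl}_2}=\mathfrak{sl}_2\otimes\mathbb C[t,t^{-1}]\oplus\mathbb Cc$. Level $\kappa$ means $c$ acts as $\kappa\,\mathrm{Id}$. The universal Whittaker module is $V_{\widehat{\mathfrak{sl}_2}}(\lambda,\mu,\kappa)=U(\widehat{\mathfrak{sl}_2})/J$, where $J$ is the left ideal generated by $e(0)-\lambda$, $f(1)-\mu$, $c-\kappa$, $e(i),h(i),f(i+1)$ $(i\ge1)$; $w_{\lambda,\mu,\kappa}$ is the image of $1$. It is a restricted module (for each vector $w$ and each $x\in\mathfrak{sl}_2$, $x(n)w=0$ for $n\gg0$), and for $\kappa\ne-2$ the Sugawara operators act on it: $$L(n)=\tfrac1{2(\kappa+2)}\sum_{k\in\mathbb Z}\left(:e(k)f(n-k):+:f(k)e(n-k):+\tfrac12:h(k)h(n-k):\right),$$ where $:x(k)y(m):=x(k)y(m)$ if $k<0$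 and $y(m)x(k)$ if $k\ge0$. Highest weight modules of $\widetilde{\mathfrak{sl}_2}$ are with respect to the positive part spanned by $e(n)$ $(n\ge0)$, $h(n),f(n)$ $(n\ge1)$ and Cartan subalgebra $\mathbb Ch(0)\oplus\mathbb Cc\oplus\mathbb Cd$. *)

theory Defs
  imports
    Complex_Main
    "HOL-Library.Poly_Mapping"
    "HOL-Algebra.Module"
    "HOL-Algebra.Algebraic_Closure_Type"
begin

section \<open>Complex Lie algebras\<close>

class complex_lie_algebra = ab_group_add +
  fixes cscale :: "complex \<Rightarrow> 'a \<Rightarrow> 'a"
    and bracket :: "'a \<Rightarrow> 'a \<Rightarrow> 'a"
  assumes cscale_add_right: "cscale c (x + y) = cscale c x + cscale c y"
    and cscale_add_left: "cscale (c + c') x = cscale c x + cscale c' x"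
    and cscale_cscale: "cscale c (cscale c' x) = cscale (c * c') x"
    and cscale_one: "cscale 1 x = x"
    and bracket_add_left: "bracket (x + y) z = bracket x z + bracket y z"
    and bracket_add_right: "bracket x (y + z) = bracket x y + bracket x z"
    and bracket_cscale_left: "bracket (cscale c x) y = cscale c (bracket x y)"
    and bracket_cscale_right: "bracket x (cscale c y) = cscale c (bracket x y)"
    and bracket_self: "bracket x x = 0"
    and bracket_jacobi:
      "bracket x (bracket y z) + bracket y (bracket z x) + bracket z (bracket x y) = 0"

global_interpretation lie_vs: vector_space "cscale :: complex \<Rightarrow> 'a::complex_lie_algebra \<Rightarrow> 'a"
  by unfold_locales (rule cscale_add_right cscale_add_left cscale_cscale cscale_one)+

lemma bracket_zero [simp]:
  "bracket 0 (x::'a::complex_lie_algebra) = 0" "bracket (x::'a::complex_lie_algebra) 0 = 0"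
  using bracket_add_left[of 0 0 x] bracket_add_right[of x 0 0] by simp_all

lemma bracket_skew: "bracket (x::'a::complex_lie_algebra) y = - bracket y x"
proof -
  have "bracket x y + bracket y x = bracket (x + y) (x + y)"
    unfolding bracket_add_left bracket_add_right by (simp add: bracket_self)
  then show ?thesis
    by (simp add: bracket_self eq_neg_iff_add_eq_0)
qed


section \<open>The Lie algebra \<open>sl\<^sub>2\<close>\<close>

datatype sl2 = Sl2 (e_coord: complex) (f_coord: complex) (h_coord: complex)

lemma sl2_eq_iff:
  "x = y \<longleftrightarrow> e_coord x = e_coord y \<and> f_coord x = f_coord y \<and> h_coord x = h_coord y"
  by (cases x; cases y) simp

instantiation sl2 :: complex_lie_algebra
begin

definition "0 = Sl2 0 0 0"
definition "x + y = Sl2 (e_coord x + e_coord y) (f_coord x + f_coord y) (h_coord x + h_coord y)"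
definition "- x = Sl2 (- e_coord x) (- f_coord x) (- h_coord x)"
definition "x - y = Sl2 (e_coord x - e_coord y) (f_coord x - f_coord y) (h_coord x - h_coord y)"
definition "cscale c x = Sl2 (c * e_coord x) (c * f_coord x) (c * h_coord x)"
definition "bracket x y =
  Sl2 (2 * (h_coord x * e_coord y - e_coord x * h_coord y))
      (2 * (f_coord x * h_coord y - h_coord x * f_coord y))
      (e_coord x * f_coord y - f_coord x * e_coord y)"

lemmas sl2_ops_defs = zero_sl2_def plus_sl2_def uminus_sl2_def minus_sl2_def
  cscale_sl2_def bracket_sl2_def

instance
  by standard (simp_all add: sl2_ops_defs sl2_eq_iff algebra_simps)

end

definition sl2_e :: sl2 where "sl2_e = Sl2 1 0 0"
definition sl2_f :: sl2 where "sl2_f = Sl2 0 1 0"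
definition sl2_h :: sl2 where "sl2_h = Sl2 0 0 1"

definition sl2_form :: "sl2 \<Rightarrow> sl2 \<Rightarrow> complex" where
  "sl2_form x y = e_coord x * f_coord y + f_coord x * e_coord y + 2 * h_coord x * h_coord y"

lemma sl2_basis_expansion:
  "x = cscale (e_coord x) sl2_e + cscale (f_coord x) sl2_f + cscale (h_coord x) sl2_h"
  by (simp add: sl2_e_def sl2_f_def sl2_h_def sl2_ops_defs sl2_eq_iff)

lemma sl2_basis_brackets:
  "bracket sl2_e sl2_f = sl2_h" "bracket sl2_h sl2_e = cscale 2 sl2_e"
  "bracket sl2_h sl2_f = cscale (-2) sl2_f"
  by (simp_all add: sl2_e_def sl2_f_def sl2_h_def sl2_ops_defs)

lemma sl2_basis_form:
  "sl2_form sl2_e sl2_f = 1" "sl2_form sl2_h sl2_h = 2" "sl2_form sl2_e sl2_e = 0"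
  "sl2_form sl2_f sl2_f = 0" "sl2_form sl2_e sl2_h = 0" "sl2_form sl2_f sl2_h = 0"
  by (simp_all add: sl2_form_def sl2_e_def sl2_f_def sl2_h_def)

lemma sl2_form_bilinear:
  "sl2_form (x + y) z = sl2_form x z + sl2_form y z"
  "sl2_form z (x + y) = sl2_form z x + sl2_form z y"
  "sl2_form (cscale c x) z = c * sl2_form x z"
  "sl2_form z (cscale c x) = c * sl2_form z x"
  "sl2_form (- x) z = - sl2_form x z" "sl2_form z (- x) = - sl2_form z x"
  "sl2_form 0 z = 0" "sl2_form z 0 = 0"
  by (simp_all add: sl2_form_def sl2_ops_defs algebra_simps)

lemma sl2_form_commute: "sl2_form x y = sl2_form y x"
  by (simp add: sl2_form_def)

lemma sl2_form_invariant: "sl2_form (bracket x y) z = sl2_form x (bracket y z)"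
  by (simp add: sl2_form_def sl2_ops_defs algebra_simps)

lemma sl2_eq_neg_self: "(x::sl2) = - x \<Longrightarrow> x = 0"
  by (simp add: sl2_ops_defs sl2_eq_iff)


section \<open>The loop algebra of \<open>sl\<^sub>2\<close>\<close>

text \<open>
  An element \<open>\<Sum>\<^sub>n x\<^sub>n \<otimes> t\<^sup>n\<close> of \<open>sl\<^sub>2 \<otimes> \<complex>[t,t\<inverse>]\<close> is the finitely supported
  family \<open>n \<mapsto> x\<^sub>n\<close>; thus \<open>x \<otimes> t\<^sup>n\<close> is \<^term>\<open>Poly_Mapping.single n x\<close>.
\<close>

type_synonym loop_sl2 = "int \<Rightarrow>\<^sub>0 sl2"

abbreviation (input) coeff_at :: "loop_sl2 \<Rightarrow> int \<Rightarrow> sl2" where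
  "coeff_at \<equiv> Poly_Mapping.lookup"

definition loop_scale :: "complex \<Rightarrow> loop_sl2 \<Rightarrow> loop_sl2" where
  "loop_scale c = Poly_Mapping.map (cscale c)"

definition loop_bracket :: "loop_sl2 \<Rightarrow> loop_sl2 \<Rightarrow> loop_sl2" where
  "loop_bracket x y =
     (\<Sum>m\<in>Poly_Mapping.keys x. \<Sum>n\<in>Poly_Mapping.keys y.
        Poly_Mapping.single (m + n) (bracket (coeff_at x m) (coeff_at y n)))"

text \<open>The derivation \<open>t d/dt\<close> and the cocycle \<open>(x t\<^sup>m, y t\<^sup>n) \<mapsto> m (x,y) \<delta>\<^bsub>m+n,0\<^esub>\<close>.\<close>

definition loop_deriv :: "loop_sl2 \<Rightarrow> loop_sl2" where
  "loop_deriv x =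
     (\<Sum>n\<in>Poly_Mapping.keys x. Poly_Mapping.single n (cscale (of_int n) (coeff_at x n)))"

definition loop_cocycle :: "loop_sl2 \<Rightarrow> loop_sl2 \<Rightarrow> complex" where
  "loop_cocycle x y =
     (\<Sum>m\<in>Poly_Mapping.keys x. of_int m * sl2_form (coeff_at x m) (coeff_at y (- m)))"

lemma lookup_loop_scale: "coeff_at (loop_scale c x) n = cscale c (coeff_at x n)"
  unfolding loop_scale_def by (auto simp: Poly_Mapping.map.rep_eq when_def)

lemma lookup_loop_deriv: "coeff_at (loop_deriv x) n = cscale (of_int n) (coeff_at x n)"
proof -
  have "coeff_at (loop_deriv x) n =
      (\<Sum>k\<in>Poly_Mapping.keys x. if k = n then cscale (of_int k) (coeff_at x k) else 0)"
    unfolding loop_deriv_def by (simp add: lookup_sum lookup_single when_def)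
  then show ?thesis
    by (auto simp: sum.delta in_keys_iff)
qed

lemma loop_bracket_superset:
  assumes "finite A" "Poly_Mapping.keys x \<subseteq> A" "finite B" "Poly_Mapping.keys y \<subseteq> B"
  shows "loop_bracket x y =
    (\<Sum>m\<in>A. \<Sum>n\<in>B. Poly_Mapping.single (m + n) (bracket (coeff_at x m) (coeff_at y n)))"
proof -
  have "loop_bracket x y =
    (\<Sum>m\<in>Poly_Mapping.keys x. \<Sum>n\<in>B.
        Poly_Mapping.single (m + n) (bracket (coeff_at x m) (coeff_at y n)))"
    unfolding loop_bracket_def using assms
    by (intro sum.cong refl sum.mono_neutral_left) (auto simp: in_keys_iff)
  also have "\<dots> =
    (\<Sum>m\<in>A. \<Sum>n\<in>B. Poly_Mapping.single (m + n) (bracket (coeff_at x m) (coeff_at y n)))"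
    using assms by (intro sum.mono_neutral_left) (auto simp: in_keys_iff)
  finally show ?thesis .
qed

lemma loop_cocycle_superset:
  assumes "finite A" "Poly_Mapping.keys x \<subseteq> A"
  shows "loop_cocycle x y = (\<Sum>m\<in>A. of_int m * sl2_form (coeff_at x m) (coeff_at y (- m)))"
  unfolding loop_cocycle_def using assms
  by (intro sum.mono_neutral_left) (auto simp: in_keys_iff sl2_form_bilinear)

lemma loop_bracket_add_left: "loop_bracket (x + y) z = loop_bracket x z + loop_bracket y z"
proof -
  let ?A = "Poly_Mapping.keys x \<union> Poly_Mapping.keys y"
  have "Poly_Mapping.keys (x + y) \<subseteq> ?A" by (rule Poly_Mapping.keys_add)
  then show ?thesis
    by (simp add: loop_bracket_superset[where A = ?A and B = "Poly_Mapping.keys z"]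
        lookup_add bracket_add_left single_add sum.distrib)
qed

lemma loop_bracket_skew: "loop_bracket x y = - loop_bracket y x"
proof -
  have "loop_bracket x y =
     (\<Sum>m\<in>Poly_Mapping.keys x. \<Sum>n\<in>Poly_Mapping.keys y.
        - Poly_Mapping.single (n + m) (bracket (coeff_at y n) (coeff_at x m)))"
    unfolding loop_bracket_def
    by (intro sum.cong refl) (subst bracket_skew, simp add: single_uminus add.commute)
  also have "\<dots> = - loop_bracket y x"
    unfolding loop_bracket_def by (subst sum.swap) (simp add: sum_negf)
  finally show ?thesis .
qed

lemma loop_bracket_add_right: "loop_bracket z (x + y) = loop_bracket z x + loop_bracket z y"
  by (metis loop_bracket_add_left loop_bracket_skew minus_add_distrib)

lemma loop_bracket_zero [simp]: "loop_bracket 0 x = 0" "loop_bracket x 0 = 0"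
  by (simp_all add: loop_bracket_def)

lemma loop_bracket_minus:
  "loop_bracket (- x) y = - loop_bracket x y" "loop_bracket x (- y) = - loop_bracket x y"
  by (metis add.right_inverse add_eq_0_iff loop_bracket_add_left loop_bracket_zero(1),
      metis add.right_inverse add_eq_0_iff loop_bracket_add_right loop_bracket_zero(2))

lemma loop_scale_sum: "loop_scale c (\<Sum>i\<in>A. g i) = (\<Sum>i\<in>A. loop_scale c (g i))"
proof (rule poly_mapping_eqI)
  fix k
  show "coeff_at (loop_scale c (sum g A)) k = coeff_at (\<Sum>i\<in>A. loop_scale c (g i)) k"
    by (simp add: lookup_loop_scale lookup_sum lie_vs.scale_sum_right)
qed

lemma loop_scale_single: "loop_scale c (Poly_Mapping.single n x) = Poly_Mapping.single n (cscale c x)"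
  by (rule poly_mapping_eqI) (simp add: lookup_loop_scale lookup_single when_def)

lemma loop_bracket_scale_left: "loop_bracket (loop_scale c x) y = loop_scale c (loop_bracket x y)"
proof -
  have "Poly_Mapping.keys (loop_scale c x) \<subseteq> Poly_Mapping.keys x"
    by (auto simp: in_keys_iff lookup_loop_scale)
  then show ?thesis
    by (simp add: loop_bracket_superset[where A = "Poly_Mapping.keys x" and B = "Poly_Mapping.keys y"]
        lookup_loop_scale loop_scale_sum loop_scale_single bracket_cscale_left)
qed

lemma loop_scale_minus: "loop_scale c (- x) = - loop_scale c x"
  by (rule poly_mapping_eqI) (simp add: lookup_loop_scale)

lemma loop_bracket_scale_right: "loop_bracket y (loop_scale c x) = loop_scale c (loop_bracket y x)"
  by (metis loop_bracket_scale_left loop_bracket_skew loop_scale_minus)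

lemma loop_bracket_self: "loop_bracket x x = 0"
proof (rule poly_mapping_eqI)
  fix k
  have "coeff_at (loop_bracket x x) k = - coeff_at (loop_bracket x x) k"
    by (subst (1) loop_bracket_skew) simp
  then show "coeff_at (loop_bracket x x) k = coeff_at 0 k"
    using sl2_eq_neg_self by simp
qed

lemma loop_bracket_single:
  "loop_bracket (Poly_Mapping.single m x) (Poly_Mapping.single n y) =
     Poly_Mapping.single (m + n) (bracket x y)"
  by (simp add: loop_bracket_superset[where A = "{m}" and B = "{n}"])

lemma loop_induct [case_names zero add single]:
  fixes x :: loop_sl2
  assumes "P 0" "\<And>x y. P x \<Longrightarrow> P y \<Longrightarrow> P (x + y)" "\<And>n a. P (Poly_Mapping.single n a)"
  shows "P x"
proof (induction x rule: Poly_Mapping.update_induct)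
  case const
  show ?case by (rule assms)
next
  case (update f a b)
  have "Poly_Mapping.update a b f = f + Poly_Mapping.single a b"
    using update(1)
    by (intro poly_mapping_eqI) (auto simp: lookup_update lookup_add lookup_single when_def in_keys_iff)
  then show ?case using update assms by simp
qed

lemma add_triple_zero:
  "a + b + c = 0 \<Longrightarrow> a' + b' + c' = 0 \<Longrightarrow> (a + a') + (b + b') + (c + c') = (0::'a::ab_group_add)"
proof -
  have "(a + a') + (b + b') + (c + c') = (a + b + c) + (a' + b' + c')"
    by (simp only: ac_simps)
  then show "a + b + c = 0 \<Longrightarrow> a' + b' + c' = 0 \<Longrightarrow> ?thesis" by simp
qed

lemma loop_jacobi:
  "loop_bracket x (loop_bracket y z) + loop_bracket y (loop_bracket z x)
     + loop_bracket z (loop_bracket x y) = 0"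
proof (induction x rule: loop_induct)
  case (add x x')
  then show ?case
    unfolding loop_bracket_add_left loop_bracket_add_right by (rule add_triple_zero)
next
  case (single m a)
  show ?case
  proof (induction y rule: loop_induct)
    case (add x x')
    then show ?case
      unfolding loop_bracket_add_left loop_bracket_add_right by (rule add_triple_zero)
  next
    case (single n b)
    show ?case
    proof (induction z rule: loop_induct)
      case (add x x')
      then show ?case
        unfolding loop_bracket_add_left loop_bracket_add_right by (rule add_triple_zero)
    next
      case (single k c)
      have *: "n + (k + m) = m + (n + k)" "k + (m + n) = m + (n + k)" by simp_all
      show ?case
        unfolding loop_bracket_single * single_add[symmetric] bracket_jacobi by simp
    qed simp
  qed simp
qed simp

lemma loop_cocycle_single:
  "loop_cocycle (Poly_Mapping.single m x) (Poly_Mapping.single n y) =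
     (if m + n = 0 then of_int m * sl2_form x y else 0)"
  by (auto simp: loop_cocycle_superset[where A = "{m}"] lookup_single when_def sl2_form_bilinear)

lemma loop_cocycle_add_left: "loop_cocycle (x + y) z = loop_cocycle x z + loop_cocycle y z"
proof -
  let ?A = "Poly_Mapping.keys x \<union> Poly_Mapping.keys y"
  have "Poly_Mapping.keys (x + y) \<subseteq> ?A" by (rule Poly_Mapping.keys_add)
  then show ?thesis
    by (simp add: loop_cocycle_superset[where A = ?A] lookup_add sl2_form_bilinear
        sum.distrib algebra_simps)
qed

lemma loop_cocycle_add_right: "loop_cocycle z (x + y) = loop_cocycle z x + loop_cocycle z y"
  by (simp add: loop_cocycle_def lookup_add sl2_form_bilinear sum.distrib algebra_simps)

lemma loop_cocycle_zero [simp]: "loop_cocycle 0 x = 0" "loop_cocycle x 0 = 0"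
  by (simp_all add: loop_cocycle_def sl2_form_bilinear)

lemma loop_cocycle_scale_left: "loop_cocycle (loop_scale c x) y = c * loop_cocycle x y"
proof -
  have "Poly_Mapping.keys (loop_scale c x) \<subseteq> Poly_Mapping.keys x"
    by (auto simp: in_keys_iff lookup_loop_scale)
  then show ?thesis
    by (simp add: loop_cocycle_superset[where A = "Poly_Mapping.keys x"] lookup_loop_scale
        sl2_form_bilinear sum_distrib_left algebra_simps)
qed

lemma loop_cocycle_scale_right: "loop_cocycle y (loop_scale c x) = c * loop_cocycle y x"
  by (simp add: loop_cocycle_def lookup_loop_scale sl2_form_bilinear sum_distrib_left algebra_simps)

lemma loop_cocycle_minus:
  "loop_cocycle (- x) y = - loop_cocycle x y" "loop_cocycle x (- y) = - loop_cocycle x y"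
  by (metis add.right_inverse add_eq_0_iff loop_cocycle_add_left loop_cocycle_zero(1),
      metis add.right_inverse add_eq_0_iff loop_cocycle_add_right loop_cocycle_zero(2))

lemma loop_cocycle_skew: "loop_cocycle x y = - loop_cocycle y x"
proof (induction x rule: loop_induct)
  case (single m a)
  show ?case
  proof (induction y rule: loop_induct)
    case (single n b)
    show ?case
      by (auto simp: loop_cocycle_single add_eq_0_iff sl2_form_commute)
  qed (simp_all add: loop_cocycle_add_left loop_cocycle_add_right)
qed (simp_all add: loop_cocycle_add_left loop_cocycle_add_right)

lemma loop_cocycle_jacobi:
  "loop_cocycle x (loop_bracket y z) + loop_cocycle y (loop_bracket z x)
     + loop_cocycle z (loop_bracket x y) = 0"
proof (induction x rule: loop_induct)
  case (add x x')
  then show ?case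
    unfolding loop_bracket_add_left loop_bracket_add_right loop_cocycle_add_left
        loop_cocycle_add_right
      by (rule add_triple_zero)
next
  case (single m a)
  show ?case
  proof (induction y rule: loop_induct)
    case (add x x')
    then show ?case
      unfolding loop_bracket_add_left loop_bracket_add_right loop_cocycle_add_left
          loop_cocycle_add_right
      by (rule add_triple_zero)
  next
    case (single n b)
    show ?case
    proof (induction z rule: loop_induct)
      case (add x x')
      then show ?case
        unfolding loop_bracket_add_left loop_bracket_add_right loop_cocycle_add_left
            loop_cocycle_add_right
      by (rule add_triple_zero)
    next
      case (single k c)
      have 1: "sl2_form b (bracket c a) = sl2_form a (bracket b c)"
        by (metis sl2_form_commute sl2_form_invariant)
      have 2: "sl2_form c (bracket a b) = sl2_form a (bracket b c)"
        by (metis sl2_form_commute sl2_form_invariant)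
      have 3: "n + (k + m) = m + (n + k)" "k + (m + n) = m + (n + k)" by simp_all
      have 4: "of_int m * s + of_int n * s + of_int k * s = 0" if "m + (n + k) = 0" for s :: complex
        using that by (metis add.assoc distrib_right mult_zero_left of_int_0 of_int_add)
      show ?case
        unfolding loop_bracket_single loop_cocycle_single 1 2 3 by (simp add: 4)
    qed simp
  qed simp
qed simp

lemma loop_deriv_add: "loop_deriv (x + y) = loop_deriv x + loop_deriv y"
  by (rule poly_mapping_eqI) (simp add: lookup_loop_deriv lookup_add cscale_add_right)

lemma loop_deriv_minus: "loop_deriv (- x) = - loop_deriv x"
  by (rule poly_mapping_eqI) (simp add: lookup_loop_deriv)

lemma loop_deriv_zero [simp]: "loop_deriv 0 = 0"
  by (simp add: loop_deriv_def)

lemma loop_deriv_single: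
  "loop_deriv (Poly_Mapping.single n x) = Poly_Mapping.single n (cscale (of_int n) x)"
  by (rule poly_mapping_eqI) (simp add: lookup_loop_deriv lookup_single when_def)

lemma loop_deriv_scale: "loop_deriv (loop_scale c x) = loop_scale c (loop_deriv x)"
  by (rule poly_mapping_eqI)
    (simp add: lookup_loop_deriv lookup_loop_scale mult.commute)

lemma loop_deriv_bracket:
  "loop_deriv (loop_bracket x y) = loop_bracket (loop_deriv x) y + loop_bracket x (loop_deriv y)"
proof (induction x rule: loop_induct)
  case (single m a)
  show ?case
  proof (induction y rule: loop_induct)
    case (single n b)
    show ?case
      by (simp add: loop_bracket_single loop_deriv_single bracket_cscale_left bracket_cscale_right
          cscale_add_left single_add)
  qed (simp_all add: loop_bracket_add_left loop_bracket_add_right loop_deriv_add)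
qed (simp_all add: loop_bracket_add_left loop_bracket_add_right loop_deriv_add)

lemma loop_cocycle_deriv: "loop_cocycle x (loop_deriv y) = loop_cocycle y (loop_deriv x)"
proof (induction x rule: loop_induct)
  case (single m a)
  show ?case
  proof (induction y rule: loop_induct)
    case (single n b)
    show ?case
      by (auto simp: loop_cocycle_single loop_deriv_single sl2_form_bilinear sl2_form_commute
          add_eq_0_iff)
  qed (simp_all add: loop_cocycle_add_left loop_cocycle_add_right loop_deriv_add)
qed (simp_all add: loop_cocycle_add_left loop_cocycle_add_right loop_deriv_add)


lemma loop_scale_add: "loop_scale c (x + y) = loop_scale c x + loop_scale c y"
  by (rule poly_mapping_eqI) (simp add: lookup_loop_scale lookup_add cscale_add_right)

lemma loop_scale_diff: "loop_scale c (x - y) = loop_scale c x - loop_scale c y"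
  by (rule poly_mapping_eqI) (simp add: lookup_loop_scale lookup_minus lie_vs.scale_right_diff_distrib)

lemma loop_scale_add_left: "loop_scale (c + c') x = loop_scale c x + loop_scale c' x"
  by (rule poly_mapping_eqI) (simp add: lookup_loop_scale lookup_add cscale_add_left)

lemma loop_scale_scale: "loop_scale c (loop_scale c' x) = loop_scale (c * c') x"
  by (rule poly_mapping_eqI) (simp add: lookup_loop_scale)

lemma loop_scale_one [simp]: "loop_scale 1 x = x"
  by (rule poly_mapping_eqI) (simp add: lookup_loop_scale)

lemma loop_scale_zero [simp]: "loop_scale 0 x = 0" "loop_scale c 0 = 0"
  by (rule poly_mapping_eqI, simp add: lookup_loop_scale)+

lemma loop_bracket_diff_right: "loop_bracket z (x - y) = loop_bracket z x - loop_bracket z y"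
  using loop_bracket_add_right[of z x "- y"] by (simp add: loop_bracket_minus)

lemma loop_cocycle_diff_right: "loop_cocycle z (x - y) = loop_cocycle z x - loop_cocycle z y"
  using loop_cocycle_add_right[of z x "- y"] by (simp add: loop_cocycle_minus)

lemma loop_deriv_diff: "loop_deriv (x - y) = loop_deriv x - loop_deriv y"
  using loop_deriv_add[of x "- y"] by (simp add: loop_deriv_minus)

lemma loop_cocycle_self: "loop_cocycle x x = 0"
  using loop_cocycle_skew[of x x] by simp

lemma jacobi_cancel:
  fixes p q :: "'a::ab_group_add"
  shows "- p - q + bxz - cxy + (- azy + ayz + abz - acy)
    + (p + cyx - ayz + (- bxz + bzx + bcx - abz))
    + (q + azy - bzx + (- cyx + cxy + acy - bcx)) = 0"
  by (simp only: diff_conv_add_uminus add.assoc) (simp add: add.commute add.left_commute)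

lemma loop_semidirect_jacobi:
  "loop_bracket x (loop_bracket y z + loop_scale b (loop_deriv z) - loop_scale c (loop_deriv y))
     + loop_scale a (loop_deriv (loop_bracket y z + loop_scale b (loop_deriv z) - loop_scale c (loop_deriv y)))
   + (loop_bracket y (loop_bracket z x + loop_scale c (loop_deriv x) - loop_scale a (loop_deriv z))
     + loop_scale b (loop_deriv (loop_bracket z x + loop_scale c (loop_deriv x) - loop_scale a (loop_deriv z))))
   + (loop_bracket z (loop_bracket x y + loop_scale a (loop_deriv y) - loop_scale b (loop_deriv x))
     + loop_scale c (loop_deriv (loop_bracket x y + loop_scale a (loop_deriv y) - loop_scale b (loop_deriv x)))) = 0"
proof -
  have s: "loop_bracket (loop_deriv y) z = - loop_bracket z (loop_deriv y)"
    "loop_bracket (loop_deriv z) x = - loop_bracket x (loop_deriv z)"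
    "loop_bracket (loop_deriv x) y = - loop_bracket y (loop_deriv x)"
    by (rule loop_bracket_skew)+
  have j: "loop_bracket x (loop_bracket y z) = - loop_bracket y (loop_bracket z x)
     - loop_bracket z (loop_bracket x y)"
    using loop_jacobi[of x y z] by (simp add: eq_neg_iff_add_eq_0 algebra_simps)
  show ?thesis
    unfolding loop_bracket_add_right loop_bracket_diff_right loop_deriv_add loop_deriv_diff
      loop_scale_add loop_scale_diff loop_scale_scale loop_deriv_bracket loop_deriv_scale s j
      loop_bracket_scale_right loop_scale_minus
      mult.commute[of b a] mult.commute[of c a] mult.commute[of c b]
    by (rule jacobi_cancel)
qed

lemma cocycle_semidirect_jacobi:
  "loop_cocycle x (loop_bracket y z + loop_scale b (loop_deriv z) - loop_scale c (loop_deriv y))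
   + loop_cocycle y (loop_bracket z x + loop_scale c (loop_deriv x) - loop_scale a (loop_deriv z))
   + loop_cocycle z (loop_bracket x y + loop_scale a (loop_deriv y) - loop_scale b (loop_deriv x)) = 0"
  using loop_cocycle_jacobi[of x y z] loop_cocycle_deriv[of x y] loop_cocycle_deriv[of x z]
    loop_cocycle_deriv[of y z]
  by (simp add: loop_cocycle_add_right loop_cocycle_diff_right loop_cocycle_scale_right add.assoc)


section \<open>The affine Lie algebras\<close>

text \<open>\<open>Tilde x a b\<close> is the element \<open>x + a c + b d\<close>.\<close>

datatype sl2_tilde =
  Tilde (tilde_loop: loop_sl2) (tilde_central: complex) (tilde_degree: complex)

lemma sl2_tilde_eq_iff:
  "x = y \<longleftrightarrow> tilde_loop x = tilde_loop y \<and> tilde_central x = tilde_central y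
     \<and> tilde_degree x = tilde_degree y"
  by (cases x; cases y) simp

instantiation sl2_tilde :: complex_lie_algebra
begin

definition "0 = Tilde 0 0 0"
definition "x + y = Tilde (tilde_loop x + tilde_loop y)
  (tilde_central x + tilde_central y) (tilde_degree x + tilde_degree y)"
definition "- x = Tilde (- tilde_loop x) (- tilde_central x) (- tilde_degree x)"
definition "x - y = Tilde (tilde_loop x - tilde_loop y)
  (tilde_central x - tilde_central y) (tilde_degree x - tilde_degree y)"
definition "cscale a x =
  Tilde (loop_scale a (tilde_loop x)) (a * tilde_central x) (a * tilde_degree x)"
definition "bracket x y =
  Tilde (loop_bracket (tilde_loop x) (tilde_loop y)
           + loop_scale (tilde_degree x) (loop_deriv (tilde_loop y))
           - loop_scale (tilde_degree y) (loop_deriv (tilde_loop x)))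
        (loop_cocycle (tilde_loop x) (tilde_loop y))
        0"

lemmas sl2_tilde_ops_defs = zero_sl2_tilde_def plus_sl2_tilde_def uminus_sl2_tilde_def
  minus_sl2_tilde_def cscale_sl2_tilde_def bracket_sl2_tilde_def

instance
proof
  fix x y z :: sl2_tilde and c c' :: complex
  show "x + y + z = x + (y + z)"
    by (simp add: sl2_tilde_ops_defs add.assoc)
  show "x + y = y + x"
    by (simp add: sl2_tilde_ops_defs add.commute)
  show "0 + x = x" "- x + x = 0" "x - y = x + - y"
    by (simp_all add: sl2_tilde_ops_defs)
  show "cscale c (x + y) = cscale c x + cscale c y"
    by (simp add: sl2_tilde_ops_defs loop_scale_add distrib_left)
  show "cscale (c + c') x = cscale c x + cscale c' x"
    by (simp add: sl2_tilde_ops_defs loop_scale_add_left distrib_right)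
  show "cscale c (cscale c' x) = cscale (c * c') x"
    by (simp add: sl2_tilde_ops_defs loop_scale_scale)
  show "cscale 1 x = x"
    by (simp add: sl2_tilde_ops_defs)
  show "bracket (x + y) z = bracket x z + bracket y z"
    by (simp add: sl2_tilde_ops_defs loop_bracket_add_left loop_scale_add_left
        loop_scale_add loop_deriv_add loop_cocycle_add_left)
  show "bracket x (y + z) = bracket x y + bracket x z"
    by (simp add: sl2_tilde_ops_defs loop_bracket_add_right loop_scale_add_left
        loop_scale_add loop_deriv_add loop_cocycle_add_right)
  show "bracket (cscale c x) y = cscale c (bracket x y)"
    by (simp add: sl2_tilde_ops_defs loop_bracket_scale_left loop_scale_scale loop_scale_add
        loop_scale_diff loop_deriv_scale loop_cocycle_scale_left mult.commute)
  show "bracket x (cscale c y) = cscale c (bracket x y)"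
    by (simp add: sl2_tilde_ops_defs loop_bracket_scale_right loop_scale_scale loop_scale_add
        loop_scale_diff loop_deriv_scale loop_cocycle_scale_right mult.commute)
  show "bracket x x = 0"
    by (simp add: sl2_tilde_ops_defs loop_bracket_self loop_cocycle_self)
  show "bracket x (bracket y z) + bracket y (bracket z x) + bracket z (bracket x y) = 0"
    using loop_semidirect_jacobi[of "tilde_loop x" "tilde_loop y" "tilde_loop z"
        "tilde_degree y" "tilde_degree z" "tilde_degree x"]
      cocycle_semidirect_jacobi[of "tilde_loop x" "tilde_loop y" "tilde_loop z"
        "tilde_degree y" "tilde_degree z" "tilde_degree x"]
    by (simp only: sl2_tilde_ops_defs sl2_tilde.sel loop_scale_zero diff_zero add_0_right)
qed

end

datatype sl2_hat = Hat (hat_loop: loop_sl2) (hat_central: complex)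

definition tilde_of_hat :: "sl2_hat \<Rightarrow> sl2_tilde" where
  "tilde_of_hat x = Tilde (hat_loop x) (hat_central x) 0"

lemma tilde_of_hat_eq_iff: "tilde_of_hat x = tilde_of_hat y \<longleftrightarrow> x = y"
  by (cases x; cases y) (simp add: tilde_of_hat_def)

instantiation sl2_hat :: complex_lie_algebra
begin

definition "0 = Hat 0 0"
definition "x + y = Hat (hat_loop x + hat_loop y) (hat_central x + hat_central y)"
definition "- x = Hat (- hat_loop x) (- hat_central x)"
definition "x - y = Hat (hat_loop x - hat_loop y) (hat_central x - hat_central y)"
definition "cscale a x = Hat (loop_scale a (hat_loop x)) (a * hat_central x)"
definition "bracket x y =
  Hat (loop_bracket (hat_loop x) (hat_loop y)) (loop_cocycle (hat_loop x) (hat_loop y))"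

lemmas sl2_hat_ops_defs = zero_sl2_hat_def plus_sl2_hat_def uminus_sl2_hat_def
  minus_sl2_hat_def cscale_sl2_hat_def bracket_sl2_hat_def

lemma tilde_of_hat_hom:
  "tilde_of_hat 0 = 0"
  "tilde_of_hat (x + y) = tilde_of_hat x + tilde_of_hat y"
  "tilde_of_hat (- x) = - tilde_of_hat x"
  "tilde_of_hat (x - y) = tilde_of_hat x - tilde_of_hat y"
  "tilde_of_hat (cscale a x) = cscale a (tilde_of_hat x)"
  "tilde_of_hat (bracket x y) = bracket (tilde_of_hat x) (tilde_of_hat y)"
  by (simp_all add: tilde_of_hat_def sl2_hat_ops_defs sl2_tilde_ops_defs)

instance
  by standard
    (simp_all add: tilde_of_hat_eq_iff[symmetric] tilde_of_hat_hom add.assoc cscale_add_right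
      cscale_add_left bracket_add_left bracket_add_right bracket_cscale_left bracket_cscale_right
      bracket_self bracket_jacobi[unfolded add.assoc])

end

definition hat_gen :: "sl2 \<Rightarrow> int \<Rightarrow> sl2_hat" where
  "hat_gen x n = Hat (Poly_Mapping.single n x) 0"

definition hat_c :: sl2_hat where "hat_c = Hat 0 1"

abbreviation "hat_e \<equiv> hat_gen sl2_e"
abbreviation "hat_f \<equiv> hat_gen sl2_f"
abbreviation "hat_h \<equiv> hat_gen sl2_h"

definition tilde_d :: sl2_tilde where "tilde_d = Tilde 0 0 1"

lemma hat_brackets:
  "bracket (hat_gen x n) (hat_gen y m) =
     hat_gen (bracket x y) (n + m) + cscale (of_int n * sl2_form x y * (if n + m = 0 then 1 else 0)) hat_c"
  "bracket hat_c z = 0"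
  by (simp_all add: hat_gen_def hat_c_def sl2_hat_ops_defs loop_bracket_single loop_cocycle_single)

lemma tilde_brackets:
  "bracket tilde_d (tilde_of_hat (hat_gen x n)) = cscale (of_int n) (tilde_of_hat (hat_gen x n))"
  "bracket (tilde_of_hat hat_c) z = 0"
  by (simp_all add: tilde_d_def hat_c_def hat_gen_def tilde_of_hat_def sl2_tilde_ops_defs
      loop_deriv_single loop_scale_single)


section \<open>Universal enveloping algebras\<close>

text \<open>
  \<open>U(g)\<close> is the free associative unital algebra on the set of symbols \<open>g\<close>, that is, the monoid
  algebra of the free monoid on \<open>g\<close>, modulo the two-sided ideal that makes the inclusion of
  \<open>g\<close> linear and turns brackets into commutators.  Factoring out the linearity relations
  alone gives the tensor algebra.
\<close>

datatype 'x free_monoid = Free_Word (letters: "'x list")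

instantiation free_monoid :: (type) monoid_add
begin

definition "0 = Free_Word []"
definition "u + v = Free_Word (letters u @ letters v)"

instance
  by standard (simp_all add: zero_free_monoid_def plus_free_monoid_def)

end

type_synonym 'x free_algebra = "'x free_monoid \<Rightarrow>\<^sub>0 complex"

definition free_gen :: "'x \<Rightarrow> 'x free_algebra" where
  "free_gen x = Poly_Mapping.single (Free_Word [x]) 1"

definition free_scalar :: "complex \<Rightarrow> 'x free_algebra" where
  "free_scalar c = Poly_Mapping.single 0 c"

inductive_set uea_ideal :: "'g::complex_lie_algebra free_algebra set" where
  rel_add: "free_gen (x + y) - free_gen x - free_gen y \<in> uea_ideal"
| rel_scale: "free_gen (cscale c x) - free_scalar c * free_gen x \<in> uea_ideal"
| rel_bracket: "free_gen x * free_gen y - free_gen y * free_gen x - free_gen (bracket x y) \<in> uea_ideal"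
| zero: "0 \<in> uea_ideal"
| add: "u \<in> uea_ideal \<Longrightarrow> v \<in> uea_ideal \<Longrightarrow> u + v \<in> uea_ideal"
| mult: "u \<in> uea_ideal \<Longrightarrow> a * u * b \<in> uea_ideal"

lemma uea_ideal_uminus: "u \<in> uea_ideal \<Longrightarrow> - u \<in> uea_ideal"
  using uea_ideal.mult[of u "- 1" 1] by simp

definition uea_rel :: "'g::complex_lie_algebra free_algebra \<Rightarrow> 'g free_algebra \<Rightarrow> bool" where
  "uea_rel u v \<longleftrightarrow> u - v \<in> uea_ideal"

lemma uea_rel_equivp: "equivp uea_rel"
proof (rule equivpI)
  show "reflp uea_rel"
    by (simp add: reflp_def uea_rel_def uea_ideal.zero)
  show "symp uea_rel"
    using uea_ideal_uminus by (fastforce simp: symp_def uea_rel_def)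
  show "transp uea_rel"
    using uea_ideal.add by (fastforce simp: transp_def uea_rel_def)
qed

quotient_type (overloaded) 'g uea = "'g::complex_lie_algebra free_algebra" / uea_rel
  by (rule uea_rel_equivp)

text \<open>The augmentation shows that \<open>U(g)\<close> is not the zero ring.\<close>

lemma lookup_mult_empty_word:
  fixes u v :: "'x free_algebra"
  shows "Poly_Mapping.lookup (u * v) 0 = Poly_Mapping.lookup u 0 * Poly_Mapping.lookup v 0"
proof -
  have "(0 = l + q) = (l = 0 \<and> q = 0)" for l q :: "'x free_monoid"
    by (cases l; cases q) (auto simp: zero_free_monoid_def plus_free_monoid_def)
  then have "Poly_Mapping.lookup (u * v) 0 =
     Sum_any (\<lambda>l. Poly_Mapping.lookup u l * Sum_any (\<lambda>q. (Poly_Mapping.lookup v q when l = 0) when q = 0))"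
    by (simp add: lookup_mult when_when conj_commute)
  also have "\<dots> = Sum_any (\<lambda>l. (Poly_Mapping.lookup u l * Poly_Mapping.lookup v 0) when l = 0)"
    by (intro Sum_any.cong) (simp add: mult_when)
  finally show ?thesis by simp
qed

lemma lookup_free_gen_empty_word: "Poly_Mapping.lookup (free_gen x) 0 = 0"
  by (simp add: free_gen_def lookup_single zero_free_monoid_def)

lemma uea_ideal_augmentation: "u \<in> uea_ideal \<Longrightarrow> Poly_Mapping.lookup u 0 = 0"
  by (induction rule: uea_ideal.induct)
    (simp_all add: lookup_mult_empty_word lookup_add lookup_minus lookup_free_gen_empty_word)

instantiation uea :: (complex_lie_algebra) ring_1
begin

lift_definition zero_uea :: "'a uea" is 0 .
lift_definition one_uea :: "'a uea" is 1 .
lift_definition plus_uea :: "'a uea \<Rightarrow> 'a uea \<Rightarrow> 'a uea" is "(+)"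
  unfolding uea_rel_def by (metis add_diff_add uea_ideal.add)
lift_definition uminus_uea :: "'a uea \<Rightarrow> 'a uea" is uminus
  unfolding uea_rel_def by (metis minus_diff_minus uea_ideal_uminus)
lift_definition minus_uea :: "'a uea \<Rightarrow> 'a uea \<Rightarrow> 'a uea" is "(-)"
proof -
  fix u u' v v' :: "'a free_algebra"
  assume "uea_rel u u'" "uea_rel v v'"
  then have "(u - u') + - (v - v') \<in> uea_ideal"
    unfolding uea_rel_def by (intro uea_ideal.add uea_ideal_uminus)
  then show "uea_rel (u - v) (u' - v')"
    unfolding uea_rel_def by (simp add: algebra_simps)
qed
lift_definition times_uea :: "'a uea \<Rightarrow> 'a uea \<Rightarrow> 'a uea" is "(*)"
proof -
  fix u u' v v' :: "'a free_algebra"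
  assume "uea_rel u u'" "uea_rel v v'"
  then have "1 * (u - u') * v + u' * (v - v') * 1 \<in> uea_ideal"
    unfolding uea_rel_def by (intro uea_ideal.add uea_ideal.mult)
  then show "uea_rel (u * v) (u' * v')"
    unfolding uea_rel_def by (simp add: algebra_simps)
qed

instance
proof
  show "(0::'a uea) \<noteq> 1"
  proof transfer
    have "(0 - 1 :: 'a free_algebra) \<notin> uea_ideal"
      using uea_ideal_augmentation[of "0 - 1 :: 'a free_algebra"] by (auto simp: lookup_minus)
    then show "\<not> uea_rel (0 :: 'a free_algebra) 1"
      by (simp add: uea_rel_def)
  qed
qed (transfer; simp add: uea_rel_def uea_ideal.zero algebra_simps)+

end

lift_definition uea_incl :: "'g::complex_lie_algebra \<Rightarrow> 'g uea" is free_gen .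

lift_definition uea_scalar :: "complex \<Rightarrow> 'g::complex_lie_algebra uea" is free_scalar .

lemma uea_incl_bracket:
  "uea_incl (bracket x y) = uea_incl x * uea_incl y - uea_incl y * uea_incl x"
proof transfer
  fix x y :: 'a
  show "uea_rel (free_gen (bracket x y)) (free_gen x * free_gen y - free_gen y * free_gen x)"
    using uea_ideal_uminus[OF uea_ideal.rel_bracket[of x y]] by (simp add: uea_rel_def)
qed

lemma uea_incl_add: "uea_incl (x + y) = uea_incl x + uea_incl y"
proof transfer
  fix x y :: 'a
  show "uea_rel (free_gen (x + y)) (free_gen x + free_gen y)"
    using uea_ideal.rel_add[of x y] by (simp add: uea_rel_def algebra_simps)
qed

lemma uea_incl_scale: "uea_incl (cscale c x) = uea_scalar c * uea_incl x"
proof transfer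
  fix c :: complex and x :: 'a
  show "uea_rel (free_gen (cscale c x)) (free_scalar c * free_gen x)"
    using uea_ideal.rel_scale[of c x] by (simp add: uea_rel_def)
qed

definition left_ideal_generated :: "'g::complex_lie_algebra uea set \<Rightarrow> 'g uea set" where
  "left_ideal_generated S =
     \<Inter> {I. 0 \<in> I \<and> (\<forall>u\<in>I. \<forall>v\<in>I. u + v \<in> I) \<and> (\<forall>a. \<forall>u\<in>I. a * u \<in> I) \<and> S \<subseteq> I}"


section \<open>Modules over a complex Lie algebra\<close>

text \<open>
  Vector spaces with a carrier set are the modules in the sense of \<^theory>\<open>HOL-Algebra.Module\<close> over
  the field of complex numbers.  As there, the inherited record fields for the
  multiplication and the unit carry no meaning.
\<close>

abbreviation complex_ring :: "complex ring" where
  "complex_ring \<equiv> ring_of_type_algebra"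

record ('g, 'v) lie_module = "(complex, 'v) module" +
  lact :: "'g \<Rightarrow> 'v \<Rightarrow> 'v" (infixr \<open>\<star>\<index>\<close> 75)

locale lie_module = module complex_ring M
  for M :: "('g::complex_lie_algebra, 'v, 'm) lie_module_scheme" (structure) +
  assumes lact_closed: "v \<in> carrier M \<Longrightarrow> x \<star> v \<in> carrier M"
    and lact_add_right:
      "v \<in> carrier M \<Longrightarrow> w \<in> carrier M \<Longrightarrow> x \<star> (v \<oplus>\<^bsub>M\<^esub> w) = x \<star> v \<oplus>\<^bsub>M\<^esub> x \<star> w"
    and lact_smult_right: "v \<in> carrier M \<Longrightarrow> x \<star> (a \<odot>\<^bsub>M\<^esub> v) = a \<odot>\<^bsub>M\<^esub> (x \<star> v)"
    and lact_add_left: "v \<in> carrier M \<Longrightarrow> (x + y) \<star> v = x \<star> v \<oplus>\<^bsub>M\<^esub> y \<star> v"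
    and lact_cscale_left: "v \<in> carrier M \<Longrightarrow> cscale a x \<star> v = a \<odot>\<^bsub>M\<^esub> (x \<star> v)"
    and lact_bracket:
      "v \<in> carrier M \<Longrightarrow> bracket x y \<star> v = x \<star> (y \<star> v) \<ominus>\<^bsub>M\<^esub> y \<star> (x \<star> v)"

definition lie_submodule :: "'v set \<Rightarrow> ('g::complex_lie_algebra, 'v, 'm) lie_module_scheme \<Rightarrow> bool" where
  "lie_submodule N M \<longleftrightarrow> submodule N complex_ring M \<and> (\<forall>x. \<forall>v\<in>N. x \<star>\<^bsub>M\<^esub> v \<in> N)"

text \<open>
  The smallest submodule containing \<open>S\<close>; for \<open>S = {v}\<close> this is \<open>U(g) v\<close>.
\<close>

definition submodule_generated ::
    "('g::complex_lie_algebra, 'v, 'm) lie_module_scheme \<Rightarrow> 'v set \<Rightarrow> 'v set" where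
  "submodule_generated M S = \<Inter> {N. lie_submodule N M \<and> S \<subseteq> N}"

definition quotient_module ::
    "('g::complex_lie_algebra, 'v, 'm) lie_module_scheme \<Rightarrow> 'v set \<Rightarrow> ('g, 'v set) lie_module" where
  "quotient_module M N =
     \<lparr>carrier = a_rcosets\<^bsub>M\<^esub> N, monoid.mult = undefined, one = undefined,
      ring.zero = N, add = set_add M,
      module.smult = (\<lambda>a A. \<Union>v\<in>A. N +>\<^bsub>M\<^esub> (a \<odot>\<^bsub>M\<^esub> v)),
      lact = (\<lambda>x A. \<Union>v\<in>A. N +>\<^bsub>M\<^esub> (x \<star>\<^bsub>M\<^esub> v))\<rparr>"

definition simple_module :: "('g::complex_lie_algebra, 'v, 'm) lie_module_scheme \<Rightarrow> bool" where
  "simple_module M \<longleftrightarrow> lie_module M \<and> carrier M \<noteq> {\<zero>\<^bsub>M\<^esub>} \<and>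
     (\<forall>N. lie_submodule N M \<longrightarrow> N = {\<zero>\<^bsub>M\<^esub>} \<or> N = carrier M)"

definition module_iso ::
    "('g::complex_lie_algebra, 'v, 'm) lie_module_scheme \<Rightarrow> ('g, 'w, 'n) lie_module_scheme \<Rightarrow> ('v \<Rightarrow> 'w) set" where
  "module_iso M M' = {\<phi> \<in> iso (add_monoid M) (add_monoid M').
     \<forall>v\<in>carrier M. (\<forall>a. \<phi> (a \<odot>\<^bsub>M\<^esub> v) = a \<odot>\<^bsub>M'\<^esub> \<phi> v) \<and> (\<forall>x. \<phi> (x \<star>\<^bsub>M\<^esub> v) = x \<star>\<^bsub>M'\<^esub> \<phi> v)}"

definition isomorphic_modules ::
    "('g::complex_lie_algebra, 'v, 'm) lie_module_scheme \<Rightarrow> ('g, 'w, 'n) lie_module_scheme \<Rightarrow> bool" where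
  "isomorphic_modules M M' \<longleftrightarrow> module_iso M M' \<noteq> {}"

definition simple_quotient_kernel ::
    "('g::complex_lie_algebra, 'v, 'm) lie_module_scheme \<Rightarrow> 'v set \<Rightarrow> bool" where
  "simple_quotient_kernel M N \<longleftrightarrow> lie_submodule N M \<and> simple_module (quotient_module M N)"

definition has_unique_simple_quotient ::
    "('g::complex_lie_algebra, 'v, 'm) lie_module_scheme \<Rightarrow> bool" where
  "has_unique_simple_quotient M \<longleftrightarrow> (\<exists>!N. simple_quotient_kernel M N)"

text \<open>Meaningful only if \<^term>\<open>has_unique_simple_quotient M\<close>.\<close>

definition the_simple_quotient ::
    "('g::complex_lie_algebra, 'v, 'm) lie_module_scheme \<Rightarrow> ('g, 'v set) lie_module" where
  "the_simple_quotient M = quotient_module M (THE N. simple_quotient_kernel M N)"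

definition left_regular_module :: "('g::complex_lie_algebra, 'g uea) lie_module" where
  "left_regular_module =
     \<lparr>carrier = UNIV, monoid.mult = (*), one = 1, ring.zero = 0, add = (+),
      module.smult = (\<lambda>a u. uea_scalar a * u), lact = (\<lambda>x u. uea_incl x * u)\<rparr>"

definition restrict_to_hat ::
    "(sl2_tilde, 'v, 'm) lie_module_scheme \<Rightarrow> (sl2_hat, 'v) lie_module" where
  "restrict_to_hat M =
     \<lparr>carrier = carrier M, monoid.mult = monoid.mult M, one = one M, ring.zero = ring.zero M, add = ring.add M,
      module.smult = module.smult M, lact = (\<lambda>x. lact M (tilde_of_hat x))\<rparr>"


section \<open>Universal Whittaker modules\<close>

definition whittaker_ideal :: "complex \<Rightarrow> complex \<Rightarrow> complex \<Rightarrow> sl2_hat uea set" where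
  "whittaker_ideal lam \<mu> \<kappa> = left_ideal_generated
     ({uea_incl (hat_e 0) - uea_scalar lam, uea_incl (hat_f 1) - uea_scalar \<mu>,
       uea_incl hat_c - uea_scalar \<kappa>}
      \<union> {uea_incl (hat_e i) | i. i \<ge> 1}
      \<union> {uea_incl (hat_h i) | i. i \<ge> 1}
      \<union> {uea_incl (hat_f (i + 1)) | i. i \<ge> 1})"

definition whittaker_module ::
    "complex \<Rightarrow> complex \<Rightarrow> complex \<Rightarrow> (sl2_hat, sl2_hat uea set) lie_module" where
  "whittaker_module lam \<mu> \<kappa> = quotient_module left_regular_module (whittaker_ideal lam \<mu> \<kappa>)"

definition whittaker_vector :: "complex \<Rightarrow> complex \<Rightarrow> complex \<Rightarrow> sl2_hat uea set" where
  "whittaker_vector lam \<mu> \<kappa> =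
     whittaker_ideal lam \<mu> \<kappa> +>\<^bsub>(left_regular_module :: (sl2_hat, sl2_hat uea) lie_module)\<^esub> 1"


section \<open>Sugawara operators\<close>

text \<open>\<^term>\<open>normal_ordered M x k y m v\<close> is \<open>:x(k)y(m): v\<close>.\<close>

definition normal_ordered ::
    "(sl2_hat, 'v, 'm) lie_module_scheme \<Rightarrow> sl2 \<Rightarrow> int \<Rightarrow> sl2 \<Rightarrow> int \<Rightarrow> 'v \<Rightarrow> 'v" where
  "normal_ordered M x k y m v =
     (if k < 0 then hat_gen x k \<star>\<^bsub>M\<^esub> (hat_gen y m \<star>\<^bsub>M\<^esub> v)
      else hat_gen y m \<star>\<^bsub>M\<^esub> (hat_gen x k \<star>\<^bsub>M\<^esub> v))"

definition sugawara_summand ::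
    "(sl2_hat, 'v, 'm) lie_module_scheme \<Rightarrow> int \<Rightarrow> 'v \<Rightarrow> int \<Rightarrow> 'v" where
  "sugawara_summand M n v k =
     normal_ordered M sl2_e k sl2_f (n - k) v
     \<oplus>\<^bsub>M\<^esub> normal_ordered M sl2_f k sl2_e (n - k) v
     \<oplus>\<^bsub>M\<^esub> (1 / 2) \<odot>\<^bsub>M\<^esub> normal_ordered M sl2_h k sl2_h (n - k) v"

text \<open>
  On a restricted module only finitely many summands are nonzero at each vector, so the sum
  over all integers is the finite sum over the support.
\<close>

definition sugawara ::
    "complex \<Rightarrow> (sl2_hat, 'v, 'm) lie_module_scheme \<Rightarrow> int \<Rightarrow> 'v \<Rightarrow> 'v" where
  "sugawara \<kappa> M n v =
     (1 / (2 * (\<kappa> + 2))) \<odot>\<^bsub>M\<^esub>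
       finsum M (sugawara_summand M n v) {k. sugawara_summand M n v k \<noteq> \<zero>\<^bsub>M\<^esub>}"

text \<open>The modules \<open>M(\<lambda>,0,\<kappa>,a)\<close> and \<open>M(0,\<mu>,\<kappa>,a)\<close>.\<close>

definition whittaker_M_e ::
    "complex \<Rightarrow> complex \<Rightarrow> complex \<Rightarrow> (sl2_hat, sl2_hat uea set set) lie_module" where
  "whittaker_M_e lam \<kappa> a =
     (let V = whittaker_module lam 0 \<kappa>; w = whittaker_vector lam 0 \<kappa> in
      quotient_module V (submodule_generated V {sugawara \<kappa> V 0 w \<ominus>\<^bsub>V\<^esub> a \<odot>\<^bsub>V\<^esub> w}))"

definition whittaker_M_f ::
    "complex \<Rightarrow> complex \<Rightarrow> complex \<Rightarrow> (sl2_hat, sl2_hat uea set set) lie_module" where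
  "whittaker_M_f \<mu> \<kappa> a =
     (let V = whittaker_module 0 \<mu> \<kappa>; w = whittaker_vector 0 \<mu> \<kappa> in
      quotient_module V (submodule_generated V
        {(1 / 2) \<odot>\<^bsub>V\<^esub> (hat_h 0 \<star>\<^bsub>V\<^esub> w) \<ominus>\<^bsub>V\<^esub> sugawara \<kappa> V 0 w \<ominus>\<^bsub>V\<^esub> a \<odot>\<^bsub>V\<^esub> w}))"


section \<open>Highest weight modules\<close>

definition tilde_positive_part :: "sl2_tilde set" where
  "tilde_positive_part = lie_vs.span
     ({tilde_of_hat (hat_e n) | n. n \<ge> 0}
      \<union> {tilde_of_hat (hat_h n) | n. n \<ge> 1}
      \<union> {tilde_of_hat (hat_f n) | n. n \<ge> 1})"

definition tilde_cartan :: "sl2_tilde set" where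
  "tilde_cartan = lie_vs.span {tilde_of_hat (hat_h 0), tilde_of_hat hat_c, tilde_d}"

definition highest_weight_module :: "(sl2_tilde, 'v, 'm) lie_module_scheme \<Rightarrow> bool" where
  "highest_weight_module M \<longleftrightarrow> lie_module M \<and>
     (\<exists>v\<in>carrier M. v \<noteq> \<zero>\<^bsub>M\<^esub> \<and>
        (\<forall>x\<in>tilde_positive_part. x \<star>\<^bsub>M\<^esub> v = \<zero>\<^bsub>M\<^esub>) \<and>
        (\<exists>wt :: sl2_tilde \<Rightarrow> complex. \<forall>x\<in>tilde_cartan. x \<star>\<^bsub>M\<^esub> v = wt x \<odot>\<^bsub>M\<^esub> v) \<and>
        submodule_generated M {v} = carrier M)"

definition has_level :: "(sl2_tilde, 'v, 'm) lie_module_scheme \<Rightarrow> complex \<Rightarrow> bool" where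
  "has_level M \<kappa> \<longleftrightarrow> (\<forall>v\<in>carrier M. tilde_of_hat hat_c \<star>\<^bsub>M\<^esub> v = \<kappa> \<odot>\<^bsub>M\<^esub> v)"

end

theory Submission
  imports Defs "HOL-Library.Product_Lexorder" "HOL-Library.Product_Plus"
begin

text \<open>
  Submodules of a cyclic module correspond to left ideals of the enveloping algebra, so
  all assertions are about left ideals \<open>I\<close> above the left ideal \<open>J\<close> of relations of the
  universal module with parameters \<open>lam\<close>, \<open>mu\<close> and level \<open>\<kappa>\<close>. Modulo \<open>J\<close>, every
  element is a combination of words in the lower generators \<open>e(n)\<close> for \<open>n < 0\<close> and
  \<open>h(n)\<close>, \<open>f(n)\<close> for \<open>n \<le> 0\<close>. A filtration of these words by weight attaches
  polynomial symbols in the lower generators to the elements outside \<open>J\<close>. The raising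
  generators minus their characters, and the Sugawara operators \<open>L(n)\<close> for \<open>n \<ge> 1\<close>
  minus their eigenvalues, lower the filtration and act on symbols by first order
  differential operators. If no symbol outside some class is killed by all these
  operators, then every left ideal above \<open>J\<close>, other than \<open>J\<close> itself, contains an element
  whose symbol lies in that class. This is the lemma \<open>reduction\<close>; the three cases differ
  in the class and in the choice of operators.

  If \<open>lam\<close> and \<open>mu\<close> are nonzero, the symbol can be reduced to a constant, so \<open>J\<close> is a
  maximal left ideal (\<open>generic_ideal_maximal\<close>).

  If only \<open>lam\<close> is nonzero, the symbol can be reduced to one in \<open>h(0)\<close> and \<open>f(0)\<close>, and
  then \<open>e(0)\<close>, which acts on the cyclic vector by \<open>lam\<close>, reduces it further to a nonzero
  polynomial in the Casimir element of the zero modes (\<open>degenerate_ideal_reduction\<close>). On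
  the cyclic vector, \<open>L(0)\<close> is a multiple of this Casimir element. A maximal left ideal
  \<open>I\<close> above \<open>J\<close> therefore admits a vector \<open>g\<close> in the quotient that satisfies the
  relations of the cyclic vector and is an eigenvector of \<open>L(0)\<close>, say with eigenvalue
  \<open>a\<close>. This vector makes the simple quotient by \<open>I\<close> a quotient of the module in which
  \<open>L(0) - a\<close> is factored out. That module has only one simple quotient because the sum
  of two of its proper submodules is proper: \<open>L(0)\<close> grades it by depth, and each nonzero
  vector of depth zero generates it (\<open>degenerate_local_ideals\<close>).

  If only \<open>mu\<close> is nonzero, the automorphism that exchanges the simple root vectors
  \<open>e(0)\<close> and \<open>f(1)\<close> leads back to the previous case; it carries \<open>L(0)\<close> to
  \<open>L(0) - h(0)/2 + \<kappa>/4\<close>.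

  If both parameters vanish, the symbol can be reduced to a polynomial in \<open>h(0)\<close>, and a
  root of this polynomial yields a highest weight vector in each simple quotient
  (\<open>verma_maximal_ideals\<close>). The element \<open>d\<close> acts by \<open>- L(0)\<close>.

  The quotients that occur must be shown to be nonzero. Proper left ideals with
  prescribed eigenvalues are obtained as annihilators of Whittaker functionals in
  coinduced modules (\<open>whittaker_functional_exists\<close>).
\<close>

section \<open>Left ideals and congruences\<close>

definition left_ideal :: "'a::ring_1 set \<Rightarrow> bool" where
  "left_ideal I \<longleftrightarrow> 0 \<in> I \<and> (\<forall>u\<in>I. \<forall>v\<in>I. u + v \<in> I) \<and> (\<forall>a. \<forall>u\<in>I. a * u \<in> I)"

definition left_cong :: "'a::ring_1 set \<Rightarrow> 'a \<Rightarrow> 'a \<Rightarrow> bool" where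
  "left_cong I u v \<longleftrightarrow> u - v \<in> I"

lemma left_idealD:
  assumes "left_ideal I"
  shows "0 \<in> I" "u \<in> I \<Longrightarrow> v \<in> I \<Longrightarrow> u + v \<in> I" "u \<in> I \<Longrightarrow> a * u \<in> I"
    "u \<in> I \<Longrightarrow> - u \<in> I" "u \<in> I \<Longrightarrow> v \<in> I \<Longrightarrow> u - v \<in> I"
proof -
  show *: "0 \<in> I" "u \<in> I \<Longrightarrow> v \<in> I \<Longrightarrow> u + v \<in> I" "u \<in> I \<Longrightarrow> a * u \<in> I" for u v a
    using assms by (auto simp: left_ideal_def)
  show **: "u \<in> I \<Longrightarrow> - u \<in> I" for u
    using *(3)[of u "- 1"] by simp
  show "u \<in> I \<Longrightarrow> v \<in> I \<Longrightarrow> u - v \<in> I"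
    using *(2)[of u "- v"] **[of v] by simp
qed

lemma left_ideal_sum:
  assumes "left_ideal I" "\<And>i. i \<in> A \<Longrightarrow> g i \<in> I"
  shows "sum g A \<in> I"
  using assms(2) by (induction A rule: infinite_finite_induct)
    (auto intro: left_idealD[OF assms(1)])

lemma left_ideal_one: "left_ideal I \<Longrightarrow> 1 \<in> I \<Longrightarrow> I = UNIV"
  using left_idealD(3)[of I 1] by auto

lemma left_ideal_generated: "left_ideal (left_ideal_generated S)" "S \<subseteq> left_ideal_generated S"
  by (auto simp: left_ideal_def left_ideal_generated_def)

lemma left_ideal_add_multiples:
  assumes "left_ideal I"
  shows "left_ideal {u + a * g | u a. u \<in> I}"
  unfolding left_ideal_def
proof (intro conjI ballI allI)
  show "0 \<in> {u + a * g | u a. u \<in> I}"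
    using left_idealD(1)[OF assms] by (auto intro!: exI[of _ 0])
next
  fix v v' assume "v \<in> {u + a * g | u a. u \<in> I}" "v' \<in> {u + a * g | u a. u \<in> I}"
  then obtain u a u' a' where "v = u + a * g" "u \<in> I" "v' = u' + a' * g" "u' \<in> I" by auto
  moreover from this have "v + v' = (u + u') + (a + a') * g"
    by (simp add: algebra_simps)
  ultimately show "v + v' \<in> {u + a * g | u a. u \<in> I}"
    using left_idealD(2)[OF assms, of u u'] by blast
next
  fix b v assume "v \<in> {u + a * g | u a. u \<in> I}"
  then obtain u a where "v = u + a * g" "u \<in> I" by auto
  moreover from this have "b * v = b * u + (b * a) * g"
    by (simp add: algebra_simps)
  ultimately show "b * v \<in> {u + a * g | u a. u \<in> I}"
    using left_idealD(3)[OF assms, of u b] by blast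
qed

lemma left_ideal_sum_ideals:
  assumes "left_ideal I" "left_ideal I'"
  shows "left_ideal {u + v | u v. u \<in> I \<and> v \<in> I'}"
  unfolding left_ideal_def
proof (intro conjI ballI allI)
  show "0 \<in> {u + v | u v. u \<in> I \<and> v \<in> I'}"
    using left_idealD(1)[OF assms(1)] left_idealD(1)[OF assms(2)] by force
next
  fix x y assume "x \<in> {u + v | u v. u \<in> I \<and> v \<in> I'}" "y \<in> {u + v | u v. u \<in> I \<and> v \<in> I'}"
  then obtain u v u' v' where "x = u + v" "u \<in> I" "v \<in> I'" "y = u' + v'" "u' \<in> I" "v' \<in> I'" by auto
  moreover from this have "x + y = (u + u') + (v + v')"
    by (simp add: algebra_simps)
  ultimately show "x + y \<in> {u + v | u v. u \<in> I \<and> v \<in> I'}"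
    using left_idealD(2)[OF assms(1), of u u'] left_idealD(2)[OF assms(2), of v v'] by blast
next
  fix b x assume "x \<in> {u + v | u v. u \<in> I \<and> v \<in> I'}"
  then obtain u v where "x = u + v" "u \<in> I" "v \<in> I'" by auto
  moreover from this have "b * x = b * u + b * v"
    by (simp add: algebra_simps)
  ultimately show "b * x \<in> {u + v | u v. u \<in> I \<and> v \<in> I'}"
    using left_idealD(3)[OF assms(1), of u b] left_idealD(3)[OF assms(2), of v b] by blast
qed

lemma left_ideal_Int: "left_ideal I \<Longrightarrow> left_ideal I' \<Longrightarrow> left_ideal (I \<inter> I')"
  by (auto simp: left_ideal_def)

text \<open>
  This is the annihilator of the class of \<open>g\<close> modulo \<open>I\<close>, so it describes the submodule
  of the quotient by \<open>I\<close> that this class generates.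
\<close>

lemma left_ideal_transporter: "left_ideal I \<Longrightarrow> left_ideal {u. u * g \<in> I}"
  by (auto simp: left_ideal_def distrib_right mult.assoc)

locale left_ideal_congruence =
  fixes J :: "'a::ring_1 set"
  assumes left_ideal_J: "left_ideal J"
begin

lemmas J_closed = left_idealD[OF left_ideal_J]

abbreviation cong_J :: "'a \<Rightarrow> 'a \<Rightarrow> bool" (infix "\<approx>" 50) where
  "u \<approx> v \<equiv> left_cong J u v"

lemma cong_refl [simp]: "u \<approx> u"
  by (simp add: left_cong_def J_closed)

lemma cong_sym: "u \<approx> v \<Longrightarrow> v \<approx> u"
  using J_closed(4)[of "u - v"] by (simp add: left_cong_def)

lemma cong_trans [trans]: "u \<approx> v \<Longrightarrow> v \<approx> w \<Longrightarrow> u \<approx> w"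
  using J_closed(2)[of "u - v" "v - w"] by (simp add: left_cong_def)

lemma cong_add: "u \<approx> v \<Longrightarrow> u' \<approx> v' \<Longrightarrow> u + u' \<approx> v + v'"
  using J_closed(2)[of "u - v" "u' - v'"] by (simp add: left_cong_def algebra_simps)

lemma cong_diff: "u \<approx> v \<Longrightarrow> u' \<approx> v' \<Longrightarrow> u - u' \<approx> v - v'"
  using J_closed(5)[of "u - v" "u' - v'"] by (simp add: left_cong_def algebra_simps)

lemma cong_mult: "u \<approx> v \<Longrightarrow> a * u \<approx> a * v"
  using J_closed(3)[of "u - v" a] by (simp add: left_cong_def algebra_simps)

lemma cong_zero_iff: "u \<approx> 0 \<longleftrightarrow> u \<in> J"
  by (simp add: left_cong_def)

lemma cong_sum: "(\<And>i. i \<in> A \<Longrightarrow> g i \<approx> g' i) \<Longrightarrow> sum g A \<approx> sum g' A"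
  unfolding left_cong_def sum_subtractf[symmetric] by (rule left_ideal_sum[OF left_ideal_J])

lemma cong_mem: "u \<approx> v \<Longrightarrow> J \<subseteq> I \<Longrightarrow> left_ideal I \<Longrightarrow> u \<in> I \<longleftrightarrow> v \<in> I"
  unfolding left_cong_def
  by (metis diff_add_cancel left_idealD(2) left_idealD(5) minus_diff_eq subsetD diff_diff_eq2 add_diff_cancel_left')

end

text \<open>
  Only two blocks of \<open>m\<close> boundary terms survive; the truncated Sugawara sums are of this
  kind.
\<close>

lemma int_telescope:
  fixes g :: "int \<Rightarrow> 'a::ab_group_add"
  assumes "a \<le> b"
  shows "m \<ge> 0 \<Longrightarrow> (\<Sum>k\<in>{a..<b}. g k - g (k + m)) = sum g {a..<a+m} - sum g {b..<b+m}"
    and "m \<le> 0 \<Longrightarrow> (\<Sum>k\<in>{a..<b}. g k - g (k + m)) = sum g {b+m..<b} - sum g {a+m..<a}"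
proof -
  have shift: "(\<Sum>k\<in>{a..<b}. g (k + m)) = sum g {a+m..<b+m}"
    by (rule sum.reindex_bij_witness[of _ "\<lambda>k. k - m" "\<lambda>k. k + m"]) auto
  have split: "sum g {x..<z} = sum g {x..<y} + sum g {y..<z}" if "x \<le> y" "y \<le> z" for x y z :: int
    using that by (subst sum.union_disjoint[symmetric]) (auto intro!: sum.cong)
  show "(\<Sum>k\<in>{a..<b}. g k - g (k + m)) = sum g {a..<a+m} - sum g {b..<b+m}" if "m \<ge> 0"
    using split[of a "a+m" "b+m"] split[of a b "b+m"] that assms
    by (simp add: sum_subtractf shift algebra_simps)
  show "(\<Sum>k\<in>{a..<b}. g k - g (k + m)) = sum g {b+m..<b} - sum g {a+m..<a}" if "m \<le> 0"
    using split[of "a+m" a b] split[of "a+m" "b+m" b] that assms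
    by (simp add: sum_subtractf shift algebra_simps)
qed

section \<open>Rings generated by affine currents\<close>

datatype gen = gE int | gH int | gF int

fun mode :: "gen \<Rightarrow> int" where
  "mode (gE n) = n" | "mode (gH n) = n" | "mode (gF n) = n"

fun shift :: "int \<Rightarrow> gen \<Rightarrow> gen" where
  "shift m (gE n) = gE (n + m)" | "shift m (gH n) = gH (n + m)" | "shift m (gF n) = gF (n + m)"

text \<open>
  The structure constants of the affine algebra: the bracket of the generators \<open>x\<close> and
  \<open>y\<close> is \<open>bracket_coeff x y\<close> times \<open>bracket_gen x y\<close> plus \<open>central_coeff x y\<close> times \<open>c\<close>.
  The value of \<open>bracket_gen\<close> at commuting pairs is a default, since \<open>bracket_coeff\<close>
  vanishes there.
\<close>

fun bracket_gen :: "gen \<Rightarrow> gen \<Rightarrow> gen" where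
  "bracket_gen (gE n) (gF m) = gH (n + m)" | "bracket_gen (gF n) (gE m) = gH (n + m)"
| "bracket_gen (gH n) (gE m) = gE (n + m)" | "bracket_gen (gE n) (gH m) = gE (n + m)"
| "bracket_gen (gH n) (gF m) = gF (n + m)" | "bracket_gen (gF n) (gH m) = gF (n + m)"
| "bracket_gen x y = x"

fun bracket_coeff :: "gen \<Rightarrow> gen \<Rightarrow> int" where
  "bracket_coeff (gE n) (gF m) = 1" | "bracket_coeff (gF n) (gE m) = - 1"
| "bracket_coeff (gH n) (gE m) = 2" | "bracket_coeff (gE n) (gH m) = - 2"
| "bracket_coeff (gH n) (gF m) = - 2" | "bracket_coeff (gF n) (gH m) = 2"
| "bracket_coeff x y = 0"

fun central_coeff :: "gen \<Rightarrow> gen \<Rightarrow> int" where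
  "central_coeff (gE n) (gF m) = (if n + m = 0 then n else 0)"
| "central_coeff (gF n) (gE m) = (if n + m = 0 then n else 0)"
| "central_coeff (gH n) (gH m) = (if n + m = 0 then 2 * n else 0)"
| "central_coeff x y = 0"

text \<open>
  A ring generated over the scalars \<open>sc\<close> by elements that satisfy the relations of the
  affine currents. Besides the standard generators of the enveloping algebra there are
  two more instances in the same ring: the currents with the roles of \<open>e\<close> and \<open>f\<close>
  exchanged, and the twisted currents that exchange the simple root vectors \<open>e(0)\<close> and
  \<open>f(1)\<close>. Each statement proved here holds for all of them. The induction rule says that
  the scalars and the currents generate the ring; \<open>c\<close> is a commutator of currents up to
  \<open>h(0)\<close>, which is why it does not occur in the rule.
\<close>

locale affine_currents =
  fixes sc :: "complex \<Rightarrow> 'a::ring_1" and e h f :: "int \<Rightarrow> 'a" and c :: 'a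
  assumes sc_add: "sc (s + t) = sc s + sc t" and sc_mult: "sc (s * t) = sc s * sc t"
    and sc_1 [simp]: "sc 1 = 1" and sc_comm: "sc t * u = u * sc t"
    and c_comm: "c * u = u * c"
    and e_f: "e n * f m - f m * e n = h (n + m) + of_int (if n + m = 0 then n else 0) * c"
    and h_e: "h n * e m - e m * h n = 2 * e (n + m)"
    and h_f: "h n * f m - f m * h n = - 2 * f (n + m)"
    and h_h: "h n * h m - h m * h n = of_int (if n + m = 0 then 2 * n else 0) * c"
    and e_e: "e n * e m = e m * e n" and f_f: "f n * f m = f m * f n"
    and current_induct: "\<And>P u. \<lbrakk>P 1; \<And>u v. P u \<Longrightarrow> P v \<Longrightarrow> P (u + v); \<And>t u. P u \<Longrightarrow> P (sc t * u);
      \<And>n u. P u \<Longrightarrow> P (e n * u); \<And>n u. P u \<Longrightarrow> P (f n * u); \<And>n u. P u \<Longrightarrow> P (h n * u)\<rbrakk> \<Longrightarrow> P u"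
begin

lemma sc_0 [simp]: "sc 0 = 0"
  using sc_add[of 0 0] by simp

lemma sc_minus: "sc (- t) = - sc t"
  using sc_add[of t "- t"] by (simp add: eq_neg_iff_add_eq_0 add.commute)

lemma sc_diff: "sc (s - t) = sc s - sc t"
  using sc_add[of s "- t"] by (simp add: sc_minus)

lemma sc_nat: "sc (of_nat n) = of_nat n"
  by (induction n) (simp_all add: sc_add)

lemma sc_int: "sc (of_int n) = of_int n"
  by (cases n) (simp_all add: sc_nat sc_minus sc_diff)

lemma sc_numeral [simp]: "sc (numeral n) = numeral n"
  using sc_int[of "numeral n"] by simp

lemma sc_sum: "sc (sum g A) = (\<Sum>i\<in>A. sc (g i))"
  by (induction A rule: infinite_finite_induct) (simp_all add: sc_add)

lemma sc_inverse: "t \<noteq> 0 \<Longrightarrow> sc (inverse t) * (sc t * u) = u"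
  by (simp add: mult.assoc[symmetric] sc_mult[symmetric])

lemma sc_mem_cancel: "left_ideal I \<Longrightarrow> t \<noteq> 0 \<Longrightarrow> sc t * u \<in> I \<Longrightarrow> u \<in> I"
  using left_idealD(3)[of I "sc t * u" "sc (inverse t)"] by (simp add: sc_inverse)

lemma sc_left_commute: "u * (sc t * v) = sc t * (u * v)"
  by (simp only: mult.assoc[symmetric] sc_comm[of t u])

lemma cocycle_swap:
  "of_int (if n + m = 0 then n else 0) = - (of_int (if m + n = 0 then m else 0) :: 'a)" for n m :: int
proof (cases "n + m = 0")
  case True
  then have "m = - n" by simp
  then show ?thesis by simp
qed auto

fun val :: "gen \<Rightarrow> 'a" where
  "val (gE n) = e n" | "val (gH n) = h n" | "val (gF n) = f n"

lemma val_bracket: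
  "val x * val y = val y * val x + of_int (bracket_coeff x y) * val (bracket_gen x y)
     + of_int (central_coeff x y) * c"
proof -
  have *: "a - b = d \<Longrightarrow> a = b + d" "a - b = d \<Longrightarrow> b = a - d" for a b d :: 'a
    by auto
  show ?thesis
  proof (cases x; cases y)
    fix n m assume "x = gE n" "y = gF m" then show ?thesis
      using e_f[of n m] by (simp add: algebra_simps)
  next
    fix n m assume "x = gF n" "y = gE m" then show ?thesis
      using *(2)[OF e_f[of m n]] cocycle_swap[of n m]
      by (simp add: add.commute[of m n] split del: if_split)
  next
    fix n m assume "x = gH n" "y = gE m" then show ?thesis
      using *(1)[OF h_e[of n m]] by simp
  next
    fix n m assume "x = gE n" "y = gH m" then show ?thesis
      using *(2)[OF h_e[of m n]] by (simp add: algebra_simps)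
  next
    fix n m assume "x = gH n" "y = gF m" then show ?thesis
      using *(1)[OF h_f[of n m]] by simp
  next
    fix n m assume "x = gF n" "y = gH m" then show ?thesis
      using *(2)[OF h_f[of m n]] by (simp add: algebra_simps)
  next
    fix n m assume "x = gH n" "y = gH m" then show ?thesis
      using *(1)[OF h_h[of n m]] by simp
  qed (use e_e f_f in auto)
qed

lemma gen_induct [case_names one add scalar gen]:
  assumes "P 1" "\<And>u v. P u \<Longrightarrow> P v \<Longrightarrow> P (u + v)" "\<And>t u. P u \<Longrightarrow> P (sc t * u)"
    "\<And>x u. P u \<Longrightarrow> P (val x * u)"
  shows "P u"
  by (rule current_induct[where P = P]) (use assms assms(4)[of _ "gE _"] assms(4)[of _ "gF _"] assms(4)[of _ "gH _"] in auto)

text \<open>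
  The Chevalley involution. It transfers each statement about \<open>e\<close> to one about \<open>f\<close>.
\<close>

lemma symmetric_currents: "affine_currents sc f (\<lambda>n. - h n) e c"
proof
  fix n m
  show "f n * e m - e m * f n = - h (n + m) + of_int (if n + m = 0 then n else 0) * c"
    using arg_cong[OF e_f[of m n], of uminus]
      cocycle_swap[of n m] by (simp add: add.commute[of m n] split del: if_split)
  show "- h n * f m - f m * - h n = 2 * f (n + m)"
    using arg_cong[OF h_f[of n m], of uminus] by simp
  show "- h n * e m - e m * - h n = - 2 * e (n + m)"
    using arg_cong[OF h_e[of n m], of uminus] by simp
  show "- h n * - h m - - h m * - h n = of_int (if n + m = 0 then 2 * n else 0) * c"
    using h_h[of n m] by simp
next
  fix P :: "'a \<Rightarrow> bool" and u
  assume P: "P 1" "\<And>u v. P u \<Longrightarrow> P v \<Longrightarrow> P (u + v)" "\<And>t u. P u \<Longrightarrow> P (sc t * u)"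
    "\<And>n u. P u \<Longrightarrow> P (f n * u)" "\<And>n u. P u \<Longrightarrow> P (e n * u)" "\<And>n u. P u \<Longrightarrow> P (- h n * u)"
  have h_closed: "P (h n * u)" if "P u" for n u
  proof -
    have "sc (- 1) * (- h n * u) = h n * u"
      by (simp add: sc_minus)
    then show ?thesis
      using P(3)[OF P(6)[OF that, of n], of "- 1"] by (simp only:)
  qed
  show "P u"
    by (rule current_induct) (fact P(1), (rule P(2); assumption), (rule P(3); assumption),
        (rule P(5); assumption), (rule P(4); assumption), (rule h_closed; assumption))
qed (rule sc_add sc_mult sc_1 sc_comm c_comm e_e f_f)+

end

section \<open>The Sugawara operators modulo a smooth left ideal\<close>

context affine_currents
begin

text \<open>
  Four times the summand of \<open>(\<kappa> + 2) L(n)\<close>, which makes all coefficients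
  integral; the sums below therefore carry the factor \<open>inverse (4 * (\<kappa> + 2))\<close>.
\<close>

definition sugawara_term :: "int \<Rightarrow> int \<Rightarrow> 'a" where
  "sugawara_term n k =
     (if k < 0 then e k * f (n - k) + e k * f (n - k) + (f k * e (n - k) + f k * e (n - k)) + h k * h (n - k)
      else f (n - k) * e k + f (n - k) * e k + (e (n - k) * f k + e (n - k) * f k) + h (n - k) * h k)"

definition sugawara_sum :: "int \<Rightarrow> int \<Rightarrow> 'a" where
  "sugawara_sum n K = (\<Sum>k\<in>{-K..<K+1}. sugawara_term n k)"

lemma commutator_product:
  "a * b * x - x * (a * b) = a * (b * x - x * b) + (a * x - x * a) * (b::'a)"
  by (simp add: algebra_simps)

lemma commutators_with_e:
  "e n * e m - e m * e n = 0" "h n * e m - e m * h n = 2 * e (n + m)"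
  "f n * e m - e m * f n = - h (n + m) - of_int (if n + m = 0 then m else 0) * c"
  using e_e[of n m] h_e[of n m] arg_cong[OF e_f[of m n], of uminus]
  by (simp_all add: add.commute[of n m] split del: if_split)

lemma central_right: "x * (of_int a * c) = of_int a * (c * x)"
  by (metis mult.assoc mult_of_int_commute c_comm)

lemma int_left_commute: "u * (of_int a * v) = of_int a * (u * (v::'a))"
  by (metis mult.assoc mult_of_int_commute)

lemma sugawara_pair_commutators:
  fixes n m k :: int
  defines "d \<equiv> \<lambda>P. of_int (if P then m else 0) * (c * e (n + m))"
  shows "e k * f (n - k) * e m - e m * (e k * f (n - k)) = - (e k * h (n + m - k)) - d (k = n + m)"
    "f k * e (n - k) * e m - e m * (f k * e (n - k)) = - (h (k + m) * e (n - k)) - d (k = - m)"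
    "h k * h (n - k) * e m - e m * (h k * h (n - k)) = 2 * (h k * e (n + m - k)) + 2 * (e (k + m) * h (n - k))"
    "f (n - k) * e k * e m - e m * (f (n - k) * e k) = - (h (n + m - k) * e k) - d (k = n + m)"
    "e (n - k) * f k * e m - e m * (e (n - k) * f k) = - (e (n - k) * h (k + m)) - d (k = - m)"
    "h (n - k) * h k * e m - e m * (h (n - k) * h k) = 2 * (h (n - k) * e (k + m)) + 2 * (e (n + m - k) * h k)"
proof -
  have N: "n - k + m = n + m - k" by simp
  have d: "of_int (if n + m - k = 0 then m else 0) * (c * e k) = d (k = n + m)"
    "of_int (if k + m = 0 then m else 0) * (c * e (n - k)) = d (k = - m)"
    by (auto simp: d_def)
  have left: "of_int a * c * x = of_int a * (c * x)" for a x by (rule mult.assoc)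
  have two: "x * (2 * y) = 2 * (x * (y::'a))" "2 * (y::'a) * x = 2 * (y * x)" for x y
    by (simp_all add: mult_2 mult_2_right algebra_simps)
  show "e k * f (n - k) * e m - e m * (e k * f (n - k)) = - (e k * h (n + m - k)) - d (k = n + m)"
    by (simp only: commutator_product commutators_with_e right_diff_distrib left_diff_distrib
        mult_minus_right mult_minus_left central_right left N d mult_zero_left mult_zero_right add_0_right add_0_left)
  show "f k * e (n - k) * e m - e m * (f k * e (n - k)) = - (h (k + m) * e (n - k)) - d (k = - m)"
    by (simp only: commutator_product commutators_with_e right_diff_distrib left_diff_distrib
        mult_minus_right mult_minus_left central_right left N d mult_zero_left mult_zero_right add_0_right add_0_left)
  show "h k * h (n - k) * e m - e m * (h k * h (n - k)) = 2 * (h k * e (n + m - k)) + 2 * (e (k + m) * h (n - k))"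
    by (simp only: commutator_product commutators_with_e right_diff_distrib left_diff_distrib
        mult_minus_right mult_minus_left central_right left N d mult_zero_left mult_zero_right add_0_right two)
  show "f (n - k) * e k * e m - e m * (f (n - k) * e k) = - (h (n + m - k) * e k) - d (k = n + m)"
    by (simp only: commutator_product commutators_with_e right_diff_distrib left_diff_distrib
        mult_minus_right mult_minus_left central_right left N d mult_zero_left mult_zero_right add_0_right add_0_left)
  show "e (n - k) * f k * e m - e m * (e (n - k) * f k) = - (e (n - k) * h (k + m)) - d (k = - m)"
    by (simp only: commutator_product commutators_with_e right_diff_distrib left_diff_distrib
        mult_minus_right mult_minus_left central_right left N d mult_zero_left mult_zero_right add_0_right add_0_left)
  show "h (n - k) * h k * e m - e m * (h (n - k) * h k) = 2 * (h (n - k) * e (k + m)) + 2 * (e (n + m - k) * h k)"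
    by (simp only: commutator_product commutators_with_e right_diff_distrib left_diff_distrib
        mult_minus_right mult_minus_left central_right left N d mult_zero_left mult_zero_right add_0_right two)
qed

text \<open>
  The commutator of a Sugawara summand with \<open>e(m)\<close> is, up to central terms, the
  difference of the values of \<open>current_tensor\<close> at \<open>k\<close> and \<open>k + m\<close>, hence telescopes. The
  two definitions belong to the two normal orderings. Passing from one to the other
  costs \<open>- 8 * e N\<close>; summed over the \<open>m\<close> indices at which the ordering changes, this
  turns the factor \<open>4 * \<kappa>\<close> that comes from the central terms into
  \<open>4 * (\<kappa> + 2)\<close>.
\<close>

definition current_tensor :: "int \<Rightarrow> int \<Rightarrow> 'a" where
  "current_tensor N j = 2 * (h j * e (N - j) - e j * h (N - j))"

definition current_tensor_rev :: "int \<Rightarrow> int \<Rightarrow> 'a" where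
  "current_tensor_rev N j = 2 * (e (N - j) * h j - h (N - j) * e j)"

lemma current_tensor_rev_diff: "current_tensor_rev N j - current_tensor N j = - 8 * e N"
proof -
  have "current_tensor_rev N j - current_tensor N j =
    - 2 * ((h j * e (N - j) - e (N - j) * h j) + (h (N - j) * e j - e j * h (N - j)))"
    by (simp add: current_tensor_def current_tensor_rev_def algebra_simps)
  moreover have "8 * e N = 4 * e N + 4 * e N"
    by (simp add: distrib_right[symmetric])
  ultimately show ?thesis
    unfolding h_e by simp
qed

lemma sugawara_term_commutator:
  "sugawara_term n k * e m - e m * sugawara_term n k =
     (if k < 0 then current_tensor (n + m) k - current_tensor (n + m) (k + m)
      else current_tensor_rev (n + m) k - current_tensor_rev (n + m) (k + m))
     - 2 * (of_int (if k = n + m then m else 0) + of_int (if k = - m then m else 0)) * (c * e (n + m))"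
proof -
  have sum: "(u + u + (v + v) + w) * x - x * (u + u + (v + v) + w) =
      2 * (u * x - x * u) + 2 * (v * x - x * v) + (w * x - (x::'a) * w)" for u v w x
    by (simp add: algebra_simps mult_2)
  have k: "n + m - (k + m) = n - k" by simp
  show ?thesis
    unfolding sugawara_term_def current_tensor_def current_tensor_rev_def k
    by (simp only: if_distrib[of "\<lambda>u. u * e m - e m * u"] sum sugawara_pair_commutators)
       (simp add: distrib_left distrib_right right_diff_distrib mult.assoc)
qed

end

text \<open>
  The left ideals \<open>J\<close> for which the quotient is a restricted module of noncritical level
  \<open>\<kappa>\<close>. All statements about the Sugawara operators are congruences modulo such an
  ideal.
\<close>

locale smooth_left_ideal = affine_currents sc e h f c + left_ideal_congruence J
  for sc :: "complex \<Rightarrow> 'a::ring_1" and e h f c and J :: "'a set" +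
  fixes \<kappa> :: complex
  assumes level: "c \<approx> sc \<kappa>" and smooth: "\<exists>N. \<forall>x. mode x \<ge> N \<longrightarrow> val x \<in> J"
    and noncritical: "\<kappa> \<noteq> - 2"
begin

lemma level_mult: "c * u \<approx> sc \<kappa> * u"
  using cong_mult[OF level, of u] by (simp add: c_comm sc_comm)

text \<open>
  Smoothness spreads from \<open>1\<close> to every \<open>u\<close> by induction on words: moving a current of
  high mode past a letter produces a current whose mode is shifted by a constant.
\<close>

lemma smooth_mult: "\<exists>N. \<forall>x. mode x \<ge> N \<longrightarrow> val x * u \<in> J"
proof (induction u rule: gen_induct)
  case one
  then show ?case using smooth by simp
next
  case (add u v)
  then obtain N N' where "\<forall>x. mode x \<ge> N \<longrightarrow> val x * u \<in> J" "\<forall>x. mode x \<ge> N' \<longrightarrow> val x * v \<in> J"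
    by blast
  then show ?case
    by (intro exI[of _ "max N N'"]) (simp add: distrib_left J_closed)
next
  case (scalar t u)
  then show ?case by (metis sc_left_commute J_closed(3))
next
  case (gen y u)
  then obtain N where N: "\<forall>x. mode x \<ge> N \<longrightarrow> val x * u \<in> J" by blast
  show ?case
  proof (intro exI[of _ "max N (max (N - mode y) (1 - mode y))"] allI impI)
    fix x assume x: "mode x \<ge> max N (max (N - mode y) (1 - mode y))"
    have "bracket_coeff x y = 0 \<or> mode (bracket_gen x y) = mode x + mode y"
      by (cases x; cases y) auto
    then have 1: "of_int (bracket_coeff x y) * (val (bracket_gen x y) * u) \<in> J"
      using N x by (cases "bracket_coeff x y = 0") (auto simp: J_closed(1) intro!: J_closed(3)[of "_ * u"])
    have 2: "central_coeff x y = 0"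
      using x by (cases x; cases y) auto
    have "val x * (val y * u) = val y * (val x * u) + of_int (bracket_coeff x y) * (val (bracket_gen x y) * u)"
      using val_bracket[of x y] 2 by (simp add: mult.assoc[symmetric] distrib_right)
    also have "\<dots> \<in> J"
      using N x 1 by (intro J_closed(2) J_closed(3)[of "val x * u"]) auto
    finally show "val x * (val y * u) \<in> J" .
  qed
qed

text \<open>
  In a large window the sum of the commutators with \<open>e(m)\<close> telescopes. The boundary
  terms at the ends of the window contain currents of high mode next to \<open>u\<close> and vanish.
  Those at \<open>0\<close>, where the normal ordering changes, contribute \<open>- 8 * m\<close> and the two
  central terms contribute \<open>- 4 * m * \<kappa>\<close>.
\<close>

lemma sugawara_sum_e:
  "\<exists>K0. \<forall>K\<ge>K0. sugawara_sum n K * (e m * u) \<approx>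
      e m * (sugawara_sum n K * u) - of_int m * (sc (4 * (\<kappa> + 2)) * (e (n + m) * u))"
proof -
  define N where "N = n + m"
  obtain N0 where N0: "\<forall>x. mode x \<ge> N0 \<longrightarrow> val x * u \<in> J"
    using smooth_mult by blast
  have N0': "j \<ge> N0 \<Longrightarrow> e j * u \<in> J" "j \<ge> N0 \<Longrightarrow> h j * u \<in> J" for j
    using N0[rule_format, of "gE j"] N0[rule_format, of "gH j"] by auto
  define g where "g j = current_tensor N j * u" for j
  define g' where "g' j = current_tensor_rev N j * u" for j
  have g: "g j \<in> J" if "j \<le> N - N0" for j
    using that unfolding g_def current_tensor_def
    by (simp add: left_diff_distrib mult.assoc J_closed N0')
  have g': "g' j \<in> J" if "j \<ge> N0" for j
    using that unfolding g'_def current_tensor_rev_def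
    by (simp add: left_diff_distrib mult.assoc J_closed N0')
  have gg': "g' j - g j = - 8 * (e N * u)" for j
    using current_tensor_rev_diff[of N j] by (simp add: g_def g'_def left_diff_distrib[symmetric] mult.assoc)
  have eight: "of_int a * (8 * x) = 8 * of_int a * x" for a and x :: 'a
    using mult_of_int_commute[of a "8::'a"] by (simp add: mult.assoc[symmetric])
  \<comment> \<open>Large enough for the window to contain both central terms and for its boundary
    terms to have high mode.\<close>
  define K0 where "K0 = \<bar>N\<bar> + \<bar>N0\<bar> + \<bar>m\<bar>"
  show ?thesis
  proof (intro exI[of _ K0] allI impI)
    fix K assume K: "K \<ge> K0"
    have inner: "(\<Sum>k\<in>{-K..<K+1}. if k < 0 then g k - g (k + m) else g' k - g' (k + m))
        = (\<Sum>k\<in>{-K..<0}. g k - g (k + m)) + (\<Sum>k\<in>{0..<K+1}. g' k - g' (k + m))"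
    proof -
      have "{-K..<K+1} = {-K..<0} \<union> {0..<K+1}" using K K0_def by auto
      then show ?thesis
        by (simp only:) (subst sum.union_disjoint; auto intro!: arg_cong2[of _ _ _ _ "(+)"] sum.cong)
    qed
    have tele: "(\<Sum>k\<in>{-K..<0}. g k - g (k + m)) + (\<Sum>k\<in>{0..<K+1}. g' k - g' (k + m))
       \<approx> - of_int (8 * m) * (e N * u)"
    proof (cases "m \<ge> 0")
      case True
      have "(\<Sum>k\<in>{-K..<0}. g k - g (k + m)) + (\<Sum>k\<in>{0..<K+1}. g' k - g' (k + m))
         = (sum g {-K..<-K+m} - sum g {0..<m}) + (sum g' {0..<m} - sum g' {K+1..<K+1+m})"
        using int_telescope(1)[of "-K" 0 m g] int_telescope(1)[of 0 "K+1" m g'] True K K0_def by simp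
      also have "\<dots> \<approx> (0 - sum g {0..<m}) + (sum g' {0..<m} - 0)"
        by (intro cong_add cong_diff cong_refl)
          (use K K0_def True in \<open>auto simp: cong_zero_iff intro!: left_ideal_sum[OF left_ideal_J] g g'\<close>)
      also have "\<dots> = (\<Sum>j\<in>{0..<m}. g' j - g j)" by (simp add: sum_subtractf)
      also have "\<dots> = - of_int (8 * m) * (e N * u)"
        unfolding gg' using True by (simp add: eight)
      finally show ?thesis .
    next
      case False
      have "(\<Sum>k\<in>{-K..<0}. g k - g (k + m)) + (\<Sum>k\<in>{0..<K+1}. g' k - g' (k + m))
         = (sum g {0+m..<0} - sum g {-K+m..<-K}) + (sum g' {K+1+m..<K+1} - sum g' {0+m..<0})"
        using int_telescope(2)[of "-K" 0 m g] int_telescope(2)[of 0 "K+1" m g'] False K K0_def by simp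
      also have "\<dots> \<approx> (sum g {0+m..<0} - 0) + (0 - sum g' {0+m..<0})"
        by (intro cong_add cong_diff cong_refl)
          (use K K0_def False in \<open>auto simp: cong_zero_iff intro!: left_ideal_sum[OF left_ideal_J] g g'\<close>)
      also have "\<dots> = - (\<Sum>j\<in>{m..<0}. g' j - g j)" by (simp add: sum_subtractf)
      also have "\<dots> = - of_int (8 * m) * (e N * u)"
        unfolding gg' using False by (simp add: eight)
      finally show ?thesis .
    qed
    have central: "(\<Sum>k\<in>{-K..<K+1}. 2 * (of_int (if k = n + m then m else 0) + of_int (if k = - m then m else 0)) * (c * e N) * u)
      = of_int (4 * m) * (c * (e N * u))"
    proof -
      have "(\<Sum>k\<in>{-K..<K+1}. 2 * (of_int (if k = n + m then m else 0) + of_int (if k = - m then m else 0)) * (c * e N) * u)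
        = (2 * of_int (\<Sum>k\<in>{-K..<K+1}. (if k = n + m then m else 0) + (if k = - m then m else 0))) * (c * (e N * u))"
        by (simp add: sum_distrib_left sum_distrib_right mult.assoc)
      also have "(\<Sum>k\<in>{-K..<K+1}. (if k = n + m then m else 0) + (if k = - m then m else 0)) = m + m"
      proof -
        have "n + m \<in> {-K..<K+1}" "- m \<in> {-K..<K+1}"
          using K unfolding K0_def N_def atLeastLessThan_iff by linarith+
        then show ?thesis
          by (simp only: sum.distrib sum.delta finite_atLeastLessThan_int if_True)
      qed
      also have "(2::'a) * of_int (m + m) = of_int (2 * (m + m))"
        by (simp only: of_int_mult of_int_numeral)
      also have "2 * (m + m) = 4 * m" by simp
      finally show ?thesis .
    qed
    have "sugawara_sum n K * (e m * u) - e m * (sugawara_sum n K * u) =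
        (\<Sum>k\<in>{-K..<K+1}. (sugawara_term n k * e m - e m * sugawara_term n k) * u)"
      by (simp add: sugawara_sum_def sum_distrib_left sum_distrib_right left_diff_distrib sum_subtractf mult.assoc)
    also have "\<dots> = (\<Sum>k\<in>{-K..<K+1}. (if k < 0 then g k - g (k + m) else g' k - g' (k + m)))
       - (\<Sum>k\<in>{-K..<K+1}. 2 * (of_int (if k = n + m then m else 0) + of_int (if k = - m then m else 0)) * (c * e N) * u)"
      unfolding sugawara_term_commutator sum_subtractf[symmetric]
      by (rule sum.cong) (auto simp: g_def g'_def N_def left_diff_distrib)
    also have "\<dots> \<approx> - of_int (8 * m) * (e N * u) - of_int (4 * m) * (sc \<kappa> * (e N * u))"
      unfolding inner central by (intro cong_diff tele cong_mult level_mult)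
    also have "\<dots> = - (of_int m * (sc (4 * (\<kappa> + 2)) * (e N * u)))"
    proof -
      have "of_int m * sc (4 * (\<kappa> + 2)) = sc (of_int (8 * m)) + sc (of_int (4 * m) * \<kappa>)"
        unfolding sc_add[symmetric] sc_int[symmetric] sc_mult[symmetric] by (simp add: algebra_simps)
      then have "of_int m * (sc (4 * (\<kappa> + 2)) * (e N * u)) = of_int (8 * m) * (e N * u) + of_int (4 * m) * (sc \<kappa> * (e N * u))"
        by (simp add: mult.assoc[symmetric] sc_mult sc_int distrib_right del: of_int_mult)
      then show ?thesis by simp
    qed
    finally have *: "sugawara_sum n K * (e m * u) - e m * (sugawara_sum n K * u) \<approx>
      - (of_int m * (sc (4 * (\<kappa> + 2)) * (e N * u)))" .
    show "sugawara_sum n K * (e m * u) \<approx>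
        e m * (sugawara_sum n K * u) - of_int m * (sc (4 * (\<kappa> + 2)) * (e (n + m) * u))"
      using cong_add[OF cong_refl[of "e m * (sugawara_sum n K * u)"] *] by (simp add: N_def)
  qed
qed

text \<open>
  Modulo \<open>J\<close> the truncated sums applied to \<open>u\<close> are eventually constant. Their value is
  described by this relation before the operator itself is chosen.
\<close>

definition sugawara_limit :: "int \<Rightarrow> 'a \<Rightarrow> 'a \<Rightarrow> bool" where
  "sugawara_limit n u v \<longleftrightarrow>
     (\<exists>K0. \<forall>K\<ge>K0. sc (inverse (4 * (\<kappa> + 2))) * (sugawara_sum n K * u) \<approx> v)"

lemma sugawara_limit_unique: "sugawara_limit n u v \<Longrightarrow> sugawara_limit n u v' \<Longrightarrow> v \<approx> v'"
  unfolding sugawara_limit_def by (metis cong_sym cong_trans linorder_le_cases)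

lemma sugawara_limit_add:
  assumes "sugawara_limit n u v" "sugawara_limit n u' v'"
  shows "sugawara_limit n (u + u') (v + v')"
proof -
  obtain K K' where "\<forall>k\<ge>K. sc (inverse (4 * (\<kappa> + 2))) * (sugawara_sum n k * u) \<approx> v"
    "\<forall>k\<ge>K'. sc (inverse (4 * (\<kappa> + 2))) * (sugawara_sum n k * u') \<approx> v'"
    using assms sugawara_limit_def by auto
  then show ?thesis
    unfolding sugawara_limit_def
    by (intro exI[of _ "max K K'"]) (simp add: distrib_left cong_add)
qed

lemma sugawara_limit_scalar:
  assumes "sugawara_limit n u v"
  shows "sugawara_limit n (sc t * u) (sc t * v)"
  using assms unfolding sugawara_limit_def
  by (simp add: sc_left_commute[of _ t]) (meson cong_mult)

lemma sugawara_limit_diff: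
  assumes "sugawara_limit n u v" "sugawara_limit n u' v'"
  shows "sugawara_limit n (u - u') (v - v')"
  using sugawara_limit_add[OF assms(1) sugawara_limit_scalar[OF assms(2), of "- 1"]]
  by (simp add: sc_minus)

lemma sugawara_limit_e:
  assumes "sugawara_limit n u v"
  shows "sugawara_limit n (e m * u) (e m * v - of_int m * (e (n + m) * u))"
proof -
  define s where "s = sc (inverse (4 * (\<kappa> + 2)))"
  obtain K K' where K: "\<And>k. k \<ge> K \<Longrightarrow> s * (sugawara_sum n k * u) \<approx> v"
    and K': "\<And>k. k \<ge> K' \<Longrightarrow> sugawara_sum n k * (e m * u) \<approx>
      e m * (sugawara_sum n k * u) - of_int m * (sc (4 * (\<kappa> + 2)) * (e (n + m) * u))"
    using assms sugawara_sum_e[of n m u] unfolding sugawara_limit_def s_def by auto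
  show ?thesis
    unfolding sugawara_limit_def s_def[symmetric]
  proof (intro exI[of _ "max K K'"] allI impI)
    fix k assume k: "k \<ge> max K K'"
    have "s * (sugawara_sum n k * (e m * u)) \<approx>
      s * (e m * (sugawara_sum n k * u) - of_int m * (sc (4 * (\<kappa> + 2)) * (e (n + m) * u)))"
      using k by (intro cong_mult K') simp
    also have "\<dots> = e m * (s * (sugawara_sum n k * u)) - of_int m * (e (n + m) * u)"
    proof -
      have "4 * (\<kappa> + 2) \<noteq> 0"
        using noncritical by (simp add: add_eq_0_iff2)
      then have "s * (sc (4 * (\<kappa> + 2)) * x) = x" for x
        unfolding s_def by (rule sc_inverse)
      moreover have "e m * (s * x) = s * (e m * x)" for x
        unfolding s_def by (rule sc_left_commute)
      ultimately show ?thesis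
        by (simp only: right_diff_distrib int_left_commute)
    qed
    also have "\<dots> \<approx> e m * v - of_int m * (e (n + m) * u)"
      using k by (intro cong_diff cong_mult K cong_refl) simp
    finally show "s * (sugawara_sum n k * (e m * u)) \<approx> e m * v - of_int m * (e (n + m) * u)" .
  qed
qed

lemma symmetric_smooth: "smooth_left_ideal sc f (\<lambda>n. - h n) e c J \<kappa>"
proof -
  interpret sym: affine_currents sc f "\<lambda>n. - h n" e c by (rule symmetric_currents)
  obtain N where N: "\<forall>x. mode x \<ge> N \<longrightarrow> val x \<in> J" using smooth by blast
  have "sym.val x \<in> J" if "mode x \<ge> N" for x
    using that N[rule_format, of "gE (mode x)"] N[rule_format, of "gH (mode x)"] N[rule_format, of "gF (mode x)"]
    by (cases x) (auto intro: J_closed)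
  then show ?thesis
    by unfold_locales (use level noncritical in auto)
qed

text \<open>Apply the Chevalley involution, under which the Sugawara summands are invariant.\<close>

lemma sugawara_limit_f:
  assumes "sugawara_limit n u v"
  shows "sugawara_limit n (f m * u) (f m * v - of_int m * (f (n + m) * u))"
proof -
  interpret sym: smooth_left_ideal sc f "\<lambda>n. - h n" e c J \<kappa> by (rule symmetric_smooth)
  have "sym.sugawara_sum n K = sugawara_sum n K" for K
    unfolding sugawara_sum_def sym.sugawara_sum_def sugawara_term_def sym.sugawara_term_def
    by (intro sum.cong) (auto simp: algebra_simps)
  then show ?thesis
    using sym.sugawara_limit_e[of n u v m] assms
    unfolding sugawara_limit_def sym.sugawara_limit_def by simp
qed

text \<open>
  Write \<open>h(m)\<close> as a commutator of currents \<open>e\<close> and \<open>f\<close>.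
\<close>

lemma sugawara_limit_h:
  assumes "sugawara_limit n u v"
  shows "sugawara_limit n (h m * u) (h m * v - of_int m * (h (n + m) * u))"
proof -
  have h: "h k * x = e k * (f 0 * x) - f 0 * (e k * x)" for k x
    using e_f[of k 0] by (cases "k = 0") (simp_all add: left_diff_distrib[symmetric] mult.assoc[symmetric])
  have "e m * (f 0 * v - of_int 0 * (f (n + 0) * u)) - of_int m * (e (n + m) * (f 0 * u))
      - (f 0 * (e m * v - of_int m * (e (n + m) * u)) - of_int 0 * (f (n + 0) * (e m * u)))
    = h m * v - of_int m * (h (n + m) * u)"
    unfolding h by (simp add: right_diff_distrib int_left_commute)
  then show ?thesis
    using sugawara_limit_diff[OF sugawara_limit_e[OF sugawara_limit_f[OF assms, of 0], of m]
        sugawara_limit_f[OF sugawara_limit_e[OF assms, of m], of 0]]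
    unfolding h[symmetric] by simp
qed

lemma sugawara_term_eventually: "\<exists>K. \<forall>k. \<bar>k\<bar> > K \<longrightarrow> sugawara_term n k * u \<in> J"
proof -
  obtain N where N: "\<forall>x. mode x \<ge> N \<longrightarrow> val x * u \<in> J" using smooth_mult by blast
  have N': "k \<ge> N \<Longrightarrow> e k * u \<in> J" "k \<ge> N \<Longrightarrow> h k * u \<in> J" "k \<ge> N \<Longrightarrow> f k * u \<in> J" for k
    using N[rule_format, of "gE k"] N[rule_format, of "gH k"] N[rule_format, of "gF k"] by auto
  show ?thesis
    by (intro exI[of _ "\<bar>N\<bar> + \<bar>n\<bar>"])
      (auto simp: sugawara_term_def distrib_right mult.assoc intro!: J_closed(2) J_closed(3)[of "_ * u"] N')
qed

lemma sugawara_sum_eventually: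
  assumes "\<forall>k. \<bar>k\<bar> > K \<longrightarrow> sugawara_term n k * u \<in> J" "K' \<ge> K"
  shows "sugawara_sum n K' * u \<approx> sugawara_sum n K * u"
proof -
  have "sugawara_sum n K' * u - sugawara_sum n K * u = (\<Sum>k\<in>{-K'..<K'+1} - {-K..<K+1}. sugawara_term n k * u)"
    using assms(2) unfolding sugawara_sum_def sum_distrib_right
    by (intro sum_diff[symmetric]) auto
  also have "\<dots> \<in> J"
    using assms by (intro left_ideal_sum[OF left_ideal_J]) auto
  finally show ?thesis by (simp add: left_cong_def)
qed

definition sugawara_op :: "int \<Rightarrow> 'a \<Rightarrow> 'a" where
  "sugawara_op n u = (SOME v. sugawara_limit n u v)"

lemma sugawara_limit_op: "sugawara_limit n u (sugawara_op n u)"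
proof -
  obtain K where "\<forall>k. \<bar>k\<bar> > K \<longrightarrow> sugawara_term n k * u \<in> J"
    using sugawara_term_eventually by blast
  then have "sugawara_limit n u (sc (inverse (4 * (\<kappa> + 2))) * (sugawara_sum n K * u))"
    unfolding sugawara_limit_def by (auto intro!: exI[of _ K] cong_mult sugawara_sum_eventually)
  then show ?thesis
    unfolding sugawara_op_def by (rule someI)
qed

lemma sugawara_op_eq:
  assumes "\<forall>k. \<bar>k\<bar> > K \<longrightarrow> sugawara_term n k * u \<in> J"
  shows "sugawara_op n u \<approx> sc (inverse (4 * (\<kappa> + 2))) * (sugawara_sum n K * u)"
  by (rule sugawara_limit_unique[OF sugawara_limit_op])
    (use assms in \<open>auto simp: sugawara_limit_def intro!: exI[of _ K] cong_mult sugawara_sum_eventually\<close>)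

lemma sugawara_op_add: "sugawara_op n (u + v) \<approx> sugawara_op n u + sugawara_op n v"
  by (intro sugawara_limit_unique[OF sugawara_limit_op] sugawara_limit_add sugawara_limit_op)

lemma sugawara_op_scalar: "sugawara_op n (sc t * u) \<approx> sc t * sugawara_op n u"
  by (intro sugawara_limit_unique[OF sugawara_limit_op] sugawara_limit_scalar sugawara_limit_op)

lemma sugawara_op_val:
  "sugawara_op n (val x * u) \<approx> val x * sugawara_op n u - of_int (mode x) * (val (shift n x) * u)"
proof (rule sugawara_limit_unique[OF sugawara_limit_op])
  show "sugawara_limit n (val x * u) (val x * sugawara_op n u - of_int (mode x) * (val (shift n x) * u))"
    using sugawara_limit_e[OF sugawara_limit_op[of n u], of "mode x"]
      sugawara_limit_f[OF sugawara_limit_op[of n u], of "mode x"]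
      sugawara_limit_h[OF sugawara_limit_op[of n u], of "mode x"]
    by (cases x) (simp_all add: add.commute)
qed

text \<open>
  Modulo \<open>J\<close> the element \<open>L(n) u\<close> is a multiple of \<open>u\<close>, so the operators preserve every
  left ideal above \<open>J\<close>.
\<close>

lemma sugawara_op_mem:
  assumes "left_ideal I" "J \<subseteq> I" "u \<in> I"
  shows "sugawara_op n u \<in> I"
proof -
  obtain K where "sc (inverse (4 * (\<kappa> + 2))) * (sugawara_sum n K * u) \<approx> sugawara_op n u"
    using sugawara_limit_op[of n u] unfolding sugawara_limit_def by blast
  then show ?thesis
    using cong_mem[OF _ assms(2,1)] left_idealD(3)[OF assms(1)] assms(3) by blast
qed

lemma sugawara_op_cong: "u \<approx> v \<Longrightarrow> sugawara_op n u \<approx> sugawara_op n v"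
proof -
  assume "u \<approx> v"
  then have "sugawara_op n (u - v) \<approx> 0"
    using sugawara_op_mem[OF left_ideal_J] by (simp add: left_cong_def)
  moreover have "sugawara_op n ((u - v) + v) \<approx> sugawara_op n (u - v) + sugawara_op n v"
    by (rule sugawara_op_add)
  ultimately show ?thesis
    using cong_trans cong_add[OF _ cong_refl] by fastforce
qed

end

section \<open>Coinduced modules\<close>

lemma poly_mapping_sum_induct [case_names zero add single]:
  fixes u :: "'x \<Rightarrow>\<^sub>0 'y::ab_group_add"
  assumes "P 0" "\<And>u v. P u \<Longrightarrow> P v \<Longrightarrow> P (u + v)" "\<And>m a. P (Poly_Mapping.single m a)"
  shows "P u"
proof (induction u rule: Poly_Mapping.update_induct)
  case const
  show ?case by (rule assms)
next
  case (update p a b)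
  have "Poly_Mapping.update a b p = p + Poly_Mapping.single a b"
    using update(1)
    by (intro poly_mapping_eqI) (auto simp: lookup_update lookup_add lookup_single when_def in_keys_iff)
  then show ?case using update assms by simp
qed

lemma bracket_minus_right: "bracket x (- y) = - bracket x (y::'g::complex_lie_algebra)"
  using bracket_add_right[of x y "- y"] by (simp add: eq_neg_iff_add_eq_0 add.commute)

lemma bracket_jacobi': "bracket x (bracket y z) = bracket y (bracket x z) + bracket (bracket x y) (z::'g::complex_lie_algebra)"
proof -
  have "bracket y (bracket z x) = - bracket y (bracket x z)"
    by (subst bracket_skew[of z x]) (rule bracket_minus_right)
  moreover have "bracket z (bracket x y) = - bracket (bracket x y) z"
    by (rule bracket_skew)
  ultimately have "bracket x (bracket y z) + - bracket y (bracket x z) + - bracket (bracket x y) z = 0"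
    using bracket_jacobi[of x y z] by simp
  then have "bracket x (bracket y z) - (bracket y (bracket x z) + bracket (bracket x y) z) = 0"
    by (simp only: diff_conv_add_uminus minus_add_distrib add.assoc)
  then show ?thesis
    by (simp only: right_minus_eq)
qed

text \<open>
  Let a Lie algebra be the sum of two subalgebras with projections \<open>pn\<close> and \<open>pb\<close>, and
  let \<open>chi\<close> be a character of the second one. The coinduced module consists of the
  functionals \<open>F\<close> on the enveloping algebra on which left multiplication by the second
  subalgebra acts through \<open>chi\<close>. Such an \<open>F\<close> is determined by its restriction to
  products of elements of the first subalgebra, so it is encoded as a function on words
  in \<open>nil\<close>. The word \<open>[y1, \<dots>, yk]\<close> stands for the product \<open>yk \<dots> y1\<close>, and the
  algebra acts by \<open>(x F)(u) = F(u x)\<close>.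

  The action has to be constructed and shown to respect brackets. Its merit is that the
  annihilator of a nonzero functional is a proper left ideal whose elements can be
  tested by evaluation.
\<close>

locale lie_splitting =
  fixes pn pb :: "'g::complex_lie_algebra \<Rightarrow> 'g" and chi :: "'g \<Rightarrow> complex"
  assumes split: "pn x + pb x = x"
    and pn_add: "pn (x + y) = pn x + pn y" and pb_add: "pb (x + y) = pb x + pb y"
    and pn_scale: "pn (cscale t x) = cscale t (pn x)" and pb_scale: "pb (cscale t x) = cscale t (pb x)"
    and pb_pn [simp]: "pb (pn x) = 0" and pn_pb [simp]: "pn (pb x) = 0"
    and pb_bracket_pn: "pb (bracket (pn x) (pn y)) = 0"
    and pn_bracket_pb: "pn (bracket (pb x) (pb y)) = 0"
    and chi_add: "chi (x + y) = chi x + chi y" and chi_scale: "chi (cscale t x) = t * chi x"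
    and chi_bracket: "chi (bracket (pb x) (pb y)) = 0"
begin

definition nil :: "'g set" where "nil = {y. pb y = 0}"

lemma nil_pn: "y \<in> nil \<Longrightarrow> pn y = y"
  using split[of y] by (simp add: nil_def)

lemma pn_nil [simp]: "pn x \<in> nil"
  by (simp add: nil_def)

lemma pb_zero [simp]: "pb 0 = 0" and pn_zero [simp]: "pn 0 = 0" and chi_zero [simp]: "chi 0 = 0"
  using pb_scale[of 0 0] pn_scale[of 0 0] chi_scale[of 0 0] by simp_all

lemma nil_closed: "y \<in> nil \<Longrightarrow> z \<in> nil \<Longrightarrow> y + z \<in> nil" "y \<in> nil \<Longrightarrow> cscale t y \<in> nil"
  "y \<in> nil \<Longrightarrow> z \<in> nil \<Longrightarrow> bracket y z \<in> nil" "0 \<in> nil"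
proof -
  show "y + z \<in> nil" if "y \<in> nil" "z \<in> nil" using that by (simp add: nil_def pb_add)
  show "cscale t y \<in> nil" if "y \<in> nil" using that by (simp add: nil_def pb_scale)
  show "bracket y z \<in> nil" if "y \<in> nil" "z \<in> nil"
    using pb_bracket_pn[of y z] nil_pn[OF that(1)] nil_pn[OF that(2)] by (simp add: nil_def)
  show "0 \<in> nil" by (simp add: nil_def)
qed

text \<open>
  The value of \<open>F\<close> at the product \<open>u x\<close>, where the word represents \<open>u\<close> and \<open>x\<close> lies in
  the second subalgebra: \<open>x\<close> is moved to the left through the word by
  \<open>y x = x y + [y, x]\<close> and is finally evaluated by \<open>chi\<close>.
\<close>

primrec lower_act :: "'g list \<Rightarrow> 'g \<Rightarrow> ('g list \<Rightarrow> complex) \<Rightarrow> complex" where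
  "lower_act [] x F = chi x * F []"
| "lower_act (y # T) x F =
     lower_act T x (\<lambda>S. F (y # S)) + (F (pn (bracket y x) # T) + lower_act T (pb (bracket y x)) F)"

definition coact :: "'g \<Rightarrow> ('g list \<Rightarrow> complex) \<Rightarrow> 'g list \<Rightarrow> complex" where
  "coact x F T = F (pn x # T) + lower_act T (pb x) F"

text \<open>
  A function on words comes from a functional on the enveloping algebra if it is linear
  in each letter and turns commutators of letters into brackets. In the last condition
  the letters appear in reversed order because words are read from right to left.
\<close>

definition admissible :: "('g list \<Rightarrow> complex) \<Rightarrow> bool" where
  "admissible F \<longleftrightarrow> (\<forall>S\<in>lists nil. \<forall>T\<in>lists nil. \<forall>y\<in>nil. \<forall>z\<in>nil.
     F (S @ (y + z) # T) = F (S @ y # T) + F (S @ z # T) \<and>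
     (\<forall>t. F (S @ cscale t y # T) = t * F (S @ y # T)) \<and>
     F (S @ z # y # T) = F (S @ y # z # T) + F (S @ bracket y z # T))"

lemma admissibleI:
  assumes "\<And>S T y z. S \<in> lists nil \<Longrightarrow> T \<in> lists nil \<Longrightarrow> y \<in> nil \<Longrightarrow> z \<in> nil \<Longrightarrow>
      F (S @ (y + z) # T) = F (S @ y # T) + F (S @ z # T)"
    "\<And>S T y t. S \<in> lists nil \<Longrightarrow> T \<in> lists nil \<Longrightarrow> y \<in> nil \<Longrightarrow>
      F (S @ cscale t y # T) = t * F (S @ y # T)"
    "\<And>S T y z. S \<in> lists nil \<Longrightarrow> T \<in> lists nil \<Longrightarrow> y \<in> nil \<Longrightarrow> z \<in> nil \<Longrightarrow>
      F (S @ z # y # T) = F (S @ y # z # T) + F (S @ bracket y z # T)"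
  shows "admissible F"
  unfolding admissible_def by (intro ballI conjI allI; rule assms; assumption)

lemma admissible_at:
  assumes "admissible F" "S \<in> lists nil" "T \<in> lists nil" "y \<in> nil" "z \<in> nil"
  shows "F (S @ (y + z) # T) = F (S @ y # T) + F (S @ z # T)" "F (S @ cscale t y # T) = t * F (S @ y # T)"
    "F (S @ z # y # T) = F (S @ y # z # T) + F (S @ bracket y z # T)"
  using assms(1)[unfolded admissible_def, THEN bspec, OF assms(2), THEN bspec, OF assms(3),
      THEN bspec, OF assms(4), THEN bspec, OF assms(5)] by blast+

lemmas admissibleD = admissible_at[where S = "[]", simplified append_Nil, OF _ lists.Nil]

lemma admissible_zero: "admissible F \<Longrightarrow> T \<in> lists nil \<Longrightarrow> F (0 # T) = 0"
  using admissibleD(2)[of F T 0 0 0] nil_closed(4) by simp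

lemma admissible_Cons:
  assumes F: "admissible F" and y: "y \<in> nil"
  shows "admissible (\<lambda>S. F (y # S))"
proof (rule admissibleI)
  fix S T x z t assume S: "S \<in> lists nil" and T: "T \<in> lists nil" and x: "x \<in> nil"
  have yS: "y # S \<in> lists nil" using y S by simp
  show "F (y # S @ cscale t x # T) = t * F (y # S @ x # T)"
    using admissible_at(2)[OF F yS T x x, of t] by simp
  assume z: "z \<in> nil"
  show "F (y # S @ (x + z) # T) = F (y # S @ x # T) + F (y # S @ z # T)"
    using admissible_at(1)[OF F yS T x z] by simp
  show "F (y # S @ z # x # T) = F (y # S @ x # z # T) + F (y # S @ bracket x z # T)"
    using admissible_at(3)[OF F yS T x z] by simp
qed

lemma admissible_scale:
  assumes F: "admissible F"
  shows "admissible (\<lambda>T. t * F T)"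
proof (rule admissibleI)
  fix S T x z s assume S: "S \<in> lists nil" and T: "T \<in> lists nil" and x: "x \<in> nil"
  show "t * F (S @ cscale s x # T) = s * (t * F (S @ x # T))"
    using admissible_at(2)[OF F S T x x, of s] by simp
  assume z: "z \<in> nil"
  show "t * F (S @ (x + z) # T) = t * F (S @ x # T) + t * F (S @ z # T)"
    using admissible_at(1)[OF F S T x z] by (simp add: distrib_left)
  show "t * F (S @ z # x # T) = t * F (S @ x # z # T) + t * F (S @ bracket x z # T)"
    using admissible_at(3)[OF F S T x z] by (simp add: distrib_left)
qed

lemma admissible_add:
  assumes F: "admissible F" and G: "admissible G"
  shows "admissible (\<lambda>T. F T + G T)"
proof (rule admissibleI)
  fix S T x z s assume S: "S \<in> lists nil" and T: "T \<in> lists nil" and x: "x \<in> nil"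
  show "F (S @ cscale s x # T) + G (S @ cscale s x # T) = s * (F (S @ x # T) + G (S @ x # T))"
    using admissible_at(2)[OF F S T x x, of s] admissible_at(2)[OF G S T x x, of s] by (simp add: distrib_left)
  assume z: "z \<in> nil"
  show "F (S @ (x + z) # T) + G (S @ (x + z) # T) = F (S @ x # T) + G (S @ x # T) + (F (S @ z # T) + G (S @ z # T))"
    using admissible_at(1)[OF F S T x z] admissible_at(1)[OF G S T x z] by simp
  show "F (S @ z # x # T) + G (S @ z # x # T) =
      F (S @ x # z # T) + G (S @ x # z # T) + (F (S @ bracket x z # T) + G (S @ bracket x z # T))"
    using admissible_at(3)[OF F S T x z] admissible_at(3)[OF G S T x z] by simp
qed

lemma lower_act_cong:
  "\<forall>T\<in>lists nil. F T = G T \<Longrightarrow> T \<in> lists nil \<Longrightarrow> lower_act T x F = lower_act T x G"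
proof (induction T arbitrary: x F G)
  case (Cons y T)
  have "lower_act T x (\<lambda>S. F (y # S)) = lower_act T x (\<lambda>S. G (y # S))"
    by (rule Cons.IH) (use Cons.prems in auto)
  moreover have "lower_act T (pb (bracket y x)) F = lower_act T (pb (bracket y x)) G"
    by (rule Cons.IH) (use Cons.prems in auto)
  ultimately show ?case using Cons.prems by simp
qed simp

lemma lower_act_combine:
  "lower_act T x (\<lambda>S. F S + G S) = lower_act T x F + lower_act T x G"
  "lower_act T x (\<lambda>S. t * F S) = t * lower_act T x F"
  by (induction T arbitrary: x F G) (simp_all add: algebra_simps)

lemma lower_act_add:
  "admissible F \<Longrightarrow> T \<in> lists nil \<Longrightarrow> lower_act T (x + x') F = lower_act T x F + lower_act T x' F"
  by (induction T arbitrary: x x' F)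
    (simp_all add: chi_add bracket_add_right pn_add pb_add admissibleD(1) admissible_Cons algebra_simps)

lemma lower_act_scale:
  "admissible F \<Longrightarrow> T \<in> lists nil \<Longrightarrow> lower_act T (cscale t x) F = t * lower_act T x F"
  by (induction T arbitrary: x F)
    (simp_all add: chi_scale bracket_cscale_right pn_scale pb_scale admissibleD(2)[where z = 0] nil_closed
      admissible_Cons algebra_simps)

lemma coact_cong:
  "\<forall>T\<in>lists nil. F T = G T \<Longrightarrow> T \<in> lists nil \<Longrightarrow> coact x F T = coact x G T"
  using lower_act_cong[of F G T "pb x"] by (simp add: coact_def)

lemma coact_combine:
  "coact x (\<lambda>S. F S + G S) T = coact x F T + coact x G T" "coact x (\<lambda>S. t * F S) T = t * coact x F T"
  by (simp_all add: coact_def lower_act_combine algebra_simps)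

lemma coact_add:
  "admissible F \<Longrightarrow> T \<in> lists nil \<Longrightarrow> coact (x + x') F T = coact x F T + coact x' F T"
  by (simp add: coact_def pn_add pb_add lower_act_add admissibleD(1))

lemma coact_scale:
  "admissible F \<Longrightarrow> T \<in> lists nil \<Longrightarrow> coact (cscale t x) F T = t * coact x F T"
  by (simp add: coact_def pn_scale pb_scale lower_act_scale admissibleD(2)[where z = 0] nil_closed algebra_simps)

lemma coact_nil: "admissible F \<Longrightarrow> T \<in> lists nil \<Longrightarrow> y \<in> nil \<Longrightarrow> coact y F T = F (y # T)"
  using lower_act_scale[of F T 0 0] by (simp add: coact_def nil_pn) (simp add: nil_def)

lemma coact_Cons:
  assumes "admissible F" "y \<in> nil" "T \<in> lists nil"
  shows "coact x F (y # T) = coact x (\<lambda>S. F (y # S)) T + coact (bracket y x) F T"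
proof -
  have "F (pn x # y # T) = F (y # pn x # T) + F (bracket y (pn x) # T)"
    by (rule admissibleD) (use assms in auto)
  moreover have "F (bracket y (pn x) # T) = coact (bracket y (pn x)) F T"
    using assms by (simp add: coact_nil nil_closed)
  moreover have "bracket y x = bracket y (pn x) + bracket y (pb x)"
    using split[of x] by (metis bracket_add_right)
  ultimately show ?thesis
    using assms by (simp add: coact_add) (simp add: coact_def)
qed

text \<open>
  The recursion \<open>coact_Cons\<close> reduces the three conditions to a word that begins with the
  letters in question; there the condition on commutators is the Jacobi identity.
\<close>

lemma admissible_coact:
  assumes "admissible F"
  shows "admissible (coact x F)"
proof (rule admissibleI)
  fix S T y z assume S: "S \<in> lists nil" and T: "T \<in> lists nil" and y: "y \<in> nil" and z: "z \<in> nil"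
  show "coact x F (S @ (y + z) # T) = coact x F (S @ y # T) + coact x F (S @ z # T)"
    using assms S
  proof (induction S arbitrary: x F)
    case Nil
    have "coact x (\<lambda>S. F ((y + z) # S)) T = coact x (\<lambda>S. F (y # S) + F (z # S)) T"
      by (rule coact_cong) (use Nil T y z in \<open>auto simp: admissibleD(1)\<close>)
    then show ?case
      using Nil T y z by (simp add: coact_Cons nil_closed coact_combine bracket_add_left coact_add)
  next
    case (Cons s S)
    then show ?case using T y z by (simp add: coact_Cons nil_closed admissible_Cons)
  qed
next
  fix S T y t assume S: "S \<in> lists nil" and T: "T \<in> lists nil" and y: "y \<in> nil"
  show "coact x F (S @ cscale t y # T) = t * coact x F (S @ y # T)"
    using assms S
  proof (induction S arbitrary: x F)
    case Nil
    have "coact x (\<lambda>S. F (cscale t y # S)) T = coact x (\<lambda>S. t * F (y # S)) T"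
      by (rule coact_cong) (use Nil T y in \<open>auto simp: admissibleD(2)[where z = 0] nil_closed\<close>)
    then show ?case
      using Nil T y by (simp add: coact_Cons nil_closed coact_combine bracket_cscale_left coact_scale algebra_simps)
  next
    case (Cons s S)
    then show ?case using T y by (simp add: coact_Cons nil_closed admissible_Cons algebra_simps)
  qed
next
  fix S T y z assume S: "S \<in> lists nil" and T: "T \<in> lists nil" and y: "y \<in> nil" and z: "z \<in> nil"
  show "coact x F (S @ z # y # T) = coact x F (S @ y # z # T) + coact x F (S @ bracket y z # T)"
    using assms S
  proof (induction S arbitrary: x F)
    case Nil
    have "coact x (\<lambda>S. F (z # y # S)) T = coact x (\<lambda>S. F (y # z # S) + F (bracket y z # S)) T"
      by (rule coact_cong) (use Nil T y z in \<open>auto intro: admissibleD(3)\<close>)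
    moreover have "coact (bracket y (bracket z x)) F T =
        coact (bracket z (bracket y x)) F T + coact (bracket (bracket y z) x) F T"
      using Nil T by (simp add: bracket_jacobi'[of y z x] coact_add)
    ultimately show ?case
      using Nil T y z by (simp add: coact_Cons nil_closed admissible_Cons coact_combine)
  next
    case (Cons s S)
    then show ?case using T y z by (simp add: coact_Cons nil_closed admissible_Cons)
  qed
qed

text \<open>
  For longer words the recursion \<open>coact_Cons\<close> and the Jacobi identity reduce the claim
  to shorter ones. At the empty word both sides are expanded into their components; the
  commutator of the first components is covered by admissibility and that of the second
  components by \<open>chi\<close> being a character.
\<close>

lemma coact_bracket:
  assumes "admissible F" "T \<in> lists nil"
  shows "coact x (coact z F) T = coact z (coact x F) T + coact (bracket x z) F T"
  using assms
proof (induction T arbitrary: x z F)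
  case Nil
  have expand: "coact x (coact z F) [] = F [pn x, pn z] + chi (pb z) * F [pn x] + chi (pb x) * F [pn z]
      + chi (pb x) * chi (pb z) * F [] + coact (bracket (pn x) z) F []" for x z
    using Nil coact_Cons[of F "pn x" "[]" z]
    by (simp add: coact_def[of x "coact z F"] coact_def[of z] algebra_simps)
  have "F [pn x, pn z] = F [pn z, pn x] + coact (bracket (pn z) (pn x)) F []"
    using Nil admissibleD(3)[of F "[]" "pn z" "pn x"] by (simp add: coact_nil nil_closed)
  moreover have "coact (bracket (pb x) (pb z)) F [] = 0"
  proof -
    have "pb (bracket (pb x) (pb z)) = bracket (pb x) (pb z)"
      using split[of "bracket (pb x) (pb z)"] by (simp add: pn_bracket_pb)
    then show ?thesis
      using Nil by (simp add: coact_def pn_bracket_pb chi_bracket admissible_zero)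
  qed
  moreover have "bracket x z + bracket (pn z) x = bracket (pn z) (pn x) + bracket (pn x) z + bracket (pb x) (pb z)"
  proof -
    have "bracket x z = bracket (pn x) z + bracket (pb x) (pn z) + bracket (pb x) (pb z)"
      by (metis split bracket_add_left bracket_add_right add.assoc)
    moreover have "bracket (pn z) x = bracket (pn z) (pn x) - bracket (pb x) (pn z)"
      by (metis split bracket_add_right bracket_skew[of "pn z" "pb x"] diff_conv_add_uminus)
    ultimately show ?thesis by simp
  qed
  then have "coact (bracket x z) F [] + coact (bracket (pn z) x) F [] = coact (bracket (pn z) (pn x)) F []
      + coact (bracket (pn x) z) F [] + coact (bracket (pb x) (pb z)) F []"
    using Nil by (metis coact_add lists.Nil)
  ultimately show ?case
    unfolding expand[of x z] expand[of z x] by (simp add: algebra_simps)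
next
  case (Cons y T)
  then have T: "T \<in> lists nil" and y: "y \<in> nil" and F: "admissible F" by auto
  have expand: "coact x (coact z F) (y # T) = coact x (coact z (\<lambda>S. F (y # S))) T
      + coact x (coact (bracket y z) F) T + coact (bracket y x) (coact z F) T" for x z
  proof -
    have "coact x (\<lambda>S. coact z F (y # S)) T = coact x (\<lambda>S. coact z (\<lambda>S. F (y # S)) S + coact (bracket y z) F S) T"
      by (rule coact_cong) (use F y T in \<open>auto simp: coact_Cons\<close>)
    then show ?thesis
      using F y T by (simp add: coact_Cons admissible_coact coact_combine)
  qed
  have "coact (bracket y (bracket x z)) F T = coact (bracket x (bracket y z)) F T + coact (bracket (bracket y x) z) F T"
    using F T by (simp add: bracket_jacobi'[of y x z] coact_add)
  moreover note Cons.IH[OF admissible_Cons[OF F y] T, of x z] Cons.IH[OF F T, of x "bracket y z"]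
    Cons.IH[OF F T, of "bracket y x" z]
  ultimately show ?case
    unfolding expand[of x z] expand[of z x] using F y T by (simp add: coact_Cons)
qed

definition free_act :: "'g free_algebra \<Rightarrow> ('g list \<Rightarrow> complex) \<Rightarrow> 'g list \<Rightarrow> complex" where
  "free_act u F T = (\<Sum>m\<in>Poly_Mapping.keys u. Poly_Mapping.lookup u m * foldr coact (letters m) F T)"

lemma free_act_superset:
  "finite A \<Longrightarrow> Poly_Mapping.keys u \<subseteq> A \<Longrightarrow>
    free_act u F T = (\<Sum>m\<in>A. Poly_Mapping.lookup u m * foldr coact (letters m) F T)"
  unfolding free_act_def by (rule sum.mono_neutral_left) (auto simp: in_keys_iff)

lemma free_act_add: "free_act (u + v) F = (\<lambda>T. free_act u F T + free_act v F T)"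
proof
  fix T
  have "Poly_Mapping.keys (u + v) \<subseteq> Poly_Mapping.keys u \<union> Poly_Mapping.keys v"
    by (rule Poly_Mapping.keys_add)
  then show "free_act (u + v) F T = free_act u F T + free_act v F T"
    by (simp add: free_act_superset[of "Poly_Mapping.keys u \<union> Poly_Mapping.keys v"] lookup_add
        distrib_right sum.distrib)
qed

lemma free_act_single: "free_act (Poly_Mapping.single m t) F = (\<lambda>T. t * foldr coact (letters m) F T)"
  by (rule ext) (simp add: free_act_superset[of "{m}"])

lemma free_act_zero: "free_act 0 F = (\<lambda>T. 0)"
  by (rule ext) (simp add: free_act_def)

lemma foldr_coact_combine:
  "foldr coact xs (\<lambda>S. F S + G S) = (\<lambda>T. foldr coact xs F T + foldr coact xs G T)"
  "foldr coact xs (\<lambda>S. t * F S) = (\<lambda>T. t * foldr coact xs F T)"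
  by (induction xs) (auto simp: coact_combine)

lemma free_act_combine:
  "free_act u (\<lambda>S. F S + G S) = (\<lambda>T. free_act u F T + free_act u G T)"
  "free_act u (\<lambda>S. t * F S) = (\<lambda>T. t * free_act u F T)"
  by (auto simp: free_act_def foldr_coact_combine algebra_simps sum.distrib sum_distrib_left)

lemma free_act_mult: "free_act (u * v) F = free_act u (free_act v F)"
proof (induction u rule: poly_mapping_sum_induct)
  case (single m a)
  show ?case
  proof (induction v rule: poly_mapping_sum_induct)
    case zero
    show ?case using free_act_combine(2)[of "Poly_Mapping.single m a" 0] by (simp add: free_act_zero)
  next
    case (single m' b)
    show ?case
      by (simp add: mult_single free_act_single foldr_coact_combine plus_free_monoid_def mult.assoc)
  qed (simp add: distrib_left free_act_add free_act_combine)
qed (simp_all add: free_act_zero distrib_right free_act_add)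

lemma admissible_foldr: "admissible F \<Longrightarrow> admissible (foldr coact xs F)"
  by (induction xs) (auto intro: admissible_coact)

lemma admissible_free_act: "admissible F \<Longrightarrow> admissible (free_act u F)"
  by (induction u rule: poly_mapping_sum_induct)
    (use admissible_scale[of F 0] in \<open>auto simp: free_act_zero free_act_add free_act_single
      intro!: admissible_add admissible_scale admissible_foldr\<close>)

lemma free_act_cong:
  assumes "\<forall>T\<in>lists nil. F T = G T" "T \<in> lists nil"
  shows "free_act u F T = free_act u G T"
proof -
  have "\<forall>T\<in>lists nil. foldr coact xs F T = foldr coact xs G T" for xs
    by (induction xs) (use assms(1) in \<open>auto intro: coact_cong\<close>)
  then show ?thesis unfolding free_act_def using assms(2) by simp
qed

lemma free_act_gen: "free_act (free_gen x) F = coact x F"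
  by (simp add: free_gen_def free_act_single)

lemma free_act_scalar: "free_act (free_scalar t) F = (\<lambda>T. t * F T)"
  by (simp add: free_scalar_def free_act_single zero_free_monoid_def)

lemma free_act_diff: "free_act (u - v) F T = free_act u F T - free_act v F T"
  using fun_cong[OF free_act_add[of "u - v" v F], of T] by simp

text \<open>
  The defining relations of the enveloping algebra act by zero, so the action descends
  to the quotient.
\<close>

lemma free_act_uea_ideal:
  "u \<in> uea_ideal \<Longrightarrow> admissible F \<Longrightarrow> T \<in> lists nil \<Longrightarrow> free_act u F T = 0"
proof (induction arbitrary: F T rule: uea_ideal.induct)
  case (rel_add x y)
  then show ?case by (simp add: free_act_diff free_act_gen coact_add)
next
  case (rel_scale t x)
  then show ?case by (simp add: free_act_diff free_act_gen free_act_mult free_act_scalar coact_scale)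
next
  case (rel_bracket x y)
  then show ?case
    using coact_bracket[of F T x y] by (simp add: free_act_diff free_act_gen free_act_mult)
next
  case zero
  then show ?case by (simp add: free_act_zero)
next
  case (add u v)
  then show ?case by (simp add: free_act_add)
next
  case (mult u a b)
  have "free_act a (free_act u (free_act b F)) T = free_act a (\<lambda>S. 0 * F S) T"
    by (rule free_act_cong) (use mult in \<open>auto intro: admissible_free_act\<close>)
  then show ?case
    by (simp add: free_act_mult free_act_combine(2)[of a 0 F, simplified])
qed

definition uea_act :: "'g uea \<Rightarrow> ('g list \<Rightarrow> complex) \<Rightarrow> 'g list \<Rightarrow> complex" where
  "uea_act u F = free_act (rep_uea u) F"

lemma uea_act_abs:
  assumes "admissible F" "T \<in> lists nil"
  shows "uea_act (abs_uea a) F T = free_act a F T"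
proof -
  have "uea_rel (rep_uea (abs_uea a)) a"
    using Quotient3_uea by (rule Quotient3_rep_abs) (simp add: uea_rel_def uea_ideal.zero)
  then have "free_act (rep_uea (abs_uea a) - a) F T = 0"
    using assms by (intro free_act_uea_ideal) (auto simp: uea_rel_def)
  then show ?thesis by (simp add: uea_act_def free_act_diff)
qed

lemma abs_rep: "abs_uea (rep_uea u) = u"
  using Quotient3_uea by (rule Quotient3_abs_rep)

lemma uea_act_simps:
  assumes "admissible F" "T \<in> lists nil"
  shows "uea_act (u + v) F T = uea_act u F T + uea_act v F T"
    "uea_act (u - v) F T = uea_act u F T - uea_act v F T"
    "uea_act (u * v) F T = uea_act u (uea_act v F) T"
    "uea_act (uea_incl x) F T = coact x F T"
    "uea_act (uea_scalar t) F T = t * F T"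
    "uea_act 0 F T = 0" "uea_act 1 F T = F T"
proof -
  have "u + v = abs_uea (rep_uea u + rep_uea v)" "u - v = abs_uea (rep_uea u - rep_uea v)"
    "u * v = abs_uea (rep_uea u * rep_uea v)"
    by (metis abs_rep plus_uea.abs_eq, metis abs_rep minus_uea.abs_eq, metis abs_rep times_uea.abs_eq)
  then show "uea_act (u + v) F T = uea_act u F T + uea_act v F T"
    "uea_act (u - v) F T = uea_act u F T - uea_act v F T"
    "uea_act (u * v) F T = uea_act u (uea_act v F) T"
    using uea_act_abs[OF assms, of "rep_uea u + rep_uea v"] uea_act_abs[OF assms, of "rep_uea u - rep_uea v"]
      uea_act_abs[OF assms, of "rep_uea u * rep_uea v"]
    by (simp_all add: uea_act_def free_act_add free_act_diff free_act_mult)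
  show "uea_act 0 F T = 0"
    using uea_act_abs[OF assms, of 0] unfolding zero_uea_def by (simp add: free_act_zero)
  show "uea_act 1 F T = F T"
    using uea_act_abs[OF assms, of 1] free_act_scalar[of 1 F] unfolding one_uea_def
    by (simp add: free_scalar_def)
  show "uea_act (uea_incl x) F T = coact x F T" "uea_act (uea_scalar t) F T = t * F T"
    using assms by (simp_all add: uea_incl.abs_eq uea_scalar.abs_eq uea_act_abs free_act_gen free_act_scalar)
qed

lemma admissible_uea_act: "admissible F \<Longrightarrow> admissible (uea_act u F)"
  by (simp add: uea_act_def admissible_free_act)

lemma uea_act_cong: "\<forall>T\<in>lists nil. F T = G T \<Longrightarrow> T \<in> lists nil \<Longrightarrow> uea_act u F T = uea_act u G T"
  by (simp add: uea_act_def free_act_cong)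

definition annihilator :: "('g list \<Rightarrow> complex) \<Rightarrow> 'g uea set" where
  "annihilator F = {u. \<forall>T\<in>lists nil. uea_act u F T = 0}"

lemma left_ideal_annihilator:
  assumes "admissible F"
  shows "left_ideal (annihilator F)"
proof -
  have "uea_act a (uea_act u F) T = 0" if "u \<in> annihilator F" "T \<in> lists nil" for a u T
  proof -
    have "uea_act a (uea_act u F) T = uea_act a (\<lambda>S. 0 * F S) T"
      by (rule uea_act_cong) (use that in \<open>auto simp: annihilator_def\<close>)
    then show ?thesis by (simp add: uea_act_def free_act_combine(2)[of _ 0 F, simplified])
  qed
  then show ?thesis
    using assms by (auto simp: left_ideal_def annihilator_def uea_act_simps)
qed

end

section \<open>Symbols with respect to a weight filtration\<close>

instance prod :: (linordered_ab_group_add, linordered_ab_group_add) linordered_ab_group_add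
  by standard (auto simp: less_eq_prod_def less_prod_def plus_prod_def)

lemma lex_less_simps:
  "(a, b) < (c, d) \<longleftrightarrow> a < c \<or> a = c \<and> b < (d::int)" for a c :: int
  by (auto simp: less_prod_def)

fun raising :: "gen \<Rightarrow> bool" where
  "raising (gE n) \<longleftrightarrow> n \<ge> 0" | "raising (gH n) \<longleftrightarrow> n \<ge> 1" | "raising (gF n) \<longleftrightarrow> n \<ge> 1"

text \<open>
  Polynomials over an arbitrary set of variables: a monomial is the multiset of its
  variables, and multiplication of polynomials is the convolution product of finitely
  supported functions.
\<close>

abbreviation monomial :: "'x multiset \<Rightarrow> complex \<Rightarrow> 'x multiset \<Rightarrow>\<^sub>0 complex" where
  "monomial \<equiv> Poly_Mapping.single"

definition partial :: "'x \<Rightarrow> ('x multiset \<Rightarrow>\<^sub>0 complex) \<Rightarrow> 'x multiset \<Rightarrow>\<^sub>0 complex" where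
  "partial y p = (\<Sum>M\<in>Poly_Mapping.keys p. monomial (M - {#y#}) (Poly_Mapping.lookup p M * of_nat (count M y)))"

text \<open>The derivation that sends each variable \<open>y\<close> to \<open>t y\<close>.\<close>

definition derivation :: "('x \<Rightarrow> 'x multiset \<Rightarrow>\<^sub>0 complex) \<Rightarrow> ('x multiset \<Rightarrow>\<^sub>0 complex) \<Rightarrow> 'x multiset \<Rightarrow>\<^sub>0 complex" where
  "derivation t p = (\<Sum>M\<in>Poly_Mapping.keys p.
     monomial {#} (Poly_Mapping.lookup p M) * (\<Sum>y\<in>#M. t y * monomial (M - {#y#}) 1))"

definition poly_vars :: "('x multiset \<Rightarrow>\<^sub>0 complex) \<Rightarrow> 'x set" where
  "poly_vars p = (\<Union>M\<in>Poly_Mapping.keys p. set_mset M)"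

lemma finite_poly_vars [simp]: "finite (poly_vars p)"
  by (simp add: poly_vars_def)

lemma derivation_partial:
  assumes "finite V" "poly_vars p \<subseteq> V"
  shows "derivation t p = (\<Sum>y\<in>V. t y * partial y p)"
proof -
  have *: "(\<Sum>y\<in>#M. t y * monomial (M - {#y#}) 1) =
      (\<Sum>y\<in>V. t y * monomial (M - {#y#}) (of_nat (count M y)))" if "set_mset M \<subseteq> V" for M
  proof -
    have N: "(\<Sum>y\<in>#N. t y * monomial (M - {#y#}) 1) =
      (\<Sum>y\<in>V. t y * monomial (M - {#y#}) (of_nat (count N y)))" if "set_mset N \<subseteq> V" for N
      using that
    proof (induction N)
      case (add x N)
      have "(\<Sum>y\<in>V. t y * monomial (M - {#y#}) (of_nat (count (add_mset x N) y))) =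
        (\<Sum>y\<in>V. (if y = x then t y * monomial (M - {#y#}) 1 else 0) + t y * monomial (M - {#y#}) (of_nat (count N y)))"
        by (intro sum.cong) (auto simp: single_add algebra_simps)
      also have "\<dots> = t x * monomial (M - {#x#}) 1 + (\<Sum>y\<in>V. t y * monomial (M - {#y#}) (of_nat (count N y)))"
        using add.prems assms(1) by (simp add: sum.distrib)
      finally show ?case using add by simp
    qed simp
    show ?thesis using N[OF that] .
  qed
  have "derivation t p = (\<Sum>M\<in>Poly_Mapping.keys p. \<Sum>y\<in>V. t y *
      monomial (M - {#y#}) (Poly_Mapping.lookup p M * of_nat (count M y)))"
    unfolding derivation_def
  proof (intro sum.cong refl)
    fix M assume "M \<in> Poly_Mapping.keys p"
    then have "set_mset M \<subseteq> V" using assms(2) by (auto simp: poly_vars_def)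
    then show "monomial {#} (Poly_Mapping.lookup p M) * (\<Sum>y\<in>#M. t y * monomial (M - {#y#}) 1) =
      (\<Sum>y\<in>V. t y * monomial (M - {#y#}) (Poly_Mapping.lookup p M * of_nat (count M y)))"
      by (subst *) (auto simp: sum_distrib_left mult_single algebra_simps intro!: sum.cong
          simp flip: mult.assoc[of "monomial _ _" "t _"])
  qed
  also have "\<dots> = (\<Sum>y\<in>V. t y * partial y p)"
    by (subst sum.swap) (simp add: partial_def sum_distrib_left)
  finally show ?thesis .
qed

lemma lookup_partial:
  "Poly_Mapping.lookup (partial y p) M = of_nat (Suc (count M y)) * Poly_Mapping.lookup p (add_mset y M)"
proof -
  have "Poly_Mapping.lookup (partial y p) M = (\<Sum>N\<in>Poly_Mapping.keys p.
      if N = add_mset y M then of_nat (Suc (count M y)) * Poly_Mapping.lookup p (add_mset y M) else 0)"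
    unfolding partial_def lookup_sum
  proof (intro sum.cong refl)
    fix N
    have "N - {#y#} = M \<and> y \<in># N \<longleftrightarrow> N = add_mset y M"
      by (metis add_mset_remove_trivial insert_DiffM union_single_eq_member)
    then show "Poly_Mapping.lookup (monomial (N - {#y#}) (Poly_Mapping.lookup p N * of_nat (count N y))) M =
      (if N = add_mset y M then of_nat (Suc (count M y)) * Poly_Mapping.lookup p (add_mset y M) else 0)"
      by (auto simp: lookup_single when_def not_in_iff)
  qed
  then show ?thesis by (auto simp: sum.delta in_keys_iff)
qed

lemma partial_nonzero: "y \<in> poly_vars p \<Longrightarrow> partial y p \<noteq> 0"
proof
  assume "y \<in> poly_vars p" "partial y p = 0"
  then obtain M where M: "Poly_Mapping.lookup p M \<noteq> 0" "y \<in># M"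
    by (auto simp: poly_vars_def in_keys_iff)
  have "of_nat (Suc (count (M - {#y#}) y)) * Poly_Mapping.lookup p (add_mset y (M - {#y#})) = 0"
    using lookup_partial[of y p "M - {#y#}"] \<open>partial y p = 0\<close> by (simp only: lookup_zero)
  then show False
    using M by (simp only: mult_eq_0_iff of_nat_eq_0_iff insert_DiffM nat.distinct simp_thms)
qed

lemma poly_expand: "p = (\<Sum>M\<in>Poly_Mapping.keys p. monomial M (Poly_Mapping.lookup p M))"
  by (rule poly_mapping_eqI) (auto simp: lookup_sum lookup_single when_def in_keys_iff)

text \<open>
  Modulo \<open>J\<close> every element is a combination of words in the generators that are not
  raising. Such words are filtered by the weight \<open>wt\<close>, a pair of integers in
  lexicographic order. A bracket of two generators has weight smaller by \<open>(0, 1)\<close> than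
  their product, so in the associated graded object the generators commute, and an
  element has a polynomial in the lower generators as its symbol. A raising generator
  acts on \<open>1\<close> by \<open>psi\<close>; it may do so only in weight \<open>0\<close>, so that it does not raise the
  filtration there.
\<close>

locale whittaker_filtration = smooth_left_ideal sc e h f c J \<kappa>
  for sc :: "complex \<Rightarrow> 'a::ring_1" and e h f c and J :: "'a set" and \<kappa> +
  fixes psi :: "gen \<Rightarrow> complex" and wt :: "gen \<Rightarrow> int \<times> int"
  assumes psi: "raising x \<Longrightarrow> val x \<approx> sc (psi x)"
    and wt_psi: "raising x \<Longrightarrow> psi x \<noteq> 0 \<Longrightarrow> wt x = 0"
    and wt_bracket: "bracket_coeff x y \<noteq> 0 \<Longrightarrow> wt (bracket_gen x y) = wt x + wt y - (0, 1)"
    and wt_central: "central_coeff x y \<noteq> 0 \<Longrightarrow> wt x + wt y > (0, 1)"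
    and wt_lower: "\<not> raising x \<Longrightarrow> fst (wt x) \<ge> 0 \<and> snd (wt x) \<ge> 0"
begin

definition lower_word :: "gen list \<Rightarrow> bool" where
  "lower_word ys \<longleftrightarrow> (\<forall>y\<in>set ys. \<not> raising y)"

definition word_val :: "gen list \<Rightarrow> 'a" where
  "word_val ys = prod_list (map val ys)"

definition weight :: "gen multiset \<Rightarrow> int \<times> int" where
  "weight M = (\<Sum>y\<in>#M. wt y)"

lemma word_simps [simp]: "word_val [] = 1" "word_val (y # ys) = val y * word_val ys"
  "lower_word []" "lower_word (y # ys) \<longleftrightarrow> \<not> raising y \<and> lower_word ys"
  "weight {#} = 0" "weight (add_mset y M) = wt y + weight M" "weight (M + N) = weight M + weight N"
  by (simp_all add: word_val_def lower_word_def weight_def)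

inductive_set filt :: "(int \<times> int \<Rightarrow> bool) \<Rightarrow> 'a set" for Q where
  ideal: "u \<in> J \<Longrightarrow> u \<in> filt Q"
| word: "lower_word ys \<Longrightarrow> Q (weight (mset ys)) \<Longrightarrow> word_val ys \<in> filt Q"
| add: "u \<in> filt Q \<Longrightarrow> v \<in> filt Q \<Longrightarrow> u + v \<in> filt Q"
| scalar: "u \<in> filt Q \<Longrightarrow> sc t * u \<in> filt Q"

lemma filt_mono: "u \<in> filt Q \<Longrightarrow> (\<And>w. Q w \<Longrightarrow> Q' w) \<Longrightarrow> u \<in> filt Q'"
proof (induction rule: filt.induct)
  case (word ys)
  then show ?case by (intro filt.word)
qed (auto intro: filt.ideal filt.add filt.scalar)

lemma filt_minus: "u \<in> filt Q \<Longrightarrow> - u \<in> filt Q"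
  using filt.scalar[of u Q "- 1"] by (simp add: sc_minus)

lemma filt_diff: "u \<in> filt Q \<Longrightarrow> v \<in> filt Q \<Longrightarrow> u - v \<in> filt Q"
  using filt.add[OF _ filt_minus, of u Q v] by simp

lemma filt_zero [simp]: "0 \<in> filt Q"
  by (rule filt.ideal) (rule J_closed)

lemma filt_of_int: "u \<in> filt Q \<Longrightarrow> of_int a * u \<in> filt Q"
  using filt.scalar[of u Q "of_int a"] by (simp add: sc_int)

lemma filt_cong: "u \<approx> v \<Longrightarrow> v \<in> filt Q \<Longrightarrow> u \<in> filt Q"
proof -
  assume "u \<approx> v" "v \<in> filt Q"
  then have "(u - v) + v \<in> filt Q"
    by (intro filt.add filt.ideal[of "u - v"]) (simp_all add: left_cong_def)
  then show "u \<in> filt Q" by simp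
qed

lemma filt_sum: "(\<And>i. i \<in> A \<Longrightarrow> g i \<in> filt Q) \<Longrightarrow> sum g A \<in> filt Q"
  by (induction A rule: infinite_finite_induct) (auto intro: filt.add)

lemma filt_lower: "u \<in> filt (\<lambda>w. w \<le> \<omega>) \<Longrightarrow> \<not> raising y \<Longrightarrow> val y * u \<in> filt (\<lambda>w. w \<le> wt y + \<omega>)"
proof (induction rule: filt.induct)
  case (word ys)
  then show ?case using filt.word[of "y # ys"] by simp
qed (auto simp: distrib_left sc_left_commute intro: filt.intros J_closed)

lemma filt_lower_strict: "u \<in> filt (\<lambda>w. w < \<omega>) \<Longrightarrow> \<not> raising y \<Longrightarrow> val y * u \<in> filt (\<lambda>w. w < wt y + \<omega>)"
proof (induction rule: filt.induct)
  case (word ys)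
  then show ?case using filt.word[of "y # ys"] by simp
qed (auto simp: distrib_left sc_left_commute intro: filt.intros J_closed)

lemma val_bracket_mult:
  "val x * (val y * u) = val y * (val x * u) + of_int (bracket_coeff x y) * (val (bracket_gen x y) * u)
     + of_int (central_coeff x y) * (c * u)"
  using arg_cong[OF val_bracket[of x y], of "\<lambda>z. z * u"] by (simp add: distrib_right mult.assoc)

text \<open>
  Straightening: a raising generator is moved through the word to the right end, where
  it becomes the scalar \<open>psi x\<close>. Each exchange produces a bracket of smaller weight,
  which is straightened in turn; the induction is therefore on the length of the word,
  for all generators at once.
\<close>

lemma filt_word: "lower_word ys \<Longrightarrow> val x * word_val ys \<in> filt (\<lambda>w. w \<le> wt x + weight (mset ys))"
proof (induction ys arbitrary: x)
  case Nil
  show ?case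
  proof (cases "raising x")
    case True
    show ?thesis
    proof (cases "psi x = 0")
      case True
      then show ?thesis using psi[OF \<open>raising x\<close>] by (auto simp: cong_zero_iff intro: filt.ideal)
    next
      case False
      then have "sc (psi x) * word_val [] \<in> filt (\<lambda>w. w \<le> wt x + weight (mset []))"
        using wt_psi[OF True] by (intro filt.scalar filt.word) auto
      then show ?thesis using psi[OF True] filt_cong by simp
    qed
  next
    case False
    then show ?thesis using filt.word[of "[x]"] by simp
  qed
next
  case (Cons y ys)
  then have y: "\<not> raising y" and ys: "lower_word ys" by auto
  show ?case
  proof (cases "raising x")
    case False
    then show ?thesis using filt.word[of "x # y # ys"] y ys by simp
  next
    case True
    have "val y * (val x * word_val ys) \<in> filt (\<lambda>w. w \<le> wt y + (wt x + weight (mset ys)))"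
      by (rule filt_lower[OF Cons.IH[OF ys] y])
    moreover have "of_int (bracket_coeff x y) * (val (bracket_gen x y) * word_val ys)
        \<in> filt (\<lambda>w. w \<le> wt y + (wt x + weight (mset ys)))"
    proof (cases "bracket_coeff x y = 0")
      case False
      have "wt (bracket_gen x y) \<le> wt x + wt y"
        using wt_bracket[OF False] by (simp add: less_eq_prod_def)
      then have "wt (bracket_gen x y) + weight (mset ys) \<le> wt y + (wt x + weight (mset ys))"
        using add_right_mono[of _ _ "weight (mset ys)"] by (simp add: add.assoc add.left_commute)
      then show ?thesis
        by (intro filt_of_int filt_mono[OF Cons.IH[OF ys]]) (auto intro: order_trans)
    qed simp
    moreover have "of_int (central_coeff x y) * (c * word_val ys) \<in> filt (\<lambda>w. w \<le> wt y + (wt x + weight (mset ys)))"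
    proof (cases "central_coeff x y = 0")
      case False
      have "(0::int\<times>int) \<le> (0, 1)" by (simp add: less_eq_prod_def zero_prod_def)
      then have "0 \<le> wt x + wt y" using wt_central[OF False] by order
      then have "weight (mset ys) \<le> wt y + (wt x + weight (mset ys))"
        using add_right_mono[of 0 _ "weight (mset ys)"] by (simp add: add.assoc add.left_commute)
      then show ?thesis
        by (intro filt_of_int filt_cong[OF level_mult] filt.scalar filt.word ys)
    qed simp
    ultimately show ?thesis
      by (simp add: val_bracket_mult[of x y "word_val ys"] add.left_commute[of "wt x"] filt.add)
  qed
qed

lemma filt_val:
  "u \<in> filt (\<lambda>w. w \<le> \<omega>) \<Longrightarrow> val x * u \<in> filt (\<lambda>w. w \<le> wt x + \<omega>)"
  "u \<in> filt (\<lambda>w. w < \<omega>) \<Longrightarrow> val x * u \<in> filt (\<lambda>w. w < wt x + \<omega>)"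
proof -
  show "val x * u \<in> filt (\<lambda>w. w \<le> wt x + \<omega>)" if "u \<in> filt (\<lambda>w. w \<le> \<omega>)"
    using that
  proof (induction rule: filt.induct)
    case (word ys)
    then show ?case by (intro filt_mono[OF filt_word]) (auto intro: order_trans add_left_mono)
  qed (auto simp: distrib_left sc_left_commute intro: filt.intros J_closed)
  show "val x * u \<in> filt (\<lambda>w. w < wt x + \<omega>)" if "u \<in> filt (\<lambda>w. w < \<omega>)"
    using that
  proof (induction rule: filt.induct)
    case (word ys)
    then show ?case by (intro filt_mono[OF filt_word]) (auto intro: le_less_trans add_strict_left_mono)
  qed (auto simp: distrib_left sc_left_commute intro: filt.intros J_closed)
qed

lemma filt_commutator:
  assumes "lower_word ys"
  shows "val x * (val y * word_val ys) - val y * (val x * word_val ys)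
    \<in> filt (\<lambda>w. w < wt x + wt y + weight (mset ys))"
proof -
  have "of_int (bracket_coeff x y) * (val (bracket_gen x y) * word_val ys)
        \<in> filt (\<lambda>w. w < wt x + wt y + weight (mset ys))"
  proof (cases "bracket_coeff x y = 0")
    case False
    have "wt (bracket_gen x y) < wt x + wt y"
      using wt_bracket[OF False] by (cases "wt x + wt y") (simp add: lex_less_simps)
    then have "wt (bracket_gen x y) + weight (mset ys) < wt x + wt y + weight (mset ys)"
      by (rule add_strict_right_mono)
    then show ?thesis
      by (intro filt_of_int filt_mono[OF filt_word[OF assms]]) (auto intro: le_less_trans)
  qed simp
  moreover have "of_int (central_coeff x y) * (c * word_val ys) \<in> filt (\<lambda>w. w < wt x + wt y + weight (mset ys))"
  proof (cases "central_coeff x y = 0")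
    case False
    have "(0::int\<times>int) < (0, 1)" by (simp add: lex_less_simps zero_prod_def)
    then have "0 < wt x + wt y" using wt_central[OF False] by order
    then have "weight (mset ys) < wt x + wt y + weight (mset ys)"
      using add_strict_right_mono[of 0 _ "weight (mset ys)"] by simp
    then show ?thesis
      by (intro filt_of_int filt_cong[OF level_mult] filt.scalar filt.word assms)
  qed simp
  ultimately show ?thesis
    by (simp add: val_bracket_mult[of x y "word_val ys"] add.assoc filt.add)
qed

lemma filt_raising:
  assumes "raising x" "lower_word ys"
  shows "val x * word_val ys - sc (psi x) * word_val ys \<in> filt (\<lambda>w. w < wt x + weight (mset ys))"
  using assms(2)
proof (induction ys)
  case Nil
  show ?case using psi[OF assms(1)] by (auto simp: left_cong_def intro: filt.ideal)
next
  case (Cons y ys)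
  then have y: "\<not> raising y" and ys: "lower_word ys" by auto
  have "val x * word_val (y # ys) - sc (psi x) * word_val (y # ys) =
    (val x * (val y * word_val ys) - val y * (val x * word_val ys)) +
    val y * (val x * word_val ys - sc (psi x) * word_val ys)"
    by (simp add: right_diff_distrib sc_left_commute)
  also have "\<dots> \<in> filt (\<lambda>w. w < wt x + weight (mset (y # ys)))"
    using filt_commutator[OF ys, of x y] filt_lower_strict[OF Cons.IH[OF ys] y]
    by (intro filt.add) (simp_all add: add.assoc add.left_commute)
  finally show ?case .
qed

lemma filt_move:
  assumes "lower_word (as @ y # bs)"
  shows "word_val (as @ y # bs) - val y * word_val (as @ bs) \<in> filt (\<lambda>w. w < weight (mset (as @ y # bs)))"
  using assms
proof (induction as)
  case (Cons a as)
  have "word_val ((a # as) @ y # bs) - val y * word_val ((a # as) @ bs) =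
     val a * (word_val (as @ y # bs) - val y * word_val (as @ bs)) +
     (val a * (val y * word_val (as @ bs)) - val y * (val a * word_val (as @ bs)))"
    by (simp add: right_diff_distrib)
  also have "\<dots> \<in> filt (\<lambda>w. w < weight (mset ((a # as) @ y # bs)))"
    using filt_lower_strict[OF Cons.IH, of a] filt_commutator[of "as @ bs" a y] Cons.prems
    by (intro filt.add) (auto simp: lower_word_def add.assoc add.left_commute)
  finally show ?case .
qed simp

text \<open>The order of the letters in a word matters only in smaller weight.\<close>

lemma filt_perm:
  "mset ys = mset zs \<Longrightarrow> lower_word ys \<Longrightarrow> word_val ys - word_val zs \<in> filt (\<lambda>w. w < weight (mset ys))"
proof (induction ys arbitrary: zs)
  case (Cons y ys)
  then have "y \<in> set zs" by (metis list.set_intros(1) mset_eq_setD)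
  then obtain as bs where zs: "zs = as @ y # bs" by (metis split_list)
  then have m: "mset ys = mset (as @ bs)" using Cons.prems(1) by simp
  have "set zs = set (y # ys)" using Cons.prems(1) by (metis mset_eq_setD)
  then have lz: "lower_word zs" using Cons.prems(2) by (auto simp: lower_word_def)
  have "word_val (y # ys) - word_val zs =
      val y * (word_val ys - word_val (as @ bs)) - (word_val zs - val y * word_val (as @ bs))"
    by (simp add: right_diff_distrib)
  also have "\<dots> \<in> filt (\<lambda>w. w < weight (mset (y # ys)))"
    using filt_lower_strict[OF Cons.IH[OF m], of y] filt_move[of as y bs] lz Cons.prems
    by (intro filt_diff[where u = "val y * (word_val ys - word_val (as @ bs))"]) (auto simp: zs)
  finally show ?case .
qed simp

text \<open>Any ordering of the letters may be chosen, by \<open>filt_perm\<close>.\<close>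

definition monomial_val :: "gen multiset \<Rightarrow> 'a" where
  "monomial_val M = word_val (SOME ys. mset ys = M)"

definition lift :: "(gen multiset \<Rightarrow>\<^sub>0 complex) \<Rightarrow> 'a" where
  "lift p = (\<Sum>M\<in>Poly_Mapping.keys p. sc (Poly_Mapping.lookup p M) * monomial_val M)"

definition homogeneous :: "int \<times> int \<Rightarrow> (gen multiset \<Rightarrow>\<^sub>0 complex) \<Rightarrow> bool" where
  "homogeneous \<omega> p \<longleftrightarrow> (\<forall>M\<in>Poly_Mapping.keys p. (\<forall>y\<in>#M. \<not> raising y) \<and> weight M = \<omega>)"

lemma monomial_val_word:
  assumes "lower_word ys"
  shows "word_val ys - monomial_val (mset ys) \<in> filt (\<lambda>w. w < weight (mset ys))"
proof -
  have "mset (SOME zs. mset zs = mset ys) = mset ys" by (rule someI[of _ ys]) simp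
  then show ?thesis unfolding monomial_val_def by (intro filt_perm assms) simp
qed

lemma monomial_val_filt:
  assumes "\<forall>y\<in>#M. \<not> raising y" "Q (weight M)"
  shows "monomial_val M \<in> filt Q"
proof -
  obtain ys where ys: "mset ys = M" by (metis ex_mset)
  have "mset (SOME zs. mset zs = M) = M" by (rule someI[of _ ys]) (rule ys)
  then show ?thesis
    unfolding monomial_val_def using assms by (intro filt.word) (auto simp: lower_word_def simp flip: set_mset_mset)
qed

lemma lift_superset:
  "finite A \<Longrightarrow> Poly_Mapping.keys p \<subseteq> A \<Longrightarrow> lift p = (\<Sum>M\<in>A. sc (Poly_Mapping.lookup p M) * monomial_val M)"
  unfolding lift_def by (rule sum.mono_neutral_left) (auto simp: in_keys_iff)

lemma lift_add: "lift (p + q) = lift p + lift q"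
proof -
  have "Poly_Mapping.keys (p + q) \<subseteq> Poly_Mapping.keys p \<union> Poly_Mapping.keys q"
    by (rule Poly_Mapping.keys_add)
  then show ?thesis
    by (simp add: lift_superset[of "Poly_Mapping.keys p \<union> Poly_Mapping.keys q"] lookup_add sc_add
        distrib_right sum.distrib)
qed

lemma lift_monomial: "lift (monomial M t) = sc t * monomial_val M"
  by (simp add: lift_superset[of "{M}"])

lemma lift_zero [simp]: "lift 0 = 0"
  by (simp add: lift_def)

lemma lift_sum: "lift (sum g A) = (\<Sum>i\<in>A. lift (g i))"
  by (induction A rule: infinite_finite_induct) (simp_all add: lift_add)

lemma lift_scalar: "lift (monomial {#} t * p) = sc t * lift p"
proof -
  have "monomial {#} t * p = (\<Sum>M\<in>Poly_Mapping.keys p. monomial M (t * Poly_Mapping.lookup p M))"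
    by (subst poly_expand) (simp add: sum_distrib_left mult_single)
  then show ?thesis
    by (simp add: lift_sum lift_monomial sc_mult lift_def[of p] sum_distrib_left mult.assoc)
qed

lemma homogeneous_zero [simp]: "homogeneous \<omega> 0"
  by (simp add: homogeneous_def)

lemma homogeneous_add: "homogeneous \<omega> p \<Longrightarrow> homogeneous \<omega> q \<Longrightarrow> homogeneous \<omega> (p + q)"
  using Poly_Mapping.keys_add[of p q] by (auto simp: homogeneous_def)

lemma homogeneous_sum: "(\<And>i. i \<in> A \<Longrightarrow> homogeneous \<omega> (g i)) \<Longrightarrow> homogeneous \<omega> (sum g A)"
  by (induction A rule: infinite_finite_induct) (auto intro: homogeneous_add)

lemma homogeneous_monomial: "t = 0 \<or> (\<forall>y\<in>#M. \<not> raising y) \<and> weight M = \<omega> \<Longrightarrow> homogeneous \<omega> (monomial M t)"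
  by (auto simp: homogeneous_def)

lemma homogeneous_mult:
  assumes "homogeneous \<omega> p" "(\<forall>y\<in>#N. \<not> raising y)"
  shows "homogeneous (weight N + \<omega>) (monomial N t * p)"
proof -
  have *: "monomial N t * p = (\<Sum>M\<in>Poly_Mapping.keys p. monomial (N + M) (t * Poly_Mapping.lookup p M))"
    by (subst poly_expand) (simp add: sum_distrib_left mult_single)
  show ?thesis
    unfolding * by (intro homogeneous_sum homogeneous_monomial disjI2)
      (use assms in \<open>auto simp: homogeneous_def\<close>)
qed

lemma lift_filt: "homogeneous \<omega> p \<Longrightarrow> Q \<omega> \<Longrightarrow> lift p \<in> filt Q"
  unfolding lift_def homogeneous_def by (intro filt_sum filt.scalar monomial_val_filt) auto

lemma lift_lower:
  assumes "homogeneous \<omega> p" "\<not> raising y"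
  shows "val y * lift p - lift (monomial {#y#} 1 * p) \<in> filt (\<lambda>w. w < wt y + \<omega>)"
proof -
  have *: "val y * monomial_val M - monomial_val (add_mset y M) \<in> filt (\<lambda>w. w < wt y + \<omega>)"
    if "M \<in> Poly_Mapping.keys p" for M
  proof -
    obtain ys where ys: "mset ys = M" by (metis ex_mset)
    have lower: "lower_word ys" "weight (mset ys) = \<omega>"
      using assms(1) that ys by (auto simp: homogeneous_def lower_word_def)
    have "val y * (word_val ys - monomial_val M) \<in> filt (\<lambda>w. w < wt y + \<omega>)"
      using filt_lower_strict[OF monomial_val_word[OF lower(1)] assms(2)] lower(2) ys by simp
    moreover have "word_val (y # ys) - monomial_val (add_mset y M) \<in> filt (\<lambda>w. w < wt y + \<omega>)"
      using monomial_val_word[of "y # ys"] lower assms(2) ys by simp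
    ultimately show ?thesis
      using filt_diff[of "word_val (y # ys) - monomial_val (add_mset y M)" _ "val y * (word_val ys - monomial_val M)"]
      by (simp add: algebra_simps)
  qed
  have "monomial {#y#} 1 * p = (\<Sum>M\<in>Poly_Mapping.keys p. monomial (add_mset y M) (Poly_Mapping.lookup p M))"
    by (subst poly_expand) (simp add: sum_distrib_left mult_single)
  then have "val y * lift p - lift (monomial {#y#} 1 * p) =
    (\<Sum>M\<in>Poly_Mapping.keys p. sc (Poly_Mapping.lookup p M) * (val y * monomial_val M - monomial_val (add_mset y M)))"
    by (simp add: lift_sum lift_monomial lift_def[of p] sum_distrib_left right_diff_distrib sum_subtractf sc_left_commute)
  also have "\<dots> \<in> filt (\<lambda>w. w < wt y + \<omega>)"
    by (intro filt_sum filt.scalar *)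
  finally show ?thesis .
qed

definition symbol :: "gen \<Rightarrow> gen multiset \<Rightarrow>\<^sub>0 complex" where
  "symbol x = (if raising x then monomial {#} (psi x) else monomial {#x#} 1)"

text \<open>
  The common shape of left multiplication by a raising generator and of the operators
  \<open>L(n)\<close>. On a word such an operator acts by the Leibniz rule, replacing the letter \<open>y\<close>
  by \<open>a y\<close> times \<open>g y\<close>; its value on \<open>1\<close> is the scalar \<open>t\<close>, and \<open>z\<close> collects central
  terms. On symbols, \<open>A\<close> minus \<open>t\<close> is then a derivation that shifts the weight by \<open>s\<close>,
  and the terms from \<open>z\<close> have smaller weight. The last condition allows new elements of
  a left ideal to be produced from given ones.
\<close>

definition word_operator ::
    "('a \<Rightarrow> 'a) \<Rightarrow> complex \<Rightarrow> (gen \<Rightarrow> complex) \<Rightarrow> (gen \<Rightarrow> gen) \<Rightarrow> (gen \<Rightarrow> complex) \<Rightarrow> int \<times> int \<Rightarrow> bool" where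
  "word_operator A t a g z s \<longleftrightarrow>
     A 1 \<approx> sc t \<and> (\<forall>u v. A (u + v) \<approx> A u + A v) \<and> (\<forall>r u. A (sc r * u) \<approx> sc r * A u) \<and>
     (\<forall>y u. A (val y * u) \<approx> val y * A u + sc (a y) * (val (g y) * u) + sc (z y) * u) \<and>
     (\<forall>y. a y \<noteq> 0 \<longrightarrow> wt (g y) = wt y + s) \<and> (\<forall>y. z y \<noteq> 0 \<longrightarrow> wt y + s > 0) \<and>
     (\<forall>I u. left_ideal I \<longrightarrow> J \<subseteq> I \<longrightarrow> u \<in> I \<longrightarrow> A u \<in> I)"

definition symbol_derivation :: "(gen \<Rightarrow> complex) \<Rightarrow> (gen \<Rightarrow> gen) \<Rightarrow> gen \<Rightarrow> gen multiset \<Rightarrow>\<^sub>0 complex" where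
  "symbol_derivation a g y = monomial {#} (a y) * symbol (g y)"

definition leibniz :: "(gen \<Rightarrow> gen multiset \<Rightarrow>\<^sub>0 complex) \<Rightarrow> gen multiset \<Rightarrow> gen multiset \<Rightarrow>\<^sub>0 complex" where
  "leibniz t M = (\<Sum>y\<in>#M. t y * monomial (M - {#y#}) 1)"

lemma leibniz_add_mset: "leibniz t (add_mset x M) = t x * monomial M 1 + monomial {#x#} 1 * leibniz t M"
proof -
  have "(\<Sum>y\<in>#M. t y * monomial (add_mset x M - {#y#}) 1) = (\<Sum>y\<in>#M. monomial {#x#} 1 * (t y * monomial (M - {#y#}) 1))"
  proof (intro arg_cong[of _ _ sum_mset] image_mset_cong)
    fix y assume "y \<in># M"
    then have "add_mset x M - {#y#} = {#x#} + (M - {#y#})" by simp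
    then show "t y * monomial (add_mset x M - {#y#}) 1 = monomial {#x#} 1 * (t y * monomial (M - {#y#}) 1)"
      by (simp add: mult.left_commute mult_single)
  qed
  then show ?thesis
    unfolding leibniz_def by (simp add: sum_mset_distrib_left)
qed

lemma homogeneous_leibniz:
  assumes "word_operator A t a g z s" "\<forall>y\<in>#M. \<not> raising y"
  shows "homogeneous (weight M + s) (leibniz (symbol_derivation a g) M)"
  using assms(2)
proof (induction M)
  case (add x M)
  have "homogeneous (weight (add_mset x M) + s) (symbol_derivation a g x * monomial M 1)"
  proof -
    have g: "a x \<noteq> 0 \<Longrightarrow> wt (g x) = wt x + s" using assms(1) by (auto simp: word_operator_def)
    show ?thesis
    proof (cases "raising (g x)")
      case True
      then show ?thesis
        using add.prems g wt_psi[OF True]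
        by (auto simp: symbol_derivation_def symbol_def mult_single add.assoc add.left_commute intro!: homogeneous_monomial)
    next
      case False
      then show ?thesis
        using add.prems g
        by (auto simp: symbol_derivation_def symbol_def mult_single ac_simps intro!: homogeneous_monomial)
    qed
  qed
  moreover have "homogeneous (weight (add_mset x M) + s) (monomial {#x#} 1 * leibniz (symbol_derivation a g) M)"
    using homogeneous_mult[OF add.IH, of "{#x#}" 1] add.prems by (simp add: add.assoc)
  ultimately show ?case
    unfolding leibniz_add_mset by (rule homogeneous_add)
qed (simp add: leibniz_def)

text \<open>
  Induction on the word: the Leibniz rule splits off the term in which the first letter
  is replaced, and the rest is the value on the shorter word multiplied by that letter.
\<close>

lemma word_operator_word:
  assumes A: "word_operator A t a g z s" and "lower_word ys"
  shows "A (word_val ys) - sc t * word_val ys - lift (leibniz (symbol_derivation a g) (mset ys))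
    \<in> filt (\<lambda>w. w < weight (mset ys) + s)"
  using assms(2)
proof (induction ys)
  case Nil
  then show ?case using A by (auto simp: word_operator_def leibniz_def left_cong_def intro: filt.ideal)
next
  case (Cons y ys)
  then have y: "\<not> raising y" and ys: "lower_word ys" by auto
  let ?D = "leibniz (symbol_derivation a g)" and ?Q = "\<lambda>w. w < weight (mset (y # ys)) + s"
  have wQ: "(\<lambda>w. w < wt y + (weight (mset ys) + s)) = ?Q" by (simp add: add.assoc)
  have g: "a y \<noteq> 0 \<Longrightarrow> wt (g y) = wt y + s" and z: "z y \<noteq> 0 \<Longrightarrow> wt y + s > 0"
    using A by (auto simp: word_operator_def)
  have 1: "val y * (A (word_val ys) - sc t * word_val ys - lift (?D (mset ys))) \<in> filt ?Q"
    using filt_lower_strict[OF Cons.IH[OF ys] y] unfolding wQ .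
  have 2: "val y * lift (?D (mset ys)) - lift (monomial {#y#} 1 * ?D (mset ys)) \<in> filt ?Q"
    using lift_lower[OF homogeneous_leibniz[OF A, of "mset ys"] y] ys unfolding wQ by (simp add: lower_word_def)
  have 3: "sc (a y) * (val (g y) * word_val ys) - lift (symbol_derivation a g y * monomial (mset ys) 1) \<in> filt ?Q"
  proof (cases "a y = 0")
    case True
    then show ?thesis by (simp add: symbol_derivation_def)
  next
    case False
    have Q: "?Q = (\<lambda>w. w < wt (g y) + weight (mset ys))" using g[OF False] by (simp add: ac_simps)
    show ?thesis
    proof (cases "raising (g y)")
      case True
      have "val (g y) * word_val ys - sc (psi (g y)) * word_val ys \<in> filt ?Q"
        unfolding Q by (rule filt_raising[OF True ys])
      moreover have "sc (psi (g y)) * (word_val ys - monomial_val (mset ys)) \<in> filt ?Q"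
      proof (cases "psi (g y) = 0")
        case False
        then show ?thesis
          unfolding Q using monomial_val_word[OF ys] wt_psi[OF True False] by (intro filt.scalar) simp
      qed simp
      ultimately have "sc (a y) * ((val (g y) * word_val ys - sc (psi (g y)) * word_val ys) +
          sc (psi (g y)) * (word_val ys - monomial_val (mset ys))) \<in> filt ?Q"
        by (rule filt.scalar[OF filt.add])
      then show ?thesis
        using True by (simp add: symbol_derivation_def symbol_def mult_single lift_monomial sc_mult
            right_diff_distrib mult.assoc)
    next
      case False
      have "sc (a y) * (word_val (g y # ys) - monomial_val (mset (g y # ys))) \<in> filt ?Q"
        unfolding Q using monomial_val_word[of "g y # ys"] False ys by (intro filt.scalar) simp
      then show ?thesis
        using False by (simp add: symbol_derivation_def symbol_def mult_single lift_monomial right_diff_distrib)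
    qed
  qed
  have 4: "sc (z y) * word_val ys \<in> filt ?Q"
  proof (cases "z y = 0")
    case False
    then have "weight (mset ys) < weight (mset (y # ys)) + s"
      using add_strict_right_mono[OF z[OF False], of "weight (mset ys)"] by (simp add: ac_simps)
    then show ?thesis by (intro filt.scalar filt.word ys)
  qed simp
  have "A (word_val (y # ys)) \<approx> val y * A (word_val ys) + sc (a y) * (val (g y) * word_val ys) + sc (z y) * word_val ys"
    using A by (simp add: word_operator_def)
  then have "A (word_val (y # ys)) - sc t * word_val (y # ys) - lift (?D (mset (y # ys))) \<approx>
     val y * A (word_val ys) + sc (a y) * (val (g y) * word_val ys) + sc (z y) * word_val ys
       - sc t * word_val (y # ys) - lift (?D (mset (y # ys)))"
    by (intro cong_diff cong_refl)
  also have "\<dots> = val y * (A (word_val ys) - sc t * word_val ys - lift (?D (mset ys)))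
      + (val y * lift (?D (mset ys)) - lift (monomial {#y#} 1 * ?D (mset ys)))
      + (sc (a y) * (val (g y) * word_val ys) - lift (symbol_derivation a g y * monomial (mset ys) 1))
      + sc (z y) * word_val ys"
    by (simp add: leibniz_add_mset lift_add right_diff_distrib sc_left_commute)
  finally show ?case
    by (rule filt_cong) (intro filt.add 1 2 3 4)
qed

lemma word_operator_diff:
  assumes "word_operator A t a g z s"
  shows "A (u - v) \<approx> A u - A v" "u \<approx> v \<Longrightarrow> A u \<approx> A v"
proof -
  have add: "A (u + v) \<approx> A u + A v" and scal: "A (sc r * u) \<approx> sc r * A u" for u v r
    using assms by (auto simp: word_operator_def)
  show *: "A (u - v) \<approx> A u - A v" for u v
    using cong_trans[OF add[of u "sc (- 1) * v"] cong_add[OF cong_refl scal[of "- 1" v]]] by (simp add: sc_minus)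
  assume "u \<approx> v"
  then have "A (u - v) \<in> J"
    using assms left_ideal_J by (auto simp: word_operator_def left_cong_def)
  then have "A u - A v \<approx> 0"
    using cong_trans[OF cong_sym[OF *[of u v]], of 0] by (simp add: cong_zero_iff)
  then show "A u \<approx> A v" by (simp add: left_cong_def)
qed

lemma word_operator_filt:
  assumes A: "word_operator A t a g z s" and "u \<in> filt (\<lambda>w. w < \<omega>)"
  shows "A u - sc t * u \<in> filt (\<lambda>w. w < \<omega> + s)"
  using assms(2)
proof (induction rule: filt.induct)
  case (ideal u)
  then show ?case
    using A left_ideal_J by (intro filt.ideal J_closed) (auto simp: word_operator_def)
next
  case (word ys)
  have less: "weight (mset ys) + s < \<omega> + s" using word by (intro add_strict_right_mono)
  have "homogeneous (weight (mset ys) + s) (leibniz (symbol_derivation a g) (mset ys))"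
    using word by (intro homogeneous_leibniz[OF A]) (simp add: lower_word_def)
  then have "lift (leibniz (symbol_derivation a g) (mset ys)) \<in> filt (\<lambda>w. w < \<omega> + s)"
    using less by (rule lift_filt)
  moreover have "A (word_val ys) - sc t * word_val ys - lift (leibniz (symbol_derivation a g) (mset ys))
      \<in> filt (\<lambda>w. w < \<omega> + s)"
    by (rule filt_mono[OF word_operator_word[OF A word(1)]]) (erule less_trans[OF _ less])
  ultimately have "A (word_val ys) - sc t * word_val ys - lift (leibniz (symbol_derivation a g) (mset ys))
      + lift (leibniz (symbol_derivation a g) (mset ys)) \<in> filt (\<lambda>w. w < \<omega> + s)"
    by (intro filt.add)
  then show ?case by simp
next
  case (add u v)
  have "A (u + v) - sc t * (u + v) \<approx> A u + A v - sc t * (u + v)"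
    using A by (intro cong_diff cong_refl) (simp add: word_operator_def)
  also have "\<dots> = (A u - sc t * u) + (A v - sc t * v)" by (simp add: distrib_left)
  finally show ?case by (rule filt_cong) (intro filt.add add.IH)
next
  case (scalar u r)
  have "A (sc r * u) - sc t * (sc r * u) \<approx> sc r * A u - sc t * (sc r * u)"
    using A by (intro cong_diff cong_refl) (simp add: word_operator_def)
  also have "\<dots> = sc r * (A u - sc t * u)" by (simp add: right_diff_distrib sc_left_commute[of "sc t" r])
  finally show ?case by (rule filt_cong) (intro filt.scalar scalar.IH)
qed

lemma derivation_leibniz:
  "derivation t p = (\<Sum>M\<in>Poly_Mapping.keys p. monomial {#} (Poly_Mapping.lookup p M) * leibniz t M)"
  by (simp add: derivation_def leibniz_def)

lemma word_operator_lift: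
  assumes A: "word_operator A t a g z s" and p: "homogeneous \<omega> p"
  shows "A (lift p) - sc t * lift p - lift (derivation (symbol_derivation a g) p) \<in> filt (\<lambda>w. w < \<omega> + s)"
    "homogeneous (\<omega> + s) (derivation (symbol_derivation a g) p)"
proof -
  let ?D = "symbol_derivation a g" and ?l = "Poly_Mapping.lookup p"
  have mon: "A (monomial_val M) - sc t * monomial_val M - lift (leibniz ?D M) \<in> filt (\<lambda>w. w < \<omega> + s)"
    if "M \<in> Poly_Mapping.keys p" for M
  proof -
    define ys where "ys = (SOME zs. mset zs = M)"
    have "mset ys = M" unfolding ys_def by (metis (mono_tags) ex_mset someI)
    moreover have "lower_word ys" "weight M = \<omega>"
      using p that calculation by (auto simp: homogeneous_def lower_word_def)
    ultimately show ?thesis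
      using word_operator_word[OF A, of ys] by (simp add: monomial_val_def ys_def)
  qed
  have "A (\<Sum>M\<in>S. sc (?l M) * monomial_val M) \<approx> (\<Sum>M\<in>S. sc (?l M) * A (monomial_val M))" if "finite S" for S
    using that
  proof (induction S)
    case empty
    have "A (0 - 0) \<approx> A 0 - A 0" by (rule word_operator_diff[OF A])
    then show ?case by simp
  next
    case (insert M S)
    have "A (sc (?l M) * monomial_val M + (\<Sum>M\<in>S. sc (?l M) * monomial_val M)) \<approx>
      A (sc (?l M) * monomial_val M) + A (\<Sum>M\<in>S. sc (?l M) * monomial_val M)"
      using A by (simp add: word_operator_def)
    also have "\<dots> \<approx> sc (?l M) * A (monomial_val M) + (\<Sum>M\<in>S. sc (?l M) * A (monomial_val M))"
      using A insert.IH by (intro cong_add) (simp_all add: word_operator_def)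
    finally show ?case using insert by simp
  qed
  then have "A (lift p) - sc t * lift p - lift (derivation ?D p) \<approx>
      (\<Sum>M\<in>Poly_Mapping.keys p. sc (?l M) * A (monomial_val M)) - sc t * lift p - lift (derivation ?D p)"
    unfolding lift_def[of p] by (intro cong_diff cong_refl) simp
  also have "\<dots> = (\<Sum>M\<in>Poly_Mapping.keys p. sc (?l M) * (A (monomial_val M) - sc t * monomial_val M - lift (leibniz ?D M)))"
    by (simp add: lift_def[of p] derivation_leibniz lift_sum lift_scalar right_diff_distrib sum_subtractf
        sum_distrib_left sc_left_commute[of "sc t"])
  finally show "A (lift p) - sc t * lift p - lift (derivation ?D p) \<in> filt (\<lambda>w. w < \<omega> + s)"
    by (rule filt_cong) (intro filt_sum filt.scalar mon)
  show "homogeneous (\<omega> + s) (derivation ?D p)"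
    unfolding derivation_leibniz
  proof (intro homogeneous_sum)
    fix M assume "M \<in> Poly_Mapping.keys p"
    then have "homogeneous (\<omega> + s) (leibniz ?D M)"
      using homogeneous_leibniz[OF A, of M] p by (auto simp: homogeneous_def)
    then show "homogeneous (\<omega> + s) (monomial {#} (?l M) * leibniz ?D M)"
      using homogeneous_mult[of "\<omega> + s" _ "{#}"] by simp
  qed
qed

end

context whittaker_filtration
begin

lemma weight_nonneg: "\<forall>y\<in>#M. \<not> raising y \<Longrightarrow> fst (weight M) \<ge> 0 \<and> snd (weight M) \<ge> 0"
  by (induction M) (use wt_lower in \<open>auto simp: add_nonneg_nonneg\<close>)

lemma homogeneous_weight_nonneg:
  assumes "homogeneous \<omega> p" "p \<noteq> 0"
  shows "fst \<omega> \<ge> 0 \<and> snd \<omega> \<ge> 0"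
proof -
  from assms(2) obtain M where "M \<in> Poly_Mapping.keys p" by (metis keys_eq_empty ex_in_conv)
  then show ?thesis using assms(1) weight_nonneg[of M] by (auto simp: homogeneous_def)
qed

text \<open>
  The element \<open>u\<close> has leading symbol \<open>p\<close>. A relation suffices: it is only ever used to
  follow one chosen symbol through a sequence of operators.
\<close>

definition leading :: "int \<times> int \<Rightarrow> (gen multiset \<Rightarrow>\<^sub>0 complex) \<Rightarrow> 'a \<Rightarrow> bool" where
  "leading \<omega> p u \<longleftrightarrow> p \<noteq> 0 \<and> homogeneous \<omega> p \<and> u - lift p \<in> filt (\<lambda>w. w < \<omega>)"

definition weight_rel :: "((int \<times> int) \<times> (int \<times> int)) set" where
  "weight_rel = inv_image (less_than <*lex*> less_than) (\<lambda>\<omega>. (nat (fst \<omega>), nat (snd \<omega>)))"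

lemma wf_weight_rel: "wf weight_rel"
  by (simp add: weight_rel_def wf_lex_prod)

lemma weight_relI: "\<omega>' < \<omega> \<Longrightarrow> fst \<omega>' \<ge> 0 \<and> snd \<omega>' \<ge> 0 \<Longrightarrow> (\<omega>', \<omega>) \<in> weight_rel"
  by (cases \<omega>; cases \<omega>') (auto simp: weight_rel_def lex_less_simps)

lemma leading_step:
  assumes A: "word_operator A t a g z s" and u: "leading \<omega> p u"
    and D: "derivation (symbol_derivation a g) p \<noteq> 0"
  shows "leading (\<omega> + s) (derivation (symbol_derivation a g) p) (A u - sc t * u)"
proof -
  let ?D = "derivation (symbol_derivation a g) p"
  have p: "homogeneous \<omega> p" and r: "u - lift p \<in> filt (\<lambda>w. w < \<omega>)" using u by (auto simp: leading_def)
  have "A u - sc t * u - lift ?D =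
    (A u - A (lift p) - A (u - lift p)) + ((A (lift p) - sc t * lift p - lift ?D) + (A (u - lift p) - sc t * (u - lift p)))"
    by (simp add: right_diff_distrib)
  also have "\<dots> \<in> filt (\<lambda>w. w < \<omega> + s)"
  proof (rule filt.add[OF _ filt.add])
    show "A u - A (lift p) - A (u - lift p) \<in> filt (\<lambda>w. w < \<omega> + s)"
      using cong_sym[OF word_operator_diff(1)[OF A, of u "lift p"]] by (intro filt.ideal) (simp add: left_cong_def)
  qed (use word_operator_lift(1)[OF A p] word_operator_filt[OF A r] in auto)
  finally show ?thesis
    using D word_operator_lift(2)[OF A p] by (simp add: leading_def)
qed

text \<open>
  Applying \<open>A\<close> minus \<open>t\<close> keeps an element in \<open>I\<close> and replaces its leading symbol by a
  derivative, of weight smaller by \<open>- s\<close>. Weights of nonzero homogeneous polynomials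
  have nonnegative components, so the process ends, and it can only end at a symbol for
  which \<open>T\<close> holds.
\<close>

lemma reduction:
  assumes I: "left_ideal I" "J \<subseteq> I" and "u \<in> I" "leading \<omega> p u"
    and step: "\<And>\<omega> p. p \<noteq> 0 \<Longrightarrow> homogeneous \<omega> p \<Longrightarrow> \<not> T p \<Longrightarrow>
      \<exists>A t a g z s. word_operator A t a g z s \<and> s < 0 \<and> derivation (symbol_derivation a g) p \<noteq> 0"
  shows "\<exists>\<omega> p u. T p \<and> u \<in> I \<and> leading \<omega> p u"
  using assms(3,4)
proof (induction \<omega> arbitrary: p u rule: wf_induct_rule[OF wf_weight_rel])
  case (1 \<omega>)
  show ?case
  proof (cases "T p")
    case True
    then show ?thesis using 1(2,3) by blast
  next
    case False
    have p: "p \<noteq> 0" "homogeneous \<omega> p" using 1(3) by (auto simp: leading_def)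
    obtain A t a g z s where A: "word_operator A t a g z s" and s: "s < 0"
      and D: "derivation (symbol_derivation a g) p \<noteq> 0"
      using step[OF p False] by blast
    have lead: "leading (\<omega> + s) (derivation (symbol_derivation a g) p) (A u - sc t * u)"
      by (rule leading_step[OF A 1(3) D])
    have "A u \<in> I" using A I 1(2) by (auto simp: word_operator_def)
    then have mem: "A u - sc t * u \<in> I" by (intro left_idealD[OF I(1)] 1(2))
    have "\<omega> + s < \<omega>" using add_strict_left_mono[OF s, of \<omega>] by simp
    then have "(\<omega> + s, \<omega>) \<in> weight_rel"
      using homogeneous_weight_nonneg[of "\<omega> + s"] lead by (intro weight_relI) (auto simp: leading_def)
    then show ?thesis using 1(1) mem lead by blast
  qed
qed

lemma filt_bounded:
  "u \<in> filt Q \<Longrightarrow> u \<in> J \<or> (\<exists>\<omega>. fst \<omega> \<ge> 0 \<and> snd \<omega> \<ge> 0 \<and> Q \<omega> \<and> u \<in> filt (\<lambda>w. w \<le> \<omega>))"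
proof (induction rule: filt.induct)
  case (word ys)
  have "fst (weight (mset ys)) \<ge> 0 \<and> snd (weight (mset ys)) \<ge> 0"
    using word(1) by (intro weight_nonneg) (simp add: lower_word_def)
  moreover have "word_val ys \<in> filt (\<lambda>w. w \<le> weight (mset ys))"
    using word(1) by (intro filt.word) auto
  ultimately show ?case using word(2) by blast
next
  case (add u v)
  have mono: "x \<in> filt (\<lambda>w. w \<le> \<omega>')" if "x \<in> filt (\<lambda>w. w \<le> \<omega>)" "\<omega> \<le> \<omega>'" for x \<omega> \<omega>'
    using that(1) by (rule filt_mono) (erule order_trans[OF _ that(2)])
  show ?case
  proof (cases "u \<in> J \<or> v \<in> J")
    case True
    then show ?thesis
      using add.IH J_closed(2) filt.add filt.ideal by metis
  next
    case False
    then obtain \<omega> \<omega>' where *: "fst \<omega> \<ge> 0 \<and> snd \<omega> \<ge> 0" "Q \<omega>" "u \<in> filt (\<lambda>w. w \<le> \<omega>)"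
      "fst \<omega>' \<ge> 0 \<and> snd \<omega>' \<ge> 0" "Q \<omega>'" "v \<in> filt (\<lambda>w. w \<le> \<omega>')"
      using add.IH by blast
    show ?thesis
    proof (cases "\<omega> \<le> \<omega>'")
      case True
      then have "u + v \<in> filt (\<lambda>w. w \<le> \<omega>')" by (intro filt.add * mono[OF *(3)])
      then show ?thesis using * by blast
    next
      case False
      then have "u + v \<in> filt (\<lambda>w. w \<le> \<omega>)" by (intro filt.add * mono[OF *(6)]) order
      then show ?thesis using * by blast
    qed
  qed
next
  case (scalar u t)
  then show ?case using J_closed(3) filt.scalar by blast
qed simp

text \<open>
  Left multiplication by a generator preserves the span of the lower words, by
  straightening.
\<close>

lemma filt_all: "u \<in> filt (\<lambda>_. True)"
proof (induction u rule: gen_induct)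
  case one
  show ?case using filt.word[of "[]"] by simp
next
  case (gen x u)
  then consider "u \<in> J" | \<omega> where "u \<in> filt (\<lambda>w. w \<le> \<omega>)" using filt_bounded by blast
  then show ?case
  proof cases
    case 1
    then show ?thesis by (intro filt.ideal J_closed)
  next
    case (2 \<omega>)
    then show ?thesis by (rule filt_mono[OF filt_val(1)]) simp
  qed
qed (auto intro: filt.add filt.scalar)

lemma filt_top: "u \<in> filt (\<lambda>w. w \<le> \<omega>) \<Longrightarrow> \<exists>p. homogeneous \<omega> p \<and> u - lift p \<in> filt (\<lambda>w. w < \<omega>)"
proof (induction rule: filt.induct)
  case (ideal u)
  then show ?case by (intro exI[of _ 0]) (simp add: filt.ideal)
next
  case (word ys)
  show ?case
  proof (cases "weight (mset ys) = \<omega>")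
    case True
    then show ?thesis
      using word monomial_val_word[OF word(1)]
      by (intro exI[of _ "monomial (mset ys) 1"]) (simp add: lift_monomial homogeneous_monomial lower_word_def)
  next
    case False
    then show ?thesis
      using word by (intro exI[of _ 0]) (simp add: filt.word)
  qed
next
  case (add u v)
  then obtain p q where *: "homogeneous \<omega> p" "u - lift p \<in> filt (\<lambda>w. w < \<omega>)"
    "homogeneous \<omega> q" "v - lift q \<in> filt (\<lambda>w. w < \<omega>)" by blast
  have "(u - lift p) + (v - lift q) \<in> filt (\<lambda>w. w < \<omega>)" by (intro filt.add *)
  then have "u + v - lift (p + q) \<in> filt (\<lambda>w. w < \<omega>)" by (simp add: lift_add algebra_simps)
  then show ?case using homogeneous_add *(1,3) by blast
next
  case (scalar u t)
  then obtain p where *: "homogeneous \<omega> p" "u - lift p \<in> filt (\<lambda>w. w < \<omega>)" by blast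
  have "sc t * u - lift (monomial {#} t * p) \<in> filt (\<lambda>w. w < \<omega>)"
    using filt.scalar[OF *(2), of t] by (simp add: lift_scalar right_diff_distrib)
  moreover have "homogeneous \<omega> (monomial {#} t * p)"
    using homogeneous_mult[OF *(1), of "{#}" t] by simp
  ultimately show ?case by blast
qed

text \<open>
  Descend along the filtration: as long as the top symbol is zero, the weight can be
  lowered.
\<close>

lemma leading_exists:
  assumes "u \<notin> J"
  shows "\<exists>\<omega> p. leading \<omega> p u"
proof -
  obtain \<omega> where "u \<in> filt (\<lambda>w. w \<le> \<omega>)"
    using filt_bounded[OF filt_all[of u]] assms by blast
  then show ?thesis
  proof (induction \<omega> rule: wf_induct_rule[OF wf_weight_rel])
    case (1 \<omega>)
    obtain p where p: "homogeneous \<omega> p" "u - lift p \<in> filt (\<lambda>w. w < \<omega>)"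
      using filt_top[OF 1(2)] by blast
    show ?case
    proof (cases "p = 0")
      case True
      then have "u \<in> filt (\<lambda>w. w < \<omega>)" using p by simp
      then obtain \<omega>' where "fst \<omega>' \<ge> 0 \<and> snd \<omega>' \<ge> 0" "\<omega>' < \<omega>" "u \<in> filt (\<lambda>w. w \<le> \<omega>')"
        using filt_bounded assms by blast
      then show ?thesis using 1(1) weight_relI by blast
    next
      case False
      then have "leading \<omega> p u" using p by (simp add: leading_def)
      then show ?thesis by blast
    qed
  qed
qed

lemma raising_operator:
  assumes "raising x"
  shows "word_operator (\<lambda>u. val x * u) (psi x) (\<lambda>y. of_int (bracket_coeff x y)) (bracket_gen x)
     (\<lambda>y. of_int (central_coeff x y) * \<kappa>) (wt x - (0, 1))"
  unfolding word_operator_def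
proof (intro conjI allI impI)
  show "val x * 1 \<approx> sc (psi x)" using psi[OF assms] by simp
  show "val x * (u + v) \<approx> val x * u + val x * v" for u v by (simp add: distrib_left)
  show "val x * (sc r * u) \<approx> sc r * (val x * u)" for r u by (simp add: sc_left_commute[of "val x"])
  show "val x * (val y * u) \<approx> val y * (val x * u) + sc (of_int (bracket_coeff x y)) * (val (bracket_gen x y) * u)
      + sc (of_int (central_coeff x y) * \<kappa>) * u" for y u
  proof -
    have "of_int (central_coeff x y) * (c * u) \<approx> sc (of_int (central_coeff x y) * \<kappa>) * u"
      using cong_mult[OF level_mult[of u], of "of_int (central_coeff x y)"] by (simp add: sc_mult sc_int mult.assoc)
    then show ?thesis
      unfolding val_bracket_mult[of x y u] sc_int by (intro cong_add cong_refl)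
  qed
  show "wt (bracket_gen x y) = wt y + (wt x - (0, 1))" if "(of_int (bracket_coeff x y) :: complex) \<noteq> 0" for y
    using wt_bracket[of x y] that by (simp add: add.commute add_diff_eq)
  show "wt y + (wt x - (0, 1)) > 0" if "of_int (central_coeff x y) * \<kappa> \<noteq> 0" for y
  proof -
    have "(0, 1) < wt x + wt y" using wt_central[of x y] that by auto
    then have "(0, 1) - (0, 1) < wt x + wt y - (0, 1)" by (rule diff_strict_right_mono)
    then show ?thesis by (simp add: add.commute add_diff_eq)
  qed
qed (auto intro: left_idealD)

lemma sugawara_operator:
  assumes "sugawara_op n 1 \<approx> sc t" "\<And>y. wt (shift n y) = wt y + s"
  shows "word_operator (sugawara_op n) t (\<lambda>y. - of_int (mode y)) (shift n) (\<lambda>_. 0) s"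
  unfolding word_operator_def
proof (intro conjI allI impI)
  show "sugawara_op n (val y * u) \<approx> val y * sugawara_op n u + sc (- of_int (mode y)) * (val (shift n y) * u) + sc 0 * u" for y u
    using sugawara_op_val[of n y u] by (simp add: sc_minus sc_int)
qed (use assms sugawara_op_add sugawara_op_scalar sugawara_op_mem in auto)

end

section \<open>Universal Whittaker ideals\<close>

text \<open>
  The construction of \<open>left_ideal_generated\<close> for an arbitrary ring, so that it applies
  to all systems of currents.
\<close>

definition generated_ideal :: "'a::ring_1 set \<Rightarrow> 'a set" where
  "generated_ideal S = \<Inter> {I. left_ideal I \<and> S \<subseteq> I}"

lemma generated_ideal: "left_ideal (generated_ideal S)" "S \<subseteq> generated_ideal S"
  by (auto simp: left_ideal_def generated_ideal_def)

lemma generated_ideal_le: "left_ideal I \<Longrightarrow> S \<subseteq> I \<Longrightarrow> generated_ideal S \<subseteq> I"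
  by (auto simp: generated_ideal_def)

lemma generated_ideal_uea: "left_ideal_generated S = generated_ideal S"
  by (simp add: left_ideal_generated_def generated_ideal_def left_ideal_def conj_assoc)

context affine_currents
begin

definition whittaker_relations :: "complex \<Rightarrow> complex \<Rightarrow> complex \<Rightarrow> 'a set" where
  "whittaker_relations lam mu \<kappa> = {e 0 - sc lam, f 1 - sc mu, c - sc \<kappa>}
     \<union> {e i | i. i \<ge> 1} \<union> {h i | i. i \<ge> 1} \<union> {f (i + 1) | i. i \<ge> 1}"

definition universal_ideal :: "complex \<Rightarrow> complex \<Rightarrow> complex \<Rightarrow> 'a set" where
  "universal_ideal lam mu \<kappa> = generated_ideal (whittaker_relations lam mu \<kappa>)"

definition eval_poly :: "'a \<Rightarrow> complex poly \<Rightarrow> 'a" where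
  "eval_poly x p = fold_coeffs (\<lambda>a b. sc a + x * b) p 0"

lemma eval_poly_0 [simp]: "eval_poly x 0 = 0"
  by (simp add: eval_poly_def)

lemma eval_poly_pCons [simp]: "eval_poly x (pCons a p) = sc a + x * eval_poly x p"
  by (cases "p = 0 \<and> a = 0") (auto simp: eval_poly_def)

lemma eval_poly_add: "eval_poly x (p + q) = eval_poly x p + eval_poly x q"
  by (induction p q rule: poly_induct2) (simp_all add: sc_add distrib_left)

lemma eval_poly_smult: "eval_poly x (smult t p) = sc t * eval_poly x p"
  by (induction p) (simp_all add: sc_mult distrib_left sc_left_commute[of x])

lemma eval_poly_mult: "eval_poly x (p * q) = eval_poly x p * eval_poly x q"
  by (induction p) (simp_all add: eval_poly_add eval_poly_smult distrib_right mult.assoc)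

lemma eval_poly_shift:
  assumes "y * x = (x + sc t) * y"
  shows "y * eval_poly x p = eval_poly x (pcompose p [:t, 1:]) * y"
proof (induction p)
  case (pCons a p)
  have "y * eval_poly x (pCons a p) = sc a * y + (x + sc t) * (y * eval_poly x p)"
    by (simp add: distrib_left sc_comm[of a y] assms flip: mult.assoc)
  also have "\<dots> = eval_poly x (pcompose (pCons a p) [:t, 1:]) * y"
    unfolding pCons.IH by (simp add: pcompose_pCons eval_poly_add eval_poly_mult eval_poly_smult distrib_right mult.assoc add.commute)
  finally show ?case .
qed simp

lemma eval_poly_commute: "y * x = x * y \<Longrightarrow> y * eval_poly x p = eval_poly x p * y"
  using eval_poly_shift[of y x 0 p] by simp

end

fun whittaker_character :: "complex \<Rightarrow> complex \<Rightarrow> gen \<Rightarrow> complex" where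
  "whittaker_character lam mu (gE n) = (if n = 0 then lam else 0)"
| "whittaker_character lam mu (gH n) = 0"
| "whittaker_character lam mu (gF n) = (if n = 1 then mu else 0)"

text \<open>
  This weight is chosen so that each bracket of two generators lowers it by exactly one.
\<close>

fun base_weight :: "gen \<Rightarrow> int" where
  "base_weight (gE n) = 0" | "base_weight (gH n) = 1" | "base_weight (gF n) = 2"

text \<open>
  The principal gradation, in which the simple root vectors \<open>e(0)\<close> and \<open>f(1)\<close> have
  degree one.
\<close>

fun principal_degree :: "gen \<Rightarrow> int" where
  "principal_degree (gE n) = 2 * n + 1" | "principal_degree (gH n) = 2 * n" | "principal_degree (gF n) = 2 * n - 1"

abbreviation const :: "complex \<Rightarrow> 'x multiset \<Rightarrow>\<^sub>0 complex" where
  "const \<equiv> Poly_Mapping.single {#}"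

lemma const_hom: "const (s + t) = const s + const t" "const (s * t) = const s * const t"
  "const (- t) = - const t" "const (s - t) = const s - const t"
  by (simp_all add: single_add single_uminus single_diff mult_single)

lemma const_1 [simp]: "const 1 = 1"
  by (simp flip: single_one add: zero_multiset_def)

lemma monomial_const_mult_eq_0: "t \<noteq> 0 \<Longrightarrow> monomial {#} t * p = 0 \<Longrightarrow> p = 0"
proof -
  assume "t \<noteq> 0" "monomial {#} t * p = 0"
  then have "monomial {#} (inverse t) * monomial {#} t * p = 0" by (simp add: mult.assoc)
  then show "p = 0" using \<open>t \<noteq> 0\<close> by (simp add: mult_single flip: zero_multiset_def)
qed

locale universal_whittaker = affine_currents sc e h f c
  for sc :: "complex \<Rightarrow> 'a::ring_1" and e h f c +
  fixes lam mu \<kappa> :: complex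
  assumes noncritical: "\<kappa> \<noteq> - 2"
begin

abbreviation J :: "'a set" where "J \<equiv> universal_ideal lam mu \<kappa>"

lemma relations_in_J: "e 0 - sc lam \<in> J" "f 1 - sc mu \<in> J" "c - sc \<kappa> \<in> J"
  "i \<ge> 1 \<Longrightarrow> e i \<in> J" "i \<ge> 1 \<Longrightarrow> h i \<in> J" "i \<ge> 2 \<Longrightarrow> f i \<in> J"
proof -
  have *: "whittaker_relations lam mu \<kappa> \<subseteq> J"
    unfolding universal_ideal_def by (rule generated_ideal)
  show "e 0 - sc lam \<in> J" "f 1 - sc mu \<in> J" "c - sc \<kappa> \<in> J"
    "i \<ge> 1 \<Longrightarrow> e i \<in> J" "i \<ge> 1 \<Longrightarrow> h i \<in> J"
    using * by (auto simp: whittaker_relations_def)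
  have "f ((i - 1) + 1) \<in> J" if "i \<ge> 2"
  proof -
    have "f ((i - 1) + 1) \<in> {f (i + 1) | i. i \<ge> 1}"
      using that by (intro CollectI exI[of _ "i - 1"]) auto
    then show ?thesis using * unfolding whittaker_relations_def by blast
  qed
  then show "i \<ge> 2 \<Longrightarrow> f i \<in> J" by simp
qed

sublocale smooth_left_ideal sc e h f c J \<kappa>
proof
  show "left_ideal J" unfolding universal_ideal_def by (rule generated_ideal)
  show "left_cong J c (sc \<kappa>)" using relations_in_J by (simp add: left_cong_def)
  have "val x \<in> J" if "mode x \<ge> 2" for x
    using that relations_in_J(4-6)[of "mode x"] by (cases x) auto
  then show "\<exists>N. \<forall>x. mode x \<ge> N \<longrightarrow> val x \<in> J" by blast
qed (rule noncritical)

abbreviation universal_cong (infix "\<approx>" 50) where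
  "u \<approx> v \<equiv> left_cong J u v"

lemma val_character: "raising x \<Longrightarrow> val x \<approx> sc (whittaker_character lam mu x)"
proof (cases x)
  case (gE n)
  assume "raising x"
  then show ?thesis using gE relations_in_J(1) relations_in_J(4)[of n] by (auto simp: left_cong_def)
next
  case (gH n)
  assume "raising x"
  then show ?thesis using gH relations_in_J(5)[of n] by (auto simp: left_cong_def)
next
  case (gF n)
  assume "raising x"
  then show ?thesis using gF relations_in_J(2) relations_in_J(6)[of n] by (auto simp: left_cong_def)
qed

text \<open>
  The generators with nonzero character must have weight \<open>0\<close>. For \<open>e(0)\<close> and \<open>f(1)\<close>
  together this leaves a combination of base weight and mode. If only \<open>e(0)\<close> remains,
  the depth \<open>- mode\<close> can be the first component; if the character vanishes, so can minus
  the principal degree.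
\<close>

lemma filtration_by_base:
  assumes "wt = (\<lambda>x. (0, base_weight x - 2 * mode x)) \<or> mu = 0 \<and> wt = (\<lambda>x. (- mode x, base_weight x))
    \<or> lam = 0 \<and> mu = 0 \<and> wt = (\<lambda>x. (- principal_degree x, 1))"
  shows "whittaker_filtration sc e h f c J \<kappa> (whittaker_character lam mu) wt"
proof
  show "whittaker_character lam mu x \<noteq> 0 \<Longrightarrow> wt x = 0" for x
    using assms by (cases x) (auto simp: zero_prod_def split: if_splits)
  show "bracket_coeff x y \<noteq> 0 \<Longrightarrow> wt (bracket_gen x y) = wt x + wt y - (0, 1)" for x y
    using assms by (cases x; cases y) auto
  show "central_coeff x y \<noteq> 0 \<Longrightarrow> (0, 1) < wt x + wt y" for x y
    using assms by (cases x; cases y) (auto simp: lex_less_simps split: if_splits)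
  show "\<not> raising x \<Longrightarrow> 0 \<le> fst (wt x) \<and> 0 \<le> snd (wt x)" for x
    using assms by (cases x) auto
qed (rule val_character)

text \<open>
  Each summand of \<open>L(n)\<close> with \<open>n \<ge> 1\<close> has a factor of positive mode. Moved to the
  right, it kills \<open>1\<close> unless it is \<open>f(1)\<close>; in that case its partner \<open>e(n - 1)\<close> acts on
  \<open>1\<close> by a scalar as well.
\<close>

lemma sugawara_positive: "n \<ge> 1 \<Longrightarrow> \<exists>t. sugawara_op n 1 \<approx> sc t"
proof -
  assume n: "n \<ge> 1"
  have zero: "\<exists>t. u * val x \<approx> sc t" if "raising x" "whittaker_character lam mu x = 0" for u x
    using cong_mult[OF val_character[OF that(1)], of u] that(2) by (intro exI[of _ 0]) simp
  have scalar: "\<exists>t. val y * val x \<approx> sc t" if "raising x" "raising y" for x y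
  proof -
    have "val y * val x \<approx> val y * sc (whittaker_character lam mu x)"
      by (intro cong_mult val_character that)
    also have "\<dots> = sc (whittaker_character lam mu x) * val y" by (simp add: sc_comm)
    also have "\<dots> \<approx> sc (whittaker_character lam mu x) * sc (whittaker_character lam mu y)"
      by (intro cong_mult val_character that)
    finally show ?thesis by (auto simp: sc_mult[symmetric])
  qed
  have add: "\<exists>t. u + v \<approx> sc t" if "\<exists>t. u \<approx> sc t" "\<exists>t. v \<approx> sc t" for u v
    using that cong_add sc_add by metis
  have "\<exists>t. sugawara_term n k \<approx> sc t" for k
  proof -
    consider "k < 0" | "k = 0" | "k = 1" | "k \<ge> 2" by linarith
    then show ?thesis
    proof cases
      case 1
      have "\<exists>t. e k * f (n - k) \<approx> sc t" "\<exists>t. f k * e (n - k) \<approx> sc t" "\<exists>t. h k * h (n - k) \<approx> sc t"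
        using zero[of "gF (n - k)" "e k"] zero[of "gE (n - k)" "f k"] zero[of "gH (n - k)" "h k"] 1 n by auto
      then show ?thesis
        using 1 unfolding sugawara_term_def by (auto intro!: add)
    next
      case 2
      have "e n * f 0 = f 0 * e n + h n"
        using e_f[of n 0] n by (simp add: algebra_simps)
      moreover have "h n * h 0 = h 0 * h n" using h_h[of n 0] n by simp
      ultimately have "\<exists>t. f n * e 0 \<approx> sc t" "\<exists>t. e n * f 0 \<approx> sc t" "\<exists>t. h n * h 0 \<approx> sc t"
        using scalar[of "gE 0" "gF n"] zero[of "gE n" "f 0"] zero[of "gH n" 1] zero[of "gH n" "h 0"] n
        by (auto intro!: add)
      then show ?thesis
        using 2 unfolding sugawara_term_def by (auto intro!: add)
    next
      case 3
      have "\<exists>t. f (n - 1) * e 1 \<approx> sc t" "\<exists>t. e (n - 1) * f 1 \<approx> sc t" "\<exists>t. h (n - 1) * h 1 \<approx> sc t"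
        using zero[of "gE 1" "f (n - 1)"] scalar[of "gF 1" "gE (n - 1)"] zero[of "gH 1" "h (n - 1)"] n by auto
      then show ?thesis
        using 3 unfolding sugawara_term_def by (auto intro!: add)
    next
      case 4
      have "\<exists>t. f (n - k) * e k \<approx> sc t" "\<exists>t. e (n - k) * f k \<approx> sc t" "\<exists>t. h (n - k) * h k \<approx> sc t"
        using zero[of "gE k" "f (n - k)"] zero[of "gF k" "e (n - k)"] zero[of "gH k" "h (n - k)"] 4 by auto
      then show ?thesis
        using 4 unfolding sugawara_term_def by (auto intro!: add)
    qed
  qed
  then obtain t where t: "\<And>k. sugawara_term n k \<approx> sc (t k)" by metis
  obtain K where K: "\<forall>k. \<bar>k\<bar> > K \<longrightarrow> sugawara_term n k * 1 \<in> J"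
    using sugawara_term_eventually by blast
  have "sugawara_op n 1 \<approx> sc (inverse (4 * (\<kappa> + 2))) * (sugawara_sum n K * 1)"
    by (rule sugawara_op_eq[OF K])
  also have "\<dots> \<approx> sc (inverse (4 * (\<kappa> + 2))) * (\<Sum>k\<in>{-K..<K+1}. sc (t k))"
    unfolding sugawara_sum_def by (simp only: mult_1_right) (intro cong_mult cong_sum t)
  also have "\<dots> = sc (inverse (4 * (\<kappa> + 2)) * (\<Sum>k\<in>{-K..<K+1}. t k))"
    by (simp only: sc_mult sc_sum)
  finally show ?thesis by blast
qed

section \<open>The generic case\<close>

text \<open>
  The symbol of \<open>u\<close> is reduced to a constant. Let \<open>y\<close> be a variable of least principal
  degree in a symbol \<open>p\<close>. If \<open>y = h(m)\<close>, then multiplication by \<open>e(- m)\<close> replaces \<open>y\<close> by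
  \<open>- 2 * lam\<close> and kills the other variables. Otherwise the variables \<open>e(m)\<close> and
  \<open>f(m + 1)\<close> share the least degree. With \<open>n = - m\<close>, the operators \<open>h(n)\<close> and \<open>L(n)\<close>
  give the combinations \<open>2 lam, - 2 mu\<close> and \<open>n lam, (n - 1) mu\<close> of the two partial
  derivatives, whose determinant \<open>2 lam mu (2 n - 1)\<close> is nonzero.
\<close>

theorem generic_ideal_maximal:
  assumes lm: "lam \<noteq> 0" "mu \<noteq> 0" and I: "left_ideal I" "J \<subseteq> I" and u: "u \<in> I" "u \<notin> J"
  shows "1 \<in> I"
proof -
  define wt where "wt x = (0::int, base_weight x - 2 * mode x)" for x
  interpret whittaker_filtration sc e h f c J \<kappa> "whittaker_character lam mu" wt
    by (rule filtration_by_base) (simp add: wt_def fun_eq_iff)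
  have step: "\<exists>A t a g z s. word_operator A t a g z s \<and> s < 0 \<and> derivation (symbol_derivation a g) p \<noteq> 0"
    if p: "homogeneous \<omega> p" and vars: "poly_vars p \<noteq> {}" for \<omega> p
  proof -
    let ?V = "poly_vars p"
    have low: "\<not> raising y" if "y \<in> ?V" for y using p that by (auto simp: homogeneous_def poly_vars_def)
    obtain y where y: "y \<in> ?V" and max: "\<And>y'. y' \<in> ?V \<Longrightarrow> principal_degree y' \<ge> principal_degree y"
    proof -
      have "Min (principal_degree ` ?V) \<in> principal_degree ` ?V" using vars by (intro Min_in) auto
      then obtain y where "y \<in> ?V" "principal_degree y = Min (principal_degree ` ?V)" by force
      then show ?thesis using that[of y] by simp
    qed
    \<comment> \<open>The variables \<open>e(m)\<close> and \<open>f(m + 1)\<close> have the same principal degree and are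
      treated together.\<close>
    have pair: ?thesis if m: "m \<le> - 1" and ym: "y = gE m \<or> y = gF (m + 1)" and yd: "principal_degree y = 2 * m + 1" for m
    proof -
      define n where "n = - m"
      have n: "n \<ge> 1" using m by (simp add: n_def)
      let ?W = "insert (gE m) (insert (gF (m + 1)) ?V)" and ?PE = "partial (gE m) p" and ?PF = "partial (gF (m + 1)) p"
      have W: "principal_degree y' \<ge> 2 * m + 1" "\<not> raising y'" if "y' \<in> ?W" for y'
        using that max low m yd by auto
      let ?a = "\<lambda>y. of_int (bracket_coeff (gH n) y) :: complex" and ?g = "bracket_gen (gH n)"
      have "symbol_derivation ?a ?g y' * partial y' p =
          (if y' = gE m then const (2 * lam) * ?PE else 0) + (if y' = gF (m + 1) then const (- 2 * mu) * ?PF else 0)"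
        if "y' \<in> ?W" for y'
        using W[OF that] n by (cases y') (auto simp: symbol_derivation_def symbol_def n_def const_hom)
      then have D1: "derivation (symbol_derivation ?a ?g) p = const (2 * lam) * ?PE + const (- 2 * mu) * ?PF"
        by (subst derivation_partial[of ?W]) (auto simp: sum.distrib)
      let ?a' = "\<lambda>y. - of_int (mode y) :: complex"
      have "symbol_derivation ?a' (shift n) y' * partial y' p =
          (if y' = gE m then const (of_int n * lam) * ?PE else 0) + (if y' = gF (m + 1) then const ((of_int n - 1) * mu) * ?PF else 0)"
        if "y' \<in> ?W" for y'
        using W[OF that] n by (cases y') (auto simp: symbol_derivation_def symbol_def n_def const_hom algebra_simps)
      then have D2: "derivation (symbol_derivation ?a' (shift n)) p = const (of_int n * lam) * ?PE + const ((of_int n - 1) * mu) * ?PF"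
        by (subst derivation_partial[of ?W]) (auto simp: sum.distrib)
      have "derivation (symbol_derivation ?a ?g) p \<noteq> 0 \<or> derivation (symbol_derivation ?a' (shift n)) p \<noteq> 0"
      proof (rule ccontr)
        assume "\<not> ?thesis"
        then have z: "const (2 * lam) * ?PE + const (- 2 * mu) * ?PF = 0"
          "const (of_int n * lam) * ?PE + const ((of_int n - 1) * mu) * ?PF = 0"
          using D1 D2 by auto
        \<comment> \<open>Eliminate the derivative with respect to \<open>e(m)\<close>; the coefficient is minus
          the determinant divided by \<open>lam\<close>.\<close>
        have "const (- 2 * mu * (2 * of_int n - 1)) * ?PF = const (of_int n) * (const (2 * lam) * ?PE + const (- 2 * mu) * ?PF)
            - 2 * (const (of_int n * lam) * ?PE + const ((of_int n - 1) * mu) * ?PF)"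
          by (simp add: const_hom algebra_simps)
        then have "const (- 2 * mu * (2 * of_int n - 1)) * ?PF = 0" unfolding z by simp
        moreover have "- 2 * mu * (2 * of_int n - 1) \<noteq> 0"
        proof -
          have "2 * n - 1 \<noteq> 0" using n by simp
          then have "(of_int (2 * n - 1) :: complex) \<noteq> 0" by (simp only: of_int_eq_0_iff not_False_eq_True)
          then show ?thesis using lm by simp
        qed
        ultimately have PF: "?PF = 0" by (rule monomial_const_mult_eq_0[rotated])
        then have "const (2 * lam) * ?PE = 0" using z by simp
        then have "?PE = 0" using lm monomial_const_mult_eq_0[of "2 * lam"] by simp
        then show False using PF ym partial_nonzero[OF y] by auto
      qed
      then show ?thesis
      proof
        assume *: "derivation (symbol_derivation ?a ?g) p \<noteq> 0"
        have "raising (gH n)" using n by simp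
        moreover have "wt (gH n) - (0, 1) < 0" using n by (simp add: wt_def zero_prod_def lex_less_simps)
        ultimately show ?thesis using raising_operator * by blast
      next
        assume *: "derivation (symbol_derivation ?a' (shift n)) p \<noteq> 0"
        obtain t where t: "sugawara_op n 1 \<approx> sc t" using sugawara_positive[OF n] by blast
        have "wt (shift n y) = wt y + (0, - 2 * n)" for y by (cases y) (auto simp: wt_def)
        moreover have "(0, - 2 * n) < (0::int \<times> int)" using n by (simp add: zero_prod_def lex_less_simps)
        ultimately show ?thesis using sugawara_operator[OF t] * by blast
      qed
    qed
    show ?thesis
    proof (cases y)
      case (gH m)
      have m: "m \<le> 0" using low[OF y] gH by simp
      let ?a = "\<lambda>y. of_int (bracket_coeff (gE (- m)) y) :: complex" and ?g = "bracket_gen (gE (- m))"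
      have "symbol_derivation ?a ?g y' * partial y' p = (if y' = y then monomial {#} (- 2 * lam) * partial y p else 0)"
        if "y' \<in> ?V" for y'
        using max[OF that] gH low[OF that] by (cases y') (auto simp: symbol_derivation_def symbol_def mult_single)
      then have "derivation (symbol_derivation ?a ?g) p = monomial {#} (- 2 * lam) * partial y p"
        using y by (simp add: derivation_partial[of ?V])
      moreover have "\<dots> \<noteq> 0"
        using monomial_const_mult_eq_0[of "- 2 * lam"] partial_nonzero[OF y] lm by auto
      moreover have "wt (gE (- m)) - (0, 1) < 0" using m by (simp add: wt_def zero_prod_def lex_less_simps)
      ultimately show ?thesis
        using raising_operator[of "gE (- m)"] m by (metis raising.simps(1) neg_0_le_iff_le)
    next
      case (gE m)
      have "m \<le> - 1" using low[OF y] gE by simp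
      moreover have "principal_degree y = 2 * m + 1" using gE by simp
      ultimately show ?thesis using pair y gE by blast
    next
      case (gF m)
      have "m - 1 \<le> - 1" using low[OF y] gF by simp
      moreover have "principal_degree y = 2 * (m - 1) + 1" using gF by simp
      ultimately show ?thesis using pair[of "m - 1"] y gF by simp
    qed
  qed
  obtain \<omega>0 p0 where "leading \<omega>0 p0 u" using leading_exists[OF u(2)] by blast
  then obtain \<omega> p v where p: "poly_vars p = {}" "v \<in> I" "leading \<omega> p v"
    using reduction[OF I u(1), of \<omega>0 p0 "\<lambda>p. poly_vars p = {}"] step by blast
  have keys: "Poly_Mapping.keys p \<subseteq> {{#}}" using p(1) by (auto simp: poly_vars_def)
  moreover have "Poly_Mapping.keys p \<noteq> {}" using p(3) by (simp add: leading_def)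
  ultimately have "{#} \<in> Poly_Mapping.keys p" by blast
  then have t: "Poly_Mapping.lookup p {#} \<noteq> 0" and \<omega>: "\<omega> = 0"
    using p(3) by (simp add: in_keys_iff) (use \<open>{#} \<in> _\<close> p(3) in \<open>auto simp: leading_def homogeneous_def\<close>)
  have "lift p = sc (Poly_Mapping.lookup p {#})"
    using keys by (simp add: lift_superset[of "{{#}}"] monomial_val_def)
  moreover have "v - lift p \<in> J"
  proof -
    have "v - lift p \<in> filt (\<lambda>w. w < 0)" using p(3) \<omega> by (simp add: leading_def)
    then show ?thesis
      using filt_bounded by (fastforce simp: zero_prod_def lex_less_simps split: prod.splits)
  qed
  ultimately have "v - sc (Poly_Mapping.lookup p {#}) \<in> I" using I(2) by auto
  then have "sc (Poly_Mapping.lookup p {#}) * 1 \<in> I"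
    using left_idealD(5)[OF I(1) p(2)] by fastforce
  then show ?thesis using sc_mem_cancel[OF I(1) t] by blast
qed

end

section \<open>The Verma case\<close>

lemma lookup_monomial_mult:
  "Poly_Mapping.lookup (monomial N t * p) K = (if N \<subseteq># K then t * Poly_Mapping.lookup p (K - N) else 0)"
proof -
  have "monomial N t * p = (\<Sum>M\<in>Poly_Mapping.keys p. monomial (N + M) (t * Poly_Mapping.lookup p M))"
    by (subst poly_expand) (simp add: sum_distrib_left mult_single)
  then have "Poly_Mapping.lookup (monomial N t * p) K =
      (\<Sum>M\<in>Poly_Mapping.keys p. if N + M = K then t * Poly_Mapping.lookup p M else 0)"
    by (simp add: lookup_sum lookup_single when_def)
  also have "\<dots> = (if N \<subseteq># K then t * Poly_Mapping.lookup p (K - N) else 0)"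
  proof (cases "N \<subseteq># K")
    case True
    then have "N + M = K \<longleftrightarrow> M = K - N" for M by (metis add_diff_cancel_left' subset_mset.add_diff_inverse)
    then show ?thesis using True by (auto simp: sum.delta in_keys_iff)
  next
    case False
    then have "N + M \<noteq> K" for M by auto
    then show ?thesis using False by simp
  qed
  finally show ?thesis .
qed

lemma monomial_mult_eq_0: "t \<noteq> 0 \<Longrightarrow> monomial N t * p = 0 \<Longrightarrow> p = 0"
proof (rule poly_mapping_eqI)
  fix M assume "t \<noteq> 0" "monomial N t * p = 0"
  then show "Poly_Mapping.lookup p M = Poly_Mapping.lookup 0 M"
    using lookup_monomial_mult[of N t p "N + M"] by simp
qed

context universal_whittaker
begin

text \<open>
  Since the character vanishes, each generator except \<open>h(0)\<close> can be removed from the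
  symbol: the current of opposite mode and root, or \<open>L(n)\<close> in the case of \<open>h(- n)\<close>,
  replaces a variable \<open>y\<close> of least principal degree by a multiple of \<open>h(0)\<close> and kills
  the other variables. All lower words of the principal degree of \<open>h(0)\<close> are powers of
  \<open>h(0)\<close>, so an element with such a symbol is a polynomial in \<open>h(0)\<close> modulo \<open>J\<close>.
\<close>

theorem verma_ideal_reduction:
  assumes lm: "lam = 0" "mu = 0" and I: "left_ideal I" "J \<subseteq> I" and u: "u \<in> I" "u \<notin> J"
  shows "\<exists>q. q \<noteq> 0 \<and> eval_poly (h 0) q \<in> I"
proof -
  define wt where "wt x = (- principal_degree x, 1::int)" for x
  interpret whittaker_filtration sc e h f c J \<kappa> "whittaker_character lam mu" wt
    by (rule filtration_by_base) (simp add: wt_def fun_eq_iff lm)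
  have symbol0: "symbol x = (if raising x then 0 else monomial {#x#} 1)" for x
    unfolding symbol_def by (cases x) (auto simp: lm)
  have step: "\<exists>A t a g z s. word_operator A t a g z s \<and> s < 0 \<and> derivation (symbol_derivation a g) p \<noteq> 0"
    if p: "homogeneous \<omega> p" and vars: "\<not> poly_vars p \<subseteq> {gH 0}" for \<omega> p
  proof -
    let ?V = "poly_vars p"
    have low: "\<not> raising y" if "y \<in> ?V" for y using p that by (auto simp: homogeneous_def poly_vars_def)
    obtain y where y: "y \<in> ?V" and max: "\<And>y'. y' \<in> ?V \<Longrightarrow> principal_degree y' \<ge> principal_degree y"
    proof -
      have "Min (principal_degree ` ?V) \<in> principal_degree ` ?V" using vars by (intro Min_in) auto
      then obtain y where "y \<in> ?V" "principal_degree y = Min (principal_degree ` ?V)" by force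
      then show ?thesis using that[of y] by simp
    qed
    have neg: "principal_degree y < 0"
    proof -
      from vars obtain y' where y': "y' \<in> ?V" "y' \<noteq> gH 0" by blast
      then have "principal_degree y' < 0" using low[OF y'(1)] by (cases y') auto
      then show ?thesis using max[OF y'(1)] by simp
    qed
    have nz: "monomial {#gH 0#} t * partial y p \<noteq> 0" if "t \<noteq> 0" for t
      using monomial_mult_eq_0[OF that] partial_nonzero[OF y] by blast
    show ?thesis
    proof (cases y)
      case (gE m)
      let ?a = "\<lambda>y. of_int (bracket_coeff (gF (- m)) y) :: complex" and ?g = "bracket_gen (gF (- m))"
      have "symbol_derivation ?a ?g y' * partial y' p = (if y' = y then monomial {#gH 0#} (- 1) * partial y p else 0)"
        if "y' \<in> ?V" for y'
        using max[OF that] gE low[OF that] by (cases y') (auto simp: symbol_derivation_def symbol0 mult_single)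
      then have "derivation (symbol_derivation ?a ?g) p = monomial {#gH 0#} (- 1) * partial y p"
        using y by (simp add: derivation_partial[of ?V])
      moreover have "\<dots> \<noteq> 0" by (rule nz) simp
      ultimately have "derivation (symbol_derivation ?a ?g) p \<noteq> 0" by metis
      moreover have "wt (gF (- m)) - (0, 1) < 0" using gE neg by (simp add: wt_def zero_prod_def lex_less_simps)
      moreover have "raising (gF (- m))" using low[OF y] gE by simp
      ultimately show ?thesis using raising_operator by blast
    next
      case (gF m)
      let ?a = "\<lambda>y. of_int (bracket_coeff (gE (- m)) y) :: complex" and ?g = "bracket_gen (gE (- m))"
      have "symbol_derivation ?a ?g y' * partial y' p = (if y' = y then monomial {#gH 0#} 1 * partial y p else 0)"
        if "y' \<in> ?V" for y'
        using max[OF that] gF low[OF that] by (cases y') (auto simp: symbol_derivation_def symbol0 mult_single)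
      then have "derivation (symbol_derivation ?a ?g) p = monomial {#gH 0#} 1 * partial y p"
        using y by (simp add: derivation_partial[of ?V])
      moreover have "\<dots> \<noteq> 0" by (rule nz) simp
      ultimately have "derivation (symbol_derivation ?a ?g) p \<noteq> 0" by metis
      moreover have "wt (gE (- m)) - (0, 1) < 0" using gF neg low[OF y] by (simp add: wt_def zero_prod_def lex_less_simps)
      moreover have "raising (gE (- m))" using low[OF y] gF by simp
      ultimately show ?thesis using raising_operator by blast
    next
      case (gH m)
      define n where "n = - m"
      have n: "n \<ge> 1" using neg gH by (simp add: n_def)
      let ?a = "\<lambda>y. - of_int (mode y) :: complex"
      have "symbol_derivation ?a (shift n) y' * partial y' p = (if y' = y then monomial {#gH 0#} (of_int n) * partial y p else 0)"
        if "y' \<in> ?V" for y'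
        using max[OF that] gH low[OF that] n by (cases y') (auto simp: symbol_derivation_def symbol0 mult_single n_def)
      then have "derivation (symbol_derivation ?a (shift n)) p = monomial {#gH 0#} (of_int n) * partial y p"
        using y by (simp add: derivation_partial[of ?V])
      moreover have "\<dots> \<noteq> 0" using n by (intro nz) simp
      ultimately have "derivation (symbol_derivation ?a (shift n)) p \<noteq> 0" by metis
      moreover obtain t where t: "sugawara_op n 1 \<approx> sc t" using sugawara_positive[OF n] by blast
      moreover have "wt (shift n y) = wt y + (- 2 * n, 0)" for y by (cases y) (auto simp: wt_def)
      moreover have "(- 2 * n, 0) < (0::int \<times> int)" using n by (simp add: zero_prod_def lex_less_simps)
      ultimately show ?thesis using sugawara_operator[OF t] by blast
    qed
  qed
  obtain \<omega>0 p0 where "leading \<omega>0 p0 u" using leading_exists[OF u(2)] by blast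
  then obtain \<omega> p v where p: "poly_vars p \<subseteq> {gH 0}" and v: "v \<in> I" and lead: "leading \<omega> p v"
    using reduction[OF I u(1), of \<omega>0 p0 "\<lambda>p. poly_vars p \<subseteq> {gH 0}"] step by blast
  have wordH: "word_val ys = eval_poly (h 0) (monom 1 (length ys)) \<and> weight (mset ys) = (0, int (length ys))"
    if "set ys \<subseteq> {gH 0}" for ys
    using that by (induction ys) (auto simp: monom_0 monom_Suc wt_def zero_prod_def)
  have lowH: "fst (weight (mset ys)) \<ge> 0 \<and> (fst (weight (mset ys)) = 0 \<longrightarrow> set ys \<subseteq> {gH 0})" if "lower_word ys" for ys
    using that
  proof (induction ys)
    case (Cons y ys)
    have "fst (wt y) \<ge> 0 \<and> (fst (wt y) = 0 \<longrightarrow> y = gH 0)" using Cons.prems by (cases y) (auto simp: wt_def)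
    then show ?case using Cons by auto
  qed simp
  have low: "\<exists>q. (\<forall>i. coeff q i \<noteq> 0 \<longrightarrow> int i < b) \<and> x \<approx> eval_poly (h 0) q" if "x \<in> filt (\<lambda>w. w < (0, b))" for x b
    using that
  proof (induction rule: filt.induct)
    case (ideal x)
    then show ?case by (intro exI[of _ 0]) (simp add: left_cong_def)
  next
    case (word ys)
    then have "set ys \<subseteq> {gH 0}" using lowH[OF word(1)] by (cases "weight (mset ys)") (auto simp: lex_less_simps)
    then show ?case
      using wordH[of ys] word(2) by (intro exI[of _ "monom 1 (length ys)"]) (auto simp: lex_less_simps)
  next
    case (add x y)
    then obtain q r where *: "\<forall>i. coeff q i \<noteq> 0 \<longrightarrow> int i < b" "x \<approx> eval_poly (h 0) q"
      "\<forall>i. coeff r i \<noteq> 0 \<longrightarrow> int i < b" "y \<approx> eval_poly (h 0) r" by blast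
    then have "\<forall>i. coeff (q + r) i \<noteq> 0 \<longrightarrow> int i < b" by (metis add.right_neutral coeff_add)
    moreover have "x + y \<approx> eval_poly (h 0) (q + r)" unfolding eval_poly_add by (intro cong_add *)
    ultimately show ?case by blast
  next
    case (scalar x t)
    then obtain q where *: "\<forall>i. coeff q i \<noteq> 0 \<longrightarrow> int i < b" "x \<approx> eval_poly (h 0) q" by blast
    then have "\<forall>i. coeff (smult t q) i \<noteq> 0 \<longrightarrow> int i < b" by auto
    moreover have "sc t * x \<approx> eval_poly (h 0) (smult t q)" unfolding eval_poly_smult by (intro cong_mult *)
    ultimately show ?case by blast
  qed
  obtain M where M: "M \<in> Poly_Mapping.keys p" using lead by (metis ex_in_conv keys_eq_empty leading_def)
  have keyH: "set_mset M' \<subseteq> {gH 0}" if "M' \<in> Poly_Mapping.keys p" for M' using p that by (auto simp: poly_vars_def)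
  have rep: "M' = replicate_mset (size M') (gH 0) \<and> weight M' = (0, int (size M'))" if "set_mset M' \<subseteq> {gH 0}" for M'
  proof -
    obtain ys where "mset ys = M'" by (metis ex_mset)
    then show ?thesis using wordH[of ys] that by (metis set_mset_mset set_mset_subset_singletonD size_mset)
  qed
  have \<omega>: "\<omega> = (0, int (size M))" using M keyH rep lead by (auto simp: leading_def homogeneous_def)
  have "M' = M" if "M' \<in> Poly_Mapping.keys p" for M'
  proof -
    have "weight M' = \<omega>" using that lead by (auto simp: leading_def homogeneous_def)
    then have "size M' = size M" using \<omega> rep[OF keyH[OF that]] by simp
    then show ?thesis using rep[OF keyH[OF that]] rep[OF keyH[OF M]] by metis
  qed
  then have "Poly_Mapping.keys p \<subseteq> {M}" by blast
  then have lift: "lift p = sc (Poly_Mapping.lookup p M) * monomial_val M" by (simp add: lift_superset[of "{M}"])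
  have mv: "monomial_val M = eval_poly (h 0) (monom 1 (size M))"
  proof -
    have "mset (SOME ys. mset ys = M) = M" by (metis (mono_tags) ex_mset someI)
    then show ?thesis
      unfolding monomial_val_def using wordH[of "SOME ys. mset ys = M"] keyH[OF M] by (metis set_mset_mset size_mset)
  qed
  obtain q where q: "\<forall>i. coeff q i \<noteq> 0 \<longrightarrow> int i < int (size M)" "v - lift p \<approx> eval_poly (h 0) q"
    using low[of "v - lift p" "int (size M)"] lead \<omega> by (auto simp: leading_def)
  define r where "r = monom (Poly_Mapping.lookup p M) (size M) + q"
  have "coeff r (size M) = Poly_Mapping.lookup p M" using q(1) by (auto simp: r_def)
  then have "r \<noteq> 0" using M by (auto simp: in_keys_iff)
  moreover have "eval_poly (h 0) r \<in> I"
  proof -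
    have "(v - lift p) + lift p \<approx> eval_poly (h 0) q + lift p" by (intro cong_add q cong_refl)
    moreover have "eval_poly (h 0) (monom (Poly_Mapping.lookup p M) (size M)) = lift p"
      unfolding lift mv eval_poly_smult[symmetric] by (simp add: smult_monom)
    ultimately have "v \<approx> eval_poly (h 0) r" by (simp add: r_def eval_poly_add add.commute)
    then show ?thesis using cong_mem[OF _ I(2,1)] v by blast
  qed
  ultimately show ?thesis by blast
qed

text \<open>
  Split linear factors off \<open>q\<close> until the value of the cofactor leaves \<open>I\<close>; this cofactor
  is an eigenvector of \<open>x\<close> modulo \<open>I\<close>.
\<close>

lemma eval_poly_root:
  assumes "left_ideal I" "q \<noteq> 0" "eval_poly x q \<in> I" "1 \<notin> I"
  shows "\<exists>b r. r \<noteq> 0 \<and> degree r < degree q \<and> eval_poly x r \<notin> I \<and> (x - sc b) * eval_poly x r \<in> I"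
  using assms(2,3)
proof (induction "degree q" arbitrary: q rule: less_induct)
  case less
  show ?case
  proof (cases "degree q = 0")
    case True
    then obtain t where "q = [:t:]" by (metis degree_eq_zeroE)
    then have "sc t * 1 \<in> I" "t \<noteq> 0" using less.prems by auto
    then show ?thesis using sc_mem_cancel[OF assms(1)] assms(4) by blast
  next
    case False
    then obtain b where "poly q b = 0"
      using fundamental_theorem_of_algebra[of q] by (auto simp: constant_degree)
    then obtain r where r: "q = [:- b, 1:] * r" by (metis dvdE poly_eq_0_iff_dvd)
    then have "r \<noteq> 0" using less.prems by auto
    then have deg: "degree r < degree q" unfolding r by (subst degree_mult_eq) auto
    have qr: "eval_poly x q = (x - sc b) * eval_poly x r"
      unfolding r eval_poly_mult by (simp add: sc_minus)
    show ?thesis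
    proof (cases "eval_poly x r \<in> I")
      case True
      then show ?thesis using less.hyps[OF deg \<open>r \<noteq> 0\<close>] deg less_trans by blast
    next
      case False
      then show ?thesis using qr less.prems deg \<open>r \<noteq> 0\<close> by metis
    qed
  qed
qed

end

section \<open>The Casimir element\<close>

lemma coeff_pcompose_shift:
  fixes g :: "complex poly"
  shows "coeff (pcompose g [:t, 1:]) j \<noteq> 0 \<Longrightarrow> j \<le> degree g \<and> coeff g (degree g) \<noteq> 0"
    and "degree g \<le> b \<Longrightarrow> coeff (pcompose g [:t, 1:]) b = coeff g b"
proof -
  have deg: "degree (pcompose g [:t, 1:]) = degree g" by (simp add: degree_pcompose)
  show "j \<le> degree g \<and> coeff g (degree g) \<noteq> 0" if "coeff (pcompose g [:t, 1:]) j \<noteq> 0"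
    using le_degree[OF that] deg that by (cases "g = 0") auto
  show "coeff (pcompose g [:t, 1:]) b = coeff g b" if "degree g \<le> b"
  proof (cases "degree g = b")
    case True
    then show ?thesis using lead_coeff_comp[of "[:t, 1:]" g] deg by simp
  next
    case False
    then show ?thesis using that deg by (simp add: coeff_eq_0)
  qed
qed

lemma poly_difference_degree:
  fixes g :: "complex poly"
  assumes "degree g > 0" "t \<noteq> 0"
  shows "pcompose g [:t, 1:] - g \<noteq> 0" "degree (pcompose g [:t, 1:] - g) < degree g"
proof -
  show "pcompose g [:t, 1:] - g \<noteq> 0"
  proof
    assume "pcompose g [:t, 1:] - g = 0"
    then have "poly (pcompose g [:t, 1:]) x = poly g x" for x by simp
    then have step: "poly g (t + x) = poly g x" for x by (simp add: poly_pcompose)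
    have "poly g (of_nat n * t) = poly g 0" for n
      by (induction n) (simp_all add: distrib_right step)
    then have "range (\<lambda>n. of_nat n * t) \<subseteq> {x. poly (g - [:poly g 0:]) x = 0}" by auto
    moreover have "infinite (range (\<lambda>n::nat. of_nat n * t))"
      using assms(2) by (intro range_inj_infinite) (auto simp: inj_def)
    ultimately have "g - [:poly g 0:] = 0"
      using poly_roots_finite finite_subset by blast
    then have "degree g = 0" by (metis degree_pCons_0 eq_iff_diff_eq_0)
    then show False using assms by simp
  qed
  have "degree (pcompose g [:t, 1:] - g) \<le> degree g"
    by (intro degree_diff_le) (simp_all add: degree_pcompose)
  moreover have "coeff (pcompose g [:t, 1:] - g) (degree g) = 0"
    using coeff_pcompose_shift(2)[of g "degree g" t] by simp
  ultimately show "degree (pcompose g [:t, 1:] - g) < degree g"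
    using assms(1) by (metis degree_0 leading_coeff_0_iff order_le_less)
qed

context affine_currents
begin

text \<open>
  Twice the Casimir element of the zero modes with respect to the invariant form; it is
  the summand of \<open>4 * (\<kappa> + 2) * L(0)\<close> that involves only zero modes.
\<close>

definition casimir :: 'a where
  "casimir = f 0 * e 0 + f 0 * e 0 + (e 0 * f 0 + e 0 * f 0) + h 0 * h 0"

lemma casimir_commute:
  "casimir * e 0 = e 0 * casimir" "casimir * f 0 = f 0 * casimir" "casimir * h 0 = h 0 * casimir"
proof -
  have cas: "casimir = sugawara_term 0 0" by (simp add: casimir_def sugawara_term_def)
  show 1: "casimir * e 0 = e 0 * casimir"
    using sugawara_term_commutator[of 0 0 0] by (simp add: cas)
  interpret sym: affine_currents sc f "\<lambda>n. - h n" e c by (rule symmetric_currents)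
  have cas': "casimir = sym.sugawara_term 0 0"
    by (simp add: casimir_def sym.sugawara_term_def add.commute[of "e 0 * f 0 + e 0 * f 0"])
  show 2: "casimir * f 0 = f 0 * casimir"
    using sym.sugawara_term_commutator[of 0 0 0] by (simp add: cas')
  have h: "h 0 = e 0 * f 0 - f 0 * e 0" using e_f[of 0 0] by simp
  have "casimir * (e 0 * f 0) = (e 0 * f 0) * casimir" "casimir * (f 0 * e 0) = (f 0 * e 0) * casimir"
    by (metis 1 2 mult.assoc)+
  then show "casimir * h 0 = h 0 * casimir" unfolding h by (simp add: right_diff_distrib left_diff_distrib)
qed

text \<open>
  Polynomials in the Casimir element whose coefficients are polynomials in \<open>h(0)\<close>.
\<close>

definition eval_pair :: "complex poly poly \<Rightarrow> 'a" where
  "eval_pair P = fold_coeffs (\<lambda>a b. eval_poly (h 0) a + casimir * b) P 0"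

lemma eval_pair_0 [simp]: "eval_pair 0 = 0"
  by (simp add: eval_pair_def)

lemma eval_pair_pCons [simp]: "eval_pair (pCons a P) = eval_poly (h 0) a + casimir * eval_pair P"
  by (cases "P = 0 \<and> a = 0") (auto simp: eval_pair_def)

lemma eval_pair_add: "eval_pair (P + Q) = eval_pair P + eval_pair Q"
  by (induction P Q rule: poly_induct2) (simp_all add: eval_poly_add distrib_left)

lemma casimir_eval_poly: "casimir * eval_poly (h 0) g = eval_poly (h 0) g * casimir"
  by (rule eval_poly_commute) (rule casimir_commute)

lemma eval_pair_smult: "eval_pair (smult g P) = eval_poly (h 0) g * eval_pair P"
proof (induction P)
  case (pCons a P)
  have "casimir * (eval_poly (h 0) g * eval_pair P) = eval_poly (h 0) g * (casimir * eval_pair P)"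
    by (simp add: casimir_eval_poly flip: mult.assoc)
  then show ?case using pCons.IH by (simp add: eval_poly_mult distrib_left)
qed simp

lemma eval_pair_diff: "eval_pair (P - Q) = eval_pair P - eval_pair Q"
  using eval_pair_add[of "P - Q" Q] by (simp add: algebra_simps)

lemma eval_pair_casimir: "eval_pair P * casimir = casimir * eval_pair P"
proof (induction P)
  case (pCons a P)
  have "eval_pair (pCons a P) * casimir = eval_poly (h 0) a * casimir + casimir * (eval_pair P * casimir)"
    by (simp add: distrib_right mult.assoc)
  then show ?case unfolding pCons.IH by (simp add: distrib_left casimir_eval_poly)
qed simp

lemma eval_pair_h: "eval_pair P * eval_poly (h 0) g = eval_poly (h 0) g * eval_pair P"
proof (induction P)
  case (pCons a P)
  have "eval_pair (pCons a P) * eval_poly (h 0) g = eval_poly (h 0) (a * g) + casimir * (eval_pair P * eval_poly (h 0) g)"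
    by (simp add: distrib_right mult.assoc eval_poly_mult)
  also have "\<dots> = eval_poly (h 0) (g * a) + (casimir * eval_poly (h 0) g) * eval_pair P"
    unfolding pCons.IH by (simp add: mult.commute[of a g] mult.assoc)
  also have "\<dots> = eval_poly (h 0) g * eval_pair (pCons a P)"
    by (simp add: casimir_eval_poly distrib_left eval_poly_mult mult.assoc)
  finally show ?case .
qed simp

lemma eval_pair_shift:
  assumes "y * h 0 = (h 0 + sc t) * y" "y * casimir = casimir * y"
  shows "y * eval_pair P = eval_pair (map_poly (\<lambda>g. pcompose g [:t, 1:]) P) * y"
proof (induction P)
  case (pCons a P)
  have "y * eval_pair (pCons a P) = y * eval_poly (h 0) a + (y * casimir) * eval_pair P"
    by (simp add: distrib_left mult.assoc)
  also have "\<dots> = eval_poly (h 0) (pcompose a [:t, 1:]) * y + casimir * (y * eval_pair P)"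
    by (simp add: assms(2) eval_poly_shift[OF assms(1)] mult.assoc)
  also have "\<dots> = eval_pair (map_poly (\<lambda>g. pcompose g [:t, 1:]) (pCons a P)) * y"
    unfolding pCons.IH by (simp add: map_poly_pCons distrib_right mult.assoc)
  finally show ?case .
qed simp

lemma e_shift: "e 0 * h 0 = (h 0 + sc (- 2)) * e 0" and f_shift: "f 0 * h 0 = (h 0 + sc 2) * f 0"
  using h_e[of 0 0] h_f[of 0 0] by (simp_all add: algebra_simps sc_minus)

lemma casimir_expand: "casimir = 4 * (f 0 * e 0) + 2 * h 0 + h 0 * h 0"
proof -
  have "(4::'a) = 2 + 2" by simp
  then have four: "4 * x = x + x + (x + x)" for x :: 'a by (simp only: distrib_right mult_2)
  have "e 0 * f 0 = f 0 * e 0 + h 0" using e_f[of 0 0] by (simp add: algebra_simps)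
  then show ?thesis unfolding casimir_def by (simp add: four mult_2 add_ac)
qed

lemma eval_pair_const:
  "(\<forall>i. degree (coeff P i) = 0) \<Longrightarrow> \<exists>q. eval_pair P = eval_poly casimir q \<and> degree q = degree P \<and> (P = 0 \<longleftrightarrow> q = 0)"
proof (induction P)
  case (pCons a P)
  have "\<forall>i. degree (coeff P i) = 0" using pCons.prems by (metis coeff_pCons_Suc)
  then obtain q where q: "eval_pair P = eval_poly casimir q" "degree q = degree P" "P = 0 \<longleftrightarrow> q = 0"
    using pCons.IH by blast
  obtain t where t: "a = [:t:]" using pCons.prems by (metis coeff_pCons_0 degree_eq_zeroE)
  show ?case using q t by (intro exI[of _ "pCons t q"]) (auto simp: degree_pCons_eq_if)
qed (auto intro!: exI[of _ 0])

text \<open>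
  The element \<open>e(0)\<close> commutes with the Casimir element and shifts \<open>h(0)\<close> by \<open>- 2\<close>. Left
  multiplication by \<open>e(0) - lam\<close> therefore replaces each coefficient by a multiple of
  its difference, whose degree in \<open>h(0)\<close> is smaller, and this is repeated until only the
  Casimir element remains.
\<close>

lemma whittaker_descent:
  assumes I: "left_ideal I" "e 0 - sc lam \<in> I" and lam: "lam \<noteq> 0" and P: "eval_pair P \<in> I" "P \<noteq> 0"
  shows "\<exists>q. q \<noteq> 0 \<and> degree q \<le> degree P \<and> eval_poly casimir q \<in> I"
proof -
  obtain N where "\<forall>i. degree (coeff P i) \<le> N"
  proof -
    have "degree (coeff P i) \<le> (\<Sum>k\<le>degree P. degree (coeff P k))" for i
      by (cases "i \<le> degree P") (auto intro!: member_le_sum simp: coeff_eq_0)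
    then show ?thesis using that by blast
  qed
  then show ?thesis using P
  proof (induction N arbitrary: P)
    case 0
    then obtain q where "eval_pair P = eval_poly casimir q" "degree q = degree P" "P = 0 \<longleftrightarrow> q = 0"
      using eval_pair_const[of P] by auto
    then show ?case using 0 by (intro exI[of _ q]) auto
  next
    case (Suc N)
    show ?case
    proof (cases "\<forall>i. degree (coeff P i) \<le> N")
      case True
      then show ?thesis using Suc by blast
    next
      case False
      then obtain i where "degree (coeff P i) > N" by (auto simp: not_le)
      then have i: "degree (coeff P i) > 0" by simp
      define D where "D = map_poly (\<lambda>g. pcompose g [:- 2, 1:] - g) P"
      define S where "S = map_poly (\<lambda>g. pcompose g [:- 2, 1:]) P"
      have coeff_D: "coeff D k = pcompose (coeff P k) [:- 2, 1:] - coeff P k" for k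
        by (simp add: D_def coeff_map_poly)
      have D: "D = S - P" by (rule poly_eqI) (simp add: S_def coeff_D coeff_map_poly)
      have "D \<noteq> 0" using poly_difference_degree(1)[OF i, of "- 2"] coeff_D[of i] by auto
      moreover have "degree D \<le> degree P" by (intro degree_le) (simp add: coeff_D coeff_eq_0)
      moreover have "\<forall>k. degree (coeff D k) \<le> N"
      proof
        fix k
        show "degree (coeff D k) \<le> N"
        proof (cases "degree (coeff P k) = 0")
          case True
          then obtain t where "coeff P k = [:t:]" by (metis degree_eq_zeroE)
          then show ?thesis by (simp add: coeff_D)
        next
          case False
          have "degree (coeff D k) < degree (coeff P k)"
            unfolding coeff_D by (rule poly_difference_degree(2)) (use False in auto)
          moreover have "degree (coeff P k) \<le> Suc N" using Suc.prems(1) by blast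
          ultimately show ?thesis by linarith
        qed
      qed
      moreover have "eval_pair D \<in> I"
      proof -
        have "e 0 * eval_pair P = eval_pair S * e 0"
          unfolding S_def by (rule eval_pair_shift[OF e_shift casimir_commute(1)[symmetric]])
        then have "sc lam * eval_pair D = e 0 * eval_pair P - eval_pair S * (e 0 - sc lam) - sc lam * eval_pair P"
          by (simp add: D eval_pair_diff right_diff_distrib sc_comm[of lam "eval_pair S"])
        also have "\<dots> \<in> I" using left_idealD(3)[OF I(1) I(2)] left_idealD(3)[OF I(1) Suc.prems(2)]
          by (intro left_idealD(5)[OF I(1)]) auto
        finally show ?thesis using sc_mem_cancel[OF I(1) lam] by blast
      qed
      ultimately show ?thesis using Suc.IH[of D] le_trans by blast
    qed
  qed
qed

end

context universal_whittaker
begin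

text \<open>
  Only the summands with \<open>\<bar>k\<bar> \<le> 1\<close> act on \<open>1\<close>, and those with
  \<open>\<bar>k\<bar> = 1\<close> reduce to \<open>e(- 1) f(1)\<close>.
\<close>

lemma sugawara_zero:
  "sugawara_op 0 1 \<approx> sc (inverse (4 * (\<kappa> + 2))) * (casimir + sc (4 * mu) * e (- 1))"
proof -
  have J: "u * f k \<in> J" if "k \<ge> 2" for u k using that relations_in_J(6) by (intro J_closed)
  have J': "u * e k \<in> J" "u * h k \<in> J" if "k \<ge> 1" for u k using that relations_in_J(4,5) by (auto intro!: J_closed)
  have K: "\<forall>k. \<bar>k\<bar> > 1 \<longrightarrow> sugawara_term 0 k * 1 \<in> J"
    by (auto simp: sugawara_term_def intro!: J_closed(2) J J')
  have "{-1..<1+1} = {-1, 0, 1::int}" by auto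
  then have S: "sugawara_sum 0 1 * 1 = sugawara_term 0 (- 1) + (casimir + sugawara_term 0 1)"
    by (simp add: sugawara_sum_def casimir_def sugawara_term_def[of 0 0])
  have f1: "e (- 1) * f 1 \<approx> sc mu * e (- 1)"
    using cong_mult[of "f 1" "sc mu" "e (- 1)"] relations_in_J(2) by (simp add: left_cong_def sc_comm)
  have "sugawara_term 0 (- 1) = e (- 1) * f 1 + e (- 1) * f 1 + (f (- 1) * e 1 + f (- 1) * e 1) + h (- 1) * h 1"
    by (simp add: sugawara_term_def)
  also have "\<dots> \<approx> sc mu * e (- 1) + sc mu * e (- 1) + (0 + 0) + 0"
    by (intro cong_add f1) (simp_all add: cong_zero_iff J')
  finally have t1: "sugawara_term 0 (- 1) \<approx> sc mu * e (- 1) + sc mu * e (- 1) + (0 + 0) + 0" .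
  have "sugawara_term 0 1 = f (- 1) * e 1 + f (- 1) * e 1 + (e (- 1) * f 1 + e (- 1) * f 1) + h (- 1) * h 1"
    by (simp add: sugawara_term_def)
  also have "\<dots> \<approx> 0 + 0 + (sc mu * e (- 1) + sc mu * e (- 1)) + 0"
    by (intro cong_add f1) (simp_all add: cong_zero_iff J')
  finally have t2: "sugawara_term 0 1 \<approx> 0 + 0 + (sc mu * e (- 1) + sc mu * e (- 1)) + 0" .
  have "sugawara_sum 0 1 * 1 \<approx> (sc mu * e (- 1) + sc mu * e (- 1) + (0 + 0) + 0) +
      (casimir + (0 + 0 + (sc mu * e (- 1) + sc mu * e (- 1)) + 0))"
    unfolding S by (intro cong_add cong_refl t1 t2)
  also have "\<dots> = casimir + sc (4 * mu) * e (- 1)"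
  proof -
    have "4 * mu = mu + mu + (mu + mu)" by simp
    then show ?thesis by (simp only: sc_add distrib_right add_0_left add_0_right add_ac)
  qed
  finally show ?thesis
    using cong_trans[OF sugawara_op_eq[OF K] cong_mult] by blast
qed

text \<open>
  Since \<open>e(0)\<close> acts on \<open>1\<close> by a nonzero scalar, the Casimir element can be solved for
  \<open>f(0)\<close>.
\<close>

lemma f_casimir:
  assumes "lam \<noteq> 0"
  shows "f 0 \<approx> sc (inverse (4 * lam)) * (casimir - eval_poly (h 0) [:0, 2, 1:])"
proof -
  have "casimir - eval_poly (h 0) [:0, 2, 1:] = 4 * (f 0 * e 0)"
    by (simp add: casimir_expand distrib_left mult_2 mult_2_right)
  also have "\<dots> \<approx> 4 * (f 0 * sc lam)"
    by (intro cong_mult) (use relations_in_J(1) in \<open>simp add: left_cong_def\<close>)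
  also have "\<dots> = sc (4 * lam) * f 0" by (simp add: sc_mult sc_comm[of lam "f 0"] mult.assoc)
  finally have "sc (inverse (4 * lam)) * (casimir - eval_poly (h 0) [:0, 2, 1:]) \<approx> sc (inverse (4 * lam)) * (sc (4 * lam) * f 0)"
    by (rule cong_mult)
  then show ?thesis using assms by (subst (asm) sc_inverse) (auto intro: cong_sym)
qed

text \<open>
  The effect of left multiplication by \<open>f(0)\<close> on \<open>eval_pair\<close>, by \<open>f_casimir\<close>.
\<close>

definition lower_f :: "complex poly poly \<Rightarrow> complex poly poly" where
  "lower_f P = (let S = map_poly (\<lambda>g. pcompose g [:2, 1:]) P in
     smult [:inverse (4 * lam):] (pCons 0 S - smult [:0, 2, 1:] S))"

lemma f_eval_pair:
  assumes "lam \<noteq> 0"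
  shows "f 0 * eval_pair P \<approx> eval_pair (lower_f P)"
proof -
  define S where "S = map_poly (\<lambda>g. pcompose g [:2, 1:]) P"
  have "f 0 * eval_pair P = eval_pair S * f 0"
    unfolding S_def by (rule eval_pair_shift[OF f_shift casimir_commute(2)[symmetric]])
  also have "\<dots> \<approx> eval_pair S * (sc (inverse (4 * lam)) * (casimir - eval_poly (h 0) [:0, 2, 1:]))"
    by (intro cong_mult f_casimir assms)
  also have "\<dots> = sc (inverse (4 * lam)) * (eval_pair S * casimir - eval_pair S * eval_poly (h 0) [:0, 2, 1:])"
    by (simp only: sc_left_commute[of "eval_pair S"] right_diff_distrib)
  also have "\<dots> = eval_pair (lower_f P)"
    unfolding eval_pair_casimir eval_pair_h lower_f_def Let_def S_def[symmetric] eval_pair_smult eval_pair_diff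
    by simp
  finally show ?thesis .
qed

lemma coeff_lower_f:
  "coeff (lower_f P) i = smult (inverse (4 * lam))
     ((case i of 0 \<Rightarrow> 0 | Suc k \<Rightarrow> pcompose (coeff P k) [:2, 1:]) - [:0, 2, 1:] * pcompose (coeff P i) [:2, 1:])"
  by (cases i) (simp_all add: lower_f_def Let_def coeff_map_poly)

definition pair_bound :: "nat \<Rightarrow> int \<Rightarrow> complex poly poly \<Rightarrow> bool" where
  "pair_bound a w P \<longleftrightarrow> (\<forall>i j. coeff (coeff P i) j \<noteq> 0 \<longrightarrow> i \<le> a \<and> int (2 * i + j) \<le> w)"

text \<open>
  Give the Casimir element degree two and \<open>h(0)\<close> degree one, as in the filtration by
  \<open>base_weight\<close>. A word with \<open>a\<close> letters \<open>f(0)\<close> and \<open>b\<close> letters \<open>h(0)\<close> becomes a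
  polynomial of total degree \<open>2 a + b\<close> and degree \<open>a\<close> in the Casimir element. Hence
  words of the same weight have different leading terms.
\<close>

lemma word_model:
  assumes "lam \<noteq> 0" "set ys \<subseteq> {gH 0, gF 0}"
  defines "a \<equiv> \<lambda>ys. count (mset ys) (gF 0)" and "b \<equiv> \<lambda>ys. count (mset ys) (gH 0)"
  shows "\<exists>P. prod_list (map val ys) \<approx> eval_pair P \<and> pair_bound (a ys) (int (2 * a ys + b ys)) P
     \<and> coeff (coeff P (a ys)) (b ys) \<noteq> 0"
  using assms(2)
proof (induction ys)
  case Nil
  show ?case
    by (intro exI[of _ "[:[:1:]:]"]) (auto simp: a_def b_def pair_bound_def coeff_pCons split: nat.splits)
next
  case (Cons y ys)
  then obtain P where P: "prod_list (map val ys) \<approx> eval_pair P" "pair_bound (a ys) (int (2 * a ys + b ys)) P"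
    "coeff (coeff P (a ys)) (b ys) \<noteq> 0" by auto
  have bound: "i \<le> a ys \<and> 2 * i + j \<le> 2 * a ys + b ys" if "coeff (coeff P i) j \<noteq> 0" for i j
    using P(2) that unfolding pair_bound_def by (metis of_nat_le_iff)
  have bound': "i \<le> a ys \<and> 2 * i + j \<le> 2 * a ys + b ys" if "coeff (pcompose (coeff P i) [:2, 1:]) j \<noteq> 0" for i j
    using coeff_pcompose_shift(1)[OF that] bound[of i "degree (coeff P i)"] by linarith
  from Cons.prems consider "y = gH 0" | "y = gF 0" by auto
  then show ?case
  proof cases
    case 1
    have "prod_list (map val (y # ys)) \<approx> eval_poly (h 0) [:0, 1:] * eval_pair P"
      using cong_mult[OF P(1), of "h 0"] 1 by simp
    then have "prod_list (map val (y # ys)) \<approx> eval_pair (smult [:0, 1:] P)" by (simp only: eval_pair_smult)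
    moreover have "pair_bound (a (y # ys)) (int (2 * a (y # ys) + b (y # ys))) (smult [:0, 1:] P)"
      unfolding pair_bound_def using bound 1 by (auto simp: a_def b_def coeff_pCons split: nat.splits) fastforce+
    moreover have "coeff (coeff (smult [:0, 1:] P) (a (y # ys))) (b (y # ys)) \<noteq> 0"
      using P(3) 1 by (simp add: a_def b_def)
    ultimately show ?thesis by blast
  next
    case 2
    have ab: "a (y # ys) = Suc (a ys)" "b (y # ys) = b ys" using 2 by (simp_all add: a_def b_def)
    have "prod_list (map val (y # ys)) \<approx> eval_pair (lower_f P)"
      using cong_trans[OF cong_mult[OF P(1), of "f 0"] f_eval_pair[OF assms(1)]] 2 by simp
    moreover have "pair_bound (a (y # ys)) (int (2 * a (y # ys) + b (y # ys))) (lower_f P)"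
      unfolding pair_bound_def ab
    proof (intro allI impI)
      fix i j assume nz: "coeff (coeff (lower_f P) i) j \<noteq> 0"
      have c: "coeff (pCons 0 (smult 2 g + pCons 0 g)) j = (if j = 0 then 0 else 2 * coeff g (j - 1) + (if j = 1 then 0 else coeff g (j - 2)))"
        for g :: "complex poly"
        by (cases j; cases "j - 1") (auto simp: coeff_pCons split: nat.splits)
      from nz consider k where "i = Suc k" "coeff (pcompose (coeff P k) [:2, 1:]) j \<noteq> 0"
        | "j \<ge> 1" "coeff (pcompose (coeff P i) [:2, 1:]) (j - 1) \<noteq> 0"
        | "j \<ge> 2" "coeff (pcompose (coeff P i) [:2, 1:]) (j - 2) \<noteq> 0"
        unfolding coeff_lower_f by (auto simp: c split: nat.splits if_splits) force+
      then show "i \<le> Suc (a ys) \<and> int (2 * i + j) \<le> int (2 * Suc (a ys) + b ys)"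
      proof cases
        case (1 k)
        then show ?thesis using bound'[of k j] by auto
      next
        case 2
        then show ?thesis using bound'[of i "j - 1"] by auto
      next
        case 3
        then show ?thesis using bound'[of i "j - 2"] by auto
      qed
    qed
    moreover have "coeff (coeff (lower_f P) (a (y # ys))) (b (y # ys)) \<noteq> 0"
    proof -
      have "coeff P (Suc (a ys)) = 0" using bound[of "Suc (a ys)"] by (intro poly_eqI) auto
      moreover have "degree (coeff P (a ys)) \<le> b ys" using bound[of "a ys"] by (intro degree_le) fastforce
      ultimately show ?thesis
        unfolding ab coeff_lower_f using coeff_pcompose_shift(2)[of "coeff P (a ys)" "b ys" 2] P(3) assms(1) by simp
    qed
    ultimately show ?thesis by blast
  qed
qed

end

section \<open>The degenerate case\<close>

text \<open>
  For \<open>x = h(0)\<close>, \<open>y = f(0)\<close> and \<open>t = 4 lam\<close> the factor is the symbol of the Casimir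
  element. It is no zero divisor: compare the terms of the product whose degree in \<open>x\<close>
  is largest.
\<close>

lemma quadric_mult_eq_0:
  assumes "x \<noteq> y" "(monomial {#x, x#} 1 + monomial {#y#} t) * q = 0"
  shows "q = 0"
proof (rule ccontr)
  assume "q \<noteq> 0"
  let ?c = "\<lambda>M. count M x"
  have "Max (?c ` Poly_Mapping.keys q) \<in> ?c ` Poly_Mapping.keys q"
    using \<open>q \<noteq> 0\<close> by (intro Max_in) auto
  then obtain M where M: "M \<in> Poly_Mapping.keys q" "count M x = Max (?c ` Poly_Mapping.keys q)" by force
  have other: "Poly_Mapping.lookup q (M + {#x, x#} - {#y#}) = 0"
  proof (rule ccontr)
    assume "Poly_Mapping.lookup q (M + {#x, x#} - {#y#}) \<noteq> 0"
    then have "M + {#x, x#} - {#y#} \<in> Poly_Mapping.keys q" by (simp only: in_keys_iff not_False_eq_True)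
    then have "count (M + {#x, x#} - {#y#}) x \<le> Max (?c ` Poly_Mapping.keys q)"
      by (intro Max_ge finite_imageI imageI) simp_all
    then show False using assms(1) M(2) by simp
  qed
  have "Poly_Mapping.lookup ((monomial {#x, x#} 1 + monomial {#y#} t) * q) (M + {#x, x#}) = Poly_Mapping.lookup q M"
    unfolding distrib_right lookup_add lookup_monomial_mult other by simp
  then show False using assms(2) M(1) by (simp add: in_keys_iff)
qed

context universal_whittaker
begin

lemma filtration_by_mode: "mu = 0 \<Longrightarrow>
  whittaker_filtration sc e h f c J \<kappa> (whittaker_character lam mu) (\<lambda>x. (- mode x, base_weight x))"
  by (rule filtration_by_base) simp

lemma lower_word_mode:
  "(\<forall>y\<in>set ys. \<not> raising y) \<Longrightarrow> (\<Sum>y\<leftarrow>ys. - mode y) \<ge> 0 \<and> ((\<Sum>y\<leftarrow>ys. - mode y) = 0 \<longrightarrow> set ys \<subseteq> {gH 0, gF 0})"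
proof (induction ys)
  case (Cons y ys)
  have "- mode y \<ge> 0 \<and> (mode y = 0 \<longrightarrow> y \<in> {gH 0, gF 0})" using Cons.prems by (cases y) auto
  then show ?case using Cons by auto
qed simp

text \<open>
  Let \<open>- n\<close> be the least mode of a variable in the symbol. The operators \<open>e(n)\<close>, \<open>h(n)\<close>
  and \<open>L(n)\<close> yield three combinations of the partial derivatives with respect to the
  variables of mode \<open>- n\<close>, with coefficients among the scalars, \<open>h(0)\<close> and \<open>f(0)\<close>. The
  determinant of this system is a multiple of \<open>h(0)\<^sup>2 + 4 lam f(0)\<close>, so one
  combination is nonzero. This removes all variables but \<open>h(0)\<close> and \<open>f(0)\<close>. An element
  with such a symbol is a nonzero polynomial in \<open>h(0)\<close> and the Casimir element by
  \<open>word_model\<close>, and \<open>whittaker_descent\<close> removes \<open>h(0)\<close>.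
\<close>

theorem degenerate_ideal_reduction:
  assumes lm: "lam \<noteq> 0" "mu = 0" and I: "left_ideal I" "J \<subseteq> I" and u: "u \<in> I" "u \<notin> J"
  shows "\<exists>q. q \<noteq> 0 \<and> eval_poly casimir q \<in> I"
proof -
  define wt where "wt x = (- mode x, base_weight x)" for x
  interpret whittaker_filtration sc e h f c J \<kappa> "whittaker_character lam mu" wt
    unfolding wt_def by (rule filtration_by_mode[OF lm(2)])
  let ?XH = "monomial {#gH 0#} 1" and ?XF = "monomial {#gF 0#} 1"
  have symbol: "symbol (gE n) = (if n \<ge> 1 then 0 else if n = 0 then const lam else monomial {#gE n#} 1)"
    "symbol (gH n) = (if n \<ge> 1 then 0 else monomial {#gH n#} 1)"
    "symbol (gF n) = (if n \<ge> 1 then 0 else monomial {#gF n#} 1)" for n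
    unfolding symbol_def by (auto simp: lm(2))
  have step: "\<exists>A t a g z s. word_operator A t a g z s \<and> s < 0 \<and> derivation (symbol_derivation a g) p \<noteq> 0"
    if p: "homogeneous \<omega> p" and vars: "\<not> poly_vars p \<subseteq> {gH 0, gF 0}" for \<omega> p
  proof -
    let ?V = "poly_vars p"
    have low: "\<not> raising y" if "y \<in> ?V" for y using p that by (auto simp: homogeneous_def poly_vars_def)
    obtain y where y: "y \<in> ?V" and max: "\<And>y'. y' \<in> ?V \<Longrightarrow> mode y' \<ge> mode y"
    proof -
      have "Min (mode ` ?V) \<in> mode ` ?V" using vars by (intro Min_in) auto
      then obtain y where "y \<in> ?V" "mode y = Min (mode ` ?V)" by force
      then show ?thesis using that[of y] by simp
    qed
    define n where "n = - mode y"
    have n: "n \<ge> 1"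
    proof -
      from vars obtain y' where y': "y' \<in> ?V" "y' \<notin> {gH 0, gF 0}" by blast
      then have "mode y' < 0" using low[OF y'(1)] by (cases y') auto
      then show ?thesis using max[OF y'(1)] by (simp add: n_def)
    qed
    let ?W = "insert (gE (- n)) (insert (gH (- n)) (insert (gF (- n)) ?V))"
    let ?PE = "partial (gE (- n)) p" and ?PH = "partial (gH (- n)) p" and ?PF = "partial (gF (- n)) p"
    have W: "mode y' \<ge> - n" if "y' \<in> ?W" for y' using that max by (auto simp: n_def)
    have collapse: "derivation T p = T (gE (- n)) * ?PE + T (gH (- n)) * ?PH + T (gF (- n)) * ?PF"
      if T: "\<And>y'. mode y' > - n \<Longrightarrow> T y' = 0" for T
    proof -
      have "derivation T p = (\<Sum>y'\<in>?W. T y' * partial y' p)" by (rule derivation_partial) auto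
      also have "\<dots> = (\<Sum>y'\<in>{gE (- n), gH (- n), gF (- n)}. T y' * partial y' p)"
      proof (rule sum.mono_neutral_right)
        show "\<forall>y'\<in>?W - {gE (- n), gH (- n), gF (- n)}. T y' * partial y' p = 0"
        proof
          fix y' assume y': "y' \<in> ?W - {gE (- n), gH (- n), gF (- n)}"
          then have "mode y' > - n" using W[of y'] by (cases y') force+
          then show "T y' * partial y' p = 0" by (simp add: T)
        qed
      qed auto
      finally show ?thesis by (simp add: add.assoc)
    qed
    let ?D = "\<lambda>x. derivation (symbol_derivation (\<lambda>y. of_int (bracket_coeff x y)) (bracket_gen x)) p"
    let ?DL = "derivation (symbol_derivation (\<lambda>y. - of_int (mode y)) (shift n)) p"
    have De: "?D (gE n) = ?XH * ?PF - const (2 * lam) * ?PH"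
    proof -
      have "?D (gE n) = symbol_derivation (\<lambda>y. of_int (bracket_coeff (gE n) y)) (bracket_gen (gE n)) (gE (- n)) * ?PE +
         symbol_derivation (\<lambda>y. of_int (bracket_coeff (gE n) y)) (bracket_gen (gE n)) (gH (- n)) * ?PH +
         symbol_derivation (\<lambda>y. of_int (bracket_coeff (gE n) y)) (bracket_gen (gE n)) (gF (- n)) * ?PF"
      proof (rule collapse)
        fix y' assume "- n < mode y'"
        then show "symbol_derivation (\<lambda>y. of_int (bracket_coeff (gE n) y)) (bracket_gen (gE n)) y' = 0"
          by (cases y') (auto simp: symbol_derivation_def symbol)
      qed
      then show ?thesis by (simp add: symbol_derivation_def symbol const_hom)
    qed
    have Dh: "?D (gH n) = const (2 * lam) * ?PE - 2 * (?XF * ?PF)"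
    proof -
      have "?D (gH n) = symbol_derivation (\<lambda>y. of_int (bracket_coeff (gH n) y)) (bracket_gen (gH n)) (gE (- n)) * ?PE +
         symbol_derivation (\<lambda>y. of_int (bracket_coeff (gH n) y)) (bracket_gen (gH n)) (gH (- n)) * ?PH +
         symbol_derivation (\<lambda>y. of_int (bracket_coeff (gH n) y)) (bracket_gen (gH n)) (gF (- n)) * ?PF"
      proof (rule collapse)
        fix y' assume "- n < mode y'"
        then show "symbol_derivation (\<lambda>y. of_int (bracket_coeff (gH n) y)) (bracket_gen (gH n)) y' = 0"
          by (cases y') (auto simp: symbol_derivation_def symbol)
      qed
      then show ?thesis by (simp add: symbol_derivation_def symbol const_hom mult.assoc)
    qed
    have DL: "?DL = const (of_int n) * (const lam * ?PE + ?XH * ?PH + ?XF * ?PF)"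
    proof -
      have "?DL = symbol_derivation (\<lambda>y. - of_int (mode y)) (shift n) (gE (- n)) * ?PE +
         symbol_derivation (\<lambda>y. - of_int (mode y)) (shift n) (gH (- n)) * ?PH +
         symbol_derivation (\<lambda>y. - of_int (mode y)) (shift n) (gF (- n)) * ?PF"
      proof (rule collapse)
        fix y' assume "- n < mode y'"
        then show "symbol_derivation (\<lambda>y. - of_int (mode y)) (shift n) y' = 0"
          by (cases y') (auto simp: symbol_derivation_def symbol)
      qed
      then show ?thesis by (simp add: symbol_derivation_def symbol distrib_left mult.assoc)
    qed
    have "?D (gE n) \<noteq> 0 \<or> ?D (gH n) \<noteq> 0 \<or> ?DL \<noteq> 0"
    proof (rule ccontr)
      assume "\<not> ?thesis"
      then have z1: "?XH * ?PF - const (2 * lam) * ?PH = 0" and z2: "const (2 * lam) * ?PE - 2 * (?XF * ?PF) = 0"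
        and "const (of_int n) * (const lam * ?PE + ?XH * ?PH + ?XF * ?PF) = 0"
        using De Dh DL by auto
      then have z3: "const lam * ?PE + ?XH * ?PH + ?XF * ?PF = 0"
        using monomial_const_mult_eq_0[of "of_int n"] n by auto
      have XX: "monomial {#gH 0, gH 0#} 1 = ?XH * ?XH" "monomial {#gF 0#} (4 * lam) = const (4 * lam) * ?XF"
        by (simp_all add: mult_single)
      \<comment> \<open>Eliminate two of the three partial derivatives; the symbol of the Casimir
        element remains.\<close>
      have "(monomial {#gH 0, gH 0#} 1 + monomial {#gF 0#} (4 * lam)) * ?PF =
        ?XH * (?XH * ?PF - const (2 * lam) * ?PH) + const (2 * lam) * (const lam * ?PE + ?XH * ?PH + ?XF * ?PF)
        - const lam * (const (2 * lam) * ?PE - 2 * (?XF * ?PF))"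
        unfolding XX by (simp add: const_hom algebra_simps)
      then have "(monomial {#gH 0, gH 0#} 1 + monomial {#gF 0#} (4 * lam)) * ?PF = 0" unfolding z1 z2 z3 by simp
      then have PF: "?PF = 0" by (rule quadric_mult_eq_0[rotated]) simp
      have "const (2 * lam) * ?PH = 0" "const (2 * lam) * ?PE = 0" using z1 z2 unfolding PF by auto
      then have "?PH = 0" "?PE = 0" using monomial_const_mult_eq_0[of "2 * lam"] lm(1) by auto
      moreover have "y = gE (- n) \<or> y = gH (- n) \<or> y = gF (- n)" by (cases y) (auto simp: n_def)
      ultimately show False using PF partial_nonzero[OF y] by auto
    qed
    moreover have "raising (gE n)" "raising (gH n)" "wt (gE n) - (0, 1) < 0" "wt (gH n) - (0, 1) < 0"
      using n by (auto simp: wt_def zero_prod_def lex_less_simps)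
    moreover obtain t where t: "sugawara_op n 1 \<approx> sc t" using sugawara_positive[OF n] by blast
    moreover have "wt (shift n y) = wt y + (- n, 0)" for y by (cases y) (auto simp: wt_def)
    moreover have "(- n, 0) < (0::int \<times> int)" using n by (simp add: zero_prod_def lex_less_simps)
    ultimately show ?thesis using raising_operator sugawara_operator[OF t] by meson
  qed
  obtain \<omega>0 p0 where "leading \<omega>0 p0 u" using leading_exists[OF u(2)] by blast
  then obtain \<omega> p v where p: "poly_vars p \<subseteq> {gH 0, gF 0}" and v: "v \<in> I" and lead: "leading \<omega> p v"
    using reduction[OF I u(1), of \<omega>0 p0 "\<lambda>p. poly_vars p \<subseteq> {gH 0, gF 0}"] step by blast
  have weight2: "weight (mset ys) = (0, int (2 * count (mset ys) (gF 0) + count (mset ys) (gH 0)))"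
    if "set ys \<subseteq> {gH 0, gF 0}" for ys
    using that by (induction ys) (auto simp: wt_def zero_prod_def)
  have weight1: "fst (weight (mset ys)) = (\<Sum>y\<leftarrow>ys. - mode y)" for ys
  proof (induction ys)
    case (Cons y ys)
    moreover have "fst (wt y) = - mode y" by (simp add: wt_def)
    ultimately show ?case by simp
  qed simp
  have low: "\<exists>P. x \<approx> eval_pair P \<and> (\<forall>i j. coeff (coeff P i) j \<noteq> 0 \<longrightarrow> int (2 * i + j) < b)"
    if "x \<in> filt (\<lambda>w. w < (0, b))" for x b
    using that
  proof (induction rule: filt.induct)
    case (ideal x)
    then show ?case by (intro exI[of _ 0]) (simp add: left_cong_def)
  next
    case (word ys)
    have "fst (weight (mset ys)) \<le> 0" using word(2) by (cases "weight (mset ys)") (auto simp: lex_less_simps)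
    then have ys: "set ys \<subseteq> {gH 0, gF 0}"
      using lower_word_mode[of ys] word(1) unfolding weight1 lower_word_def by auto
    obtain P where P: "word_val ys \<approx> eval_pair P"
      "pair_bound (count (mset ys) (gF 0)) (int (2 * count (mset ys) (gF 0) + count (mset ys) (gH 0))) P"
      using word_model[OF lm(1) ys] unfolding word_val_def by blast
    then show ?case
      using word(2) unfolding weight2[OF ys] pair_bound_def lex_less_simps by (intro exI[of _ P]) force
  next
    case (add x y)
    then obtain P Q where *: "x \<approx> eval_pair P" "y \<approx> eval_pair Q"
      "\<forall>i j. coeff (coeff P i) j \<noteq> 0 \<longrightarrow> int (2 * i + j) < b" "\<forall>i j. coeff (coeff Q i) j \<noteq> 0 \<longrightarrow> int (2 * i + j) < b"
      by blast
    have "x + y \<approx> eval_pair (P + Q)" unfolding eval_pair_add by (intro cong_add *)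
    moreover have "\<forall>i j. coeff (coeff (P + Q) i) j \<noteq> 0 \<longrightarrow> int (2 * i + j) < b"
      using *(3,4) by (metis add.right_neutral coeff_add)
    ultimately show ?case by blast
  next
    case (scalar x t)
    then obtain P where *: "x \<approx> eval_pair P" "\<forall>i j. coeff (coeff P i) j \<noteq> 0 \<longrightarrow> int (2 * i + j) < b" by blast
    have "sc t * x \<approx> eval_pair (smult [:t:] P)" unfolding eval_pair_smult using cong_mult[OF *(1), of "sc t"] by simp
    then show ?case using *(2) by (intro exI[of _ "smult [:t:] P"]) auto
  qed
  let ?F = "\<lambda>M. count M (gF 0)" and ?H = "\<lambda>M. count M (gH 0)"
  have keyV: "set_mset M \<subseteq> {gH 0, gF 0}" if "M \<in> Poly_Mapping.keys p" for M using p that by (auto simp: poly_vars_def)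
  have wM: "\<omega> = (0, int (2 * ?F M + ?H M))" if "M \<in> Poly_Mapping.keys p" for M
  proof -
    obtain ys where ys: "mset ys = M" by (metis ex_mset)
    then show ?thesis using weight2[of ys] keyV[OF that] lead that
      by (auto simp: leading_def homogeneous_def simp flip: set_mset_mset)
  qed
  have "\<exists>P. monomial_val M \<approx> eval_pair P \<and> pair_bound (?F M) (int (2 * ?F M + ?H M)) P
     \<and> coeff (coeff P (?F M)) (?H M) \<noteq> 0" if "M \<in> Poly_Mapping.keys p" for M
  proof -
    define ys where "ys = (SOME ys. mset ys = M)"
    have ys: "mset ys = M" unfolding ys_def by (metis (mono_tags) ex_mset someI)
    then have "set ys \<subseteq> {gH 0, gF 0}" using keyV[OF that] by (simp flip: set_mset_mset)
    then show ?thesis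
      using word_model[OF lm(1), of ys] unfolding ys monomial_val_def word_val_def ys_def[symmetric] by blast
  qed
  then obtain R where R: "\<And>M. M \<in> Poly_Mapping.keys p \<Longrightarrow> monomial_val M \<approx> eval_pair (R M)"
    "\<And>M. M \<in> Poly_Mapping.keys p \<Longrightarrow> pair_bound (?F M) (int (2 * ?F M + ?H M)) (R M)"
    "\<And>M. M \<in> Poly_Mapping.keys p \<Longrightarrow> coeff (coeff (R M) (?F M)) (?H M) \<noteq> 0"
    by metis
  have "Max (?F ` Poly_Mapping.keys p) \<in> ?F ` Poly_Mapping.keys p"
    using lead by (intro Max_in) (auto simp: leading_def)
  then obtain M where M: "M \<in> Poly_Mapping.keys p" "?F M = Max (?F ` Poly_Mapping.keys p)" by force
  obtain Q where Q: "v - lift p \<approx> eval_pair Q" "\<forall>i j. coeff (coeff Q i) j \<noteq> 0 \<longrightarrow> int (2 * i + j) < int (2 * ?F M + ?H M)"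
    using low[of "v - lift p"] lead wM[OF M(1)] unfolding leading_def by metis
  define S where "S = (\<Sum>N\<in>Poly_Mapping.keys p. smult [:Poly_Mapping.lookup p N:] (R N))"
  have eval_sum: "eval_pair (\<Sum>N\<in>A. g N) = (\<Sum>N\<in>A. eval_pair (g N))" for A and g :: "gen multiset \<Rightarrow> complex poly poly"
    by (induction A rule: infinite_finite_induct) (simp_all add: eval_pair_add)
  have "lift p \<approx> eval_pair S"
    unfolding S_def lift_def eval_sum
  proof (rule cong_sum)
    fix N assume "N \<in> Poly_Mapping.keys p"
    then show "sc (Poly_Mapping.lookup p N) * monomial_val N \<approx> eval_pair (smult [:Poly_Mapping.lookup p N:] (R N))"
      unfolding eval_pair_smult using cong_mult[OF R(1)] by simp
  qed
  then have "(v - lift p) + lift p \<approx> eval_pair Q + eval_pair S" by (intro cong_add Q(1))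
  then have "eval_pair (Q + S) \<in> I" using cong_mem[OF _ I(2,1)] v by (auto simp: eval_pair_add)
  moreover have "Q + S \<noteq> 0"
  proof
    assume "Q + S = 0"
    have "coeff (coeff Q (?F M)) (?H M) = 0" using Q(2) by force
    moreover have "coeff (coeff S (?F M)) (?H M) = Poly_Mapping.lookup p M * coeff (coeff (R M) (?F M)) (?H M)"
    proof -
      have "Poly_Mapping.lookup p N * coeff (coeff (R N) (?F M)) (?H M) = 0" if N: "N \<in> Poly_Mapping.keys p" "N \<noteq> M" for N
      proof -
        have le: "?F N \<le> ?F M" unfolding M(2) using N by (intro Max_ge) auto
        have "?F N \<noteq> ?F M"
        proof
          assume eq: "?F N = ?F M"
          then have "?H N = ?H M" using wM[OF N(1)] wM[OF M(1)] by auto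
          then have "count N x = count M x" for x
            using eq keyV[OF N(1)] keyV[OF M(1)] by (cases "x \<in> {gH 0, gF 0}") (auto simp: count_eq_zero_iff, metis count_eq_zero_iff empty_iff insert_iff subsetD)
          then show False using N(2) multiset_eqI by blast
        qed
        then show ?thesis using R(2)[OF N(1)] le unfolding pair_bound_def by force
      qed
      then have "(\<Sum>N\<in>Poly_Mapping.keys p. Poly_Mapping.lookup p N * coeff (coeff (R N) (?F M)) (?H M)) =
          (\<Sum>N\<in>{M}. Poly_Mapping.lookup p N * coeff (coeff (R N) (?F M)) (?H M))"
        using M(1) by (intro sum.mono_neutral_right) auto
      then show ?thesis by (simp add: S_def coeff_sum)
    qed
    ultimately have "Poly_Mapping.lookup p M * coeff (coeff (R M) (?F M)) (?H M) = 0"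
      using \<open>Q + S = 0\<close> by (metis add_0 coeff_0 coeff_add)
    then show False using R(3)[OF M(1)] M(1) by (simp add: in_keys_iff)
  qed
  moreover have "e 0 - sc lam \<in> I" using relations_in_J(1) I(2) by blast
  ultimately show ?thesis using whittaker_descent[OF I(1) _ lm(1)] by blast
qed

end

section \<open>Eigenvalues of the degree operator and local quotients\<close>

context universal_whittaker
begin

lemma sugawara_op_congruent:
  assumes "left_ideal K" "J \<subseteq> K" "left_cong K u v"
  shows "left_cong K (sugawara_op n u) (sugawara_op n v)"
proof -
  interpret K: left_ideal_congruence K using assms(1) by unfold_locales
  have "sugawara_op n ((u - v) + v) \<approx> sugawara_op n (u - v) + sugawara_op n v" by (rule sugawara_op_add)
  then have "left_cong K (sugawara_op n u) (sugawara_op n (u - v) + sugawara_op n v)"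
    using assms(2) by (auto simp: left_cong_def)
  moreover have "sugawara_op n (u - v) \<in> K"
    using assms(3) by (intro sugawara_op_mem[OF assms(1,2)]) (simp add: left_cong_def)
  then have "left_cong K (sugawara_op n (u - v) + sugawara_op n v) (0 + sugawara_op n v)"
    by (intro K.cong_add K.cong_refl) (simp add: K.cong_zero_iff)
  ultimately have "left_cong K (sugawara_op n u) (0 + sugawara_op n v)" by (rule K.cong_trans)
  then show ?thesis by simp
qed

text \<open>
  The product of \<open>L(0) - (a + j)\<close> for \<open>j = 1, \<dots>, k\<close>. It kills the eigenvectors of
  \<open>L(0)\<close> with these eigenvalues and multiplies those with eigenvalue \<open>a\<close> by a nonzero
  scalar.
\<close>

primrec eigen_filter :: "complex \<Rightarrow> nat \<Rightarrow> 'a \<Rightarrow> 'a" where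
  "eigen_filter a 0 u = u"
| "eigen_filter a (Suc k) u = sugawara_op 0 (eigen_filter a k u) - sc (a + of_nat (Suc k)) * eigen_filter a k u"

lemma eigen_filter_mem:
  assumes "left_ideal I" "J \<subseteq> I" "u \<in> I"
  shows "eigen_filter a k u \<in> I"
  by (induction k) (auto intro!: left_idealD[OF assms(1)] sugawara_op_mem[OF assms(1,2)] assms(3))

lemma eigen_filter_add: "eigen_filter a k (u + v) \<approx> eigen_filter a k u + eigen_filter a k v"
proof (induction k)
  case (Suc k)
  let ?e = "eigen_filter a k"
  have "sugawara_op 0 (?e (u + v)) \<approx> sugawara_op 0 (?e u + ?e v)" by (rule sugawara_op_cong[OF Suc])
  also have "\<dots> \<approx> sugawara_op 0 (?e u) + sugawara_op 0 (?e v)" by (rule sugawara_op_add)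
  finally have "sugawara_op 0 (?e (u + v)) - sc (a + of_nat (Suc k)) * ?e (u + v) \<approx>
      (sugawara_op 0 (?e u) + sugawara_op 0 (?e v)) - sc (a + of_nat (Suc k)) * (?e u + ?e v)"
    by (intro cong_diff cong_mult Suc)
  then show ?case by (simp only: eigen_filter.simps distrib_left add_diff_add)
qed simp

lemma eigen_filter_scalar: "eigen_filter a k (sc t * u) \<approx> sc t * eigen_filter a k u"
proof (induction k)
  case (Suc k)
  let ?e = "eigen_filter a k"
  have "sugawara_op 0 (?e (sc t * u)) \<approx> sugawara_op 0 (sc t * ?e u)" by (rule sugawara_op_cong[OF Suc])
  also have "\<dots> \<approx> sc t * sugawara_op 0 (?e u)" by (rule sugawara_op_scalar)
  finally have "sugawara_op 0 (?e (sc t * u)) - sc (a + of_nat (Suc k)) * ?e (sc t * u) \<approx>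
      sc t * sugawara_op 0 (?e u) - sc (a + of_nat (Suc k)) * (sc t * ?e u)"
    by (intro cong_diff cong_mult Suc)
  then show ?case by (simp only: eigen_filter.simps right_diff_distrib sc_left_commute[of "sc (a + of_nat (Suc k))" t])
qed simp

lemma eigen_filter_eigenvector:
  assumes K: "left_ideal K" "J \<subseteq> K" and w: "left_cong K (sugawara_op 0 w) (sc b * w)"
  shows "left_cong K (eigen_filter a k w) (sc (\<Prod>j\<in>{1..k}. b - a - of_nat j) * w)"
proof (induction k)
  case 0
  interpret K: left_ideal_congruence K using K(1) by unfold_locales
  show ?case by simp
next
  case (Suc k)
  interpret K: left_ideal_congruence K using K(1) by unfold_locales
  let ?c = "\<Prod>j\<in>{1..k}. b - a - of_nat j"
  have "left_cong K (sugawara_op 0 (eigen_filter a k w)) (sugawara_op 0 (sc ?c * w))"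
    by (rule sugawara_op_congruent[OF K Suc])
  moreover have "left_cong K (sugawara_op 0 (sc ?c * w)) (sc ?c * sugawara_op 0 w)"
    using sugawara_op_scalar K(2) by (auto simp: left_cong_def)
  moreover have "left_cong K (sc ?c * sugawara_op 0 w) (sc ?c * (sc b * w))"
    by (rule K.cong_mult[OF w])
  ultimately have "left_cong K (sugawara_op 0 (eigen_filter a k w)) (sc ?c * (sc b * w))"
    using K.cong_trans by blast
  then have "left_cong K (eigen_filter a (Suc k) w) (sc ?c * (sc b * w) - sc (a + of_nat (Suc k)) * (sc ?c * w))"
    unfolding eigen_filter.simps by (intro K.cong_diff K.cong_mult Suc)
  also have "sc ?c * (sc b * w) - sc (a + of_nat (Suc k)) * (sc ?c * w) = sc (?c * b - (a + of_nat (Suc k)) * ?c) * w"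
    by (simp only: sc_diff sc_mult left_diff_distrib mult.assoc)
  also have "?c * b - (a + of_nat (Suc k)) * ?c = (\<Prod>j\<in>{1..Suc k}. b - a - of_nat j)"
    by (simp add: algebra_simps)
  finally show ?case .
qed

lemma eval_pair_local:
  assumes K: "left_ideal K" and cas: "left_cong K casimir (sc w)"
  shows "\<exists>g. left_cong K (eval_pair P) (eval_poly (h 0) g)"
proof (induction P)
  case 0
  interpret K: left_ideal_congruence K using K by unfold_locales
  show ?case by (auto intro!: exI[of _ 0])
next
  case (pCons p P)
  interpret K: left_ideal_congruence K using K by unfold_locales
  obtain g where g: "left_cong K (eval_pair P) (eval_poly (h 0) g)" using pCons.IH by blast
  have "left_cong K (eval_pair P * casimir) (eval_pair P * sc w)" by (rule K.cong_mult[OF cas])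
  also have "eval_pair P * sc w = sc w * eval_pair P" by (rule sc_comm[symmetric])
  also have "left_cong K (sc w * eval_pair P) (sc w * eval_poly (h 0) g)" by (rule K.cong_mult[OF g])
  finally have "left_cong K (casimir * eval_pair P) (sc w * eval_poly (h 0) g)" unfolding eval_pair_casimir .
  then have "left_cong K (eval_pair (pCons p P)) (eval_poly (h 0) (p + smult w g))"
    unfolding eval_pair_pCons eval_poly_add eval_poly_smult by (intro K.cong_add K.cong_refl)
  then show ?case by blast
qed

lemma casimir_local:
  assumes "mu = 0" "left_ideal K" "J \<subseteq> K" "sugawara_op 0 1 - sc a \<in> K"
  shows "left_cong K casimir (sc (4 * (\<kappa> + 2) * a))"
proof -
  interpret K: left_ideal_congruence K using assms(2) by unfold_locales
  have k: "4 * (\<kappa> + 2) \<noteq> 0" using noncritical by (simp add: add_eq_0_iff2)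
  have "sugawara_op 0 1 \<approx> sc (inverse (4 * (\<kappa> + 2))) * casimir"
    using sugawara_zero unfolding assms(1) by simp
  then have A: "left_cong K (sugawara_op 0 1) (sc (inverse (4 * (\<kappa> + 2))) * casimir)"
    using assms(3) unfolding left_cong_def by blast
  have B: "left_cong K (sugawara_op 0 1) (sc a)" using assms(4) by (simp add: left_cong_def)
  have "left_cong K (sc (inverse (4 * (\<kappa> + 2))) * casimir) (sc a)"
    by (rule K.cong_trans[OF K.cong_sym[OF A] B])
  then have "left_cong K (sc (4 * (\<kappa> + 2)) * (sc (inverse (4 * (\<kappa> + 2))) * casimir)) (sc (4 * (\<kappa> + 2)) * sc a)"
    by (rule K.cong_mult)
  moreover have "sc (4 * (\<kappa> + 2)) * (sc (inverse (4 * (\<kappa> + 2))) * casimir) = casimir"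
    using right_inverse[OF k] by (simp only: mult.assoc[symmetric] sc_mult[symmetric] sc_1 mult_1_left)
  ultimately show ?thesis by (simp only: sc_mult)
qed

text \<open>
  Modulo the intersection \<open>K\<close> of the two ideals, \<open>L(0)\<close> acts on a word by \<open>a\<close> plus its
  depth, so a long enough \<open>eigen_filter\<close> projects \<open>u\<close> and \<open>u'\<close> to their components of
  depth zero. There the Casimir element is a scalar and \<open>f(0)\<close> can be eliminated, so the
  components are polynomials \<open>g\<close> and \<open>g'\<close> in \<open>h(0)\<close>. If \<open>g\<close> is nonzero,
  \<open>whittaker_descent\<close> turns it into a nonzero scalar in \<open>I\<close>. If \<open>g = 0\<close>, then \<open>g'\<close>
  represents \<open>1\<close>, which therefore lies in \<open>I'\<close>.
\<close>

theorem degenerate_local_ideals: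
  assumes lm: "lam \<noteq> 0" "mu = 0"
    and I: "left_ideal I" "J \<subseteq> I" "sugawara_op 0 1 - sc a \<in> I"
    and I': "left_ideal I'" "J \<subseteq> I'" "sugawara_op 0 1 - sc a \<in> I'"
    and one: "u + u' = 1" "u \<in> I" "u' \<in> I'"
  shows "1 \<in> I \<or> 1 \<in> I'"
proof -
  define K where "K = I \<inter> I'"
  have K: "left_ideal K" "J \<subseteq> K" "sugawara_op 0 1 - sc a \<in> K"
    using I I' by (auto simp: K_def left_ideal_Int)
  interpret K: left_ideal_congruence K using K(1) by unfold_locales
  interpret filtration: whittaker_filtration sc e h f c J \<kappa> "whittaker_character lam mu" "\<lambda>x. (- mode x, base_weight x)"
    by (rule filtration_by_mode[OF lm(2)])
  define d where "d k = (\<Prod>j\<in>{1..k}. - of_nat j :: complex)" for k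
  have d: "d k \<noteq> 0" for k by (simp add: d_def)
  \<comment> \<open>Each letter raises the eigenvalue of \<open>L(0)\<close> by its depth.\<close>
  have word_eigen: "left_cong K (sugawara_op 0 (prod_list (map val ys))) (sc (a + of_int (\<Sum>y\<leftarrow>ys. - mode y)) * prod_list (map val ys))" for ys
  proof (induction ys)
    case Nil
    show ?case using K(3) by (simp add: left_cong_def)
  next
    case (Cons y ys)
    let ?w = "prod_list (map val ys)" and ?b = "a + of_int (\<Sum>y\<leftarrow>ys. - mode y)"
    have "shift 0 y = y" by (cases y) auto
    then have "left_cong K (sugawara_op 0 (val y * ?w)) (val y * sugawara_op 0 ?w - of_int (mode y) * (val y * ?w))"
      using sugawara_op_val[of 0 y ?w] K(2) by (auto simp: left_cong_def)
    also have "left_cong K \<dots> (val y * (sc ?b * ?w) - of_int (mode y) * (val y * ?w))"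
      by (intro K.cong_diff K.cong_mult Cons K.cong_refl)
    also have "\<dots> = sc (?b - of_int (mode y)) * (val y * ?w)"
      by (simp only: sc_diff sc_int left_diff_distrib sc_left_commute[of "val y"])
    also have "?b - of_int (mode y) = a + of_int (\<Sum>y\<leftarrow>(y # ys). - mode y)" by simp
    finally show ?case by simp
  qed
  have top: "\<exists>g k0. \<forall>k\<ge>k0. left_cong K (eigen_filter a k x) (sc (d k) * eval_poly (h 0) g)" for x
    using filtration.filt_all[of x]
  proof (induction rule: filtration.filt.induct)
    case (ideal x)
    then have "eigen_filter a k x \<in> K" for k using K by (intro eigen_filter_mem) auto
    then show ?case by (intro exI[of _ 0]) (simp add: left_cong_def)
  next
    case (word ys)
    let ?w = "filtration.word_val ys" and ?i = "\<Sum>y\<leftarrow>ys. - mode y"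
    have ev: "left_cong K (eigen_filter a k ?w) (sc (\<Prod>j\<in>{1..k}. of_int ?i - of_nat j) * ?w)" for k
      using eigen_filter_eigenvector[OF K(1,2) word_eigen[of ys], of a k]
      by (simp add: filtration.word_val_def)
    have i: "?i \<ge> 0" "?i = 0 \<longrightarrow> set ys \<subseteq> {gH 0, gF 0}"
      using lower_word_mode[of ys] word(1) unfolding filtration.lower_word_def by auto
    show ?case
    proof (cases "?i = 0")
      case True
      obtain P where "?w \<approx> eval_pair P"
        using word_model[OF lm(1)] i True unfolding filtration.word_val_def by blast
      then have "left_cong K ?w (eval_pair P)" using K(2) by (auto simp: left_cong_def)
      moreover obtain g where "left_cong K (eval_pair P) (eval_poly (h 0) g)"
        using eval_pair_local[OF K(1) casimir_local[OF lm(2) K]] by blast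
      ultimately have g: "left_cong K ?w (eval_poly (h 0) g)" by (rule K.cong_trans)
      have "left_cong K (eigen_filter a k ?w) (sc (d k) * eval_poly (h 0) g)" for k
        using K.cong_trans[OF ev[of k] K.cong_mult[OF g]] unfolding True d_def by simp
      then show ?thesis by blast
    next
      case False
      have "left_cong K (eigen_filter a k ?w) (sc (d k) * eval_poly (h 0) 0)" if k: "k \<ge> nat ?i" for k
      proof -
        have "nat ?i \<in> {1..k}" using False i(1) k by auto
        moreover have "of_int ?i - of_nat (nat ?i) = (0::complex)" using i(1) by simp
        ultimately have z: "(\<Prod>j\<in>{1..k}. of_int ?i - of_nat j :: complex) = 0" by (intro prod_zero) auto
        show ?thesis using ev[of k] unfolding z by simp
      qed
      then show ?thesis by blast
    qed
  next
    case (add x y)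
    then obtain g k g' k' where *: "\<forall>n\<ge>k. left_cong K (eigen_filter a n x) (sc (d n) * eval_poly (h 0) g)"
      "\<forall>n\<ge>k'. left_cong K (eigen_filter a n y) (sc (d n) * eval_poly (h 0) g')" by blast
    have "left_cong K (eigen_filter a n (x + y)) (sc (d n) * eval_poly (h 0) (g + g'))" if "n \<ge> max k k'" for n
    proof -
      have "left_cong K (eigen_filter a n (x + y)) (eigen_filter a n x + eigen_filter a n y)"
        using eigen_filter_add K(2) by (auto simp: left_cong_def)
      also have "left_cong K \<dots> (sc (d n) * eval_poly (h 0) g + sc (d n) * eval_poly (h 0) g')"
        using * that by (intro K.cong_add) auto
      finally show ?thesis by (simp add: eval_poly_add distrib_left)
    qed
    then show ?case by blast
  next
    case (scalar x t)
    then obtain g k where *: "\<forall>n\<ge>k. left_cong K (eigen_filter a n x) (sc (d n) * eval_poly (h 0) g)" by blast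
    have "left_cong K (eigen_filter a n (sc t * x)) (sc (d n) * eval_poly (h 0) (smult t g))" if "n \<ge> k" for n
    proof -
      have "left_cong K (eigen_filter a n (sc t * x)) (sc t * eigen_filter a n x)"
        using eigen_filter_scalar K(2) by (auto simp: left_cong_def)
      also have "left_cong K \<dots> (sc t * (sc (d n) * eval_poly (h 0) g))"
        using * that by (intro K.cong_mult) auto
      finally show ?thesis by (simp add: eval_poly_smult sc_left_commute[of "sc (d n)" t])
    qed
    then show ?case by blast
  qed
  obtain g k where g: "\<forall>n\<ge>k. left_cong K (eigen_filter a n u) (sc (d n) * eval_poly (h 0) g)" using top by blast
  obtain g' k' where g': "\<forall>n\<ge>k'. left_cong K (eigen_filter a n u') (sc (d n) * eval_poly (h 0) g')" using top by blast
  define n where "n = max k k'"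
  have gI: "eval_poly (h 0) g \<in> I"
  proof -
    have "eigen_filter a n u \<in> I" by (rule eigen_filter_mem[OF I(1,2) one(2)])
    moreover have "left_cong K (eigen_filter a n u) (sc (d n) * eval_poly (h 0) g)"
      using g by (simp add: n_def)
    moreover have "K \<subseteq> I" by (simp add: K_def)
    ultimately have "sc (d n) * eval_poly (h 0) g \<in> I"
      using K.cong_mem I(1) by blast
    then show ?thesis by (rule sc_mem_cancel[OF I(1) d])
  qed
  have gI': "eval_poly (h 0) g' \<in> I'"
  proof -
    have "eigen_filter a n u' \<in> I'" by (rule eigen_filter_mem[OF I'(1,2) one(3)])
    moreover have "left_cong K (eigen_filter a n u') (sc (d n) * eval_poly (h 0) g')"
      using g' by (simp add: n_def)
    moreover have "K \<subseteq> I'" by (simp add: K_def)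
    ultimately have "sc (d n) * eval_poly (h 0) g' \<in> I'"
      using K.cong_mem I'(1) by blast
    then show ?thesis by (rule sc_mem_cancel[OF I'(1) d])
  qed
  show ?thesis
  proof (cases "g = 0")
    case False
    have "eval_pair [:g:] \<in> I" using gI by simp
    moreover have "e 0 - sc lam \<in> I" using relations_in_J(1) I(2) by blast
    ultimately obtain q where "q \<noteq> 0" "degree q \<le> 0" "eval_poly casimir q \<in> I"
      using whittaker_descent[OF I(1) _ lm(1), of "[:g:]"] False by auto
    then obtain t where "t \<noteq> 0" "sc t * 1 \<in> I" by (metis degree_eq_zeroE eval_poly_0 eval_poly_pCons le_zero_eq mult_1_right mult_zero_right add_0_right pCons_0_0)
    then show ?thesis using sc_mem_cancel[OF I(1)] by blast
  next
    case True
    have A: "left_cong K (eigen_filter a n 1) (sc (d n) * 1)"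
      using eigen_filter_eigenvector[OF K(1,2), of 1 a a n] K(3) by (simp add: d_def left_cong_def)
    have B: "left_cong K (eigen_filter a n (u + u')) (eigen_filter a n u + eigen_filter a n u')"
      using eigen_filter_add K(2) by (auto simp: left_cong_def)
    have C: "left_cong K (eigen_filter a n u + eigen_filter a n u')
        (sc (d n) * eval_poly (h 0) g + sc (d n) * eval_poly (h 0) g')"
      using g g' by (intro K.cong_add) (auto simp: n_def)
    have "left_cong K (sc (d n) * 1) (sc (d n) * eval_poly (h 0) g')"
      using K.cong_trans[OF K.cong_sym[OF A] K.cong_trans[OF B[unfolded one(1)] C]] by (simp add: True)
    moreover have "K \<subseteq> I'" by (simp add: K_def)
    ultimately have "sc (d n) * 1 \<in> I'"
      using K.cong_mem[of _ _ I'] I'(1) gI' left_idealD(3)[OF I'(1) gI'] by blast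
    then show ?thesis using sc_mem_cancel[OF I'(1) d] by blast
  qed
qed

text \<open>
  Brackets with zero modes preserve the positive modes, so the elements killed by the
  latter are stable under the former.
\<close>

lemma positive_modes_zero_modes:
  assumes "\<And>y. mode y \<ge> 1 \<Longrightarrow> val y * u \<in> J" "mode x = 0" "mode y \<ge> 1"
  shows "val y * (val x * u) \<in> J"
proof -
  have 1: "mode (bracket_gen y x) \<ge> 1 \<or> bracket_coeff y x = 0" and 2: "central_coeff y x = 0"
    using assms(2,3) by (cases y; cases x; auto)+
  have "of_int (bracket_coeff y x) * (val (bracket_gen y x) * u) \<in> J"
    using 1 assms(1) by (cases "bracket_coeff y x = 0") (auto simp: J_closed(1) intro: J_closed(3))
  moreover have "val y * (val x * u) = val x * (val y * u) + of_int (bracket_coeff y x) * (val (bracket_gen y x) * u)"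
    using val_bracket[of y x] 2 by (simp add: distrib_right flip: mult.assoc)
  ultimately show ?thesis
    using assms(1,3) J_closed(2,3) by simp
qed

text \<open>
  A polynomial in the Casimir element is killed by the positive modes and commutes with
  \<open>e(0)\<close>, so sending \<open>1\<close> to it defines an endomorphism of the universal module.
\<close>

lemma casimir_polynomial_shift:
  assumes "mu = 0"
  shows "J \<subseteq> {u. u * eval_poly casimir q \<in> J}"
proof -
  let ?g = "eval_poly casimir q"
  have pos: "val y * ?g \<in> J" if "mode y \<ge> 1" for y
    using that
  proof (induction q arbitrary: y)
    case 0
    then show ?case by (simp add: J_closed)
  next
    case (pCons a q)
    let ?u = "eval_poly casimir q"
    have u: "\<And>y. mode y \<ge> 1 \<Longrightarrow> val y * ?u \<in> J" by (rule pCons.IH)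
    have x: "\<And>x y. mode x = 0 \<Longrightarrow> mode y \<ge> 1 \<Longrightarrow> val y * (val x * ?u) \<in> J"
      by (rule positive_modes_zero_modes[OF u])
    have xx: "\<And>x x' y. mode x = 0 \<Longrightarrow> mode x' = 0 \<Longrightarrow> mode y \<ge> 1 \<Longrightarrow> val y * (val x' * (val x * ?u)) \<in> J"
      by (rule positive_modes_zero_modes[OF x])
    have "casimir * ?u = f 0 * (e 0 * ?u) + f 0 * (e 0 * ?u) + (e 0 * (f 0 * ?u) + e 0 * (f 0 * ?u)) + h 0 * (h 0 * ?u)"
      by (simp add: casimir_def distrib_right mult.assoc)
    then have "val y * (casimir * ?u) \<in> J"
      using xx[of "gE 0" "gF 0" y] xx[of "gF 0" "gE 0" y] xx[of "gH 0" "gH 0" y] pCons.prems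
      by (simp add: distrib_left J_closed(2))
    moreover have "val y * sc a \<in> J"
    proof -
      have "val y \<in> J" using val_character[of y] pCons.prems assms
        by (cases y) (auto simp: left_cong_def)
      then show ?thesis using J_closed(3)[of "val y" "sc a"] by (simp add: sc_comm)
    qed
    ultimately show ?case by (simp add: distrib_left J_closed(2))
  qed
  have "whittaker_relations lam mu \<kappa> \<subseteq> {u. u * ?g \<in> J}"
  proof -
    have com: "x * ?g \<in> J" if "x \<in> J" "x * casimir = casimir * x" for x
      using eval_poly_commute[OF that(2)] J_closed(3)[OF that(1)] by simp
    have "(e 0 - sc lam) * ?g \<in> J"
      using relations_in_J(1) casimir_commute(1) by (intro com) (simp_all add: left_diff_distrib right_diff_distrib sc_comm)
    moreover have "(c - sc \<kappa>) * ?g \<in> J"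
      using relations_in_J(3) by (intro com) (simp_all add: left_diff_distrib right_diff_distrib sc_comm c_comm)
    moreover have "(f 1 - sc mu) * ?g \<in> J" using pos[of "gF 1"] assms by simp
    moreover have "e i * ?g \<in> J" "h i * ?g \<in> J" "f (i + 1) * ?g \<in> J" if "i \<ge> 1" for i
      using that pos[of "gE i"] pos[of "gH i"] pos[of "gF (i + 1)"] by auto
    ultimately show ?thesis unfolding whittaker_relations_def by auto
  qed
  then show ?thesis
    unfolding universal_ideal_def by (intro generated_ideal_le left_ideal_transporter) (simp_all add: left_ideal_J[unfolded universal_ideal_def])
qed

text \<open>
  The ideal \<open>I\<close> contains a nonzero polynomial in the Casimir element: by
  \<open>degenerate_ideal_reduction\<close> if it is larger than \<open>J\<close>; if \<open>I = J\<close>, then \<open>J\<close> is maximal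
  and coincides with the left ideal of the last hypothesis, in which the Casimir element
  is a scalar. By \<open>eval_poly_root\<close> some polynomial in the Casimir element is an
  eigenvector modulo \<open>I\<close>, hence one of \<open>L(0)\<close>.
\<close>

theorem degenerate_maximal_ideals:
  assumes lm: "lam \<noteq> 0" "mu = 0" and I: "left_ideal I" "J \<subseteq> I" "1 \<notin> I"
    and max: "\<And>K. left_ideal K \<Longrightarrow> I \<subseteq> K \<Longrightarrow> 1 \<notin> K \<Longrightarrow> K = I"
    and proper: "\<exists>K a. left_ideal K \<and> J \<subseteq> K \<and> sugawara_op 0 1 - sc a \<in> K \<and> 1 \<notin> K"
  shows "\<exists>a g. g \<notin> I \<and> J \<subseteq> {u. u * g \<in> I} \<and> (sugawara_op 0 1 - sc a) * g \<in> I"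
proof -
  have "\<exists>q. q \<noteq> 0 \<and> eval_poly casimir q \<in> I"
  proof (cases "I = J")
    case True
    obtain K a where K: "left_ideal K" "J \<subseteq> K" "sugawara_op 0 1 - sc a \<in> K" "1 \<notin> K" using proper by blast
    then have "K = I" using max True by blast
    then have "casimir - sc (4 * (\<kappa> + 2) * a) \<in> I"
      using casimir_local[OF lm(2) K(1,2,3)] by (simp add: left_cong_def)
    then show ?thesis by (intro exI[of _ "[:- (4 * (\<kappa> + 2) * a), 1:]"]) (simp add: sc_minus)
  next
    case False
    then obtain u where "u \<in> I" "u \<notin> J" using I(2) by blast
    then show ?thesis using degenerate_ideal_reduction[OF lm I(1,2)] by blast
  qed
  then obtain b r where r: "eval_poly casimir r \<notin> I" "(casimir - sc b) * eval_poly casimir r \<in> I"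
    using eval_poly_root[OF I(1) _ _ I(3)] by blast
  let ?g = "eval_poly casimir r" and ?s = "inverse (4 * (\<kappa> + 2))"
  have shift: "J \<subseteq> {u. u * ?g \<in> I}" using casimir_polynomial_shift[OF lm(2), of r] I(2) by blast
  have "sugawara_op 0 1 - sc ?s * casimir \<in> J"
    using sugawara_zero lm(2) by (simp add: left_cong_def)
  then have "(sugawara_op 0 1 - sc ?s * casimir) * ?g \<in> I" using shift by blast
  moreover have "sc ?s * ((casimir - sc b) * ?g) \<in> I" by (intro left_idealD(3)[OF I(1)] r)
  ultimately have "(sugawara_op 0 1 - sc ?s * casimir) * ?g + sc ?s * ((casimir - sc b) * ?g) \<in> I"
    by (rule left_idealD(2)[OF I(1)])
  also have "(sugawara_op 0 1 - sc ?s * casimir) * ?g + sc ?s * ((casimir - sc b) * ?g) = (sugawara_op 0 1 - sc (?s * b)) * ?g"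
    by (simp only: sc_mult left_diff_distrib right_diff_distrib mult.assoc) simp
  finally show ?thesis using r(1) shift by blast
qed

text \<open>
  The same argument with \<open>h(0)\<close> in place of the Casimir element. A polynomial in \<open>h(0)\<close>
  is still killed by the raising generators modulo \<open>J\<close>, since they merely shift its
  argument.
\<close>

theorem verma_maximal_ideals:
  assumes lm: "lam = 0" "mu = 0" and I: "left_ideal I" "J \<subseteq> I" "1 \<notin> I"
    and max: "\<And>K. left_ideal K \<Longrightarrow> I \<subseteq> K \<Longrightarrow> 1 \<notin> K \<Longrightarrow> K = I"
    and proper: "\<exists>K b. left_ideal K \<and> J \<subseteq> K \<and> h 0 - sc b \<in> K \<and> 1 \<notin> K"
  shows "\<exists>b g. g \<notin> I \<and> J \<subseteq> {u. u * g \<in> I} \<and> (h 0 - sc b) * g \<in> I"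
proof -
  have "\<exists>q. q \<noteq> 0 \<and> eval_poly (h 0) q \<in> I"
  proof (cases "I = J")
    case True
    obtain K b where K: "left_ideal K" "J \<subseteq> K" "h 0 - sc b \<in> K" "1 \<notin> K" using proper by blast
    then have "h 0 - sc b \<in> I" using max True by blast
    then show ?thesis by (intro exI[of _ "[:- b, 1:]"]) (simp add: sc_minus)
  next
    case False
    then obtain u where "u \<in> I" "u \<notin> J" using I(2) by blast
    then show ?thesis using verma_ideal_reduction[OF lm I(1,2)] by blast
  qed
  then obtain b r where r: "eval_poly (h 0) r \<notin> I" "(h 0 - sc b) * eval_poly (h 0) r \<in> I"
    using eval_poly_root[OF I(1) _ _ I(3)] by blast
  let ?g = "eval_poly (h 0) r"
  have shift: "x * ?g \<in> J" if "x \<in> J" "x * h 0 = (h 0 + sc t) * x" for x t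
    unfolding eval_poly_shift[OF that(2)] by (rule J_closed(3)[OF that(1)])
  have "(c - sc \<kappa>) * ?g \<in> J"
    using relations_in_J(3) by (intro shift[of _ 0]) (simp_all add: left_diff_distrib right_diff_distrib sc_comm c_comm)
  moreover have "e i * ?g \<in> J" if "e i \<in> J" for i
    using that h_e[of 0 i] by (intro shift[of _ "- 2"]) (simp_all add: sc_minus algebra_simps)
  moreover have "f i * ?g \<in> J" if "f i \<in> J" for i
    using that h_f[of 0 i] by (intro shift[of _ 2]) (simp_all add: algebra_simps)
  moreover have "h i * ?g \<in> J" if "i \<ge> 1" for i
    using relations_in_J(5)[OF that] h_h[of 0 i] that by (intro shift[of _ 0]) (simp_all add: algebra_simps)
  ultimately have "whittaker_relations lam mu \<kappa> \<subseteq> {u. u * ?g \<in> J}"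
    using relations_in_J lm unfolding whittaker_relations_def by auto
  then have "J \<subseteq> {u. u * ?g \<in> J}"
    unfolding universal_ideal_def by (intro generated_ideal_le left_ideal_transporter) (simp_all add: left_ideal_J[unfolded universal_ideal_def])
  then show ?thesis using r I(2) by blast
qed

end

section \<open>The enveloping algebra of the affine algebra\<close>

lemma uea_scalar_hom:
  "uea_scalar (s + t) = uea_scalar s + (uea_scalar t :: 'g::complex_lie_algebra uea)"
  "uea_scalar (s * t) = uea_scalar s * (uea_scalar t :: 'g uea)"
  "uea_scalar 1 = (1 :: 'g uea)"
  by (simp_all add: uea_scalar.abs_eq plus_uea.abs_eq times_uea.abs_eq one_uea_def free_scalar_def single_add mult_single)

lemma uea_scalar_central: "uea_scalar t * u = u * (uea_scalar t :: 'g::complex_lie_algebra uea)"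
proof -
  have "free_scalar t * a = a * free_scalar t" for a :: "'g free_algebra"
    by (induction a rule: poly_mapping_sum_induct)
      (simp_all add: free_scalar_def mult_single distrib_left distrib_right mult.commute)
  then have "uea_scalar t * abs_uea a = abs_uea a * uea_scalar t" for a :: "'g free_algebra"
    by (simp add: uea_scalar.abs_eq times_uea.abs_eq)
  then show ?thesis by (metis Quotient3_abs_rep[OF Quotient3_uea])
qed

lemma uea_induct [case_names one add scalar incl]:
  fixes u :: "'g::complex_lie_algebra uea"
  assumes "P 1" "\<And>u v. P u \<Longrightarrow> P v \<Longrightarrow> P (u + v)" "\<And>t u. P u \<Longrightarrow> P (uea_scalar t * u)"
    "\<And>x u. P u \<Longrightarrow> P (uea_incl x * u)"
  shows "P u"
proof -
  have word: "P (abs_uea (Poly_Mapping.single (Free_Word xs) t))" for xs :: "'g list" and t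
  proof (induction xs)
    case Nil
    have "abs_uea (Poly_Mapping.single (Free_Word []) t) = uea_scalar t * (1 :: 'g uea)"
      by (simp add: uea_scalar.abs_eq free_scalar_def zero_free_monoid_def)
    then show ?case using assms(1,3) by metis
  next
    case (Cons x xs)
    have "Poly_Mapping.single (Free_Word (x # xs)) t = free_gen x * Poly_Mapping.single (Free_Word xs) t"
      by (simp add: free_gen_def mult_single plus_free_monoid_def)
    then have "abs_uea (Poly_Mapping.single (Free_Word (x # xs)) t) = uea_incl x * abs_uea (Poly_Mapping.single (Free_Word xs) t)"
      by (simp add: uea_incl.abs_eq times_uea.abs_eq)
    then show ?case using assms(4) Cons by simp
  qed
  have "P (abs_uea a)" for a :: "'g free_algebra"
  proof (induction a rule: poly_mapping_sum_induct)
    case zero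
    show ?case using word[of "[]" 0] by simp
  next
    case (add a b)
    then show ?case using assms(2) by (simp flip: plus_uea.abs_eq)
  next
    case (single m t)
    show ?case using word[of "letters m" t] by simp
  qed
  then show ?thesis by (metis Quotient3_abs_rep[OF Quotient3_uea])
qed

lemma hat_gen_linear: "hat_gen (x + y) n = hat_gen x n + hat_gen y n" "hat_gen (cscale t x) n = cscale t (hat_gen x n)"
  by (simp_all add: hat_gen_def sl2_hat_ops_defs single_add loop_scale_single)

lemma hat_induct [case_names add scale e h f c]:
  assumes "\<And>x y. P x \<Longrightarrow> P y \<Longrightarrow> P (x + y)" "\<And>t x. P x \<Longrightarrow> P (cscale t x)"
    and "\<And>n. P (hat_e n)" "\<And>n. P (hat_h n)" "\<And>n. P (hat_f n)" "P hat_c"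
  shows "P (x :: sl2_hat)"
proof -
  have zero: "P 0" using assms(2)[OF assms(6), of 0] by simp
  have "P (Hat l 0)" for l
  proof (induction l rule: loop_induct)
    case zero
    show ?case using \<open>P 0\<close> by (simp add: sl2_hat_ops_defs)
  next
    case (add l l')
    then show ?case using assms(1)[OF add] by (simp add: sl2_hat_ops_defs)
  next
    case (single n a)
    have "Hat (Poly_Mapping.single n a) 0 = cscale (e_coord a) (hat_e n) + cscale (f_coord a) (hat_f n) + cscale (h_coord a) (hat_h n)"
      using sl2_basis_expansion[of a] by (metis hat_gen_def hat_gen_linear)
    then show ?case using assms by simp
  qed
  moreover have "x = Hat (hat_loop x) 0 + cscale (hat_central x) hat_c"
    by (cases x) (simp add: sl2_hat_ops_defs hat_c_def)
  ultimately show ?thesis using assms(1,2,6) by metis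
qed

abbreviation "ue n \<equiv> uea_incl (hat_e n)"
abbreviation "uf n \<equiv> uea_incl (hat_f n)"
abbreviation "uh n \<equiv> uea_incl (hat_h n)"
abbreviation "uc \<equiv> uea_incl hat_c"

lemma uea_hat_bracket:
  "uea_incl (hat_gen x n) * uea_incl (hat_gen y m) - uea_incl (hat_gen y m) * uea_incl (hat_gen x n) =
    uea_incl (hat_gen (bracket x y) (n + m)) + uea_scalar (of_int n * sl2_form x y * (if n + m = 0 then 1 else 0)) * uc"
  by (simp only: uea_incl_bracket[symmetric] hat_brackets(1) uea_incl_add uea_incl_scale)

lemma uea_hat_central: "uc * u = u * uc"
proof (induction u rule: uea_induct)
  case (add u v)
  then show ?case by (simp add: distrib_left distrib_right)
next
  case (scalar t u)
  then show ?case by (metis mult.assoc uea_scalar_central)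
next
  case (incl x u)
  have "uea_incl (bracket hat_c x) = 0"
    using uea_incl_scale[of 0 "0::sl2_hat"] uea_scalar_hom(1)[of 0 0, where 'g = sl2_hat] by (simp add: hat_brackets(2))
  then have "uc * uea_incl x = uea_incl x * uc" using uea_incl_bracket[of hat_c x] by simp
  then show ?case using incl by (metis mult.assoc)
qed simp

global_interpretation standard: affine_currents "uea_scalar :: complex \<Rightarrow> sl2_hat uea" ue uh uf uc
proof
  fix n m :: int and s t :: complex and u :: "sl2_hat uea"
  have [simp]: "uea_scalar 0 = (0 :: sl2_hat uea)" using uea_scalar_hom(1)[of 0 0, where 'g = sl2_hat] by simp
  have int: "uea_scalar (of_int k) = (of_int k :: sl2_hat uea)" for k
  proof -
    have "uea_scalar (of_nat j) = (of_nat j :: sl2_hat uea)" for j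
      by (induction j) (simp_all add: uea_scalar_hom)
    moreover have "uea_scalar (- r) = - (uea_scalar r :: sl2_hat uea)" for r
      using uea_scalar_hom(1)[of r "- r", where 'g = sl2_hat] by (simp add: eq_neg_iff_add_eq_0 add.commute)
    ultimately show ?thesis by (cases k) (simp_all del: of_nat_Suc)
  qed
  have int': "uea_scalar (2 * of_int k) = 2 * (of_int k :: sl2_hat uea)" for k
    using int[of "2 * k"] by simp
  have num: "uea_scalar 2 = (2 :: sl2_hat uea)" "uea_scalar (- 2) = (- 2 :: sl2_hat uea)"
    using int[of 2] int[of "- 2"] by simp_all
  have zero: "uea_incl (hat_gen 0 k) = 0" for k
    using uea_incl_scale[of 0 "hat_gen 0 k"] by (simp flip: hat_gen_linear(2))
  show "uea_scalar (s + t) = uea_scalar s + (uea_scalar t :: sl2_hat uea)" "uea_scalar (s * t) = uea_scalar s * (uea_scalar t :: sl2_hat uea)"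
    "uea_scalar 1 = (1 :: sl2_hat uea)" by (rule uea_scalar_hom)+
  show "uea_scalar t * u = u * uea_scalar t" by (rule uea_scalar_central)
  show "uc * u = u * uc" by (rule uea_hat_central)
  show "ue n * uf m - uf m * ue n = uh (n + m) + of_int (if n + m = 0 then n else 0) * uc"
    using uea_hat_bracket[of sl2_e n sl2_f m] by (auto simp: sl2_basis_brackets sl2_basis_form int)
  show "uh n * ue m - ue m * uh n = 2 * ue (n + m)"
    using uea_hat_bracket[of sl2_h n sl2_e m]
    by (simp add: sl2_basis_brackets sl2_basis_form sl2_form_commute[of sl2_h] hat_gen_linear uea_incl_scale num)
  show "uh n * uf m - uf m * uh n = - 2 * uf (n + m)"
  proof -
    have "uea_incl (hat_gen (bracket sl2_h sl2_f) (n + m)) = uea_scalar (- 2) * uf (n + m)"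
      by (simp only: sl2_basis_brackets hat_gen_linear uea_incl_scale)
    then show ?thesis
      using uea_hat_bracket[of sl2_h n sl2_f m] by (simp add: sl2_basis_form sl2_form_commute[of sl2_h] num)
  qed
  show "uh n * uh m - uh m * uh n = of_int (if n + m = 0 then 2 * n else 0) * uc"
    using uea_hat_bracket[of sl2_h n sl2_h m] by (auto simp: sl2_basis_form bracket_self zero int' mult.commute[of _ 2])
  show "ue n * ue m = ue m * ue n" "uf n * uf m = uf m * uf n"
    using uea_hat_bracket[of sl2_e n sl2_e m] uea_hat_bracket[of sl2_f n sl2_f m]
    by (simp_all add: sl2_basis_form bracket_self zero)
  fix P :: "sl2_hat uea \<Rightarrow> bool"
  assume P: "P 1" "\<And>u v. P u \<Longrightarrow> P v \<Longrightarrow> P (u + v)" "\<And>t u. P u \<Longrightarrow> P (uea_scalar t * u)"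
    "\<And>n u. P u \<Longrightarrow> P (ue n * u)" "\<And>n u. P u \<Longrightarrow> P (uf n * u)" "\<And>n u. P u \<Longrightarrow> P (uh n * u)"
  have minus: "P (u - v)" if "P u" "P v" for u v
  proof -
    have "u - v = u + uea_scalar (of_int (- 1)) * v" unfolding int by simp
    then show ?thesis using P(2)[OF that(1) P(3)[OF that(2)]] by metis
  qed
  show "P u"
  proof (induction u rule: uea_induct)
    case (incl x u)
    have c: "P (uc * u)"
    proof -
      have "uc = ue 1 * uf (- 1) - uf (- 1) * ue 1 - uh 0"
        using uea_hat_bracket[of sl2_e 1 sl2_f "- 1"] uea_scalar_hom(3)[where 'g = sl2_hat] by (simp add: sl2_basis_brackets sl2_basis_form)
      then have "uc * u = ue 1 * (uf (- 1) * u) - uf (- 1) * (ue 1 * u) - uh 0 * u"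
        by (simp add: left_diff_distrib mult.assoc)
      moreover have "P (ue 1 * (uf (- 1) * u) - uf (- 1) * (ue 1 * u) - uh 0 * u)"
        by (intro minus P(4) P(5) P(6) incl)
      ultimately show ?thesis by simp
    qed
    show ?case
    proof (induction x rule: hat_induct)
      case (add x y)
      then show ?case using P(2)[OF add] by (simp add: uea_incl_add distrib_right)
    next
      case (scale t x)
      then show ?case using P(3)[OF scale] by (simp add: uea_incl_scale mult.assoc)
    qed (use P incl c in auto)
  qed (use P in auto)
qed

context affine_currents
begin

text \<open>
  The diagram automorphism that exchanges the simple root vectors \<open>e(0)\<close> and \<open>f(1)\<close>. It
  interchanges the two parameters of the universal modules.
\<close>

lemma twisted_currents:
  "affine_currents sc (\<lambda>n. f (n + 1)) (\<lambda>n. (if n = 0 then c else 0) - h n) (\<lambda>n. e (n - 1)) c"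
proof
  fix n m :: int and P :: "'a \<Rightarrow> bool" and u
  have cc: "(if k = 0 then c else 0) * x = x * (if k = 0 then c else 0)" for k :: int and x by (simp add: c_comm)
  have comm: "((if k = 0 then c else 0) - x) * y - y * ((if k = 0 then c else 0) - x) = - (x * y - y * x)" for k :: int and x y
    using cc[of k y] by (simp add: left_diff_distrib right_diff_distrib)
  show "f (n + 1) * e (m - 1) - e (m - 1) * f (n + 1) = (if n + m = 0 then c else 0) - h (n + m) + of_int (if n + m = 0 then n else 0) * c"
  proof -
    have "f (n + 1) * e (m - 1) - e (m - 1) * f (n + 1) = - (h (n + m) + of_int (if n + m = 0 then m - 1 else 0) * c)"
      using arg_cong[OF e_f[of "m - 1" "n + 1"], of uminus] by (simp add: add.commute[of m n] split del: if_split)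
    then show ?thesis
    proof (cases "n + m = 0")
      case True
      then have m: "m = - n" by simp
      show ?thesis using \<open>_ = - (h (n + m) + _)\<close> unfolding m by (simp add: algebra_simps)
    qed simp
  qed
  show "((if n = 0 then c else 0) - h n) * f (m + 1) - f (m + 1) * ((if n = 0 then c else 0) - h n) = 2 * f (n + m + 1)"
    unfolding comm h_f by (simp add: add.assoc)
  show "((if n = 0 then c else 0) - h n) * e (m - 1) - e (m - 1) * ((if n = 0 then c else 0) - h n) = - 2 * e (n + m - 1)"
    unfolding comm h_e by (simp add: add_diff_eq)
  show "((if n = 0 then c else 0) - h n) * ((if m = 0 then c else 0) - h m) - ((if m = 0 then c else 0) - h m) * ((if n = 0 then c else 0) - h n)
      = of_int (if n + m = 0 then 2 * n else 0) * c"
    using h_h[of n m] c_comm[of "h n"] c_comm[of "h m"]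
    by (cases "n = 0"; cases "m = 0") (simp_all add: left_diff_distrib right_diff_distrib)
  show "f (n + 1) * f (m + 1) = f (m + 1) * f (n + 1)" "e (n - 1) * e (m - 1) = e (m - 1) * e (n - 1)"
    by (rule f_f e_e)+
  assume P: "P 1" "\<And>u v. P u \<Longrightarrow> P v \<Longrightarrow> P (u + v)" "\<And>t u. P u \<Longrightarrow> P (sc t * u)"
    "\<And>n u. P u \<Longrightarrow> P (f (n + 1) * u)" "\<And>n u. P u \<Longrightarrow> P (e (n - 1) * u)" "\<And>n u. P u \<Longrightarrow> P (((if n = 0 then c else 0) - h n) * u)"
  have F: "P (f k * x)" if "P x" for k x using P(4)[OF that, of "k - 1"] by simp
  have E: "P (e k * x)" if "P x" for k x using P(5)[OF that, of "k + 1"] by simp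
  have minus: "P (x - y)" if "P x" "P y" for x y
    using P(2)[OF that(1) P(3)[OF that(2), of "- 1"]] by (simp add: sc_minus)
  have H: "P (h k * x)" if "P x" for k x
  proof -
    have "h k * x = e k * (f 0 * x) - f 0 * (e k * x)"
      using e_f[of k 0] by (cases "k = 0") (simp_all add: left_diff_distrib[symmetric] mult.assoc[symmetric])
    moreover have "P (e k * (f 0 * x) - f 0 * (e k * x))" by (intro minus E F that)
    ultimately show ?thesis by simp
  qed
  show "P u"
    by (rule current_induct) (fact P(1), (rule P(2); assumption), (rule P(3); assumption),
        (rule E; assumption), (rule F; assumption), (rule H; assumption))
qed (rule sc_add sc_mult sc_1 sc_comm c_comm)+

end

section \<open>Proper ideals from coinduced modules\<close>

text \<open>
  The projection to the span of the raising generators along that of the remaining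
  \<open>x(n)\<close>.
\<close>

definition raising_loop :: "loop_sl2 \<Rightarrow> loop_sl2" where
  "raising_loop = Poly_Mapping.mapp (\<lambda>n a. if n \<ge> 1 then a else if n = 0 then Sl2 (e_coord a) 0 0 else 0)"

lemma lookup_raising_loop:
  "coeff_at (raising_loop l) n = (if n \<ge> 1 then coeff_at l n else if n = 0 then Sl2 (e_coord (coeff_at l 0)) 0 0 else 0)"
  by (auto simp: raising_loop_def mapp.rep_eq when_def in_keys_iff sl2_ops_defs)

lemma raising_loop_linear:
  "raising_loop (l + l') = raising_loop l + raising_loop l'" "raising_loop (loop_scale t l) = loop_scale t (raising_loop l)"
  "raising_loop (l - l') = raising_loop l - raising_loop l'" "raising_loop (raising_loop l) = raising_loop l" "raising_loop 0 = 0"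
  by (rule poly_mapping_eqI, auto simp: lookup_raising_loop lookup_add lookup_minus lookup_loop_scale sl2_ops_defs)+

lemma raising_loop_single:
  "raising_loop (Poly_Mapping.single n a) =
    (if n \<ge> 1 then Poly_Mapping.single n a else if n = 0 then Poly_Mapping.single 0 (Sl2 (e_coord a) 0 0) else 0)"
  by (rule poly_mapping_eqI) (auto simp: lookup_raising_loop lookup_single when_def sl2_ops_defs)

lemma sl2_coords_add [simp]:
  "e_coord (x + y) = e_coord x + e_coord y" "f_coord (x + y) = f_coord x + f_coord y" "h_coord (x + y) = h_coord x + h_coord y"
  "e_coord (cscale t x) = t * e_coord x" "f_coord (cscale t x) = t * f_coord x" "h_coord (cscale t x) = t * h_coord x"
  "e_coord 0 = 0" "f_coord 0 = 0" "h_coord 0 = 0"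
  by (simp_all add: sl2_ops_defs)

lemma loop_bilinear_induct:
  assumes "\<And>n a m b. P (Poly_Mapping.single n a) (Poly_Mapping.single m b)"
    and "\<And>l l' k. P l k \<Longrightarrow> P l' k \<Longrightarrow> P (l + l') k" "\<And>l k k'. P l k \<Longrightarrow> P l k' \<Longrightarrow> P l (k + k')"
    and "\<And>k. P 0 k" "\<And>l. P l 0"
  shows "P (l :: loop_sl2) (k :: loop_sl2)"
proof (induction l rule: loop_induct)
  case (single n a)
  show ?case by (induction k rule: loop_induct) (use assms in auto)
qed (use assms in auto)

lemma raising_loop_brackets:
  "raising_loop (loop_bracket (raising_loop l) (raising_loop k)) = loop_bracket (raising_loop l) (raising_loop k)"
  "loop_cocycle (raising_loop l) (raising_loop k) = 0"
  "raising_loop (loop_bracket (l - raising_loop l) (k - raising_loop k)) = 0"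
  "h_coord (coeff_at (loop_bracket (l - raising_loop l) (k - raising_loop k)) 0) = 0"
  "loop_cocycle (l - raising_loop l) (k - raising_loop k) = 0"
  "e_coord (coeff_at (loop_bracket (raising_loop l) (raising_loop k)) 0) = 0"
  "f_coord (coeff_at (loop_bracket (raising_loop l) (raising_loop k)) 1) = 0"
proof -
  have zero: "Poly_Mapping.single k (Sl2 0 0 0) = 0" for k :: int
    by (simp flip: zero_sl2_def)
  define lw where "lw = (\<lambda>l. l - raising_loop l)"
  have low: "lw (Poly_Mapping.single n a) =
     (if n \<ge> 1 then 0 else if n = 0 then Poly_Mapping.single 0 (Sl2 0 (f_coord a) (h_coord a)) else Poly_Mapping.single n a)" for n a
    unfolding lw_def
    by (rule poly_mapping_eqI) (auto simp: raising_loop_single lookup_minus lookup_single when_def sl2_ops_defs sl2_eq_iff)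
  have lin: "lw (l + l') = lw l + lw l'" "lw 0 = 0" for l l'
    by (simp_all add: raising_loop_linear lw_def)
  show "raising_loop (loop_bracket (raising_loop l) (raising_loop k)) = loop_bracket (raising_loop l) (raising_loop k)"
    by (induction l k rule: loop_bilinear_induct)
      (auto simp: raising_loop_linear loop_bracket_add_left loop_bracket_add_right raising_loop_single loop_bracket_single sl2_ops_defs zero)
  show "loop_cocycle (raising_loop l) (raising_loop k) = 0"
    by (induction l k rule: loop_bilinear_induct)
      (auto simp: raising_loop_linear loop_cocycle_add_left loop_cocycle_add_right raising_loop_single loop_cocycle_single sl2_form_def)
  have "raising_loop (loop_bracket (lw l) (lw k)) = 0"
    by (induction l k rule: loop_bilinear_induct)
      (auto simp: lin low raising_loop_linear loop_bracket_add_left loop_bracket_add_right raising_loop_single loop_bracket_single sl2_ops_defs zero)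
  moreover have "h_coord (coeff_at (loop_bracket (lw l) (lw k)) 0) = 0"
    by (induction l k rule: loop_bilinear_induct)
      (auto simp: lin low loop_bracket_add_left loop_bracket_add_right loop_bracket_single lookup_add lookup_single when_def bracket_sl2_def)
  moreover have "loop_cocycle (lw l) (lw k) = 0"
    by (induction l k rule: loop_bilinear_induct)
      (auto simp: lin low loop_cocycle_add_left loop_cocycle_add_right loop_cocycle_single sl2_form_def)
  ultimately show "raising_loop (loop_bracket (l - raising_loop l) (k - raising_loop k)) = 0"
    "h_coord (coeff_at (loop_bracket (l - raising_loop l) (k - raising_loop k)) 0) = 0"
    "loop_cocycle (l - raising_loop l) (k - raising_loop k) = 0"
    unfolding lw_def by simp_all
  show "e_coord (coeff_at (loop_bracket (raising_loop l) (raising_loop k)) 0) = 0"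
    by (induction l k rule: loop_bilinear_induct)
      (auto simp: raising_loop_single raising_loop_linear loop_bracket_add_left loop_bracket_add_right loop_bracket_single lookup_add lookup_single when_def bracket_sl2_def)
  show "f_coord (coeff_at (loop_bracket (raising_loop l) (raising_loop k)) 1) = 0"
    by (induction l k rule: loop_bilinear_induct)
      (auto simp: raising_loop_single raising_loop_linear loop_bracket_add_left loop_bracket_add_right loop_bracket_single lookup_add lookup_single when_def bracket_sl2_def)
qed

definition raising_part :: "sl2_hat \<Rightarrow> sl2_hat" where
  "raising_part x = Hat (raising_loop (hat_loop x)) 0"

definition lower_part :: "sl2_hat \<Rightarrow> sl2_hat" where
  "lower_part x = Hat (hat_loop x - raising_loop (hat_loop x)) (hat_central x)"

definition lower_character :: "complex \<Rightarrow> complex \<Rightarrow> sl2_hat \<Rightarrow> complex" where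
  "lower_character \<kappa> s x = s * h_coord (coeff_at (hat_loop x) 0) + \<kappa> * hat_central x"

definition raising_character :: "complex \<Rightarrow> complex \<Rightarrow> sl2_hat \<Rightarrow> complex" where
  "raising_character lam mu x = lam * e_coord (coeff_at (hat_loop x) 0) + mu * f_coord (coeff_at (hat_loop x) 1)"

lemma affine_splitting: "lie_splitting raising_part lower_part (lower_character \<kappa> s)"
proof
  fix x y :: sl2_hat and t
  show "raising_part x + lower_part x = x" by (cases x) (simp add: raising_part_def lower_part_def sl2_hat_ops_defs)
  show "raising_part (x + y) = raising_part x + raising_part y" "lower_part (x + y) = lower_part x + lower_part y"
    by (simp_all add: raising_part_def lower_part_def sl2_hat_ops_defs raising_loop_linear)
  show "raising_part (cscale t x) = cscale t (raising_part x)" "lower_part (cscale t x) = cscale t (lower_part x)"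
    by (simp_all add: raising_part_def lower_part_def sl2_hat_ops_defs raising_loop_linear loop_scale_diff)
  show "lower_part (raising_part x) = 0" "raising_part (lower_part x) = 0"
    by (simp_all add: raising_part_def lower_part_def sl2_hat_ops_defs raising_loop_linear)
  show "lower_part (bracket (raising_part x) (raising_part y)) = 0" "raising_part (bracket (lower_part x) (lower_part y)) = 0"
    by (simp_all add: raising_part_def lower_part_def sl2_hat_ops_defs raising_loop_brackets)
  show "lower_character \<kappa> s (x + y) = lower_character \<kappa> s x + lower_character \<kappa> s y"
    "lower_character \<kappa> s (cscale t x) = t * lower_character \<kappa> s x"
    by (simp_all add: lower_character_def sl2_hat_ops_defs lookup_add lookup_loop_scale algebra_simps)
  show "lower_character \<kappa> s (bracket (lower_part x) (lower_part y)) = 0"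
    by (simp add: lower_character_def lower_part_def sl2_hat_ops_defs raising_loop_brackets)
qed

lemma raising_part_induct:
  assumes "\<And>x y. P x \<Longrightarrow> P y \<Longrightarrow> P (x + y)" "\<And>t x. P x \<Longrightarrow> P (cscale t x)"
    and "\<And>n. n \<ge> 0 \<Longrightarrow> P (hat_e n)" "\<And>n. n \<ge> 1 \<Longrightarrow> P (hat_h n)" "\<And>n. n \<ge> 1 \<Longrightarrow> P (hat_f n)"
  shows "P (raising_part x)"
proof -
  have zero: "P 0" using assms(2)[OF assms(3)[of 0], of 0] by simp
  have "P (Hat (raising_loop l) 0)" for l
  proof (induction l rule: loop_induct)
    case zero
    show ?case using \<open>P 0\<close> by (simp add: raising_loop_linear sl2_hat_ops_defs)
  next
    case (add l l')
    then show ?case using assms(1)[OF add] by (simp add: raising_loop_linear sl2_hat_ops_defs)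
  next
    case (single n a)
    have "Hat (raising_loop (Poly_Mapping.single n a)) 0 = (if n \<ge> 1 then cscale (e_coord a) (hat_e n) + cscale (f_coord a) (hat_f n) + cscale (h_coord a) (hat_h n)
        else if n = 0 then cscale (e_coord a) (hat_e 0) else 0)"
      using sl2_basis_expansion[of a]
      by (auto simp: raising_loop_single hat_gen_def sl2_hat_ops_defs loop_scale_single sl2_e_def sl2_f_def sl2_h_def sl2_ops_defs simp flip: single_add)
    moreover have "P (if n \<ge> 1 then cscale (e_coord a) (hat_e n) + cscale (f_coord a) (hat_f n) + cscale (h_coord a) (hat_h n)
        else if n = 0 then cscale (e_coord a) (hat_e 0) else 0)"
      using zero by (auto intro!: assms)
    ultimately show ?case by simp
  qed
  then show ?thesis by (simp add: raising_part_def)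
qed

lemma characters_on_generators:
  "raising_character lam mu (hat_e n) = (if n = 0 then lam else 0)" "raising_character lam mu (hat_h n) = 0"
  "raising_character lam mu (hat_f n) = (if n = 1 then mu else 0)"
  "lower_character \<kappa> s (hat_e n) = 0" "lower_character \<kappa> s (hat_f n) = 0"
  "lower_character \<kappa> s (hat_h n) = (if n = 0 then s else 0)" "lower_character \<kappa> s hat_c = \<kappa>"
  by (auto simp: raising_character_def lower_character_def hat_gen_def hat_c_def lookup_single when_def sl2_e_def sl2_f_def sl2_h_def zero_sl2_def)

lemma raising_part_generators:
  "n \<ge> 0 \<Longrightarrow> raising_part (hat_e n) = hat_e n" "n < 0 \<Longrightarrow> raising_part (hat_e n) = 0"
  "n \<ge> 1 \<Longrightarrow> raising_part (hat_h n) = hat_h n" "n \<le> 0 \<Longrightarrow> raising_part (hat_h n) = 0"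
  "n \<ge> 1 \<Longrightarrow> raising_part (hat_f n) = hat_f n" "n \<le> 0 \<Longrightarrow> raising_part (hat_f n) = 0"
  "raising_part hat_c = 0"
  by (cases "n = 0"; auto simp: raising_part_def hat_gen_def hat_c_def raising_loop_single sl2_hat_ops_defs raising_loop_linear sl2_e_def sl2_f_def sl2_h_def
      simp flip: zero_sl2_def)+

text \<open>
  Here \<open>A\<close> is the annihilator of a functional \<open>F\<close> in a coinduced module and \<open>ev u\<close> is
  the value of \<open>u F\<close> at the empty word. An element \<open>z\<close> that generates a Whittaker vector
  modulo \<open>J\<close> sends \<open>F\<close> to a functional with the same equivariance, and this is \<open>ev z\<close>
  times \<open>F\<close>. The eigenvalue of such a \<open>z\<close> on the quotient by \<open>A\<close> is thus computed by
  \<open>ev\<close>, which is governed by the parameter \<open>s\<close> of \<open>h(0)\<close>.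
\<close>

locale whittaker_functional =
  fixes A :: "sl2_hat uea set" and ev :: "sl2_hat uea \<Rightarrow> complex" and lam mu \<kappa> s :: complex
  assumes ideal: "left_ideal A" "standard.universal_ideal lam mu \<kappa> \<subseteq> A" "1 \<notin> A"
    and add: "ev (u + v) = ev u + ev v" and scale: "ev (uea_scalar t * u) = t * ev u" and one: "ev 1 = 1"
    and h: "ev (uh 0 * u) = s * ev u" and f: "ev (uf 0 * u) = 0" and e: "ev (ue (- 1) * u) = 0"
    and c: "ev (uc * u) = \<kappa> * ev u" and zero: "u \<in> standard.universal_ideal lam mu \<kappa> \<Longrightarrow> ev u = 0"
    and whittaker_vector:
      "(\<And>x. raising x \<Longrightarrow> standard.val x * z - uea_scalar (whittaker_character lam mu x) * z
          \<in> standard.universal_ideal lam mu \<kappa>) \<Longrightarrow> z - uea_scalar (ev z) \<in> A"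

text \<open>
  The functional \<open>F\<close> multiplies the values of the character on the letters of a word.
  The raising generators act on it by their characters.
\<close>

theorem whittaker_functional_exists: "\<exists>A ev. whittaker_functional A ev lam mu \<kappa> s"
proof -
  interpret lie_splitting raising_part lower_part "lower_character \<kappa> s" by (rule affine_splitting)
  let ?psi = "raising_character lam mu"
  define J where "J = standard.universal_ideal lam mu \<kappa>"
  define F where "F T = prod_list (map ?psi T)" for T
  have psi: "?psi (x + y) = ?psi x + ?psi y" "?psi (cscale t x) = t * ?psi x" for x y t
    by (simp_all add: raising_character_def sl2_hat_ops_defs lookup_add lookup_loop_scale algebra_simps)
  have psi_bracket: "?psi (bracket y z) = 0" if "y \<in> nil" "z \<in> nil" for y z
  proof -
    have "y = raising_part y" "z = raising_part z" using that nil_pn by simp_all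
    then show ?thesis
      by (metis (no_types) raising_part_def raising_character_def bracket_sl2_hat_def sl2_hat.sel(1) raising_loop_brackets(6,7) add.right_neutral mult_zero_right)
  qed
  have F: "admissible F"
    by (rule admissibleI) (simp_all add: F_def psi psi_bracket algebra_simps)
  have coact_nil': "coact y F T = ?psi y * F T" if "y \<in> nil" "T \<in> lists nil" for y T
    using that F by (simp add: coact_nil F_def)
  have coact_c: "coact hat_c F T = \<kappa> * F T" if "T \<in> lists nil" for T
  proof -
    have "lower_act T (lower_part hat_c) G = \<kappa> * G T" if "T \<in> lists nil" "admissible G" for T G
      using that
    proof (induction T arbitrary: G)
      case Nil
      have "lower_part hat_c = hat_c" using split[of hat_c] by (simp add: raising_part_generators)
      then show ?case by (simp add: characters_on_generators)
    next
      case (Cons y T)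
      have c: "lower_part hat_c = hat_c" using split[of hat_c] by (simp add: raising_part_generators)
      have "bracket y hat_c = 0" using bracket_skew[of y hat_c] by (simp add: hat_brackets(2))
      then show ?case
        using Cons lower_act_scale[of G T 0 0] by (simp add: c admissible_Cons admissible_zero)
    qed
    then show ?thesis using that F by (simp add: coact_def raising_part_generators admissible_zero)
  qed
  define A where "A = annihilator F"
  define ev where "ev u = uea_act u F []" for u
  have A: "left_ideal A" unfolding A_def by (rule left_ideal_annihilator[OF F])
  have ann: "uea_incl x - uea_scalar t \<in> A" if "\<And>T. T \<in> lists nil \<Longrightarrow> coact x F T = t * F T" for x t
    using that F by (simp add: A_def annihilator_def uea_act_simps)
  have nils: "n \<ge> 0 \<Longrightarrow> hat_e n \<in> nil" "n \<ge> 1 \<Longrightarrow> hat_h n \<in> nil" "n \<ge> 1 \<Longrightarrow> hat_f n \<in> nil" for n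
    using pn_nil[of "hat_e n"] pn_nil[of "hat_h n"] pn_nil[of "hat_f n"] by (simp_all add: raising_part_generators)
  have gen: "uea_incl x - uea_scalar (?psi x) \<in> A" if "x \<in> nil" for x
    by (rule ann) (rule coact_nil'[OF that])
  have J: "J \<subseteq> A"
    unfolding J_def standard.universal_ideal_def
  proof (rule generated_ideal_le[OF A])
    have s0: "uea_scalar 0 = (0 :: sl2_hat uea)" by (rule standard.sc_0)
    have "uc - uea_scalar \<kappa> \<in> A" by (rule ann) (rule coact_c)
    moreover have "ue 0 - uea_scalar lam \<in> A" using gen[OF nils(1)[of 0]] by (simp add: characters_on_generators)
    moreover have "uf 1 - uea_scalar mu \<in> A" using gen[OF nils(3)[of 1]] by (simp add: characters_on_generators)
    moreover have "ue i \<in> A" "uh i \<in> A" "uf (i + 1) \<in> A" if "i \<ge> 1" for i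
      using gen[OF nils(1)[of i]] gen[OF nils(2)[of i]] gen[OF nils(3)[of "i + 1"]] that by (simp_all add: characters_on_generators s0)
    ultimately show "standard.whittaker_relations lam mu \<kappa> \<subseteq> A"
      unfolding standard.whittaker_relations_def by auto
  qed
  have ev1: "ev 1 = 1" using F by (simp add: ev_def uea_act_simps F_def)
  then have one: "1 \<notin> A" by (auto simp: A_def annihilator_def ev_def intro!: bexI[of _ "[]"])
  have ev_incl: "ev (uea_incl x * u) = lower_character \<kappa> s x * ev u" if "raising_part x = 0" for x u
  proof -
    have "lower_part x = x" using split[of x] that by simp
    then show ?thesis
      using F that admissible_zero[OF admissible_uea_act[OF F, of u], of "[]"]
      by (simp add: ev_def uea_act_simps admissible_uea_act) (simp add: coact_def)
  qed
  have ev_scalar: "ev (uea_scalar t * u) = t * ev u" for t u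
    using F by (simp add: ev_def uea_act_simps admissible_uea_act)
  have whit: "z - uea_scalar (ev z) \<in> A"
    if z: "\<And>x. raising x \<Longrightarrow> standard.val x * z - uea_scalar (whittaker_character lam mu x) * z \<in> J" for z
  proof -
    have z': "uea_incl (raising_part x) * z - uea_scalar (?psi (raising_part x)) * z \<in> A" for x
    proof (induction x rule: raising_part_induct)
      case (1 x y)
      then show ?case using left_idealD(2)[OF A 1] by (simp add: uea_incl_add psi uea_scalar_hom algebra_simps)
    next
      case (2 t x)
      then show ?case using left_idealD(3)[OF A 2, of "uea_scalar t"]
        by (simp add: uea_incl_scale psi uea_scalar_hom right_diff_distrib mult.assoc)
    next
      case (3 n)
      then show ?case using z[of "gE n"] J by (auto simp: characters_on_generators)
    next
      case (4 n)
      then show ?case using z[of "gH n"] J by (auto simp: characters_on_generators)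
    next
      case (5 n)
      then show ?case using z[of "gF n"] J by (auto simp: characters_on_generators)
    qed
    have "uea_act z F T = ev z * F T" if "T \<in> lists nil" for T
      using that
    proof (induction T)
      case Nil
      have "F [] = 1" by (simp add: F_def)
      then show ?case by (simp add: ev_def)
    next
      case (Cons y T)
      then have y: "y \<in> nil" "raising_part y = y" and T: "T \<in> lists nil" using nil_pn by auto
      have "uea_act (uea_incl y * z - uea_scalar (?psi y) * z) F T = 0"
        using z'[of y] y(2) T by (simp add: A_def annihilator_def)
      then have "uea_act z F (y # T) = ?psi y * uea_act z F T"
        using F T y by (simp add: uea_act_simps admissible_uea_act coact_nil)
      moreover have "F (y # T) = ?psi y * F T" by (simp add: F_def)
      ultimately show ?case using Cons.IH T by simp
    qed
    then show ?thesis using F by (simp add: A_def annihilator_def uea_act_simps)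
  qed
  have "whittaker_functional A ev lam mu \<kappa> s"
  proof
    show "ev (u + v) = ev u + ev v" for u v using F by (simp add: ev_def uea_act_simps)
    show "ev u = 0" if "u \<in> standard.universal_ideal lam mu \<kappa>" for u
      using that J by (auto simp: A_def annihilator_def ev_def J_def)
    show "z - uea_scalar (ev z) \<in> A"
      if "\<And>x. raising x \<Longrightarrow> standard.val x * z - uea_scalar (whittaker_character lam mu x) * z
        \<in> standard.universal_ideal lam mu \<kappa>" for z
      using that by (intro whit) (simp add: J_def)
    show "standard.universal_ideal lam mu \<kappa> \<subseteq> A" using J by (simp add: J_def)
  qed (auto simp: ev_incl raising_part_generators characters_on_generators A one ev_scalar ev1)
  then show ?thesis by blast
qed

section \<open>Spectral parameters\<close>

context universal_whittaker
begin

text \<open>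
  The commutator of \<open>L(0)\<close> with \<open>x(n)\<close> is \<open>- n x(n)\<close>, and the only generator with
  nonzero character is \<open>e(0)\<close>, for which \<open>n = 0\<close>.
\<close>

lemma sugawara_zero_whittaker:
  assumes "mu = 0" "raising x" "z \<approx> sugawara_op 0 1"
  shows "val x * z - sc (whittaker_character lam mu x) * z \<in> J"
proof -
  have "sc (whittaker_character lam mu x) * z \<approx> sc (whittaker_character lam mu x) * sugawara_op 0 1"
    by (rule cong_mult[OF assms(3)])
  also have "\<dots> \<approx> sugawara_op 0 (sc (whittaker_character lam mu x) * 1)"
    by (rule cong_sym[OF sugawara_op_scalar])
  also have "\<dots> \<approx> sugawara_op 0 (val x * 1)"
    using cong_sym[OF sugawara_op_cong[OF val_character[OF assms(2)]]] by simp
  also have "\<dots> \<approx> val x * sugawara_op 0 1 - of_int (mode x) * (val (shift 0 x) * 1)" by (rule sugawara_op_val)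
  also have "\<dots> \<approx> val x * sugawara_op 0 1 - 0"
  proof (rule cong_diff[OF cong_refl])
    have "shift 0 x = x" by (cases x) simp_all
    then have "of_int (mode x) * (val (shift 0 x) * 1) \<approx> of_int (mode x) * sc (whittaker_character lam mu x)"
      using cong_mult[OF val_character[OF assms(2)]] by simp
    also have "of_int (mode x) * sc (whittaker_character lam mu x) = 0"
      using assms(1) by (cases x) auto
    finally show "of_int (mode x) * (val (shift 0 x) * 1) \<approx> 0" .
  qed
  also have "val x * sugawara_op 0 1 - 0 \<approx> val x * z" using cong_mult[OF cong_sym[OF assms(3)], of "val x"] by simp
  finally have "sc (whittaker_character lam mu x) * z \<approx> val x * z" .
  from cong_sym[OF this] show ?thesis by (simp add: left_cong_def)
qed

end

text \<open>
  The element \<open>z\<close> plays the role of \<open>L(0)\<close>. Its eigenvalues parametrise the simple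
  quotients: every complex number occurs as an eigenvalue in a proper quotient, the
  proper left ideals with a given eigenvalue are closed under sums, and each maximal
  left ideal admits a vector \<open>g\<close> that satisfies the relations of the cyclic vector and
  is an eigenvector of \<open>z\<close>.
\<close>

definition spectral_parameter :: "'a::ring_1 set \<Rightarrow> (complex \<Rightarrow> 'a) \<Rightarrow> 'a \<Rightarrow> bool" where
  "spectral_parameter J sc z \<longleftrightarrow>
     (\<forall>a. \<exists>K. left_ideal K \<and> J \<subseteq> K \<and> z - sc a \<in> K \<and> 1 \<notin> K) \<and>
     (\<forall>a I I' u u'. left_ideal I \<and> J \<subseteq> I \<and> z - sc a \<in> I \<and> left_ideal I' \<and> J \<subseteq> I' \<and> z - sc a \<in> I'
        \<and> u + u' = 1 \<and> u \<in> I \<and> u' \<in> I' \<longrightarrow> 1 \<in> I \<or> 1 \<in> I') \<and>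
     (\<forall>I. left_ideal I \<and> J \<subseteq> I \<and> 1 \<notin> I \<and> (\<forall>K. left_ideal K \<longrightarrow> I \<subseteq> K \<longrightarrow> 1 \<notin> K \<longrightarrow> K = I) \<longrightarrow>
        (\<exists>a g. g \<notin> I \<and> J \<subseteq> {u. u * g \<in> I} \<and> (z - sc a) * g \<in> I))"

context universal_whittaker
begin

lemma spectral_parameter_sugawara:
  assumes "lam \<noteq> 0" "mu = 0"
    and proper: "\<And>a. \<exists>K. left_ideal K \<and> J \<subseteq> K \<and> sugawara_op 0 1 - sc a \<in> K \<and> 1 \<notin> K"
    and z: "left_cong J z (sugawara_op 0 1)"
  shows "spectral_parameter J sc z"
proof -
  have mem: "z - sc a \<in> I \<longleftrightarrow> sugawara_op 0 1 - sc a \<in> I" if "left_ideal I" "J \<subseteq> I" for I a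
  proof -
    have "z - sugawara_op 0 1 \<in> I" using z that(2) by (auto simp: left_cong_def)
    from left_idealD(2)[OF that(1) this, of "sugawara_op 0 1 - sc a"] left_idealD(5)[OF that(1) _ this, of "z - sc a"]
    show ?thesis by auto
  qed
  show ?thesis
    unfolding spectral_parameter_def
  proof (intro conjI allI impI)
    show "\<exists>K. left_ideal K \<and> J \<subseteq> K \<and> z - sc a \<in> K \<and> 1 \<notin> K" for a
      using proper[of a] mem by blast
  next
    fix a I I' u u'
    assume "left_ideal I \<and> J \<subseteq> I \<and> z - sc a \<in> I \<and> left_ideal I' \<and> J \<subseteq> I' \<and> z - sc a \<in> I'
        \<and> u + u' = 1 \<and> u \<in> I \<and> u' \<in> I'"
    then show "1 \<in> I \<or> 1 \<in> I'"
      using degenerate_local_ideals[OF assms(1,2), of I a I' u u'] mem by blast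
  next
    fix I
    assume *: "left_ideal I \<and> J \<subseteq> I \<and> 1 \<notin> I \<and> (\<forall>K. left_ideal K \<longrightarrow> I \<subseteq> K \<longrightarrow> 1 \<notin> K \<longrightarrow> K = I)"
    then have I: "left_ideal I" "J \<subseteq> I" "1 \<notin> I" and max: "\<And>K. left_ideal K \<Longrightarrow> I \<subseteq> K \<Longrightarrow> 1 \<notin> K \<Longrightarrow> K = I"
      by auto
    have "\<exists>K a. left_ideal K \<and> J \<subseteq> K \<and> sugawara_op 0 1 - sc a \<in> K \<and> 1 \<notin> K" using proper by blast
    from degenerate_maximal_ideals[OF assms(1,2) I max this]
    obtain a g where g: "g \<notin> I" "J \<subseteq> {u. u * g \<in> I}" "(sugawara_op 0 1 - sc a) * g \<in> I" by auto
    have "(z - sc a) * g \<in> I"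
      using mem[of "{u. u * g \<in> I}" a] g * left_ideal_transporter[of I g] by auto
    then show "\<exists>a g. g \<notin> I \<and> J \<subseteq> {u. u * g \<in> I} \<and> (z - sc a) * g \<in> I" using g by blast
  qed
qed

end

text \<open>Replacing \<open>z\<close> by \<open>b - z\<close> only renames the eigenvalues.\<close>

lemma spectral_parameter_reflect:
  assumes sp: "spectral_parameter J sc z'" and z: "left_cong J (z + z') (sc b)"
    and sc: "\<And>s t. sc (s - t) = sc s - sc t"
  shows "spectral_parameter J sc z"
proof -
  have mem: "z - sc a \<in> I \<longleftrightarrow> z' - sc (b - a) \<in> I" if I: "left_ideal I" "J \<subseteq> I" for I a
  proof -
    have 1: "(z - sc a) + (z' - sc (b - a)) \<in> I" using z I(2) by (auto simp: left_cong_def sc algebra_simps)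
    show ?thesis
      using left_idealD(5)[OF I(1) 1, of "z - sc a"] left_idealD(5)[OF I(1) 1, of "z' - sc (b - a)"] by auto
  qed
  have b: "b - (b - a) = a" for a by simp
  show ?thesis
    unfolding spectral_parameter_def
  proof (intro conjI allI impI)
    fix a
    obtain K where "left_ideal K \<and> J \<subseteq> K \<and> z' - sc (b - a) \<in> K \<and> 1 \<notin> K"
      using sp[unfolded spectral_parameter_def, THEN conjunct1, rule_format, of "b - a"] by blast
    then show "\<exists>K. left_ideal K \<and> J \<subseteq> K \<and> z - sc a \<in> K \<and> 1 \<notin> K"
      using mem by blast
  next
    fix a I I' u u'
    assume *: "left_ideal I \<and> J \<subseteq> I \<and> z - sc a \<in> I \<and> left_ideal I' \<and> J \<subseteq> I' \<and> z - sc a \<in> I'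
        \<and> u + u' = 1 \<and> u \<in> I \<and> u' \<in> I'"
    then have "z' - sc (b - a) \<in> I" "z' - sc (b - a) \<in> I'" using mem by blast+
    with * show "1 \<in> I \<or> 1 \<in> I'"
      using sp[unfolded spectral_parameter_def, THEN conjunct2, THEN conjunct1, rule_format, of I "b - a" I' u u'] by simp
  next
    fix I
    assume *: "left_ideal I \<and> J \<subseteq> I \<and> 1 \<notin> I \<and> (\<forall>K. left_ideal K \<longrightarrow> I \<subseteq> K \<longrightarrow> 1 \<notin> K \<longrightarrow> K = I)"
    then obtain a g where g: "g \<notin> I" "J \<subseteq> {u. u * g \<in> I}" "(z' - sc a) * g \<in> I"
      using sp[unfolded spectral_parameter_def, THEN conjunct2, THEN conjunct2, rule_format, of I] by auto
    have "(z - sc (b - a)) * g \<in> I"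
      using mem[of "{u. u * g \<in> I}" "b - a"] g * left_ideal_transporter[of I g] unfolding b by auto
    then show "\<exists>a g. g \<notin> I \<and> J \<subseteq> {u. u * g \<in> I} \<and> (z - sc a) * g \<in> I" using g by blast
  qed
qed

text \<open>
  The value of \<open>L(0)\<close> on the cyclic vector, according to \<open>sugawara_zero\<close>.
\<close>

definition affine_sugawara :: "complex \<Rightarrow> complex \<Rightarrow> sl2_hat uea" where
  "affine_sugawara \<kappa> mu = uea_scalar (inverse (4 * (\<kappa> + 2))) * (standard.casimir + uea_scalar (4 * mu) * ue (- 1))"

lemma quadratic_root: "\<exists>s::complex. s * s + 2 * s = r"
proof -
  have "(csqrt (1 + r) - 1) * (csqrt (1 + r) - 1) + 2 * (csqrt (1 + r) - 1) = (csqrt (1 + r))\<^sup>2 - 1"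
    by (simp add: power2_eq_square algebra_simps)
  then show ?thesis by (intro exI[of _ "csqrt (1 + r) - 1"]) simp
qed

text \<open>The annihilator of any Whittaker functional is a proper left ideal above it.\<close>

lemma universal_ideal_proper: "1 \<notin> standard.universal_ideal lam mu \<kappa>"
proof -
  obtain A ev where "whittaker_functional A ev lam mu \<kappa> 0" using whittaker_functional_exists by blast
  then show ?thesis by (auto simp: whittaker_functional_def)
qed

text \<open>
  By the formula for the Casimir element, \<open>ev\<close> takes the value
  \<open>(s\<^sup>2 + 2 s) / (4 (\<kappa> + 2))\<close> at \<open>L(0)\<close>. Every \<open>a\<close> is of this form, which
  yields the proper left ideals.
\<close>

theorem spectral_parameter_e:
  assumes \<kappa>: "\<kappa> \<noteq> - 2" and lam: "lam \<noteq> 0"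
  shows "spectral_parameter (standard.universal_ideal lam 0 \<kappa>) uea_scalar (affine_sugawara \<kappa> 0)"
proof -
  interpret V: universal_whittaker uea_scalar ue uh uf uc lam 0 \<kappa> using \<kappa> by unfold_locales
  let ?L = "V.sugawara_op 0 1"
  have k: "4 * (\<kappa> + 2) \<noteq> 0" using \<kappa> by (simp add: add_eq_0_iff2)
  show ?thesis
  proof (rule V.spectral_parameter_sugawara[OF lam refl])
    show "left_cong V.J (affine_sugawara \<kappa> 0) ?L"
      using V.cong_sym[OF V.sugawara_zero] by (simp add: affine_sugawara_def)
    fix a
    \<comment> \<open>The parameter for which \<open>ev\<close> takes the value \<open>a\<close> at \<open>L(0)\<close>.\<close>
    obtain s where s: "s * s + 2 * s = 4 * (\<kappa> + 2) * a" using quadratic_root by blast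
    obtain A ev where "whittaker_functional A ev lam 0 \<kappa> s" using whittaker_functional_exists by blast
  then interpret ev: whittaker_functional A ev lam 0 \<kappa> s .
    have ev_cong: "ev u = ev v" if "left_cong V.J u v" for u v
      using ev.zero[of "u - v"] that ev.add[of "u - v" v] by (simp add: left_cong_def)
    have num: "ev (4 * u) = 4 * ev u" "ev (2 * u) = 2 * ev u" for u
      using ev.scale[of 4 u] ev.scale[of 2 u] by (simp_all add: standard.sc_numeral)
    have h1: "ev (uh 0) = s" using ev.h[of 1] ev.one by simp
    have "ev ?L = ev (uea_scalar (inverse (4 * (\<kappa> + 2))) * standard.casimir)"
      using ev_cong[OF V.sugawara_zero] by simp
    also have "\<dots> = inverse (4 * (\<kappa> + 2)) * (s * s + 2 * s)"
      unfolding ev.scale standard.casimir_expand by (simp add: ev.add num ev.f ev.h h1)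
    also have "\<dots> = a" unfolding s by (metis k left_inverse mult.assoc mult_1)
    finally have "?L - uea_scalar a \<in> A" using ev.whittaker_vector[of ?L] V.sugawara_zero_whittaker[OF refl _ V.cong_refl] by simp
    then show "\<exists>K. left_ideal K \<and> V.J \<subseteq> K \<and> ?L - uea_scalar a \<in> K \<and> 1 \<notin> K" using ev.ideal by blast
  qed
qed

text \<open>The relations of both sides agree up to signs.\<close>

lemma twisted_universal_ideal:
  assumes \<kappa>: "\<kappa> \<noteq> - 2"
  shows "affine_currents.universal_ideal uea_scalar (\<lambda>n. uf (n + 1)) (\<lambda>n. (if n = 0 then uc else 0) - uh n) (\<lambda>n. ue (n - 1)) uc mu 0 \<kappa>
     = standard.universal_ideal 0 mu \<kappa>"
proof -
  interpret twisted: affine_currents uea_scalar "\<lambda>n. uf (n + 1)" "\<lambda>n. (if n = 0 then uc else 0) - uh n" "\<lambda>n. ue (n - 1)" uc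
    by (rule standard.twisted_currents)
  interpret W: universal_whittaker uea_scalar "\<lambda>n. uf (n + 1)" "\<lambda>n. (if n = 0 then uc else 0) - uh n" "\<lambda>n. ue (n - 1)" uc mu 0 \<kappa>
    using \<kappa> by unfold_locales
  interpret V: universal_whittaker uea_scalar ue uh uf uc 0 mu \<kappa> using \<kappa> by unfold_locales
  have neg: "- u \<in> I \<longleftrightarrow> u \<in> I" if "left_ideal I" for I and u :: "sl2_hat uea"
    using left_idealD(4)[OF that, of u] left_idealD(4)[OF that, of "- u"] by auto
  have 1: "uf 1 - uea_scalar mu \<in> W.J" "ue 0 \<in> W.J" "uc - uea_scalar \<kappa> \<in> W.J"
    using W.relations_in_J(1-3) by (simp_all add: standard.sc_0)
  have 2: "uf (i + 1) \<in> W.J" "uh i \<in> W.J" "ue i \<in> W.J" if "i \<ge> 1" for i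
    using W.relations_in_J(4)[of i] W.relations_in_J(5)[of i] W.relations_in_J(6)[of "i + 1"] that
    by (simp_all add: neg[OF W.left_ideal_J])
  have 3: "ue 0 \<in> V.J" using V.relations_in_J(1) by (simp add: standard.sc_0)
  have 4: "uf (i + 1) \<in> V.J" "(if i = 0 then uc else 0) - uh i \<in> V.J" "ue (i + 1 - 1) \<in> V.J" if "i \<ge> 1" for i
    using V.relations_in_J(6)[of "i + 1"] V.relations_in_J(5)[of i] V.relations_in_J(4)[of i] that
    by (simp_all add: neg[OF V.left_ideal_J])
  have "W.J \<subseteq> V.J"
    unfolding twisted.universal_ideal_def
  proof (rule generated_ideal_le[OF V.left_ideal_J])
    have "{uf (0 + 1) - uea_scalar mu, ue (1 - 1) - uea_scalar 0, uc - uea_scalar \<kappa>} \<subseteq> V.J"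
      using 3 V.relations_in_J(2,3) by (simp add: standard.sc_0)
    then show "twisted.whittaker_relations mu 0 \<kappa> \<subseteq> V.J"
      unfolding twisted.whittaker_relations_def using 4 by (intro Un_least) blast+
  qed
  moreover have "V.J \<subseteq> W.J"
    unfolding standard.universal_ideal_def
  proof (rule generated_ideal_le[OF W.left_ideal_J])
    have "{ue 0 - uea_scalar 0, uf 1 - uea_scalar mu, uc - uea_scalar \<kappa>} \<subseteq> W.J"
      using 1 by (simp add: standard.sc_0)
    then show "standard.whittaker_relations 0 mu \<kappa> \<subseteq> W.J"
      unfolding standard.whittaker_relations_def using 2 by (intro Un_least) blast+
  qed
  ultimately show ?thesis by blast
qed

text \<open>
  The twisted currents reduce this to the case where \<open>mu\<close> vanishes. If \<open>L'(0)\<close> denotes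
  their Sugawara operator, then \<open>h(0) / 2 - L(0) = \<kappa> / 4 - L'(0)\<close> on the cyclic
  vector, and \<open>L'(0)\<close> is a spectral parameter. Its value under \<open>ev\<close> is
  \<open>(t\<^sup>2 + 2 t) / (4 (\<kappa> + 2))\<close> with \<open>t = \<kappa> - s\<close>, the eigenvalue of
  \<open>c - h(0)\<close>.
\<close>

theorem spectral_parameter_f:
  assumes \<kappa>: "\<kappa> \<noteq> - 2" and mu: "mu \<noteq> 0"
  shows "spectral_parameter (standard.universal_ideal 0 mu \<kappa>) uea_scalar
    (uea_scalar (1 / 2) * uh 0 - affine_sugawara \<kappa> mu)"
proof -
  interpret twisted: affine_currents uea_scalar "\<lambda>n. uf (n + 1)" "\<lambda>n. (if n = 0 then uc else 0) - uh n" "\<lambda>n. ue (n - 1)" uc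
    by (rule standard.twisted_currents)
  interpret W: universal_whittaker uea_scalar "\<lambda>n. uf (n + 1)" "\<lambda>n. (if n = 0 then uc else 0) - uh n" "\<lambda>n. ue (n - 1)" uc mu 0 \<kappa>
    using \<kappa> by unfold_locales
  interpret V: universal_whittaker uea_scalar ue uh uf uc 0 mu \<kappa> using \<kappa> by unfold_locales
  have J: "W.J = V.J" by (rule twisted_universal_ideal[OF \<kappa>])
  define L where "L = W.sugawara_op 0 1"
  have k: "4 * (\<kappa> + 2) \<noteq> 0" using \<kappa> by (simp add: add_eq_0_iff2)
  have casimir: "twisted.casimir = 4 * (ue (- 1) * uf 1) + 2 * (uc - uh 0) + (uc - uh 0) * (uc - uh 0)"
    by (simp add: twisted.casimir_expand)
  have L_cong: "left_cong V.J L (uea_scalar (inverse (4 * (\<kappa> + 2))) * twisted.casimir)"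
    using W.sugawara_zero[folded L_def, unfolded J] by (simp add: standard.sc_0)
  have "spectral_parameter V.J uea_scalar L"
  proof (rule W.spectral_parameter_sugawara[OF mu refl, folded L_def, unfolded J])
    show "left_cong V.J L L" by (rule V.cong_refl)
    fix a
    \<comment> \<open>The parameter \<open>s\<close> is chosen so that \<open>c - h(0)\<close> has eigenvalue \<open>t\<close>.\<close>
    obtain t where t: "t * t + 2 * t = 4 * (\<kappa> + 2) * a" using quadratic_root by blast
    define s where "s = \<kappa> - t"
    obtain A ev where "whittaker_functional A ev 0 mu \<kappa> s" using whittaker_functional_exists by blast
  then interpret ev: whittaker_functional A ev 0 mu \<kappa> s .
    have diff: "ev (u - v) = ev u - ev v" for u v using ev.add[of "u - v" v] by simp
    have ev_cong: "ev u = ev v" if "left_cong V.J u v" for u v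
      using ev.zero[of "u - v"] that diff[of u v] by (simp add: left_cong_def)
    have num: "ev (4 * u) = 4 * ev u" "ev (2 * u) = 2 * ev u" for u
      using ev.scale[of 4 u] ev.scale[of 2 u] by (simp_all add: standard.sc_numeral)
    have ch: "ev ((uc - uh 0) * u) = t * ev u" for u by (simp add: left_diff_distrib diff ev.h ev.c s_def)
    have ch1: "ev (uc - uh 0) = t" using ch[of 1] ev.one by simp
    have "ev L = ev (uea_scalar (inverse (4 * (\<kappa> + 2))) * twisted.casimir)"
      by (rule ev_cong[OF L_cong])
    also have "\<dots> = inverse (4 * (\<kappa> + 2)) * (t * t + 2 * t)"
      unfolding ev.scale casimir by (simp only: ev.add num ev.e ch ch1) simp
    also have "\<dots> = a" unfolding t by (metis k left_inverse mult.assoc mult_1)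
    finally have ev: "ev L = a" .
    have "standard.val x * L - uea_scalar (whittaker_character 0 mu x) * L \<in> V.J" if x: "raising x" for x
    proof -
      note * = W.sugawara_zero_whittaker[OF refl _ W.cong_refl, folded L_def, unfolded J]
      show ?thesis
      proof (cases x)
        case (gE n)
        show ?thesis using *[of "gF (n + 1)"] x by (auto simp: gE standard.sc_0)
      next
        case (gH n)
        then show ?thesis using *[of "gH n"] x left_idealD(4)[OF V.left_ideal_J, of "- (uh n * L)"] by (auto simp: standard.sc_0)
      next
        case (gF n)
        show ?thesis using *[of "gE (n - 1)"] x by (auto simp: gF standard.sc_0)
      qed
    qed
    then have "L - uea_scalar a \<in> A" using ev.whittaker_vector[of L] ev by simp
    then show "\<exists>K. left_ideal K \<and> V.J \<subseteq> K \<and> L - uea_scalar a \<in> K \<and> 1 \<notin> K" using ev.ideal by blast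
  qed
  then show ?thesis
  proof (rule spectral_parameter_reflect)
    let ?i = "inverse (4 * (\<kappa> + 2))"
    have J1: "left_cong V.J (uf 1) (uea_scalar mu)" "left_cong V.J uc (uea_scalar \<kappa>)" "left_cong V.J (ue 0) 0"
      using V.relations_in_J(1-3) by (simp_all add: left_cong_def standard.sc_0)
    have "left_cong V.J standard.casimir (4 * (uf 0 * 0) + 2 * uh 0 + uh 0 * uh 0)"
      unfolding standard.casimir_expand by (intro V.cong_add V.cong_mult V.cong_refl J1)
    then have A: "left_cong V.J (affine_sugawara \<kappa> mu)
        (uea_scalar ?i * ((2 * uh 0 + uh 0 * uh 0) + uea_scalar (4 * mu) * ue (- 1)))"
      unfolding affine_sugawara_def by (intro V.cong_mult V.cong_add V.cong_refl) simp_all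
    let ?b = "uc - uh 0"
    have sq: "left_cong V.J (?b * ?b) (uea_scalar \<kappa> * uea_scalar \<kappa> - 2 * (uea_scalar \<kappa> * uh 0) + uh 0 * uh 0)"
    proof -
      have "?b * ?b = uc * uc - 2 * (uh 0 * uc) + uh 0 * uh 0"
        using standard.c_comm[of "uh 0"] by (simp add: algebra_simps mult_2)
      also have "left_cong V.J \<dots> (uc * uea_scalar \<kappa> - 2 * (uh 0 * uea_scalar \<kappa>) + uh 0 * uh 0)"
        by (intro V.cong_add V.cong_diff V.cong_mult V.cong_refl J1)
      also have "\<dots> = uea_scalar \<kappa> * uc - 2 * (uea_scalar \<kappa> * uh 0) + uh 0 * uh 0"
        using standard.c_comm[of "uea_scalar \<kappa>"] standard.sc_comm[of \<kappa> "uh 0"] by simp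
      also have "left_cong V.J \<dots> (uea_scalar \<kappa> * uea_scalar \<kappa> - 2 * (uea_scalar \<kappa> * uh 0) + uh 0 * uh 0)"
        by (intro V.cong_add V.cong_diff V.cong_mult V.cong_refl J1)
      finally show ?thesis .
    qed
    have B: "left_cong V.J L (uea_scalar ?i * (4 * (ue (- 1) * uea_scalar mu) + 2 * (uea_scalar \<kappa> - uh 0)
        + (uea_scalar \<kappa> * uea_scalar \<kappa> - 2 * (uea_scalar \<kappa> * uh 0) + uh 0 * uh 0)))"
      by (rule V.cong_trans[OF L_cong], unfold casimir) (intro V.cong_mult V.cong_add V.cong_diff V.cong_refl J1 sq)
    have "left_cong V.J (uea_scalar (1 / 2) * uh 0 - affine_sugawara \<kappa> mu + L)
       (uea_scalar (1 / 2) * uh 0 - uea_scalar ?i * ((2 * uh 0 + uh 0 * uh 0) + uea_scalar (4 * mu) * ue (- 1))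
        + uea_scalar ?i * (4 * (ue (- 1) * uea_scalar mu) + 2 * (uea_scalar \<kappa> - uh 0)
        + (uea_scalar \<kappa> * uea_scalar \<kappa> - 2 * (uea_scalar \<kappa> * uh 0) + uh 0 * uh 0)))"
      by (intro V.cong_add V.cong_diff A B V.cong_refl)
    also have "\<dots> = uea_scalar (1 / 2) * uh 0 + uea_scalar ?i * (2 * uea_scalar \<kappa> + uea_scalar \<kappa> * uea_scalar \<kappa>
        - (2 * uh 0 + 2 * uh 0 + 2 * (uea_scalar \<kappa> * uh 0)))"
    proof -
      have "4 * (ue (- 1) * uea_scalar mu) = uea_scalar (4 * mu) * ue (- 1)"
        using standard.sc_comm[of mu "ue (- 1)"] by (simp add: standard.sc_mult standard.sc_numeral mult.assoc)
      then show ?thesis by (simp add: algebra_simps)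
    qed
    also have "2 * uea_scalar \<kappa> + uea_scalar \<kappa> * uea_scalar \<kappa> = (uea_scalar (2 * \<kappa> + \<kappa> * \<kappa>) :: sl2_hat uea)"
      by (simp add: standard.sc_mult standard.sc_add standard.sc_numeral)
    also have "2 * uh 0 + 2 * uh 0 + 2 * (uea_scalar \<kappa> * uh 0) = uea_scalar (2 + 2 + 2 * \<kappa>) * uh 0"
      by (simp only: standard.sc_mult standard.sc_add standard.sc_numeral distrib_right mult.assoc)
    also have "2 + 2 = (4 :: complex)" by simp
    also have "uea_scalar (1 / 2) * uh 0 + uea_scalar ?i * (uea_scalar (2 * \<kappa> + \<kappa> * \<kappa>) - uea_scalar (4 + 2 * \<kappa>) * uh 0)
        = uea_scalar (?i * (2 * \<kappa> + \<kappa> * \<kappa>)) + uea_scalar (1 / 2 - ?i * (4 + 2 * \<kappa>)) * uh 0"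
      by (simp only: standard.sc_mult standard.sc_diff right_diff_distrib left_diff_distrib mult.assoc) simp
    also have "1 / 2 - ?i * (4 + 2 * \<kappa>) = 0"
    proof -
      have "?i * (4 + 2 * \<kappa>) = ?i * (4 * (\<kappa> + 2)) / 2" by (simp add: algebra_simps)
      also have "\<dots> = 1 / 2" using left_inverse[OF k] by metis
      finally show ?thesis by simp
    qed
    finally show "left_cong V.J (uea_scalar (1 / 2) * uh 0 - affine_sugawara \<kappa> mu + L) (uea_scalar (?i * (2 * \<kappa> + \<kappa> * \<kappa>)))"
      by (simp add: standard.sc_0)
  qed (rule standard.sc_diff)
qed

text \<open>
  If the character vanishes, \<open>h(0)\<close> generates a Whittaker vector with value \<open>b\<close> under
  \<open>ev\<close>.
\<close>

theorem verma_proper: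
  assumes \<kappa>: "\<kappa> \<noteq> - 2"
  shows "\<exists>K. left_ideal K \<and> standard.universal_ideal 0 0 \<kappa> \<subseteq> K \<and> uh 0 - uea_scalar b \<in> K \<and> 1 \<notin> K"
proof -
  obtain A ev where "whittaker_functional A ev 0 0 \<kappa> b" using whittaker_functional_exists by blast
  then interpret ev: whittaker_functional A ev 0 0 \<kappa> b .
  interpret V: universal_whittaker uea_scalar ue uh uf uc 0 0 \<kappa> using \<kappa> by unfold_locales
  have zero: "whittaker_character 0 0 x = 0" for x by (cases x) simp_all
  have gen: "standard.val x \<in> V.J" if "raising x" for x
    using V.val_character[OF that] by (simp add: zero left_cong_def standard.sc_0)
  have "uh 0 - uea_scalar b \<in> A"
  proof -
    have "standard.val x * uh 0 - uea_scalar (whittaker_character 0 0 x) * uh 0 \<in> V.J" if "raising x" for x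
    proof -
      have "standard.val x * uh 0 = uh 0 * standard.val x + of_int (bracket_coeff x (gH 0)) * standard.val (bracket_gen x (gH 0))
          + of_int (central_coeff x (gH 0)) * uc"
        using standard.val_bracket[of x "gH 0"] by (simp add: algebra_simps)
      moreover have "central_coeff x (gH 0) = 0" "raising (bracket_gen x (gH 0)) \<or> bracket_coeff x (gH 0) = 0"
        using that by (cases x; auto)+
      moreover have "uh 0 * standard.val x \<in> V.J" by (rule left_idealD(3)[OF V.left_ideal_J gen[OF that]])
      moreover have "of_int (bracket_coeff x (gH 0)) * standard.val (bracket_gen x (gH 0)) \<in> V.J"
        using calculation(3) gen[of "bracket_gen x (gH 0)"] left_idealD(1,3)[OF V.left_ideal_J] by auto
      ultimately show ?thesis
        using left_idealD(2)[OF V.left_ideal_J] by (simp add: zero standard.sc_0)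
    qed
    then show ?thesis using ev.whittaker_vector[of "uh 0"] ev.h[of 1] ev.one by simp
  qed
  then show ?thesis using ev.ideal by blast
qed

section \<open>Cyclic modules and left ideals\<close>

lemma complex_ring_simps [simp]:
  "carrier complex_ring = UNIV" "add complex_ring = (+)" "monoid.mult complex_ring = (*)"
  "one complex_ring = 1" "ring.zero complex_ring = 0"
  by (simp_all add: ring_of_type_algebra_def)

definition maximal_left_ideal :: "'a::ring_1 set \<Rightarrow> bool" where
  "maximal_left_ideal I \<longleftrightarrow> left_ideal I \<and> 1 \<notin> I \<and> (\<forall>K. left_ideal K \<longrightarrow> I \<subseteq> K \<longrightarrow> 1 \<notin> K \<longrightarrow> K = I)"

lemma maximal_left_ideal_complement:
  assumes "maximal_left_ideal I" "g \<notin> I"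
  shows "\<exists>u. v - u * g \<in> I"
proof -
  have I: "left_ideal I" using assms(1) by (simp add: maximal_left_ideal_def)
  let ?K = "{u + a * g | u a. u \<in> I}"
  have K: "left_ideal ?K" by (rule left_ideal_add_multiples[OF I])
  have "u + 0 * g \<in> ?K" if "u \<in> I" for u using that by blast
  then have "I \<subseteq> ?K" by auto
  moreover have "0 + 1 * g \<in> ?K" using left_idealD(1)[OF I] by blast
  then have "g \<in> ?K" by simp
  ultimately have "1 \<in> ?K" using assms K unfolding maximal_left_ideal_def by blast
  then have "v \<in> ?K" using left_idealD(3)[OF K, of 1 v] by simp
  then obtain u a where "u \<in> I" "v = u + a * g" by blast
  then have "v - a * g \<in> I" by simp
  then show ?thesis ..
qed

text \<open>
  The multiples of \<open>g\<close> exhaust the quotient by \<open>I\<close>, so that quotient is isomorphic to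
  the one by the transporter and both are simple.
\<close>

lemma maximal_left_ideal_transporter:
  assumes "maximal_left_ideal I" "g \<notin> I"
  shows "maximal_left_ideal {u. u * g \<in> I}"
  unfolding maximal_left_ideal_def
proof (intro conjI allI impI)
  have I: "left_ideal I" using assms(1) by (simp add: maximal_left_ideal_def)
  show "left_ideal {u. u * g \<in> I}" by (rule left_ideal_transporter[OF I])
  show "1 \<notin> {u. u * g \<in> I}" using assms(2) by simp
  fix K assume K: "left_ideal K" "{u. u * g \<in> I} \<subseteq> K" "1 \<notin> K"
  show "K = {u. u * g \<in> I}"
  proof
    show "K \<subseteq> {u. u * g \<in> I}"
    proof
      fix k assume k: "k \<in> K"
      show "k \<in> {u. u * g \<in> I}"
      proof (rule ccontr)
        assume "k \<notin> {u. u * g \<in> I}"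
        then have "k * g \<notin> I" by simp
        then obtain a where "g - a * (k * g) \<in> I" using maximal_left_ideal_complement[OF assms(1)] by blast
        then have "1 - a * k \<in> K" using K(2) by (auto simp: left_diff_distrib mult.assoc)
        then have "1 - a * k + a * k \<in> K" using left_idealD(2,3)[OF K(1)] k by blast
        then show False using K(3) by simp
      qed
    qed
  qed (rule K(2))
qed

text \<open>
  A module \<open>M\<close> is identified with the quotient of the enveloping algebra by a left ideal
  through a surjection with kernel \<open>I\<close>. Only the linear structure is involved at this
  point, so that the notion applies equally to a module on the same space for a larger
  Lie algebra.
\<close>

locale linear_presentation =
  fixes \<pi> :: "'g::complex_lie_algebra uea \<Rightarrow> 'v" and I :: "'g uea set"
    and M :: "(complex, 'v, 'm) module_scheme" (structure)
  assumes left_ideal: "left_ideal I" and range: "range \<pi> = carrier M"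
    and zero: "\<pi> 0 = \<zero>\<^bsub>M\<^esub>" and add: "\<pi> (u + v) = \<pi> u \<oplus>\<^bsub>M\<^esub> \<pi> v"
    and smult: "\<pi> (uea_scalar a * u) = a \<odot>\<^bsub>M\<^esub> \<pi> u" and eq_iff: "\<pi> u = \<pi> v \<longleftrightarrow> u - v \<in> I"
begin

lemma carrier_cases: "v \<in> carrier M \<Longrightarrow> (\<And>u. v = \<pi> u \<Longrightarrow> P) \<Longrightarrow> P"
  using range by auto

lemma in_carrier [simp]: "\<pi> u \<in> carrier M"
  using range by auto

lemmas linear_ops = zero[symmetric] add[symmetric] smult[symmetric]

lemma abelian_group: "abelian_group M"
proof (rule abelian_groupI)
  fix x assume "x \<in> carrier M"
  then obtain u where u: "x = \<pi> u" by (rule carrier_cases)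
  then have "\<pi> (- u) \<oplus> x = \<zero>" by (simp add: linear_ops)
  then show "\<exists>y\<in>carrier M. y \<oplus> x = \<zero>" by (rule bexI) simp
qed (auto elim!: carrier_cases simp: linear_ops ac_simps)

lemma minus: "\<ominus> \<pi> u = \<pi> (- u)"
  using abelian_group.minus_equality[OF abelian_group, of "\<pi> (- u)" "\<pi> u"] by (simp add: linear_ops)

lemma diff: "\<pi> u \<ominus> \<pi> v = \<pi> (u - v)"
  by (simp add: a_minus_def minus linear_ops)

lemma module: "module complex_ring M"
  by (rule moduleI[OF cring_from_type_algebra abelian_group])
    (auto elim!: carrier_cases simp: linear_ops uea_scalar_hom distrib_left distrib_right mult.assoc)

end

text \<open>
  Cyclic modules are handled through presentations: submodules, quotients, simplicity
  and isomorphisms translate into statements about the left ideals above \<open>I\<close>.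
\<close>

locale presentation = linear_presentation \<pi> I M
  for \<pi> :: "'g::complex_lie_algebra uea \<Rightarrow> 'v" and I :: "'g uea set"
    and M :: "('g, 'v, 'm) lie_module_scheme" (structure) +
  assumes lact: "\<pi> (uea_incl x * u) = x \<star>\<^bsub>M\<^esub> \<pi> u"
begin

lemmas ops = linear_ops lact[symmetric]

lemma lie_module: "lie_module M"
  using module
  by (rule lie_module.intro, unfold_locales)
    (auto elim!: carrier_cases simp: ops diff uea_incl_add uea_incl_scale uea_incl_bracket distrib_left distrib_right
      left_diff_distrib mult.assoc, metis mult.assoc uea_scalar_central)

lemma submodule_of_ideal:
  assumes "left_ideal K" "I \<subseteq> K"
  shows "lie_submodule (\<pi> ` K) M" "\<pi> -` (\<pi> ` K) = K"
proof -
  interpret M: lie_module M by (rule lie_module)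
  show "lie_submodule (\<pi> ` K) M"
    unfolding lie_submodule_def
  proof (intro conjI allI ballI M.submoduleI)
    show "\<zero> \<in> \<pi> ` K" using left_idealD(1)[OF assms(1)] by (auto simp: ops)
    show "\<ominus> x \<in> \<pi> ` K" if "x \<in> \<pi> ` K" for x using left_idealD(4)[OF assms(1)] that by (auto simp: minus)
    show "x \<oplus> y \<in> \<pi> ` K" if "x \<in> \<pi> ` K" "y \<in> \<pi> ` K" for x y using left_idealD(2)[OF assms(1)] that by (auto simp: ops)
    show "a \<odot> x \<in> \<pi> ` K" if "x \<in> \<pi> ` K" for a x using left_idealD(3)[OF assms(1)] that by (auto simp: ops)
    show "a \<star> x \<in> \<pi> ` K" if "x \<in> \<pi> ` K" for a x using left_idealD(3)[OF assms(1)] that by (auto simp: ops)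
  qed auto
  show "\<pi> -` (\<pi> ` K) = K"
  proof
    show "\<pi> -` (\<pi> ` K) \<subseteq> K"
    proof
      fix u assume "u \<in> \<pi> -` (\<pi> ` K)"
      then obtain v where "\<pi> u = \<pi> v" "v \<in> K" by auto
      then have "u - v \<in> K" using eq_iff assms(2) by auto
      then show "u \<in> K" using left_idealD(2)[OF assms(1) _ \<open>v \<in> K\<close>, of "u - v"] by simp
    qed
  qed auto
qed

lemma ideal_of_submodule:
  assumes "lie_submodule N M"
  shows "left_ideal (\<pi> -` N)" "I \<subseteq> \<pi> -` N" "\<pi> ` (\<pi> -` N) = N"
proof -
  interpret M: lie_module M by (rule lie_module)
  have sub: "submodule N complex_ring M" and act: "\<And>x v. v \<in> N \<Longrightarrow> x \<star> v \<in> N"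
    using assms by (auto simp: lie_submodule_def)
  have N: "N \<subseteq> carrier M" "\<And>a v. v \<in> N \<Longrightarrow> a \<odot> v \<in> N" "\<And>v w. v \<in> N \<Longrightarrow> w \<in> N \<Longrightarrow> v \<oplus> w \<in> N"
    using M.submoduleE[OF sub] by auto
  have z: "\<zero> \<in> N" using submodule.axioms(1)[OF sub] subgroup.one_closed by fastforce
  have mult: "\<pi> (a * u) \<in> N" if "\<pi> u \<in> N" for a u
    using that
    by (induction a rule: uea_induct) (simp_all add: distrib_right mult.assoc add N smult lact act)
  show "left_ideal (\<pi> -` N)" unfolding left_ideal_def using z N(3) mult by (auto simp: zero add)
  show "I \<subseteq> \<pi> -` N" using eq_iff[of _ 0] z by (auto simp: zero)
  show "\<pi> ` (\<pi> -` N) = N" using N(1) range by auto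
qed

lemma quotient:
  assumes "lie_submodule N M"
  shows "presentation (\<lambda>u. N +>\<^bsub>M\<^esub> \<pi> u) (\<pi> -` N) (quotient_module M N)"
proof -
  let ?K = "\<pi> -` N"
  note K = ideal_of_submodule[OF assms]
  interpret K: left_ideal_congruence ?K using K(1) by unfold_locales
  have N: "N = \<pi> ` ?K" using K(3) by simp
  have coset: "N +> \<pi> u = \<pi> ` {v. v - u \<in> ?K}" for u
  proof -
    have "N +> \<pi> u = (\<lambda>n. n \<oplus> \<pi> u) ` N" by (auto simp: a_r_coset_def')
    also have "\<dots> = (\<lambda>k. \<pi> (k + u)) ` ?K" by (subst N, unfold image_image) (simp add: add)
    also have "\<dots> = \<pi> ` {v. v - u \<in> ?K}"
    proof -
      have "{v. v - u \<in> ?K} = (\<lambda>k. k + u) ` ?K" by (auto intro!: image_eqI[of _ _ "_ - u"])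
      then show ?thesis by (simp add: image_image)
    qed
    finally show ?thesis .
  qed
  have self: "\<pi> u \<in> N +> \<pi> u" for u unfolding coset using left_idealD(1)[OF K(1)] by auto
  have coset_eq: "N +> \<pi> u = N +> \<pi> v \<longleftrightarrow> u - v \<in> ?K" for u v
  proof
    assume "N +> \<pi> u = N +> \<pi> v"
    then obtain w where w: "\<pi> u = \<pi> w" "w - v \<in> ?K" using self[of u] unfolding coset by auto
    have "u - w \<in> ?K" using w(1) eq_iff K(2) by auto
    then show "u - v \<in> ?K" using left_idealD(2)[OF K(1) _ w(2), of "u - w"] by simp
  next
    assume uv: "u - v \<in> ?K"
    have "w - u \<in> ?K \<longleftrightarrow> w - v \<in> ?K" for w
      using left_idealD(2)[OF K(1) _ uv, of "w - u"] left_idealD(5)[OF K(1) _ uv, of "w - v"] by auto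
    then show "N +> \<pi> u = N +> \<pi> v" unfolding coset by simp
  qed
  have union: "(\<Union>w\<in>N +> \<pi> u. N +> g w) = N +> \<pi> (a * u)" if "\<And>v. g (\<pi> v) = \<pi> (a * v)" for g a u
  proof -
    have "N +> g (\<pi> v) = N +> \<pi> (a * u)" if "v - u \<in> ?K" for v
      unfolding \<open>\<And>v. g (\<pi> v) = \<pi> (a * v)\<close> coset_eq
      using left_idealD(3)[OF K(1) that, of a] by (simp add: right_diff_distrib)
    then have "(\<Union>w\<in>N +> \<pi> u. N +> g w) = (\<Union>w\<in>N +> \<pi> u. N +> \<pi> (a * u))" unfolding coset[of u] by auto
    then show ?thesis using self[of u] by auto
  qed
  have sum: "set_add M (N +> \<pi> u) (N +> \<pi> v) = N +> \<pi> (u + v)" for u v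
  proof -
    have "set_add M (N +> \<pi> u) (N +> \<pi> v) = {\<pi> (x + y) | x y. x - u \<in> ?K \<and> y - v \<in> ?K}"
      unfolding coset set_add_def' by (auto simp: add)
    also have "\<dots> = \<pi> ` {w. w - (u + v) \<in> ?K}"
    proof (intro equalityI subsetI)
      fix z assume "z \<in> {\<pi> (x + y) | x y. x - u \<in> ?K \<and> y - v \<in> ?K}"
      then obtain x y where "z = \<pi> (x + y)" "x - u \<in> ?K" "y - v \<in> ?K" by blast
      then show "z \<in> \<pi> ` {w. w - (u + v) \<in> ?K}"
        using left_idealD(2)[OF K(1), of "x - u" "y - v"] by (auto simp: algebra_simps)
    next
      fix z assume "z \<in> \<pi> ` {w. w - (u + v) \<in> ?K}"
      then obtain w where "z = \<pi> w" "w - (u + v) \<in> ?K" by blast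
      then have "z = \<pi> (u + (w - u))" "u - u \<in> ?K" "(w - u) - v \<in> ?K"
        using left_idealD(1)[OF K(1)] by (simp_all add: diff_diff_eq)
      then show "z \<in> {\<pi> (x + y) | x y. x - u \<in> ?K \<and> y - v \<in> ?K}" by blast
    qed
    finally show ?thesis unfolding coset .
  qed
  show ?thesis
  proof
    show "range (\<lambda>u. N +> \<pi> u) = carrier (quotient_module M N)"
      unfolding quotient_module_def by (simp add: A_RCOSETS_def' range[symmetric]) blast
    show "N +> \<pi> 0 = \<zero>\<^bsub>quotient_module M N\<^esub>"
      using K(3) by (simp add: quotient_module_def coset vimage_def)
    show "N +> \<pi> (u + v) = (N +> \<pi> u) \<oplus>\<^bsub>quotient_module M N\<^esub> (N +> \<pi> v)" for u v
      by (simp add: quotient_module_def sum)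
    show "N +> \<pi> (uea_scalar a * u) = a \<odot>\<^bsub>quotient_module M N\<^esub> (N +> \<pi> u)" for a u
      using union[of "(\<odot>) a" "uea_scalar a" u] by (simp add: quotient_module_def smult)
    show "N +> \<pi> (uea_incl x * u) = x \<star>\<^bsub>quotient_module M N\<^esub> (N +> \<pi> u)" for x u
      using union[of "(\<star>) x" "uea_incl x" u] by (simp add: quotient_module_def lact)
  qed (rule K(1) coset_eq)+
qed

lemma simple_iff: "simple_module M \<longleftrightarrow> maximal_left_ideal I"
proof
  assume S: "simple_module M"
  have "1 \<notin> I"
  proof
    assume "1 \<in> I"
    then have "carrier M = {\<zero>}" using left_ideal_one[OF left_ideal] eq_iff[of _ 0] range zero by auto
    then show False using S by (simp add: simple_module_def)
  qed
  moreover have "K = I" if K: "left_ideal K" "I \<subseteq> K" "1 \<notin> K" for K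
  proof -
    have "\<pi> ` K = {\<zero>} \<or> \<pi> ` K = carrier M"
      using S submodule_of_ideal(1)[OF K(1,2)] by (auto simp: simple_module_def)
    then show "K = I"
    proof
      assume "\<pi> ` K = {\<zero>}"
      then have "K \<subseteq> I" using eq_iff[of _ 0] zero by auto
      then show ?thesis using K(2) by blast
    next
      assume "\<pi> ` K = carrier M"
      then have "1 \<in> \<pi> -` (\<pi> ` K)" by simp
      then show ?thesis using submodule_of_ideal(2)[OF K(1,2)] K(3) by simp
    qed
  qed
  ultimately show "maximal_left_ideal I" using left_ideal by (simp add: maximal_left_ideal_def)
next
  assume I: "maximal_left_ideal I"
  show "simple_module M"
    unfolding simple_module_def
  proof (intro conjI allI impI)
    show "lie_module M" by (rule lie_module)
    have "\<pi> 1 \<noteq> \<zero>" using I eq_iff[of 1 0] zero by (simp add: maximal_left_ideal_def)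
    then show "carrier M \<noteq> {\<zero>}" using in_carrier[of 1] by blast
    fix N assume "lie_submodule N M"
    note K = ideal_of_submodule[OF this]
    show "N = {\<zero>} \<or> N = carrier M"
    proof (cases "1 \<in> \<pi> -` N")
      case True
      then have "\<pi> -` N = UNIV" by (rule left_ideal_one[OF K(1)])
      then show ?thesis using K(3) range by simp
    next
      case False
      then have "\<pi> -` N = I" using I K by (auto simp: maximal_left_ideal_def)
      then have "N = \<pi> ` I" using K(3) by simp
      also have "\<dots> = {\<zero>}"
      proof -
        have "\<pi> u = \<zero>" if "u \<in> I" for u using eq_iff[of u 0] that zero by simp
        then show ?thesis using left_idealD(1)[OF left_ideal] by force
      qed
      finally show ?thesis by simp
    qed
  qed
qed

lemma generated_submodule:
  "lie_submodule (submodule_generated M {\<pi> u}) M"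
  "left_ideal K \<Longrightarrow> \<pi> -` submodule_generated M {\<pi> u} \<subseteq> K \<longleftrightarrow> I \<subseteq> K \<and> u \<in> K"
proof -
  define K0 where "K0 = \<Inter> {K. left_ideal K \<and> I \<subseteq> K \<and> u \<in> K}"
  have K0: "left_ideal K0" "I \<subseteq> K0" "u \<in> K0" by (auto simp: K0_def left_ideal_def)
  have "submodule_generated M {\<pi> u} = \<pi> ` K0"
  proof
    show "submodule_generated M {\<pi> u} \<subseteq> \<pi> ` K0"
      using submodule_of_ideal(1)[OF K0(1,2)] K0(3) unfolding submodule_generated_def by blast
    show "\<pi> ` K0 \<subseteq> submodule_generated M {\<pi> u}"
      unfolding submodule_generated_def
    proof (rule Inter_greatest)
      fix N assume "N \<in> {N. lie_submodule N M \<and> {\<pi> u} \<subseteq> N}"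
      then have N: "lie_submodule N M" "u \<in> \<pi> -` N" by auto
      then have "K0 \<subseteq> \<pi> -` N" using ideal_of_submodule[OF N(1)] unfolding K0_def by blast
      then show "\<pi> ` K0 \<subseteq> N" by auto
    qed
  qed
  then show "lie_submodule (submodule_generated M {\<pi> u}) M"
    "left_ideal K \<Longrightarrow> \<pi> -` submodule_generated M {\<pi> u} \<subseteq> K \<longleftrightarrow> I \<subseteq> K \<and> u \<in> K"
    using submodule_of_ideal[OF K0(1,2)] K0 by (auto simp: K0_def)
qed

lemma simple_quotient_kernel_iff:
  "simple_quotient_kernel M N \<longleftrightarrow> lie_submodule N M \<and> maximal_left_ideal (\<pi> -` N)"
  unfolding simple_quotient_kernel_def using presentation.simple_iff[OF quotient[of N]] by blast

lemma unique_simple_quotient: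
  assumes K: "maximal_left_ideal K" "I \<subseteq> K" and unique: "\<And>K'. maximal_left_ideal K' \<Longrightarrow> I \<subseteq> K' \<Longrightarrow> K' = K"
  shows "has_unique_simple_quotient M"
    "presentation (\<lambda>u. \<pi> ` K +>\<^bsub>M\<^esub> \<pi> u) K (the_simple_quotient M)"
proof -
  have "left_ideal K" using K(1) by (simp add: maximal_left_ideal_def)
  note sub = submodule_of_ideal[OF this K(2)]
  have kernel: "simple_quotient_kernel M N \<longleftrightarrow> N = \<pi> ` K" for N
  proof
    assume "simple_quotient_kernel M N"
    then have N: "lie_submodule N M" "maximal_left_ideal (\<pi> -` N)" by (simp_all add: simple_quotient_kernel_iff)
    then show "N = \<pi> ` K" using unique[OF N(2)] ideal_of_submodule[OF N(1)] by metis
  qed (use sub K(1) in \<open>simp add: simple_quotient_kernel_iff\<close>)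
  then show "has_unique_simple_quotient M" by (simp add: has_unique_simple_quotient_def)
  show "presentation (\<lambda>u. \<pi> ` K +>\<^bsub>M\<^esub> \<pi> u) K (the_simple_quotient M)"
    using quotient[OF sub(1)] by (simp add: the_simple_quotient_def kernel sub(2))
qed

text \<open>
  The isomorphism sends the image of \<open>u * g\<close> in \<open>M\<close> to that of \<open>u\<close> in \<open>M'\<close>.
\<close>

lemma isomorphic:
  assumes P': "presentation \<pi>' {u. u * g \<in> I} M'" and cyclic: "\<And>v. \<exists>u. v - u * g \<in> I"
  shows "isomorphic_modules M M'"
proof -
  interpret P': presentation \<pi>' "{u. u * g \<in> I}" M' by (rule P')
  define \<phi> where "\<phi> v = \<pi>' (SOME u. \<pi> (u * g) = v)" for v
  have \<phi>: "\<phi> (\<pi> (u * g)) = \<pi>' u" for u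
  proof -
    have "\<pi> ((SOME w. \<pi> (w * g) = \<pi> (u * g)) * g) = \<pi> (u * g)" by (rule someI) (rule refl)
    then show ?thesis unfolding \<phi>_def by (simp add: eq_iff P'.eq_iff left_diff_distrib)
  qed
  have gen: "\<exists>u. v = \<pi> (u * g)" if "v \<in> carrier M" for v
    using that cyclic eq_iff by (metis carrier_cases)
  have "\<phi> \<in> iso (add_monoid M) (add_monoid M')"
  proof -
    have "\<phi> \<in> carrier M \<rightarrow> carrier M'" using gen \<phi> by fastforce
    moreover have "\<phi> (v \<oplus> w) = \<phi> v \<oplus>\<^bsub>M'\<^esub> \<phi> w" if v: "v \<in> carrier M" "w \<in> carrier M" for v w
    proof -
      obtain a b where ab: "v = \<pi> (a * g)" "w = \<pi> (b * g)" using gen v by metis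
      have "v \<oplus> w = \<pi> ((a + b) * g)" by (simp add: ab add distrib_right)
      then show ?thesis using \<phi> by (simp add: ab P'.add)
    qed
    moreover have "inj_on \<phi> (carrier M)"
    proof (rule inj_onI)
      fix v w assume v: "v \<in> carrier M" "w \<in> carrier M" "\<phi> v = \<phi> w"
      obtain a b where ab: "v = \<pi> (a * g)" "w = \<pi> (b * g)" using gen v(1,2) by metis
      then show "v = w" using v(3) by (simp add: \<phi> P'.eq_iff eq_iff left_diff_distrib)
    qed
    moreover have "\<phi> ` carrier M = carrier M'"
    proof -
      have "carrier M' = (\<lambda>u. \<phi> (\<pi> (u * g))) ` UNIV" using P'.range \<phi> by simp
      also have "\<dots> = \<phi> ` carrier M" using gen by (auto intro!: imageI)
      finally show ?thesis by simp
    qed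
    ultimately show ?thesis by (simp add: iso_def hom_def bij_betw_def)
  qed
  moreover have "(\<forall>a. \<phi> (a \<odot> v) = a \<odot>\<^bsub>M'\<^esub> \<phi> v) \<and> (\<forall>x. \<phi> (x \<star> v) = x \<star>\<^bsub>M'\<^esub> \<phi> v)" if v: "v \<in> carrier M" for v
  proof -
    obtain u where u: "v = \<pi> (u * g)" using gen[OF v] by blast
    have "a \<odot> v = \<pi> ((uea_scalar a * u) * g)" "x \<star> v = \<pi> ((uea_incl x * u) * g)" for a x
      by (simp_all add: u ops mult.assoc)
    then show ?thesis unfolding \<phi> by (simp add: u \<phi> P'.smult P'.lact)
  qed
  ultimately show ?thesis by (auto simp: isomorphic_modules_def module_iso_def)
qed

end

lemma presentation_regular: "presentation (\<lambda>u. u) {0} left_regular_module"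
  by unfold_locales (auto simp: left_regular_module_def left_ideal_def)

lemma presentation_quotient_regular:
  assumes "left_ideal I"
  shows "presentation (\<lambda>u. I +>\<^bsub>left_regular_module\<^esub> u) I (quotient_module left_regular_module I)"
proof -
  interpret presentation "\<lambda>u. u" "{0}" left_regular_module by (rule presentation_regular)
  show ?thesis using quotient[of I] submodule_of_ideal[OF assms] left_idealD(1)[OF assms] by simp
qed

text \<open>
  Proper left ideals with eigenvalue \<open>a\<close> are closed under sums, so their union is the
  largest one among them.
\<close>

lemma spectral_parameter_maximal:
  assumes J: "left_ideal J" and sp: "spectral_parameter J sc z"
  shows "\<exists>K. maximal_left_ideal K \<and> J \<subseteq> K \<and> z - sc a \<in> K
    \<and> (\<forall>K'. maximal_left_ideal K' \<longrightarrow> J \<subseteq> K' \<longrightarrow> z - sc a \<in> K' \<longrightarrow> K' = K)"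
proof -
  define \<I> where "\<I> = {I. left_ideal I \<and> J \<subseteq> I \<and> z - sc a \<in> I \<and> 1 \<notin> I}"
  obtain K0 where K0: "K0 \<in> \<I>"
    using sp[unfolded spectral_parameter_def, THEN conjunct1, rule_format, of a] by (auto simp: \<I>_def)
  have sum: "\<exists>I''\<in>\<I>. I \<subseteq> I'' \<and> I' \<subseteq> I''" if I: "I \<in> \<I>" "I' \<in> \<I>" for I I'
  proof (intro bexI conjI)
    let ?S = "{u + v | u v. u \<in> I \<and> v \<in> I'}"
    have I1: "left_ideal I" "J \<subseteq> I" "z - sc a \<in> I" "1 \<notin> I" and I2: "left_ideal I'" "J \<subseteq> I'" "z - sc a \<in> I'" "1 \<notin> I'"
      using I by (auto simp: \<I>_def)
    show 1: "I \<subseteq> ?S" using left_idealD(1)[OF I2(1)] by force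
    show "I' \<subseteq> ?S" using left_idealD(1)[OF I1(1)] by force
    have "1 \<notin> ?S"
    proof
      assume "1 \<in> ?S"
      then obtain u v where "1 = u + v" "u \<in> I" "v \<in> I'" by blast
      then show False
        using sp[unfolded spectral_parameter_def, THEN conjunct2, THEN conjunct1, rule_format, of I a I' u v] I1 I2 by metis
    qed
    then show "?S \<in> \<I>" using left_ideal_sum_ideals[OF I1(1) I2(1)] 1 I1 by (auto simp: \<I>_def)
  qed
  define K where "K = \<Union>\<I>"
  have "left_ideal K"
    unfolding left_ideal_def K_def
  proof (intro conjI ballI allI)
    show "0 \<in> \<Union>\<I>" using K0 left_idealD(1) by (auto simp: \<I>_def)
    show "u + v \<in> \<Union>\<I>" if uv: "u \<in> \<Union>\<I>" "v \<in> \<Union>\<I>" for u v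
    proof -
      obtain I I' where "I \<in> \<I>" "I' \<in> \<I>" "u \<in> I" "v \<in> I'" using uv by blast
      moreover obtain I'' where "I'' \<in> \<I>" "I \<subseteq> I''" "I' \<subseteq> I''" using sum[of I I'] calculation by blast
      moreover have "left_ideal I''" using calculation(5) by (simp add: \<I>_def)
      ultimately show ?thesis using left_idealD(2)[of I'' u v] by blast
    qed
    show "b * u \<in> \<Union>\<I>" if "u \<in> \<Union>\<I>" for b u using that left_idealD(3) by (fastforce simp: \<I>_def)
  qed
  moreover have "J \<subseteq> K" "z - sc a \<in> K" "1 \<notin> K" using K0 by (auto simp: K_def \<I>_def)
  moreover have top: "K' \<subseteq> K" if "left_ideal K'" "J \<subseteq> K'" "z - sc a \<in> K'" "1 \<notin> K'" for K'
    using that by (auto simp: K_def \<I>_def)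
  ultimately have "maximal_left_ideal K" by (auto simp: maximal_left_ideal_def)
  moreover have "K' = K" if "maximal_left_ideal K'" "J \<subseteq> K'" "z - sc a \<in> K'" for K'
    using that top[of K'] \<open>left_ideal K\<close> \<open>1 \<notin> K\<close> unfolding maximal_left_ideal_def by auto
  ultimately show ?thesis using \<open>J \<subseteq> K\<close> \<open>z - sc a \<in> K\<close> by blast
qed

section \<open>Sugawara operators on quotients of the universal module\<close>

context universal_whittaker
begin

lemma sugawara_term_vanishes: "\<bar>k\<bar> > 1 \<Longrightarrow> sugawara_term 0 k \<in> J"
proof -
  assume k: "\<bar>k\<bar> > 1"
  have J: "u * e k \<in> J" "u * h k \<in> J" "u * f k \<in> J" if "k \<ge> 2" for u k
    using that relations_in_J(4-6)[of k] by (auto intro!: J_closed)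
  show ?thesis using k by (auto simp: sugawara_term_def intro!: J_closed(2) J)
qed

end

lemma whittaker_ideal_eq: "whittaker_ideal lam mu \<kappa> = standard.universal_ideal lam mu \<kappa>"
  by (simp add: whittaker_ideal_def standard.universal_ideal_def generated_ideal_uea standard.whittaker_relations_def)

lemma left_ideal_whittaker: "left_ideal (whittaker_ideal lam mu \<kappa>)"
  unfolding whittaker_ideal_def by (rule left_ideal_generated)

lemma presentation_whittaker:
  "presentation (\<lambda>u. whittaker_ideal lam mu \<kappa> +>\<^bsub>left_regular_module\<^esub> u) (whittaker_ideal lam mu \<kappa>) (whittaker_module lam mu \<kappa>)"
  unfolding whittaker_module_def by (rule presentation_quotient_regular[OF left_ideal_whittaker])

lemma (in linear_presentation) finsum: "finite A \<Longrightarrow> finsum M (\<lambda>k. \<pi> (s k)) A = \<pi> (sum s A)"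
proof (induction A rule: finite_induct)
  case empty
  interpret M: abelian_group M by (rule abelian_group)
  show ?case by (simp add: zero)
next
  case (insert k A)
  interpret M: abelian_group M by (rule abelian_group)
  show ?case using insert by (simp add: add)
qed

text \<open>
  Only the summands with \<open>\<bar>k\<bar> \<le> 1\<close> can be nonzero. Extending the sum from
  its support to all three indices changes it by elements of \<open>I\<close>, and then
  \<open>sugawara_zero\<close> applies.
\<close>

lemma sugawara_cyclic_vector:
  assumes P: "presentation \<pi> I M" and J: "whittaker_ideal lam mu \<kappa> \<subseteq> I" and \<kappa>: "\<kappa> \<noteq> - 2"
  shows "sugawara \<kappa> M 0 (\<pi> 1) = \<pi> (affine_sugawara \<kappa> mu)"
proof -
  interpret presentation \<pi> I M by (rule P)
  interpret V: universal_whittaker uea_scalar ue uh uf uc lam mu \<kappa> using \<kappa> by unfold_locales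
  have J: "V.J \<subseteq> I" using J by (simp add: whittaker_ideal_eq)
  define s where "s k = uea_scalar (1 / 2) * standard.sugawara_term 0 k" for k
  have half: "uea_scalar (1 / 2) * (u + u) = u" for u :: "sl2_hat uea"
  proof -
    have "uea_scalar (1 / 2) * (u + u) = uea_scalar (1 / 2 + 1 / 2) * u"
      unfolding uea_scalar_hom(1) by (simp only: distrib_left distrib_right)
    then show ?thesis by (simp add: uea_scalar_hom)
  qed
  have s_eq: "s k = (if k < 0 then ue k * uf (- k) + uf k * ue (- k) + uea_scalar (1 / 2) * (uh k * uh (- k))
      else uf (- k) * ue k + ue (- k) * uf k + uea_scalar (1 / 2) * (uh (- k) * uh k))" for k
    unfolding s_def standard.sugawara_term_def by (simp only: distrib_left[of "uea_scalar (1 / 2)" "_ + (_ + _)"] distrib_left[of "uea_scalar (1 / 2)" "_ + _" "_ + _"] half diff_0 if_distrib) simp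
  have summand: "sugawara_summand M 0 (\<pi> 1) = (\<lambda>k. \<pi> (s k))"
  proof
    fix k
    show "sugawara_summand M 0 (\<pi> 1) k = \<pi> (s k)"
      by (auto simp: sugawara_summand_def normal_ordered_def ops s_eq)
  qed
  define A where "A = {k. \<pi> (s k) \<noteq> \<zero>\<^bsub>M\<^esub>}"
  have zero_iff: "\<pi> u = \<zero>\<^bsub>M\<^esub> \<longleftrightarrow> u \<in> I" for u using eq_iff[of u 0] zero by simp
  have A: "A \<subseteq> {-1, 0, 1}"
  proof
    fix k assume "k \<in> A"
    then have "s k \<notin> I" by (simp add: A_def zero_iff)
    then have "standard.sugawara_term 0 k \<notin> V.J"
      using J left_idealD(3)[OF left_ideal] unfolding s_def by blast
    then have "\<not> \<bar>k\<bar> > 1" using V.sugawara_term_vanishes by blast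
    then show "k \<in> {-1, 0, 1}" by auto
  qed
  have "finsum M (\<lambda>k. \<pi> (s k)) A = \<pi> (sum s A)"
    by (rule finsum) (use A finite_subset in blast)
  also have "\<dots> = \<pi> (sum s {-1, 0, 1})"
  proof -
    have "sum s {-1, 0, 1} - sum s A = sum s ({-1, 0, 1} - A)" using A by (simp add: sum_diff)
    also have "\<dots> \<in> I" by (rule left_ideal_sum[OF left_ideal]) (auto simp: A_def zero_iff)
    finally show ?thesis using eq_iff by metis
  qed
  also have "sum s {-1, 0, 1} = uea_scalar (1 / 2) * (standard.sugawara_sum 0 1 * 1)"
  proof -
    have "{-1..<1+1} = {-1, 0, 1::int}" by auto
    then show ?thesis unfolding standard.sugawara_sum_def s_def by (simp only: sum_distrib_left[symmetric] mult_1_right)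
  qed
  finally have "sugawara \<kappa> M 0 (\<pi> 1) = \<pi> (uea_scalar (1 / (2 * (\<kappa> + 2))) * (uea_scalar (1 / 2) * (standard.sugawara_sum 0 1 * 1)))"
    unfolding sugawara_def summand A_def by (simp add: ops)
  also have "\<dots> = \<pi> (uea_scalar (inverse (4 * (\<kappa> + 2))) * (standard.sugawara_sum 0 1 * 1))"
    unfolding mult.assoc[symmetric] uea_scalar_hom(2)[symmetric] by (simp add: divide_simps)
  also have "\<dots> = \<pi> (affine_sugawara \<kappa> mu)"
  proof -
    have "left_cong V.J (uea_scalar (inverse (4 * (\<kappa> + 2))) * (standard.sugawara_sum 0 1 * 1)) (V.sugawara_op 0 1)"
      by (rule V.cong_sym[OF V.sugawara_op_eq]) (use V.sugawara_term_vanishes in auto)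
    also have "left_cong V.J \<dots> (affine_sugawara \<kappa> mu)" unfolding affine_sugawara_def by (rule V.sugawara_zero)
    finally show ?thesis using J by (auto simp: eq_iff left_cong_def)
  qed
  finally show ?thesis .
qed

section \<open>Simple quotients in the degenerate cases\<close>

text \<open>
  The simple quotients of \<open>M a\<close> correspond to the maximal left ideals above \<open>J\<close> that
  contain \<open>z - a\<close>, and there is exactly one such ideal. For a simple quotient of \<open>V\<close>,
  the eigenvector \<open>g\<close> of \<open>z\<close> generates it, and the annihilator of \<open>g\<close> is a maximal left
  ideal that contains \<open>z - a\<close> for the eigenvalue \<open>a\<close>.
\<close>

lemma simple_quotients_of_spectral_parameter:
  assumes P: "presentation \<pi> J V" and sp: "spectral_parameter J uea_scalar z"
  defines "M \<equiv> \<lambda>a. quotient_module V (submodule_generated V {\<pi> (z - uea_scalar a)})"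
  shows "has_unique_simple_quotient (M a)"
    "simple_quotient_kernel V N \<Longrightarrow> \<exists>a. isomorphic_modules (quotient_module V N) (the_simple_quotient (M a))"
proof -
  interpret presentation \<pi> J V by (rule P)
  have M: "presentation (\<lambda>u. submodule_generated V {\<pi> (z - uea_scalar a)} +>\<^bsub>V\<^esub> \<pi> u)
      (\<pi> -` submodule_generated V {\<pi> (z - uea_scalar a)}) (M a)" for a
    unfolding M_def by (rule quotient[OF generated_submodule(1)])
  have sub: "\<pi> -` submodule_generated V {\<pi> (z - uea_scalar a)} \<subseteq> K \<longleftrightarrow> J \<subseteq> K \<and> z - uea_scalar a \<in> K"
    if "maximal_left_ideal K" for K a
    using that by (intro generated_submodule(2)) (simp add: maximal_left_ideal_def)
  have unique: "has_unique_simple_quotient (M a) \<and> (\<exists>K \<pi>'. presentation \<pi>' K (the_simple_quotient (M a))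
      \<and> (\<forall>K'. maximal_left_ideal K' \<longrightarrow> J \<subseteq> K' \<longrightarrow> z - uea_scalar a \<in> K' \<longrightarrow> K' = K))" for a
  proof -
    obtain K where *: "maximal_left_ideal K \<and> J \<subseteq> K \<and> z - uea_scalar a \<in> K
        \<and> (\<forall>K'. maximal_left_ideal K' \<longrightarrow> J \<subseteq> K' \<longrightarrow> z - uea_scalar a \<in> K' \<longrightarrow> K' = K)"
      using spectral_parameter_maximal[OF left_ideal sp, of a] by (rule exE)
    note K = *[THEN conjunct1] *[THEN conjunct2, THEN conjunct1] *[THEN conjunct2, THEN conjunct2, THEN conjunct1]
      and uniq = *[THEN conjunct2, THEN conjunct2, THEN conjunct2]
    have K': "\<pi> -` submodule_generated V {\<pi> (z - uea_scalar a)} \<subseteq> K" using sub[OF K(1)] K(2,3) by simp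
    have uniq': "K' = K" if "maximal_left_ideal K'" "\<pi> -` submodule_generated V {\<pi> (z - uea_scalar a)} \<subseteq> K'" for K'
      using sub[OF that(1)] that uniq[rule_format, of K'] by simp
    note * = presentation.unique_simple_quotient[OF M K(1) K' uniq']
    have "has_unique_simple_quotient (M a)" by (rule *(1))
    moreover have "\<exists>\<pi>'. presentation \<pi>' K (the_simple_quotient (M a))" using *(2) by blast
    ultimately show ?thesis using uniq by blast
  qed
  show "has_unique_simple_quotient (M a)" using unique by blast
  assume "simple_quotient_kernel V N"
  then have N: "lie_submodule N V" and max: "maximal_left_ideal (\<pi> -` N)" by (simp_all add: simple_quotient_kernel_iff)
  let ?I = "\<pi> -` N"
  have "left_ideal ?I \<and> J \<subseteq> ?I \<and> 1 \<notin> ?I \<and> (\<forall>K. left_ideal K \<longrightarrow> ?I \<subseteq> K \<longrightarrow> 1 \<notin> K \<longrightarrow> K = ?I)"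
    using max ideal_of_submodule(2)[OF N] unfolding maximal_left_ideal_def by blast
  then obtain a g where g: "g \<notin> ?I" "J \<subseteq> {u. u * g \<in> ?I}" "(z - uea_scalar a) * g \<in> ?I"
    using sp[unfolded spectral_parameter_def, THEN conjunct2, THEN conjunct2, rule_format, of ?I] by auto
  obtain K \<pi>' where K: "presentation \<pi>' K (the_simple_quotient (M a))"
    "\<And>K'. maximal_left_ideal K' \<Longrightarrow> J \<subseteq> K' \<Longrightarrow> z - uea_scalar a \<in> K' \<Longrightarrow> K' = K"
    using unique[of a] by blast
  have "{u. u * g \<in> ?I} = K"
    by (rule K(2)) (use maximal_left_ideal_transporter[OF max g(1)] g in auto)
  then have "isomorphic_modules (quotient_module V N) (the_simple_quotient (M a))"
    using presentation.isomorphic[OF quotient[OF N], of \<pi>' g] K(1) maximal_left_ideal_complement[OF max g(1)] by simp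
  then show "\<exists>a. isomorphic_modules (quotient_module V N) (the_simple_quotient (M a))" ..
qed

section \<open>Adjoining the degree operator\<close>

definition hat_deriv :: "sl2_hat \<Rightarrow> sl2_hat" where
  "hat_deriv x = Hat (loop_deriv (hat_loop x)) 0"

lemma hat_deriv_simps:
  "hat_deriv (x + y) = hat_deriv x + hat_deriv y" "hat_deriv (cscale t x) = cscale t (hat_deriv x)"
  "hat_deriv (hat_gen a n) = cscale (of_int n) (hat_gen a n)" "hat_deriv hat_c = 0"
  by (simp_all add: hat_deriv_def sl2_hat_ops_defs loop_deriv_add loop_deriv_scale hat_gen_def hat_c_def
      loop_deriv_single loop_scale_single)

definition hat_part :: "sl2_tilde \<Rightarrow> sl2_hat" where
  "hat_part \<xi> = Hat (tilde_loop \<xi>) (tilde_central \<xi>)"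

lemma hat_part_simps:
  "hat_part (\<xi> + \<eta>) = hat_part \<xi> + hat_part \<eta>" "hat_part (cscale t \<xi>) = cscale t (hat_part \<xi>)"
  "hat_part (tilde_of_hat x) = x" "hat_part tilde_d = 0"
  "hat_part (bracket \<xi> \<eta>) = bracket (hat_part \<xi>) (hat_part \<eta>) + cscale (tilde_degree \<xi>) (hat_deriv (hat_part \<eta>))
     - cscale (tilde_degree \<eta>) (hat_deriv (hat_part \<xi>))"
  by (cases x) (simp_all add: hat_part_def sl2_hat_ops_defs sl2_tilde_ops_defs tilde_of_hat_def tilde_d_def hat_deriv_def)

lemma tilde_degree_simps:
  "tilde_degree (\<xi> + \<eta>) = tilde_degree \<xi> + tilde_degree \<eta>" "tilde_degree (cscale t \<xi>) = t * tilde_degree \<xi>"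
  "tilde_degree (tilde_of_hat x) = 0" "tilde_degree tilde_d = 1" "tilde_degree (bracket \<xi> \<eta>) = 0"
  by (simp_all add: sl2_tilde_ops_defs tilde_of_hat_def tilde_d_def)

definition adjoin_degree ::
    "(sl2_hat, 'v, 'm) lie_module_scheme \<Rightarrow> ('v \<Rightarrow> 'v) \<Rightarrow> (sl2_tilde, 'v) lie_module" where
  "adjoin_degree M D =
     \<lparr>carrier = carrier M, monoid.mult = monoid.mult M, one = one M, ring.zero = ring.zero M, add = ring.add M,
      module.smult = module.smult M,
      lact = (\<lambda>\<xi> v. (hat_part \<xi> \<star>\<^bsub>M\<^esub> v) \<oplus>\<^bsub>M\<^esub> (tilde_degree \<xi> \<odot>\<^bsub>M\<^esub> D v))\<rparr>"

text \<open>
  An operator \<open>D\<close> on the module whose commutator with each \<open>x\<close> is the derivative of \<open>x\<close>,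
  as required of the action of \<open>d\<close>. It is given through a lift to the enveloping
  algebra.
\<close>

locale degree_operator = presentation \<pi> I M
  for \<pi> :: "sl2_hat uea \<Rightarrow> 'v" and I and M :: "(sl2_hat, 'v, 'm) lie_module_scheme" (structure) +
  fixes D :: "'v \<Rightarrow> 'v" and d :: "sl2_hat uea \<Rightarrow> sl2_hat uea"
  assumes D: "D (\<pi> u) = \<pi> (d u)" and d_add: "\<pi> (d (u + v)) = \<pi> (d u + d v)"
    and d_smult: "\<pi> (d (uea_scalar t * u)) = \<pi> (uea_scalar t * d u)"
    and d_lact: "\<pi> (d (uea_incl x * u)) = \<pi> (uea_incl x * d u + uea_incl (hat_deriv x) * u)"
begin

abbreviation E where "E \<equiv> adjoin_degree M D"

lemma lact_E: "\<xi> \<star>\<^bsub>E\<^esub> \<pi> u = \<pi> (uea_incl (hat_part \<xi>) * u + uea_scalar (tilde_degree \<xi>) * d u)"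
  by (simp add: adjoin_degree_def D ops)

sublocale E: linear_presentation \<pi> I E
  by unfold_locales (simp_all add: adjoin_degree_def left_ideal range zero add smult eq_iff)

lemma lact_E_lact_E:
  "\<xi> \<star>\<^bsub>E\<^esub> (\<eta> \<star>\<^bsub>E\<^esub> \<pi> u) = \<pi> (uea_incl (hat_part \<xi>) * (uea_incl (hat_part \<eta>) * u + uea_scalar (tilde_degree \<eta>) * d u)
     + uea_scalar (tilde_degree \<xi>) * (uea_incl (hat_part \<eta>) * d u + uea_incl (hat_deriv (hat_part \<eta>)) * u
     + uea_scalar (tilde_degree \<eta>) * d (d u)))"
proof -
  have "\<pi> (d (uea_incl (hat_part \<eta>) * u + uea_scalar (tilde_degree \<eta>) * d u)) =
      \<pi> (uea_incl (hat_part \<eta>) * d u + uea_incl (hat_deriv (hat_part \<eta>)) * u + uea_scalar (tilde_degree \<eta>) * d (d u))"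
    by (simp only: d_add add d_lact d_smult)
  then show ?thesis unfolding lact_E add[of "uea_incl (hat_part \<xi>) * _"] smult by simp
qed

lemma lie_module_E: "lie_module E"
proof (rule lie_module.intro[OF E.module], unfold_locales)
  fix v w \<xi> \<eta> and a :: complex
  assume "v \<in> carrier E"
  then obtain u where u: "v = \<pi> u" by (rule E.carrier_cases)
  show "\<xi> \<star>\<^bsub>E\<^esub> v \<in> carrier E" by (simp add: u lact_E)
  show "\<xi> \<star>\<^bsub>E\<^esub> (a \<odot>\<^bsub>E\<^esub> v) = a \<odot>\<^bsub>E\<^esub> (\<xi> \<star>\<^bsub>E\<^esub> v)"
  proof -
    have "\<xi> \<star>\<^bsub>E\<^esub> (a \<odot>\<^bsub>E\<^esub> v) = \<pi> (uea_incl (hat_part \<xi>) * (uea_scalar a * u) + uea_scalar (tilde_degree \<xi>) * (uea_scalar a * d u))"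
      unfolding u E.smult[symmetric] lact_E add[of "uea_incl (hat_part \<xi>) * _"] smult[of "tilde_degree \<xi>"] d_smult ..
    also have "\<dots> = \<pi> (uea_scalar a * (uea_incl (hat_part \<xi>) * u + uea_scalar (tilde_degree \<xi>) * d u))"
    proof -
      have "w * (uea_scalar a * w') = uea_scalar a * (w * w')" for w w' :: "sl2_hat uea"
        by (metis mult.assoc uea_scalar_central)
      then show ?thesis by (simp only: distrib_left)
    qed
    finally show ?thesis by (simp add: u lact_E E.smult)
  qed
  show "(\<xi> + \<eta>) \<star>\<^bsub>E\<^esub> v = \<xi> \<star>\<^bsub>E\<^esub> v \<oplus>\<^bsub>E\<^esub> \<eta> \<star>\<^bsub>E\<^esub> v"
    by (simp add: u lact_E hat_part_simps tilde_degree_simps uea_incl_add uea_scalar_hom distrib_right ac_simps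
        flip: E.add)
  show "cscale a \<xi> \<star>\<^bsub>E\<^esub> v = a \<odot>\<^bsub>E\<^esub> (\<xi> \<star>\<^bsub>E\<^esub> v)"
    by (simp add: u lact_E hat_part_simps tilde_degree_simps uea_incl_scale uea_scalar_hom distrib_left mult.assoc
        flip: E.smult)
  show "bracket \<xi> \<eta> \<star>\<^bsub>E\<^esub> v = \<xi> \<star>\<^bsub>E\<^esub> (\<eta> \<star>\<^bsub>E\<^esub> v) \<ominus>\<^bsub>E\<^esub> \<eta> \<star>\<^bsub>E\<^esub> (\<xi> \<star>\<^bsub>E\<^esub> v)"
  proof -
    let ?x = "uea_incl (hat_part \<xi>)" and ?y = "uea_incl (hat_part \<eta>)"
      and ?a = "uea_scalar (tilde_degree \<xi>) :: sl2_hat uea" and ?b = "uea_scalar (tilde_degree \<eta>) :: sl2_hat uea"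
      and ?dx = "uea_incl (hat_deriv (hat_part \<xi>))" and ?dy = "uea_incl (hat_deriv (hat_part \<eta>))"
    have incl_diff: "uea_incl (x - y) = uea_incl x - uea_incl y" for x y :: sl2_hat
      using uea_incl_add[of "x - y" y] by simp
    have c1: "?x * (?b * d u) = ?b * (?x * d u)" by (metis mult.assoc uea_scalar_central)
    have c2: "?y * (?a * d u) = ?a * (?y * d u)" by (metis mult.assoc uea_scalar_central)
    have c3: "?a * (?b * w) = ?b * (?a * w)" for w by (metis mult.assoc uea_scalar_central)
    have "bracket \<xi> \<eta> \<star>\<^bsub>E\<^esub> v = \<pi> ((?x * ?y - ?y * ?x + ?a * ?dy - ?b * ?dx) * u)"
      by (simp add: u lact_E hat_part_simps tilde_degree_simps incl_diff uea_incl_add uea_incl_scale uea_incl_bracket standard.sc_0)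
    also have "(?x * ?y - ?y * ?x + ?a * ?dy - ?b * ?dx) * u =
       (?x * (?y * u + ?b * d u) + ?a * (?y * d u + ?dy * u + ?b * d (d u)))
       - (?y * (?x * u + ?a * d u) + ?b * (?x * d u + ?dx * u + ?a * d (d u)))"
      unfolding distrib_left c1 c2 c3 by (simp add: left_diff_distrib distrib_right mult.assoc)
    finally show ?thesis unfolding u lact_E_lact_E E.diff .
  qed
  assume "w \<in> carrier E"
  then obtain u' where u': "w = \<pi> u'" by (rule E.carrier_cases)
  show "\<xi> \<star>\<^bsub>E\<^esub> (v \<oplus>\<^bsub>E\<^esub> w) = \<xi> \<star>\<^bsub>E\<^esub> v \<oplus>\<^bsub>E\<^esub> \<xi> \<star>\<^bsub>E\<^esub> w"
  proof -
    have "\<xi> \<star>\<^bsub>E\<^esub> (v \<oplus>\<^bsub>E\<^esub> w) = \<pi> (uea_incl (hat_part \<xi>) * (u + u') + uea_scalar (tilde_degree \<xi>) * (d u + d u'))"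
      unfolding u u' E.add[symmetric] lact_E add[of "uea_incl (hat_part \<xi>) * _"] smult[of "tilde_degree \<xi>"] d_add ..
    also have "\<dots> = \<pi> ((uea_incl (hat_part \<xi>) * u + uea_scalar (tilde_degree \<xi>) * d u)
        + (uea_incl (hat_part \<xi>) * u' + uea_scalar (tilde_degree \<xi>) * d u'))"
      by (simp add: distrib_left ac_simps)
    finally show ?thesis unfolding u u' lact_E E.add[symmetric] .
  qed
qed

lemma lact_tilde_of_hat: "tilde_of_hat x \<star>\<^bsub>E\<^esub> \<pi> u = \<pi> (uea_incl x * u)"
  by (simp add: lact_E hat_part_simps tilde_degree_simps standard.sc_0)

lemma lie_submodule_E: "lie_submodule N E \<Longrightarrow> lie_submodule N M"
proof -
  assume N: "lie_submodule N E"
  interpret E': lie_module E by (rule lie_module_E)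
  interpret M': lie_module M by (rule lie_module)
  have sub: "submodule N complex_ring E" using N by (simp add: lie_submodule_def)
  have N1: "N \<subseteq> carrier E" "\<And>a. a \<in> N \<Longrightarrow> \<ominus>\<^bsub>E\<^esub> a \<in> N" "\<And>a b. b \<in> N \<Longrightarrow> a \<odot>\<^bsub>E\<^esub> b \<in> N"
    "\<And>a b. a \<in> N \<Longrightarrow> b \<in> N \<Longrightarrow> a \<oplus>\<^bsub>E\<^esub> b \<in> N"
    using E'.submoduleE[OF sub] by auto
  have z: "\<zero>\<^bsub>E\<^esub> \<in> N" using submodule.axioms(1)[OF sub] subgroup.one_closed by fastforce
  show "lie_submodule N M"
    unfolding lie_submodule_def
  proof (intro conjI allI ballI M'.submoduleI)
    show "N \<subseteq> carrier M" using N1(1) E.range range by simp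
    show "\<zero>\<^bsub>M\<^esub> \<in> N" using z by (simp add: adjoin_degree_def)
    fix x assume x: "x \<in> N"
    then obtain u where u: "x = \<pi> u" using N1(1) E.range by auto
    show "\<ominus>\<^bsub>M\<^esub> x \<in> N" using N1(2)[OF x] by (simp add: u minus E.minus)
    show "y \<star>\<^bsub>M\<^esub> x \<in> N" for y
      using N x lact_tilde_of_hat[of y u] unfolding lie_submodule_def u lact by metis
    show "a \<odot>\<^bsub>M\<^esub> x \<in> N" for a using N1(3)[OF x, of a] by (simp add: adjoin_degree_def)
    show "x \<oplus>\<^bsub>M\<^esub> y \<in> N" if "y \<in> N" for y using N1(4)[OF x that] by (simp add: adjoin_degree_def)
  qed
qed

lemma simple_E: "simple_module M \<Longrightarrow> simple_module E"
  using lie_submodule_E lie_module_E unfolding simple_module_def by (simp add: adjoin_degree_def)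

lemma isomorphic_restriction: "isomorphic_modules M (restrict_to_hat E)"
proof -
  have "(\<lambda>v. v) \<in> iso (add_monoid M) (add_monoid (restrict_to_hat E))"
    by (simp add: iso_def hom_def bij_betw_def restrict_to_hat_def adjoin_degree_def)
  moreover have "a \<odot>\<^bsub>M\<^esub> v = a \<odot>\<^bsub>restrict_to_hat E\<^esub> v" for a v by (simp add: restrict_to_hat_def adjoin_degree_def)
  moreover have "x \<star>\<^bsub>M\<^esub> v = x \<star>\<^bsub>restrict_to_hat E\<^esub> v" if "v \<in> carrier M" for x v
    using that lact_tilde_of_hat by (auto elim!: carrier_cases simp: restrict_to_hat_def lact)
  ultimately have "(\<lambda>v. v) \<in> module_iso M (restrict_to_hat E)" unfolding module_iso_def by blast
  then show ?thesis unfolding isomorphic_modules_def by blast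
qed

end

text \<open>
  The degree operator acts by \<open>- L(0)\<close>, which has the required commutators. By
  \<open>verma_maximal_ideals\<close> the module contains a vector that is killed by the raising
  generators and is an eigenvector of \<open>h(0)\<close> with some eigenvalue \<open>b\<close>; on it the Casimir
  element acts by \<open>2 b + b\<^sup>2\<close>, which makes it an eigenvector of \<open>L(0)\<close> as well.
  Simplicity implies that it generates the module.
\<close>

theorem simple_quotient_is_highest_weight:
  assumes \<kappa>: "\<kappa> \<noteq> - 2" and P: "presentation \<pi> I (Q :: (sl2_hat, 'v, 'm) lie_module_scheme)"
    and max: "maximal_left_ideal I" and J: "standard.universal_ideal 0 0 \<kappa> \<subseteq> I"
  shows "\<exists>M :: (sl2_tilde, 'v) lie_module. highest_weight_module M \<and> simple_module M \<and> has_level M \<kappa> \<and>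
    isomorphic_modules Q (restrict_to_hat M)"
proof -
  interpret presentation \<pi> I Q by (rule P)
  interpret V: universal_whittaker uea_scalar ue uh uf uc 0 0 \<kappa> using \<kappa> by unfold_locales
  have cong_I: "left_cong I u v" if "left_cong V.J u v" for u v using that J by (auto simp: left_cong_def)
  interpret S: smooth_left_ideal uea_scalar ue uh uf uc I \<kappa>
  proof
    show "left_ideal I" by (rule left_ideal)
    show "left_cong I uc (uea_scalar \<kappa>)" by (rule cong_I[OF V.level])
    show "\<exists>N. \<forall>x. mode x \<ge> N \<longrightarrow> standard.val x \<in> I" using V.smooth J by blast
  qed (rule \<kappa>)
  define d where "d u = - S.sugawara_op 0 u" for u
  have cong: "\<pi> u = \<pi> v \<longleftrightarrow> left_cong I u v" for u v by (simp add: eq_iff left_cong_def)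
  have neg: "left_cong I (- u) (- v)" if "left_cong I u v" for u v
    using S.cong_diff[OF S.cong_refl[of 0] that] by simp
  have L_incl: "left_cong I (S.sugawara_op 0 (uea_incl x * u)) (uea_incl x * S.sugawara_op 0 u - uea_incl (hat_deriv x) * u)" for x u
  proof (induction x rule: hat_induct)
    case (add x y)
    have "left_cong I (S.sugawara_op 0 (uea_incl x * u + uea_incl y * u))
        (S.sugawara_op 0 (uea_incl x * u) + S.sugawara_op 0 (uea_incl y * u))" by (rule S.sugawara_op_add)
    also have "left_cong I \<dots> ((uea_incl x * S.sugawara_op 0 u - uea_incl (hat_deriv x) * u)
        + (uea_incl y * S.sugawara_op 0 u - uea_incl (hat_deriv y) * u))" by (rule S.cong_add[OF add])
    finally show ?case by (simp add: uea_incl_add hat_deriv_simps distrib_right add_diff_add)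
  next
    case (scale t x)
    have "left_cong I (S.sugawara_op 0 (uea_scalar t * (uea_incl x * u))) (uea_scalar t * S.sugawara_op 0 (uea_incl x * u))"
      by (rule S.sugawara_op_scalar)
    also have "left_cong I \<dots> (uea_scalar t * (uea_incl x * S.sugawara_op 0 u - uea_incl (hat_deriv x) * u))"
      by (rule S.cong_mult[OF scale])
    finally show ?case by (simp add: uea_incl_scale hat_deriv_simps right_diff_distrib mult.assoc)
  next
    case (e n)
    then show ?case using S.sugawara_op_val[of 0 "gE n" u] by (simp add: hat_deriv_simps uea_incl_scale mult.assoc standard.sc_int)
  next
    case (h n)
    then show ?case using S.sugawara_op_val[of 0 "gH n" u] by (simp add: hat_deriv_simps uea_incl_scale mult.assoc standard.sc_int)
  next
    case (f n)
    then show ?case using S.sugawara_op_val[of 0 "gF n" u] by (simp add: hat_deriv_simps uea_incl_scale mult.assoc standard.sc_int)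
  next
    case c
    have "uea_incl (0 :: sl2_hat) = 0" using uea_incl_add[of "0 :: sl2_hat" 0] by simp
    have "left_cong I (S.sugawara_op 0 (uc * u)) (S.sugawara_op 0 (uea_scalar \<kappa> * u))"
      by (rule S.sugawara_op_cong[OF S.level_mult])
    also have "left_cong I \<dots> (uea_scalar \<kappa> * S.sugawara_op 0 u)" by (rule S.sugawara_op_scalar)
    also have "left_cong I \<dots> (uc * S.sugawara_op 0 u)" by (rule S.cong_sym[OF S.level_mult])
    finally show ?case using \<open>uea_incl 0 = 0\<close> by (simp add: hat_deriv_simps)
  qed
  define D where "D v = \<pi> (d (SOME u. \<pi> u = v))" for v
  interpret T: degree_operator \<pi> I Q D d
  proof
    show "D (\<pi> u) = \<pi> (d u)" for u
    proof -
      have "\<pi> (SOME w. \<pi> w = \<pi> u) = \<pi> u" by (rule someI) (rule refl)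
      then show ?thesis unfolding D_def d_def cong by (intro neg S.sugawara_op_cong) 
    qed
    show "\<pi> (d (u + v)) = \<pi> (d u + d v)" for u v
      using neg[OF S.sugawara_op_add[of 0 u v]] by (simp add: d_def cong)
    show "\<pi> (d (uea_scalar t * u)) = \<pi> (uea_scalar t * d u)" for t u
      using neg[OF S.sugawara_op_scalar[of 0 t u]] by (simp add: d_def cong)
    show "\<pi> (d (uea_incl x * u)) = \<pi> (uea_incl x * d u + uea_incl (hat_deriv x) * u)" for x u
      using neg[OF L_incl[of x u]] by (simp add: d_def cong)
  qed
  have I: "1 \<notin> I" and I_max: "\<And>K. left_ideal K \<Longrightarrow> I \<subseteq> K \<Longrightarrow> 1 \<notin> K \<Longrightarrow> K = I"
    using max by (auto simp: maximal_left_ideal_def)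
  have "\<exists>K b. left_ideal K \<and> V.J \<subseteq> K \<and> uh 0 - uea_scalar b \<in> K \<and> 1 \<notin> K" using verma_proper[OF \<kappa>] by blast
  from V.verma_maximal_ideals[OF refl refl left_ideal J I I_max this]
  obtain b g where g: "g \<notin> I" "V.J \<subseteq> {u. u * g \<in> I}" and h0: "(uh 0 - uea_scalar b) * g \<in> I" by auto
  have zero_iff: "\<pi> u = \<zero>\<^bsub>Q\<^esub> \<longleftrightarrow> u \<in> I" for u using eq_iff[of u 0] zero by simp
  have E_zero: "\<zero>\<^bsub>T.E\<^esub> = \<zero>\<^bsub>Q\<^esub>" using T.E.zero zero by simp
  have J_g: "u * g \<in> I" if "u \<in> V.J" for u using that g(2) by auto
  have h: "left_cong I (uh 0 * g) (uea_scalar b * g)" using h0 by (simp add: left_cong_def left_diff_distrib)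
  have casimir_g: "left_cong I (standard.casimir * g) (uea_scalar (2 * b + b * b) * g)"
  proof -
    have "ue 0 * g \<in> I" using J_g[OF V.relations_in_J(1)] by (simp add: standard.sc_0)
    then have e: "left_cong I (ue 0 * g) 0" by (simp add: left_cong_def)
    have "standard.casimir * g = 4 * (uf 0 * (ue 0 * g)) + 2 * (uh 0 * g) + uh 0 * (uh 0 * g)"
      by (simp add: standard.casimir_expand distrib_right mult.assoc)
    also have "left_cong I \<dots> (4 * (uf 0 * 0) + 2 * (uea_scalar b * g) + uh 0 * (uea_scalar b * g))"
      by (intro S.cong_add S.cong_mult e h)
    also have "\<dots> = 2 * (uea_scalar b * g) + uea_scalar b * (uh 0 * g)"
      by simp (metis mult.assoc uea_scalar_central)
    also have "left_cong I \<dots> (2 * (uea_scalar b * g) + uea_scalar b * (uea_scalar b * g))"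
      by (intro S.cong_add S.cong_mult S.cong_refl h)
    also have "\<dots> = uea_scalar (2 * b + b * b) * g"
      by (simp add: uea_scalar_hom standard.sc_numeral distrib_right mult.assoc)
    finally show ?thesis .
  qed
  let ?i = "inverse (4 * (\<kappa> + 2))"
  have L_g: "left_cong I (S.sugawara_op 0 g) (uea_scalar (?i * (2 * b + b * b)) * g)"
  proof -
    have "left_cong I (S.sugawara_op 0 g) (uea_scalar ?i * (standard.sugawara_sum 0 1 * g))"
      by (rule S.sugawara_op_eq) (use J_g V.sugawara_term_vanishes in auto)
    also have "uea_scalar ?i * (standard.sugawara_sum 0 1 * g) = (uea_scalar ?i * (standard.sugawara_sum 0 1 * 1)) * g"
      by (simp add: mult.assoc)
    also have "left_cong I \<dots> ((uea_scalar ?i * standard.casimir) * g)"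
    proof -
      have "left_cong V.J (uea_scalar ?i * (standard.sugawara_sum 0 1 * 1)) (V.sugawara_op 0 1)"
        by (rule V.cong_sym[OF V.sugawara_op_eq]) (use V.sugawara_term_vanishes in auto)
      also have "left_cong V.J \<dots> (uea_scalar ?i * standard.casimir)"
        using V.sugawara_zero by (simp add: standard.sc_0)
      finally show ?thesis using J_g by (auto simp: left_cong_def simp flip: left_diff_distrib)
    qed
    also have "(uea_scalar ?i * standard.casimir) * g = uea_scalar ?i * (standard.casimir * g)" by (simp add: mult.assoc)
    also have "left_cong I \<dots> (uea_scalar ?i * (uea_scalar (2 * b + b * b) * g))" by (rule S.cong_mult[OF casimir_g])
    also have "\<dots> = uea_scalar (?i * (2 * b + b * b)) * g" by (simp only: uea_scalar_hom(2) mult.assoc)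
    finally show ?thesis .
  qed
  interpret E': lie_module T.E by (rule T.lie_module_E)
  let ?v = "\<pi> g"
  have simple: "simple_module T.E" using T.simple_E simple_iff max by blast
  have null: "0 \<star>\<^bsub>T.E\<^esub> ?v = \<zero>\<^bsub>T.E\<^esub>" "0 \<odot>\<^bsub>T.E\<^esub> ?v = \<zero>\<^bsub>T.E\<^esub>"
    using E'.lact_cscale_left[of ?v 0 0] E'.lact_closed[of ?v 0] E'.smult_l_null[of ?v] E'.smult_l_null[of "0 \<star>\<^bsub>T.E\<^esub> ?v"]
    by simp_all
  have subspace_Ex: "lie_vs.subspace {\<xi>. \<exists>t. \<xi> \<star>\<^bsub>T.E\<^esub> ?v = t \<odot>\<^bsub>T.E\<^esub> ?v}"
  proof (rule lie_vs.subspaceI)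
    have "0 \<star>\<^bsub>T.E\<^esub> ?v = 0 \<odot>\<^bsub>T.E\<^esub> ?v" unfolding null ..
    then show "0 \<in> {\<xi>. \<exists>t. \<xi> \<star>\<^bsub>T.E\<^esub> ?v = t \<odot>\<^bsub>T.E\<^esub> ?v}" by blast
  next
    fix \<xi> \<eta> assume "\<xi> \<in> {\<xi>. \<exists>t. \<xi> \<star>\<^bsub>T.E\<^esub> ?v = t \<odot>\<^bsub>T.E\<^esub> ?v}" "\<eta> \<in> {\<xi>. \<exists>t. \<xi> \<star>\<^bsub>T.E\<^esub> ?v = t \<odot>\<^bsub>T.E\<^esub> ?v}"
    then obtain s t where "\<xi> \<star>\<^bsub>T.E\<^esub> ?v = s \<odot>\<^bsub>T.E\<^esub> ?v" "\<eta> \<star>\<^bsub>T.E\<^esub> ?v = t \<odot>\<^bsub>T.E\<^esub> ?v" by blast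
    then have "(\<xi> + \<eta>) \<star>\<^bsub>T.E\<^esub> ?v = (s + t) \<odot>\<^bsub>T.E\<^esub> ?v"
      using E'.lact_add_left[of ?v \<xi> \<eta>] E'.smult_l_distr[of s t ?v] by simp
    then show "\<xi> + \<eta> \<in> {\<xi>. \<exists>t. \<xi> \<star>\<^bsub>T.E\<^esub> ?v = t \<odot>\<^bsub>T.E\<^esub> ?v}" by blast
  next
    fix a \<xi> assume "\<xi> \<in> {\<xi>. \<exists>t. \<xi> \<star>\<^bsub>T.E\<^esub> ?v = t \<odot>\<^bsub>T.E\<^esub> ?v}"
    then obtain s where "\<xi> \<star>\<^bsub>T.E\<^esub> ?v = s \<odot>\<^bsub>T.E\<^esub> ?v" by blast
    then have "cscale a \<xi> \<star>\<^bsub>T.E\<^esub> ?v = (a * s) \<odot>\<^bsub>T.E\<^esub> ?v"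
      using E'.lact_cscale_left[of ?v a \<xi>] E'.smult_assoc1[of a s ?v] by simp
    then show "cscale a \<xi> \<in> {\<xi>. \<exists>t. \<xi> \<star>\<^bsub>T.E\<^esub> ?v = t \<odot>\<^bsub>T.E\<^esub> ?v}" by blast
  qed
  have subspace_0: "lie_vs.subspace {\<xi>. \<xi> \<star>\<^bsub>T.E\<^esub> ?v = \<zero>\<^bsub>T.E\<^esub>}"
  proof (rule lie_vs.subspaceI)
    show "0 \<in> {\<xi>. \<xi> \<star>\<^bsub>T.E\<^esub> ?v = \<zero>\<^bsub>T.E\<^esub>}"
      using null by simp
    show "\<xi> + \<eta> \<in> {\<xi>. \<xi> \<star>\<^bsub>T.E\<^esub> ?v = \<zero>\<^bsub>T.E\<^esub>}"
      if "\<xi> \<in> {\<xi>. \<xi> \<star>\<^bsub>T.E\<^esub> ?v = \<zero>\<^bsub>T.E\<^esub>}" "\<eta> \<in> {\<xi>. \<xi> \<star>\<^bsub>T.E\<^esub> ?v = \<zero>\<^bsub>T.E\<^esub>}" for \<xi> \<eta>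
      using that E'.lact_add_left[of ?v \<xi> \<eta>] by simp
    show "cscale a \<xi> \<in> {\<xi>. \<xi> \<star>\<^bsub>T.E\<^esub> ?v = \<zero>\<^bsub>T.E\<^esub>}" if "\<xi> \<in> {\<xi>. \<xi> \<star>\<^bsub>T.E\<^esub> ?v = \<zero>\<^bsub>T.E\<^esub>}" for a \<xi>
      using that E'.lact_cscale_left[of ?v a \<xi>] by simp
  qed
  have pos: "tilde_positive_part \<subseteq> {\<xi>. \<xi> \<star>\<^bsub>T.E\<^esub> ?v = \<zero>\<^bsub>T.E\<^esub>}"
    unfolding tilde_positive_part_def
  proof (rule lie_vs.span_minimal[OF _ subspace_0])
    have "ue n * g \<in> I" if "n \<ge> 0" for n
      using J_g[OF V.relations_in_J(1)] J_g[OF V.relations_in_J(4)[of n]] that by (cases "n = 0") (simp_all add: standard.sc_0)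
    moreover have "uh n * g \<in> I" if "n \<ge> 1" for n using J_g[OF V.relations_in_J(5)[OF that]] .
    moreover have "uf n * g \<in> I" if "n \<ge> 1" for n
      using J_g[OF V.relations_in_J(2)] J_g[OF V.relations_in_J(6)[of n]] that by (cases "n = 1") (simp_all add: standard.sc_0)
    ultimately show "{tilde_of_hat (hat_e n) | n. n \<ge> 0} \<union> {tilde_of_hat (hat_h n) | n. n \<ge> 1}
      \<union> {tilde_of_hat (hat_f n) | n. n \<ge> 1} \<subseteq> {\<xi>. \<xi> \<star>\<^bsub>T.E\<^esub> ?v = \<zero>\<^bsub>T.E\<^esub>}"
      by (auto simp: T.lact_tilde_of_hat E_zero zero_iff)
  qed
  have level: "tilde_of_hat hat_c \<star>\<^bsub>T.E\<^esub> \<pi> u = \<kappa> \<odot>\<^bsub>T.E\<^esub> \<pi> u" for u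
    using S.level_mult[of u] by (simp add: T.lact_tilde_of_hat cong flip: T.E.smult)
  have cartan: "tilde_cartan \<subseteq> {\<xi>. \<exists>t. \<xi> \<star>\<^bsub>T.E\<^esub> ?v = t \<odot>\<^bsub>T.E\<^esub> ?v}"
    unfolding tilde_cartan_def
  proof (rule lie_vs.span_minimal[OF _ subspace_Ex])
    have "tilde_of_hat (hat_h 0) \<star>\<^bsub>T.E\<^esub> ?v = b \<odot>\<^bsub>T.E\<^esub> ?v"
      using h by (simp add: T.lact_tilde_of_hat cong flip: T.E.smult)
    moreover have "tilde_d \<star>\<^bsub>T.E\<^esub> ?v = (- (?i * (2 * b + b * b))) \<odot>\<^bsub>T.E\<^esub> ?v"
    proof -
      have "uea_incl (0 :: sl2_hat) = 0" using uea_incl_add[of "0 :: sl2_hat" 0] by simp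
      then have "tilde_d \<star>\<^bsub>T.E\<^esub> ?v = \<pi> (- S.sugawara_op 0 g)"
        by (simp add: T.lact_E hat_part_simps tilde_degree_simps uea_scalar_hom d_def)
      also have "\<dots> = \<pi> (- (uea_scalar (?i * (2 * b + b * b)) * g))" unfolding cong by (rule neg[OF L_g])
      also have "- (uea_scalar (?i * (2 * b + b * b)) * g) = uea_scalar (- (?i * (2 * b + b * b))) * g"
        unfolding standard.sc_minus by simp
      finally show ?thesis by (simp only: T.E.smult)
    qed
    ultimately show "{tilde_of_hat (hat_h 0), tilde_of_hat hat_c, tilde_d} \<subseteq> {\<xi>. \<exists>t. \<xi> \<star>\<^bsub>T.E\<^esub> ?v = t \<odot>\<^bsub>T.E\<^esub> ?v}"
      using level[of g] by blast
  qed
  then have weight: "\<exists>wt. \<forall>\<xi>\<in>tilde_cartan. \<xi> \<star>\<^bsub>T.E\<^esub> ?v = wt \<xi> \<odot>\<^bsub>T.E\<^esub> ?v"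
    by (intro bchoice) blast
  have v: "?v \<noteq> \<zero>\<^bsub>T.E\<^esub>" using g(1) by (simp add: E_zero zero_iff)
  have "submodule_generated T.E {?v} = carrier T.E"
  proof -
    have "lie_submodule (carrier T.E) T.E"
      using E'.carrier_is_submodule E'.lact_closed by (simp add: lie_submodule_def)
    moreover have "N = carrier T.E" if "lie_submodule N T.E" "{?v} \<subseteq> N" for N
      using simple that v by (auto simp: simple_module_def)
    moreover have "?v \<in> carrier T.E" by (rule T.E.in_carrier)
    ultimately show ?thesis unfolding submodule_generated_def by blast
  qed
  then have "highest_weight_module T.E"
    unfolding highest_weight_module_def using T.lie_module_E T.E.in_carrier[of g] v pos weight by blast
  moreover have "has_level T.E \<kappa>"
    unfolding has_level_def using level by (auto elim!: T.E.carrier_cases)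
  ultimately show ?thesis using simple T.isomorphic_restriction by blast
qed

section \<open>The simple quotients of universal Whittaker modules\<close>

theorem theorem4p1:
  fixes lam \<mu> \<kappa> :: complex
  assumes "\<kappa> \<noteq> - 2"
  shows
    "(lam * \<mu> \<noteq> 0 \<longrightarrow> simple_module (whittaker_module lam \<mu> \<kappa>)) \<and>
     (lam \<noteq> 0 \<longrightarrow>
        (\<forall>a. has_unique_simple_quotient (whittaker_M_e lam \<kappa> a)) \<and>
        (\<forall>N. simple_quotient_kernel (whittaker_module lam 0 \<kappa>) N \<longrightarrow>
           (\<exists>a. isomorphic_modules (quotient_module (whittaker_module lam 0 \<kappa>) N)
                  (the_simple_quotient (whittaker_M_e lam \<kappa> a))))) \<and>
     (\<mu> \<noteq> 0 \<longrightarrow>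
        (\<forall>a. has_unique_simple_quotient (whittaker_M_f \<mu> \<kappa> a)) \<and>
        (\<forall>N. simple_quotient_kernel (whittaker_module 0 \<mu> \<kappa>) N \<longrightarrow>
           (\<exists>a. isomorphic_modules (quotient_module (whittaker_module 0 \<mu> \<kappa>) N)
                  (the_simple_quotient (whittaker_M_f \<mu> \<kappa> a))))) \<and>
     (\<forall>N. simple_quotient_kernel (whittaker_module 0 0 \<kappa>) N \<longrightarrow>
        (\<exists>M :: (sl2_tilde, sl2_hat uea set set) lie_module.
           highest_weight_module M \<and> simple_module M \<and> has_level M \<kappa> \<and>
           isomorphic_modules (quotient_module (whittaker_module 0 0 \<kappa>) N) (restrict_to_hat M)))"
proof (intro conjI impI)
  let ?\<pi> = "\<lambda>lam \<mu> u. whittaker_ideal lam \<mu> \<kappa> +>\<^bsub>(left_regular_module :: (sl2_hat, sl2_hat uea) lie_module)\<^esub> u"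
  note P = presentation_whittaker[of _ _ \<kappa>]
  have L: "sugawara \<kappa> (whittaker_module lam \<mu> \<kappa>) 0 (whittaker_vector lam \<mu> \<kappa>) = ?\<pi> lam \<mu> (affine_sugawara \<kappa> \<mu>)" for lam \<mu>
    unfolding whittaker_vector_def by (rule sugawara_cyclic_vector[OF P order_refl assms])
  {
    assume lm: "lam * \<mu> \<noteq> 0"
    interpret V: universal_whittaker uea_scalar ue uh uf uc lam \<mu> \<kappa> using assms by unfold_locales
    have "maximal_left_ideal (whittaker_ideal lam \<mu> \<kappa>)"
      unfolding maximal_left_ideal_def whittaker_ideal_eq
    proof (intro conjI allI impI)
      show "left_ideal V.J" by (rule V.left_ideal_J)
      show "1 \<notin> V.J" by (rule universal_ideal_proper)
      fix K assume K: "left_ideal K" "V.J \<subseteq> K" "1 \<notin> K"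
      show "K = V.J" using V.generic_ideal_maximal[OF _ _ K(1,2)] K(2,3) lm by auto
    qed
    then show "simple_module (whittaker_module lam \<mu> \<kappa>)" by (simp only: presentation.simple_iff[OF P])
  }
  {
    assume lam: "lam \<noteq> 0"
    interpret P: presentation "?\<pi> lam 0" "whittaker_ideal lam 0 \<kappa>" "whittaker_module lam 0 \<kappa>" by (rule P)
    have sp: "spectral_parameter (whittaker_ideal lam 0 \<kappa>) uea_scalar (affine_sugawara \<kappa> 0)"
      unfolding whittaker_ideal_eq by (rule spectral_parameter_e[OF assms lam])
    have M: "whittaker_M_e lam \<kappa> = (\<lambda>a. quotient_module (whittaker_module lam 0 \<kappa>)
        (submodule_generated (whittaker_module lam 0 \<kappa>) {?\<pi> lam 0 (affine_sugawara \<kappa> 0 - uea_scalar a)}))"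
    proof
      fix a
      have "a \<odot>\<^bsub>whittaker_module lam 0 \<kappa>\<^esub> whittaker_vector lam 0 \<kappa> = ?\<pi> lam 0 (uea_scalar a)"
        using P.smult[of a 1] by (simp add: whittaker_vector_def)
      then show "whittaker_M_e lam \<kappa> a = quotient_module (whittaker_module lam 0 \<kappa>)
        (submodule_generated (whittaker_module lam 0 \<kappa>) {?\<pi> lam 0 (affine_sugawara \<kappa> 0 - uea_scalar a)})"
        by (simp add: whittaker_M_e_def Let_def L P.diff)
    qed
    show "\<forall>a. has_unique_simple_quotient (whittaker_M_e lam \<kappa> a)"
      unfolding M by (intro allI simple_quotients_of_spectral_parameter(1)[OF P sp])
    show "\<forall>N. simple_quotient_kernel (whittaker_module lam 0 \<kappa>) N \<longrightarrow>
           (\<exists>a. isomorphic_modules (quotient_module (whittaker_module lam 0 \<kappa>) N)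
                  (the_simple_quotient (whittaker_M_e lam \<kappa> a)))"
      unfolding M by (intro allI impI simple_quotients_of_spectral_parameter(2)[OF P sp])
  }
  {
    assume mu: "\<mu> \<noteq> 0"
    interpret P: presentation "?\<pi> 0 \<mu>" "whittaker_ideal 0 \<mu> \<kappa>" "whittaker_module 0 \<mu> \<kappa>" by (rule P)
    let ?z = "uea_scalar (1 / 2) * uh 0 - affine_sugawara \<kappa> \<mu>"
    have sp: "spectral_parameter (whittaker_ideal 0 \<mu> \<kappa>) uea_scalar ?z"
      unfolding whittaker_ideal_eq by (rule spectral_parameter_f[OF assms mu])
    have M: "whittaker_M_f \<mu> \<kappa> = (\<lambda>a. quotient_module (whittaker_module 0 \<mu> \<kappa>)
        (submodule_generated (whittaker_module 0 \<mu> \<kappa>) {?\<pi> 0 \<mu> (?z - uea_scalar a)}))"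
    proof
      fix a
      have 1: "a \<odot>\<^bsub>whittaker_module 0 \<mu> \<kappa>\<^esub> whittaker_vector 0 \<mu> \<kappa> = ?\<pi> 0 \<mu> (uea_scalar a)"
        using P.smult[of a 1] by (simp add: whittaker_vector_def)
      have 2: "(1 / 2) \<odot>\<^bsub>whittaker_module 0 \<mu> \<kappa>\<^esub> (hat_h 0 \<star>\<^bsub>whittaker_module 0 \<mu> \<kappa>\<^esub> whittaker_vector 0 \<mu> \<kappa>)
          = ?\<pi> 0 \<mu> (uea_scalar (1 / 2) * uh 0)"
        using P.smult[of "1 / 2" "uh 0 * 1"] P.lact[of "hat_h 0" 1] by (simp add: whittaker_vector_def)
      show "whittaker_M_f \<mu> \<kappa> a = quotient_module (whittaker_module 0 \<mu> \<kappa>)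
        (submodule_generated (whittaker_module 0 \<mu> \<kappa>) {?\<pi> 0 \<mu> (?z - uea_scalar a)})"
        by (simp only: whittaker_M_f_def Let_def L 1 2 P.diff)
    qed
    show "\<forall>a. has_unique_simple_quotient (whittaker_M_f \<mu> \<kappa> a)"
      unfolding M by (intro allI simple_quotients_of_spectral_parameter(1)[OF P sp])
    show "\<forall>N. simple_quotient_kernel (whittaker_module 0 \<mu> \<kappa>) N \<longrightarrow>
           (\<exists>a. isomorphic_modules (quotient_module (whittaker_module 0 \<mu> \<kappa>) N)
                  (the_simple_quotient (whittaker_M_f \<mu> \<kappa> a)))"
      unfolding M by (intro allI impI simple_quotients_of_spectral_parameter(2)[OF P sp])
  }
  show "\<forall>N. simple_quotient_kernel (whittaker_module 0 0 \<kappa>) N \<longrightarrow>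
        (\<exists>M :: (sl2_tilde, sl2_hat uea set set) lie_module.
           highest_weight_module M \<and> simple_module M \<and> has_level M \<kappa> \<and>
           isomorphic_modules (quotient_module (whittaker_module 0 0 \<kappa>) N) (restrict_to_hat M))"
  proof (intro allI impI)
    fix N assume N: "simple_quotient_kernel (whittaker_module 0 0 \<kappa>) N"
    interpret P: presentation "?\<pi> 0 0" "whittaker_ideal 0 0 \<kappa>" "whittaker_module 0 0 \<kappa>" by (rule P)
    from N have N: "lie_submodule N (whittaker_module 0 0 \<kappa>)" "maximal_left_ideal (?\<pi> 0 0 -` N)"
      unfolding P.simple_quotient_kernel_iff by blast+
    have J: "standard.universal_ideal 0 0 \<kappa> \<subseteq> ?\<pi> 0 0 -` N"
      using P.ideal_of_submodule(2)[OF N(1)] unfolding whittaker_ideal_eq .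
    show "\<exists>M :: (sl2_tilde, sl2_hat uea set set) lie_module.
           highest_weight_module M \<and> simple_module M \<and> has_level M \<kappa> \<and>
           isomorphic_modules (quotient_module (whittaker_module 0 0 \<kappa>) N) (restrict_to_hat M)"
      by (rule simple_quotient_is_highest_weight[OF assms P.quotient[OF N(1)] N(2) J])
  qed
qed

end
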